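(* Let $C$ be a random finite simple counting measure on $\mathbb{R}$ with $C(\{0\})=1$ a.s., $\mathrm{supp}(C)\subset[0,\infty)$ a.s., and $\mathbb{E}[C(\mathbb{R})^3]<\infty$; let $\nu>0$ and let $N_\theta$, $\theta\in[-1,1]$, be the sign-randomized stationary Poisson cluster processes defined in the context. Assume that the reduced third factorial cumulant measure of $N_1$ has a density $c_{3,1}\in L^1(\mathbb{R}^2)$, let $B_1$ be the Fourier transform of $c_{3,1}$, and let $c_3^{\mathrm o}(\tau):=\frac12(c_{3,1}(\tau)-c_{3,1}(-\tau))$. Let $g:\mathbb{R}^2\to\mathbb{R}$ be bounded Borel, compactly supported, and jointly odd, i.e. $g(-\tau_1,-\tau_2)=-g(\tau_1,\tau_2)$. For $T>0$ define $$\mathcal O_{T,g}:=\frac1T\sum_{x_0,x_1,x_2\in N\cap[0,T]}^{\neq}g(x_1-x_0,x_2-x_0).$$ Then for every $\theta\in[-1,1]$ $$\mathbb{E}_\theta[\mathcal O_{T,g}]=\theta\,\mu_{T,g},$$ where $$\mu_{T,g}=\frac1T\int_0^T\iint_{\mathbb{R}^2}g(\tau_1,\tau_2)\,\mathbf{1}_{\{0\le x_0+\tau_1\le T,\ 0\le x_0+\tau_2\le T\}}\,c_3^{\mathrm o}(\tau_1,\tau_2)\,d\tau_1d\tau_2\,dx_0 .$$ If $\mathrm{supp}(g)\subset[-H,H]^2$, then, as $T\to\infty$, $$\mu_{T,g}=\mu_g+O(T^{-1}),\qquad \mu_g:=\iint_{\mathbb{R}^2}g(\tau_1,\tau_2)c_3^{\mathrm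 o}(\tau_1,\tau_2)\,d\tau_1d\tau_2 .$$ If in addition $\widehat g=\mathrm{i}H_g$ with $H_g$ real-valued and integrable, then $$\mu_g=\frac1{(2\pi)^2}\iint_{\mathbb{R}^2}H_g(\omega_1,\omega_2)\operatorname{Im}B_1(\omega_1,\omega_2)\,d\omega_1d\omega_2 .$$
   Context: Fourier convention: $\widehat f(\omega)=\int_{\mathbb{R}^2}e^{-\mathrm{i}\omega\cdot t}f(t)\,dt$. $\sum^{\neq}$ denotes summation over ordered tuples of pairwise distinct points. $\mathbb{E}_\theta$ denotes expectation when $N$ has the law of $N_\theta$. Construction of $N_\theta$: let $\{U_j\}$ be a homogeneous Poisson process on $\mathbb{R}$ with rate $\nu$, independent of i.i.d. copies $\{C_j\}$ of $C$. Let $\{S_{j,\theta}\}_j$ be i.i.d. signs with $\mathbb{P}(S_{j,\theta}=+1)=\frac{1+\theta}{2}$, $\mathbb{P}(S_{j,\theta}=-1)=\frac{1-\theta}{2}$, independent of $\{U_j,C_j\}_j$. For $s\in\{\pm1\}$ and a counting measure $\mu$ put $(s\mu)(A)=\mu(sA)$, and let $(\vartheta_u\mu)(A)=\mu(A-u)$. Set $N_\theta:=\sum_j\vartheta_{U_j}(S_{j,\theta}C_j)$. Third factorial cumulant measure: $\kappa_3$ is characterized by $\int f_0(t_0)f_1(t_1)f_2(t_2)\,\kappa_3(dt)=\partial_{s_0}\partial_{s_1}\partial_{s_2}\log\mathbb{E}\prod_{x\in N}(1+\sum_js_jf_j(x))|_{s=0}$ for bounded compactly supported $f_0,f_1,f_2$,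 interpreted as a finite-order variational derivative at the origin (the standard factorial cumulant measure). The reduced measure is defined by $\int F\,d\kappa_3=\int_{\mathbb{R}}\int_{\mathbb{R}^2}F(t_0,t_0+\tau_1,t_0+\tau_2)\,\kappa_3^{\mathrm{red}}(d\tau_1,d\tau_2)\,dt_0$. *)

theory Defs
  imports "HOL-Probability.Probability"
begin

section \<open>Counting measures and the cluster process\<close>

definition finite_simple_counting :: "real measure \<Rightarrow> bool" where
  "finite_simple_counting \<mu> \<longleftrightarrow> sets \<mu> = sets borel \<and>
     (\<exists>F. finite F \<and> (\<forall>A\<in>sets borel. emeasure \<mu> A = of_nat (card (F \<inter> A))))"

text \<open>The evaluation sigma-algebra, built in the same way as the library's Giry space
  (\<^const>\<open>subprob_algebra\<close>). A random finite simple counting measure is a measurable map into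
  this space.\<close>

definition counting_space :: "real measure measure" where
  "counting_space =
     (SUP A \<in> sets borel. vimage_algebra {\<mu>. finite_simple_counting \<mu>} (\<lambda>\<mu>. emeasure \<mu> A) borel)"

definition measure_supp :: "real measure \<Rightarrow> real set" where
  "measure_supp \<mu> = {x. \<forall>V. open V \<and> x \<in> V \<longrightarrow> emeasure \<mu> V \<noteq> 0}"

definition points :: "real measure \<Rightarrow> real set" where
  "points \<mu> = {x. emeasure \<mu> {x} \<noteq> 0}"

text \<open>For \<open>s = 1\<close> and \<open>s = - 1\<close> the image measure under multiplication by \<open>s\<close> gives \<open>A\<close> the mass
  \<open>\<mu> (s A)\<close>, because \<open>s\<close> is its own inverse.\<close>

definition sign_meas :: "real \<Rightarrow> real measure \<Rightarrow> real measure" where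
  "sign_meas s \<mu> = distr \<mu> borel (\<lambda>x. s * x)"

text \<open>The image measure under \<open>x \<mapsto> x + u\<close> gives \<open>A\<close> the mass \<open>\<mu> (A - u)\<close>.\<close>

definition shift_meas :: "real \<Rightarrow> real measure \<Rightarrow> real measure" where
  "shift_meas u \<mu> = distr \<mu> borel (\<lambda>x. x + u)"

definition cluster_process ::
    "(nat \<Rightarrow> 'w \<Rightarrow> real) \<Rightarrow> (nat \<Rightarrow> 'w \<Rightarrow> real) \<Rightarrow> (nat \<Rightarrow> 'w \<Rightarrow> real measure) \<Rightarrow> 'w \<Rightarrow> real measure" where
  "cluster_process U S D w =
     measure_of UNIV (sets borel)
       (\<lambda>A. \<Sum>j. emeasure (shift_meas (U j w) (sign_meas (S j w) (D j w))) A)"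

text \<open>The points are given by an enumeration \<open>U\<close>; repeated values count with multiplicity. The
  Poisson weights are written out because \<^const>\<open>poisson_pmf\<close> is unspecified at rate \<open>0\<close>, which
  occurs for null sets \<open>A\<close>.\<close>

definition poisson_process :: "'w measure \<Rightarrow> real \<Rightarrow> (nat \<Rightarrow> 'w \<Rightarrow> real) \<Rightarrow> bool" where
  "poisson_process M \<nu> U \<longleftrightarrow>
     (\<forall>j. U j \<in> borel_measurable M) \<and>
     (\<forall>A\<in>sets borel. emeasure lborel A < \<infinity> \<longrightarrow>
        (\<forall>k. measure M {w\<in>space M. finite {j. U j w \<in> A} \<and> card {j. U j w \<in> A} = k} =
             (\<nu> * measure lborel A) ^ k / fact k * exp (- (\<nu> * measure lborel A)))) \<and>
     (\<forall>(A :: nat \<Rightarrow> real set) I. finite I \<and> disjoint_family_on A I \<and>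
        (\<forall>i\<in>I. A i \<in> sets borel \<and> emeasure lborel (A i) < \<infinity>) \<longrightarrow>
        prob_space.indep_vars M (\<lambda>_. count_space UNIV) (\<lambda>i w. card {j. U j w \<in> A i}) I)"

text \<open>Independence of two random elements with values in different types, for which
  \<^const>\<open>prob_space.indep_var\<close> cannot be used.\<close>

definition indep_elements ::
    "'w measure \<Rightarrow> 'a measure \<Rightarrow> ('w \<Rightarrow> 'a) \<Rightarrow> 'b measure \<Rightarrow> ('w \<Rightarrow> 'b) \<Rightarrow> bool" where
  "indep_elements M K X L Y \<longleftrightarrow>
     prob_space.indep_set M (sets (vimage_algebra (space M) X K)) (sets (vimage_algebra (space M) Y L))"


section \<open>Third factorial cumulant measure\<close>

definition fun_supp :: "('a::topological_space \<Rightarrow> real) \<Rightarrow> 'a set" where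
  "fun_supp f = closure {x. f x \<noteq> 0}"

definition test_fun :: "('a::euclidean_space \<Rightarrow> real) \<Rightarrow> bool" where
  "test_fun f \<longleftrightarrow> f \<in> borel_measurable borel \<and> bounded (range f) \<and> compact (fun_supp f)"

text \<open>A signed Radon measure is a pair \<open>(P, Q)\<close> of locally finite measures standing for \<open>P - Q\<close>.
  The pair is needed because \<open>P - Q\<close> on the whole space may have the form infinity minus infinity.\<close>

type_synonym 'a signed_measure = "'a measure \<times> 'a measure"

definition signed_radon :: "'a::euclidean_space signed_measure \<Rightarrow> bool" where
  "signed_radon \<kappa> \<longleftrightarrow> sets (fst \<kappa>) = sets borel \<and> sets (snd \<kappa>) = sets borel \<and>
     (\<forall>K. compact K \<longrightarrow> emeasure (fst \<kappa>) K < \<infinity> \<and> emeasure (snd \<kappa>) K < \<infinity>)"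

definition signed_int :: "'a signed_measure \<Rightarrow> ('a \<Rightarrow> real) \<Rightarrow> real" where
  "signed_int \<kappa> f = (LINT x|fst \<kappa>. f x) - (LINT x|snd \<kappa>. f x)"

text \<open>The product is over the finitely many points at which the factor differs from \<open>1\<close>; the
  processes considered are almost surely simple.\<close>

definition pgfl :: "'w measure \<Rightarrow> ('w \<Rightarrow> real measure) \<Rightarrow> (real \<Rightarrow> real) \<Rightarrow> real" where
  "pgfl M N h = (LINT w|M. (\<Prod>x\<in>{x \<in> points (N w). h x \<noteq> 0}. 1 + h x))"

text \<open>\<open>L\<close> is the iterated derivative in \<open>s\<^sub>2\<close>, then \<open>s\<^sub>1\<close>, then \<open>s\<^sub>0\<close>, at the origin, all
  derivatives being taken from the left.\<close>

definition has_mixed_left_derivative3 :: "(real \<Rightarrow> real \<Rightarrow> real \<Rightarrow> real) \<Rightarrow> real \<Rightarrow> bool" where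
  "has_mixed_left_derivative3 \<Phi> L \<longleftrightarrow>
     (\<exists>\<delta>>0. \<exists>D2 D1.
        (\<forall>s0\<in>{-\<delta><..0}. \<forall>s1\<in>{-\<delta><..0}. (\<Phi> s0 s1 has_real_derivative D2 s0 s1) (at 0 within {..0})) \<and>
        (\<forall>s0\<in>{-\<delta><..0}. (D2 s0 has_real_derivative D1 s0) (at 0 within {..0})) \<and>
        (D1 has_real_derivative L) (at 0 within {..0}))"

text \<open>With only three moments available, \<open>E \<Prod> (1 + h x)\<close> can be infinite for every \<open>h\<close> that is
  positive somewhere, however small. The variational derivative at the origin is therefore taken
  along \<open>h = s\<^sub>0 f\<^sub>0 + s\<^sub>1 f\<^sub>1 + s\<^sub>2 f\<^sub>2\<close> with \<open>f\<^sub>j \<ge> 0\<close> and \<open>s\<^sub>j \<le> 0\<close>, where the product lies in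
  \<open>[0, 1]\<close> for small \<open>s\<^sub>j\<close>. By trilinearity the nonnegative \<open>f\<^sub>j\<close> determine the measure.\<close>

definition factorial_cumulant3 ::
    "'w measure \<Rightarrow> ('w \<Rightarrow> real measure) \<Rightarrow> (real \<times> real \<times> real) signed_measure \<Rightarrow> bool" where
  "factorial_cumulant3 M N \<kappa> \<longleftrightarrow> signed_radon \<kappa> \<and>
     (\<forall>f0 f1 f2. test_fun f0 \<and> test_fun f1 \<and> test_fun f2 \<and>
        (\<forall>x. 0 \<le> f0 x \<and> 0 \<le> f1 x \<and> 0 \<le> f2 x) \<longrightarrow>
        has_mixed_left_derivative3
          (\<lambda>s0 s1 s2. ln (pgfl M N (\<lambda>x. s0 * f0 x + s1 * f1 x + s2 * f2 x)))
          (signed_int \<kappa> (\<lambda>(t0, t1, t2). f0 t0 * f1 t1 * f2 t2)))"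

definition reduced_measure3 ::
    "(real \<times> real \<times> real) signed_measure \<Rightarrow> (real \<times> real) signed_measure \<Rightarrow> bool" where
  "reduced_measure3 \<kappa> \<rho> \<longleftrightarrow> signed_radon \<rho> \<and>
     (\<forall>F. test_fun F \<longrightarrow>
        signed_int \<kappa> F = (LINT t0|lborel. signed_int \<rho> (\<lambda>(\<tau>1, \<tau>2). F (t0, t0 + \<tau>1, t0 + \<tau>2))))"

definition signed_density :: "'a::euclidean_space signed_measure \<Rightarrow> ('a \<Rightarrow> real) \<Rightarrow> bool" where
  "signed_density \<rho> c \<longleftrightarrow>
     (\<forall>A\<in>sets borel. bounded A \<longrightarrow>
        measure (fst \<rho>) A - measure (snd \<rho>) A = (LINT x:A|lborel. c x))"


section \<open>Statistic, mean and Fourier transform\<close>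

definition fourier2 :: "(real \<times> real \<Rightarrow> real) \<Rightarrow> real \<times> real \<Rightarrow> complex" where
  "fourier2 f \<omega> = (LINT t|lborel. exp (- (\<i> * complex_of_real (\<omega> \<bullet> t))) * complex_of_real (f t))"

definition odd_part :: "(real \<times> real \<Rightarrow> real) \<Rightarrow> real \<times> real \<Rightarrow> real" where
  "odd_part c \<tau> = 1 / 2 * (c \<tau> - c (- \<tau>))"

definition triple_stat :: "real \<Rightarrow> (real \<times> real \<Rightarrow> real) \<Rightarrow> real measure \<Rightarrow> real" where
  "triple_stat T g \<mu> = 1 / T *
     (\<Sum>(x0, x1, x2) \<in> {(x0, x1, x2). x0 \<in> points \<mu> \<inter> {0..T} \<and> x1 \<in> points \<mu> \<inter> {0..T} \<and>
        x2 \<in> points \<mu> \<inter> {0..T} \<and> x0 \<noteq> x1 \<and> x0 \<noteq> x2 \<and> x1 \<noteq> x2}. g (x1 - x0, x2 - x0))"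

definition window_mean :: "(real \<times> real \<Rightarrow> real) \<Rightarrow> (real \<times> real \<Rightarrow> real) \<Rightarrow> real \<Rightarrow> real" where
  "window_mean c g T = 1 / T *
     (LINT x0:{0..T}|lborel. LINT \<tau>|lborel.
        g \<tau> * indicator {\<tau>. 0 \<le> x0 + fst \<tau> \<and> x0 + fst \<tau> \<le> T \<and> 0 \<le> x0 + snd \<tau> \<and> x0 + snd \<tau> \<le> T} \<tau> *
        odd_part c \<tau>)"

definition limit_mean :: "(real \<times> real \<Rightarrow> real) \<Rightarrow> (real \<times> real \<Rightarrow> real) \<Rightarrow> real" where
  "limit_mean c g = (LINT \<tau>|lborel. g \<tau> * odd_part c \<tau>)"

end

theory Submission
  imports Defs
begin

text \<open>By the Campbell formulas the third factorial moment of the process is the sum of a one-cluster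
  term \<open>K3\<close> and of mixed terms built from the intensity and from pairs inside one cluster.
  The reflection \<open>t \<mapsto> T - t\<close> preserves the window, changes the sign of the odd kernel \<open>g\<close>, fixes the
  mixed terms, whatever the signs of the clusters, and acts on the one-cluster term by exchanging the two
  signs. Hence only the one-cluster term contributes to the mean of the statistic, with weight
  \<open>(1 + \<theta>)/2 - (1 - \<theta>)/2 = \<theta>\<close>.

  For \<open>\<theta> = 1\<close> this term is the third factorial cumulant: on products of indicators of dyadic
  intervals it is obtained by differentiating the generating functional under the expectation, and dyadic
  cubes determine a locally finite measure. The window only matters for base points within distance \<open>H\<close> of its
  ends, whence the error \<open>O(1/T)\<close>. The spectral formula follows from Fourier inversion of \<open>g\<close>, which is
  proved by Gaussian regularisation.\<close>

section \<open>Counting measures\<close>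

text \<open>An enumeration of a Poisson process controls only the numbers of points in sets; the law
  of a single \<open>U j\<close> is unknown. Every Campbell formula therefore sums over all indices.
  It comes from computing factorial moment measures on dyadic cubes, whose sides are equal or
  disjoint, so that Poisson counts and independence suffice. Points are counted in two ways: cluster
  by cluster with multiplicity, as expectations require, and as elements of the set of points, as
  the statistic and the generating functional require. The two agree almost surely because the
  diagonal is a Lebesgue null set. Since only three moments are finite, each difference quotient of
  the generating functional is dominated by the factorial sum of the next order. Moments are
  nonnegative extended integrals; a signed kernel is split into its positive and negative parts,
  which the reflection exchanges, so that the finite mixed terms cancel. A reflected pair is a
  translate of the pair, a reflected triple in general is not: this is why the sign is felt only by
  the one-cluster triple term.\<close>

lemma space_counting_space: "space counting_space = {\<mu>. finite_simple_counting \<mu>}"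
  by (auto simp: counting_space_def space_Sup_eq_UN)

lemma measurable_emeasure_counting_space [measurable]:
  assumes "A \<in> sets borel"
  shows "(\<lambda>\<mu>. emeasure \<mu> A) \<in> borel_measurable counting_space"
  using assms by (auto intro!: measurable_Sup1 measurable_vimage_algebra1 simp: counting_space_def)

text \<open>Testing singletons identifies the witnessing finite set with
  \<open>points \<mu>\<close>, so that integrals against \<open>\<mu>\<close> become finite sums
  over its points.\<close>

lemma finite_simple_counting_eq_distr:
  assumes "finite_simple_counting \<mu>"
  shows "finite (points \<mu>)" "\<mu> = distr (count_space (points \<mu>)) borel (\<lambda>x. x)"
proof -
  obtain F where F: "finite F" "\<And>A. A \<in> sets borel \<Longrightarrow> emeasure \<mu> A = of_nat (card (F \<inter> A))"
    using assms by (auto simp: finite_simple_counting_def)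
  have P: "points \<mu> = F"
    using F by (auto simp: points_def)
  then show "finite (points \<mu>)" using F by simp
  show "\<mu> = distr (count_space (points \<mu>)) borel (\<lambda>x. x)"
  proof (rule measure_eqI)
    show "sets \<mu> = sets (distr (count_space (points \<mu>)) borel (\<lambda>x. x))"
      using assms by (simp add: finite_simple_counting_def)
    fix A assume "A \<in> sets \<mu>"
    then have A: "A \<in> sets borel"
      using assms by (simp add: finite_simple_counting_def)
    then show "emeasure \<mu> A = emeasure (distr (count_space (points \<mu>)) borel (\<lambda>x. x)) A"
      using F P by (simp add: emeasure_distr emeasure_count_space_finite Int_commute)
  qed
qed

lemma sets_counting: "finite_simple_counting \<mu> \<Longrightarrow> sets \<mu> = sets borel"
  by (simp add: finite_simple_counting_def)

lemma space_counting: "finite_simple_counting \<mu> \<Longrightarrow> space \<mu> = UNIV"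
  using sets_eq_imp_space_eq[OF sets_counting] by simp

lemma finite_measure_counting: "finite_simple_counting \<mu> \<Longrightarrow> finite_measure \<mu>"
  by (rule finite_measureI) (auto simp: space_counting finite_simple_counting_def of_nat_less_top[THEN less_imp_neq])

lemma nn_integral_counting:
  assumes "finite_simple_counting \<mu>" "f \<in> borel_measurable borel"
  shows "(\<integral>\<^sup>+x. f x \<partial>\<mu>) = (\<integral>\<^sup>+x. f x \<partial>count_space (points \<mu>))"
  by (subst finite_simple_counting_eq_distr(2)[OF assms(1)], subst nn_integral_distr) (use assms in auto)

lemma normalising_factor:
  assumes "finite_simple_counting \<mu>"
  shows "(1 + emeasure \<mu> UNIV) * inverse (1 + emeasure \<mu> UNIV) = 1"
  using finite_measure.emeasure_finite[OF finite_measure_counting[OF assms], of UNIV]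
  by (auto simp: divide_ennreal_def[symmetric] less_top intro!: ennreal_divide_self)

text \<open>Normalising the total mass makes the Giry space available.\<close>

definition counting_kernel :: "real measure \<Rightarrow> real measure" where
  "counting_kernel \<mu> = scale_measure (inverse (1 + emeasure \<mu> UNIV)) \<mu>"

lemma counting_kernel_measurable: "counting_kernel \<in> measurable counting_space (subprob_algebra borel)"
proof (rule measurable_subprob_algebra)
  fix \<mu> assume "\<mu> \<in> space counting_space"
  then have \<mu>: "finite_simple_counting \<mu>" by (simp add: space_counting_space)
  show "sets (counting_kernel \<mu>) = sets borel"
    using \<mu> by (simp add: counting_kernel_def sets_counting)
  show "subprob_space (counting_kernel \<mu>)"
  proof
    have "inverse (1 + emeasure \<mu> UNIV) * emeasure \<mu> UNIV \<le> inverse (1 + emeasure \<mu> UNIV) * (1 + emeasure \<mu> UNIV)"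
      by (intro mult_left_mono) auto
    also have "\<dots> = 1"
      using normalising_factor[OF \<mu>] by (simp add: mult.commute)
    finally show "emeasure (counting_kernel \<mu>) (space (counting_kernel \<mu>)) \<le> 1"
      by (simp add: counting_kernel_def space_counting[OF \<mu>] space_scale_measure)
    show "space (counting_kernel \<mu>) \<noteq> {}"
      by (simp add: counting_kernel_def space_counting[OF \<mu>] space_scale_measure)
  qed
next
  fix A :: "real set" assume [measurable]: "A \<in> sets borel"
  show "(\<lambda>\<mu>. emeasure (counting_kernel \<mu>) A) \<in> borel_measurable counting_space"
    by (simp add: counting_kernel_def)
qed

text \<open>The Giry space covers subprobability kernels only. The integral is therefore taken
  against the normalised kernel and multiplied back by \<open>1 + emeasure (d y) UNIV\<close>, which
  is itself measurable in \<open>y\<close>.\<close>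

lemma measurable_nn_integral_counting:
  assumes f: "(\<lambda>(y, x). f y x) \<in> borel_measurable (Y \<Otimes>\<^sub>M borel)"
    and d: "d \<in> measurable Y counting_space"
  shows "(\<lambda>y. \<integral>\<^sup>+x. f y x \<partial>d y) \<in> borel_measurable Y"
proof -
  note [measurable] = d measurable_compose[OF d counting_kernel_measurable]
  have *: "(\<integral>\<^sup>+x. f y x \<partial>d y) = (1 + emeasure (d y) UNIV) * (\<integral>\<^sup>+x. f y x \<partial>counting_kernel (d y))"
    if y: "y \<in> space Y" for y
  proof -
    have \<mu>: "finite_simple_counting (d y)"
      using measurable_space[OF d y] by (simp add: space_counting_space)
    have [measurable]: "f y \<in> borel_measurable (d y)"
      using measurable_Pair2[OF f y] sets_counting[OF \<mu>] by (simp cong: measurable_cong_sets)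
    then show ?thesis
      using normalising_factor[OF \<mu>] by (simp add: counting_kernel_def nn_integral_scale_measure mult.assoc[symmetric])
  qed
  have "(\<lambda>y. (1 + emeasure (d y) UNIV) * (\<integral>\<^sup>+x. f y x \<partial>counting_kernel (d y))) \<in> borel_measurable Y"
    using nn_integral_measurable_subprob_algebra2[of f Y borel "\<lambda>y. counting_kernel (d y)"] f
    by (intro borel_measurable_times_ennreal) (auto intro!: borel_measurable_add measurable_compose[OF d])
  then show ?thesis
    by (subst measurable_cong[OF *])
qed

section \<open>Factorial moments of the Poisson process\<close>

text \<open>Half-open cubes of side \<open>2 ^ - n\<close>, encoded by integer parts of the scaled
  coordinates so that one definition serves every dimension. Values of \<open>m\<close> off
  \<open>Basis\<close> are irrelevant.\<close>

definition dyadic_cube :: "nat \<Rightarrow> ('a::euclidean_space \<Rightarrow> int) \<Rightarrow> 'a set" where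
  "dyadic_cube n m = {x. \<forall>b\<in>Basis. \<lfloor>2 ^ n * (x \<bullet> b)\<rfloor> = m b}"

lemma dyadic_cube_borel [measurable]: "dyadic_cube n m \<in> sets borel"
  unfolding dyadic_cube_def by measurable

text \<open>An integer part at a coarser scale is the integer quotient of the one at a finer scale,
  hence determined by it. This is the nesting of dyadic cubes.\<close>

lemma floor_dyadic_coarser:
  fixes x y :: real
  assumes "l \<le> n" "\<lfloor>2 ^ n * x\<rfloor> = \<lfloor>2 ^ n * (y::real)\<rfloor>"
  shows "\<lfloor>2 ^ l * x\<rfloor> = \<lfloor>2 ^ l * y\<rfloor>"
proof -
  have *: "\<lfloor>2 ^ l * z\<rfloor> = \<lfloor>2 ^ n * z\<rfloor> div 2 ^ (n - l)" for z :: real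
  proof -
    have "2 ^ l * z = 2 ^ n * z / real_of_int (2 ^ (n - l))"
      using assms(1) by (simp add: field_simps flip: power_add)
    then show ?thesis
      using floor_divide_real_eq_div[of "2 ^ (n - l)" "2 ^ n * z"] by simp
  qed
  show ?thesis unfolding * assms(2) ..
qed

text \<open>Two dyadic cubes are nested or disjoint. The empty set is adjoined for the disjoint
  case.\<close>

lemma Int_stable_dyadic_cube: "Int_stable (insert {} {dyadic_cube n m | n m. True})"
proof -
  have *: "dyadic_cube l k \<inter> dyadic_cube n m \<in> insert {} {dyadic_cube n m | n m. True}"
    if "l \<le> n" for l n and k m :: "'a \<Rightarrow> int"
  proof (cases "dyadic_cube l k \<inter> dyadic_cube n m = {}")
    case False
    then obtain x where x: "x \<in> dyadic_cube l k" "x \<in> dyadic_cube n m" by auto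
    have "y \<in> dyadic_cube l k" if "y \<in> dyadic_cube n m" for y
      using floor_dyadic_coarser[OF \<open>l \<le> n\<close>] x that unfolding dyadic_cube_def by (smt (verit) mem_Collect_eq)
    then have "dyadic_cube l k \<inter> dyadic_cube n m = dyadic_cube n m" by auto
    then show ?thesis by auto
  qed simp
  show ?thesis
    unfolding Int_stable_def
  proof (intro ballI)
    fix a b assume a: "a \<in> insert {} {dyadic_cube n (m::'a \<Rightarrow> int) | n m. True}"
      and b: "b \<in> insert {} {dyadic_cube n (m::'a \<Rightarrow> int) | n m. True}"
    show "a \<inter> b \<in> insert {} {dyadic_cube n m | n m. True}"
    proof (cases "a = {} \<or> b = {}")
      case False
      then obtain l k n m where "a = dyadic_cube l k" "b = dyadic_cube n m" using a b by auto
      then show ?thesis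
        using *[of l n k m] *[of n l m k] by (cases "l \<le> n") (auto simp: Int_commute)
    qed auto
  qed
qed

text \<open>Restricting \<open>m\<close> to the finite set \<open>Basis\<close> does not change the
  cube, and leaves only countably many index functions.\<close>

lemma countable_dyadic_cubes: "countable {dyadic_cube n (m :: 'a::euclidean_space \<Rightarrow> int) | n m. True}"
proof -
  have "{dyadic_cube n (m :: 'a \<Rightarrow> int) | n m. True} \<subseteq> (\<lambda>(n, m). dyadic_cube n m) ` (UNIV \<times> (Basis \<rightarrow>\<^sub>E UNIV))"
  proof clarsimp
    fix n and m :: "'a \<Rightarrow> int"
    have "dyadic_cube n m = dyadic_cube n (restrict m Basis)" by (simp add: dyadic_cube_def)
    then show "dyadic_cube n m \<in> (\<lambda>(n, m). dyadic_cube n m) ` (UNIV \<times> (Basis \<rightarrow>\<^sub>E UNIV))"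
      by (intro image_eqI[of _ _ "(n, restrict m Basis)"]) auto
  qed
  then show ?thesis
    by (rule countable_subset) (auto intro!: countable_image countable_SIGMA countable_PiE)
qed

lemma sets_borel_dyadic_cubes:
  "sets (borel :: 'a::euclidean_space measure) = sigma_sets UNIV (insert {} {dyadic_cube n m | n m. True})"
    (is "_ = sigma_sets UNIV ?E")
proof
  show "sigma_sets UNIV ?E \<subseteq> sets (borel :: 'a measure)"
  proof -
    have "?E \<subseteq> sets (borel :: 'a measure)" by auto
    then show ?thesis using sets.sigma_sets_subset[of ?E "borel :: 'a measure"] by (simp only: space_borel)
  qed
  have op: "U \<in> sigma_sets UNIV ?E" if "open U" for U :: "'a set"
  proof -
    have "\<exists>n m. x \<in> dyadic_cube n m \<and> dyadic_cube n m \<subseteq> U" if "x \<in> U" for x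
    proof -
      obtain e where e: "e > 0" "ball x e \<subseteq> U" using \<open>open U\<close> \<open>x \<in> U\<close> open_contains_ball by blast
      \<comment> \<open>By comparison with the l1 norm, two points of one cube of level
        \<open>n\<close> are at distance at most \<open>DIM('a) / 2 ^ n\<close>, which has to be
        below \<open>e\<close>.\<close>
      obtain n where n: "real DIM('a) / e < 2 ^ n" using real_arch_pow[of 2 "real DIM('a) / e"] by auto
      have "y \<in> ball x e" if y: "y \<in> dyadic_cube n (\<lambda>b. \<lfloor>2 ^ n * (x \<bullet> b)\<rfloor>)" for y
      proof -
        have "\<bar>(x - y) \<bullet> b\<bar> \<le> 1 / 2 ^ n" if "b \<in> Basis" for b
        proof -
          have "\<lfloor>2 ^ n * (y \<bullet> b)\<rfloor> = \<lfloor>2 ^ n * (x \<bullet> b)\<rfloor>" using y that by (simp add: dyadic_cube_def)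
          then have "\<bar>2 ^ n * (x \<bullet> b) - 2 ^ n * (y \<bullet> b)\<bar> \<le> 1" by linarith
          then have "2 ^ n * \<bar>(x - y) \<bullet> b\<bar> \<le> 1"
            by (simp add: inner_diff_left abs_mult[symmetric] right_diff_distrib)
               (metis abs_mult abs_numeral power_abs right_diff_distrib)
          then show ?thesis by (simp add: field_simps)
        qed
        then have "(\<Sum>b\<in>Basis. \<bar>(x - y) \<bullet> b\<bar>) \<le> real DIM('a) * (1 / 2 ^ n)"
          by (rule sum_bounded_above)
        then have "norm (x - y) \<le> real DIM('a) / 2 ^ n" using norm_le_l1[of "x - y"] by simp
        also have "\<dots> < e" using n e by (simp add: field_simps)
        finally show ?thesis by (simp add: dist_norm)
      qed
      then show ?thesis
        using e by (intro exI[of _ n] exI[of _ "\<lambda>b. \<lfloor>2 ^ n * (x \<bullet> b)\<rfloor>"]) (auto simp: dyadic_cube_def)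
    qed
    then have "U = \<Union>{c \<in> {dyadic_cube n m | n m. True}. c \<subseteq> U}" by blast
    moreover have "\<Union>{c \<in> {dyadic_cube n m | n m. True}. c \<subseteq> U} \<in> sigma_sets UNIV ?E"
      by (rule sigma_sets_UNION) (auto intro: countable_subset[OF _ countable_dyadic_cubes])
    ultimately show ?thesis by simp
  qed
  show "sets (borel :: 'a measure) \<subseteq> sigma_sets UNIV ?E"
    unfolding borel_def by (simp, rule sigma_sets_mono) (use op in auto)
qed

text \<open>Uniqueness of measures on a generating family stable under intersections. The cubes are
  countably many and cover the space, so finiteness on each of them is the only size condition;
  equality of measures is reduced to cubes below by this rule.\<close>

lemma measure_eqI_dyadic_cubes:
  fixes \<mu> \<eta> :: "'a::euclidean_space measure"
  assumes "sets \<mu> = sets borel" "sets \<eta> = sets borel"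
    and "\<And>n m. emeasure \<mu> (dyadic_cube n m) = emeasure \<eta> (dyadic_cube n m)"
    and "\<And>n m. emeasure \<mu> (dyadic_cube n m) \<noteq> \<infinity>"
  shows "\<mu> = \<eta>"
proof (rule measure_eqI_generator_eq_countable[OF Int_stable_dyadic_cube])
  show "sets \<mu> = sigma_sets UNIV (insert {} {dyadic_cube n m | n m. True})"
    "sets \<eta> = sigma_sets UNIV (insert {} {dyadic_cube n m | n m. True})"
    using assms(1,2) sets_borel_dyadic_cubes by auto
  show "{dyadic_cube n m | n m. True} \<subseteq> insert {} {dyadic_cube n m | n m. True}" by auto
  show "\<Union>{dyadic_cube n m | n m. True} = (UNIV :: 'a set)"
  proof -
    have "x \<in> dyadic_cube 0 (\<lambda>b. \<lfloor>2 ^ 0 * (x \<bullet> b)\<rfloor>)" for x :: 'a by (simp add: dyadic_cube_def)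
    then show ?thesis by blast
  qed
qed (use assms countable_dyadic_cubes in auto)

abbreviation dyadic_cell :: "nat \<Rightarrow> int \<Rightarrow> real set" where
  "dyadic_cell n m \<equiv> dyadic_cube n (\<lambda>_. m)"

lemma dyadic_cell_disjoint: "m \<noteq> k \<Longrightarrow> dyadic_cell n m \<inter> dyadic_cell n k = {}"
  by (auto simp: dyadic_cube_def)

lemma dyadic_cube_prod:
  fixes m :: "'a::euclidean_space \<times> 'b::euclidean_space \<Rightarrow> int"
  shows "dyadic_cube n m = dyadic_cube n (\<lambda>b. m (b, 0)) \<times> dyadic_cube n (\<lambda>b. m (0, b))"
  by (auto simp: dyadic_cube_def Basis_prod_def ball_Un)

lemma dyadic_cube_real: "dyadic_cube n (m :: real \<Rightarrow> int) = dyadic_cell n (m 1)"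
  by (auto simp: dyadic_cube_def)

lemma bounded_dyadic_cell: "dyadic_cell n m \<subseteq> {real_of_int m / 2 ^ n .. real_of_int (m + 1) / 2 ^ n}"
proof
  fix x assume "x \<in> dyadic_cell n m"
  then have "\<lfloor>2 ^ n * x\<rfloor> = m" by (simp add: dyadic_cube_def)
  then have "real_of_int m \<le> 2 ^ n * x" "2 ^ n * x \<le> real_of_int (m + 1)" by linarith+
  then show "x \<in> {real_of_int m / 2 ^ n .. real_of_int (m + 1) / 2 ^ n}" by (simp add: field_simps)
qed

lemma emeasure_dyadic_cell_finite: "emeasure lborel (dyadic_cell n m) < \<infinity>"
proof -
  have "emeasure lborel (dyadic_cell n m) \<le> emeasure lborel {real_of_int m / 2 ^ n .. real_of_int (m + 1) / 2 ^ n}"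
    by (intro emeasure_mono bounded_dyadic_cell) simp
  also have "\<dots> < \<infinity>" by (simp add: divide_right_mono)
  finally show ?thesis .
qed

section \<open>Factorial moments of Poisson counts\<close>

lemma prod_falling_fact: "(\<Prod>i<m. k + m - i) * fact k = (fact (k + m) :: nat)"
proof (induction m)
  case (Suc m)
  have "(\<Prod>i<Suc m. k + Suc m - i) = (k + Suc m) * (\<Prod>i<m. k + m - i)"
    by (subst prod.lessThan_Suc_shift) simp
  then show ?case using Suc by (simp add: algebra_simps)
qed simp

text \<open>The falling factorial cancels the first \<open>m\<close> factors of
  \<open>fact k\<close>; after the shift by \<open>m\<close> an exponential series remains, and the
  terms before the shift vanish.\<close>

lemma poisson_factorial_moment:
  assumes "0 \<le> (l::real)"
  shows "(\<Sum>k. of_nat (\<Prod>i<m. k - i) * ennreal (l ^ k / fact k * exp (- l))) = ennreal (l ^ m)"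
proof -
  let ?f = "\<lambda>k. real (\<Prod>i<m. k - i) * (l ^ k / fact k * exp (- l))"
  have eq: "?f (k + m) = l ^ m * exp (- l) * (l ^ k /\<^sub>R fact k)" for k
  proof -
    have "real (\<Prod>i<m. k + m - i) * fact k = fact (k + m)"
      by (metis of_nat_fact of_nat_mult prod_falling_fact)
    then have "real (\<Prod>i<m. k + m - i) = fact (k + m) / fact k"
      by (simp add: eq_divide_eq)
    then show ?thesis by (simp only:) (simp add: field_simps power_add)
  qed
  have "(\<lambda>k. l ^ m * exp (- l) * (l ^ k /\<^sub>R fact k)) sums (l ^ m * exp (- l) * exp l)"
    by (intro sums_mult exp_converges)
  then have "(\<lambda>k. ?f (k + m)) sums (l ^ m)"
    unfolding eq by (simp add: mult.assoc flip: exp_add)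
  then have "?f sums (l ^ m + (\<Sum>k<m. ?f k))"
    by (subst (asm) sums_iff_shift)
  moreover have "?f k = 0" if "k < m" for k
  proof -
    \<comment> \<open>The factor with \<open>i = k\<close> is zero.\<close>
    have "(\<Prod>i<m. k - i) = 0" using that by (intro prod_zero) auto
    then show ?thesis by (simp del: of_nat_prod)
  qed
  then have "(\<Sum>k<m. ?f k) = 0" by (intro sum.neutral) blast
  ultimately have *: "?f sums (l ^ m)" by (simp only: add_0_right)
  have "(\<Sum>k. ennreal (?f k)) = ennreal (l ^ m)"
    using * assms by (intro sums_unique[symmetric]) (subst sums_ennreal, auto intro!: mult_nonneg_nonneg divide_nonneg_nonneg prod_nonneg)
  moreover have "of_nat (\<Prod>i<m. k - i) * ennreal (l ^ k / fact k * exp (- l)) = ennreal (?f k)" for k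
    by (subst ennreal_mult') (simp_all only: ennreal_of_nat_eq_real_of_nat of_nat_0_le_iff)
  ultimately show ?thesis by (simp only:)
qed

text \<open>Only the numbers of points in Borel sets are governed by the hypotheses. The law of an
  individual \<open>U j\<close> depends on the enumeration, so useful statements sum over all
  indices.\<close>

locale poisson_points = prob_space M for M :: "'w measure" +
  fixes \<nu> :: real and U :: "nat \<Rightarrow> 'w \<Rightarrow> real"
  assumes poisson: "poisson_process M \<nu> U" and nu_pos: "0 < \<nu>"
begin

lemma U_measurable [measurable]: "U j \<in> borel_measurable M"
  using poisson by (simp add: poisson_process_def)

definition idx :: "real set \<Rightarrow> 'w \<Rightarrow> nat set" where
  "idx A w = {j. U j w \<in> A}"

lemma prob_card_idx:
  assumes "A \<in> sets borel" "emeasure lborel A < \<infinity>"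
  shows "prob {w\<in>space M. finite (idx A w) \<and> card (idx A w) = k} =
    (\<nu> * measure lborel A) ^ k / fact k * exp (- (\<nu> * measure lborel A))"
  unfolding idx_def
  by (rule poisson[unfolded poisson_process_def, THEN conjunct2, THEN conjunct1, rule_format]) (use assms in auto)

lemma card_idx_event [measurable]:
  assumes [measurable]: "A \<in> sets borel"
  shows "{w\<in>space M. finite (idx A w) \<and> card (idx A w) = k} \<in> sets M"
  unfolding idx_def by measurable

text \<open>The definition prescribes the probabilities of having exactly \<open>k\<close> points.
  They add up to one, which leaves no mass for infinitely many points.\<close>

lemma AE_finite_idx:
  assumes A: "A \<in> sets borel" "emeasure lborel A < \<infinity>"
  shows "AE w in M. finite (idx A w)"
proof -
  note [measurable] = A(1)
  let ?E = "\<lambda>k. {w\<in>space M. finite (idx A w) \<and> card (idx A w) = k}"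
  have "(\<lambda>k. prob (?E k)) sums prob (\<Union>k. ?E k)"
    by (intro finite_measure_UNION) (auto simp: disjoint_family_on_def)
  moreover have "(\<lambda>k. prob (?E k)) sums 1"
  proof -
    let ?l = "\<nu> * measure lborel A"
    have "(\<lambda>k. exp (- ?l) * (?l ^ k /\<^sub>R fact k)) sums (exp (- ?l) * exp ?l)"
      by (intro sums_mult exp_converges)
    moreover have "exp (- ?l) * (?l ^ k /\<^sub>R fact k) = ?l ^ k / fact k * exp (- ?l)" for k
      by (simp add: divide_inverse)
    ultimately show ?thesis unfolding prob_card_idx[OF A] by (simp flip: exp_add)
  qed
  ultimately have "prob (\<Union>k. ?E k) = 1" by (rule sums_unique2)
  then have "AE w in M. w \<in> (\<Union>k. ?E k)"
    by (subst (asm) prob_eq_1) auto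
  then show ?thesis by eventually_elim auto
qed

lemma nn_integral_card_idx:
  assumes A: "A \<in> sets borel" "emeasure lborel A < \<infinity>"
  shows "(\<integral>\<^sup>+w. f (card (idx A w)) \<partial>M) =
    (\<Sum>k. f k * ennreal ((\<nu> * measure lborel A) ^ k / fact k * exp (- (\<nu> * measure lborel A))))"
proof -
  note [measurable] = A(1)
  let ?E = "\<lambda>k. {w\<in>space M. finite (idx A w) \<and> card (idx A w) = k}"
  have "(\<integral>\<^sup>+w. f (card (idx A w)) \<partial>M) = (\<integral>\<^sup>+w. (\<Sum>k. f k * indicator (?E k) w) \<partial>M)"
  proof (rule nn_integral_cong_AE)
    from AE_finite_idx[OF A] AE_space[of M] show "AE w in M. f (card (idx A w)) = (\<Sum>k. f k * indicator (?E k) w)"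
    proof eventually_elim
      case (elim w)
      have "(\<Sum>k. f k * indicator (?E k) w) = (\<Sum>k\<in>{card (idx A w)}. f k * indicator (?E k) w)"
        by (rule suminf_finite) (auto simp: indicator_def)
      then show ?case using elim by (simp add: indicator_def)
    qed
  qed
  also have "\<dots> = (\<Sum>k. f k * emeasure M (?E k))"
    by (subst nn_integral_suminf) (auto simp: nn_integral_cmult)
  finally show ?thesis unfolding emeasure_eq_measure prob_card_idx[OF A] .
qed

lemma nn_integral_factorial_moment:
  assumes A: "A \<in> sets borel" "emeasure lborel A < \<infinity>"
  shows "(\<integral>\<^sup>+w. of_nat (\<Prod>i<m. card (idx A w) - i) \<partial>M) = ennreal ((\<nu> * measure lborel A) ^ m)"
  unfolding nn_integral_card_idx[OF A, of "\<lambda>n. of_nat (\<Prod>i<m. n - i)"]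
  by (rule poisson_factorial_moment) (use nu_pos in simp)

lemma nn_integral_prod_card_idx:
  fixes A :: "nat \<Rightarrow> real set"
  assumes "finite I" "disjoint_family_on A I" "\<And>i. i \<in> I \<Longrightarrow> A i \<in> sets borel"
    "\<And>i. i \<in> I \<Longrightarrow> emeasure lborel (A i) < \<infinity>"
  shows "(\<integral>\<^sup>+w. (\<Prod>i\<in>I. f i (card (idx (A i) w))) \<partial>M) = (\<Prod>i\<in>I. \<integral>\<^sup>+w. (f i (card (idx (A i) w)) :: ennreal) \<partial>M)"
proof -
  have "indep_vars (\<lambda>_. count_space UNIV) (\<lambda>i w. card (idx (A i) w)) I"
    unfolding idx_def
    by (rule poisson[unfolded poisson_process_def, THEN conjunct2, THEN conjunct2, rule_format]) (use assms in auto)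
  then have "indep_vars (\<lambda>_. borel) (\<lambda>i w. f i (card (idx (A i) w))) I"
    by (rule indep_vars_compose2) auto
  then show ?thesis
    using indep_vars_nn_integral[of I "\<lambda>i w. f i (card (idx (A i) w))"] assms(1) by simp
qed

end

section \<open>Factorial moment measures of the points\<close>

text \<open>The flag \<open>p\<close> records which case of equal or disjoint sets occurs: the
  choice of \<open>i\<close> removes a candidate for \<open>j\<close> exactly when the sets
  coincide.\<close>

lemma card_distinct_pairs:
  assumes "finite A" "finite B" "p \<Longrightarrow> A = B" "\<not> p \<Longrightarrow> A \<inter> B = {}"
  shows "card {(i, j). i \<noteq> j \<and> i \<in> A \<and> j \<in> B} = card A * (card B - of_bool p)"
proof -
  have "{(i, j). i \<noteq> j \<and> i \<in> A \<and> j \<in> B} = (SIGMA i:A. B - {i})" by auto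
  moreover have "card (B - {i}) = card B - of_bool p" if "i \<in> A" for i
    using assms that by (cases p) (auto simp: card_Diff_singleton_if)
  ultimately show ?thesis using assms by simp
qed

lemma card_distinct_triples:
  assumes "finite A" "finite B" "finite C"
    and "p \<Longrightarrow> A = B" "\<not> p \<Longrightarrow> A \<inter> B = {}"
    and "q \<Longrightarrow> A = C" "\<not> q \<Longrightarrow> A \<inter> C = {}"
    and "r \<Longrightarrow> B = C" "\<not> r \<Longrightarrow> B \<inter> C = {}"
  shows "card {(i, j, k). i \<noteq> j \<and> i \<noteq> k \<and> j \<noteq> k \<and> i \<in> A \<and> j \<in> B \<and> k \<in> C}
    = card A * ((card B - of_bool p) * (card C - of_bool q - of_bool r))"
proof -
  have "{(i, j, k). i \<noteq> j \<and> i \<noteq> k \<and> j \<noteq> k \<and> i \<in> A \<and> j \<in> B \<and> k \<in> C}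
    = (SIGMA i:A. SIGMA j:B - {i}. C - {i} - {j})" by auto
  moreover have "card (B - {i}) = card B - of_bool p" if "i \<in> A" for i
    using assms that by (cases p) (auto simp: card_Diff_singleton_if)
  moreover have "card (C - {i} - {j}) = card C - of_bool q - of_bool r" if "i \<in> A" "j \<in> B - {i}" for i j
    using assms(3,6-9) that by (cases q; cases r) (auto simp: card_Diff_singleton_if)
  ultimately show ?thesis using assms by simp
qed

abbreviation distinct_pairs :: "(nat \<times> nat) set" where
  "distinct_pairs \<equiv> {(i, j). i \<noteq> j}"

abbreviation distinct_triples :: "(nat \<times> nat \<times> nat) set" where
  "distinct_triples \<equiv> {(i, j, k). i \<noteq> j \<and> i \<noteq> k \<and> j \<noteq> k}"

lemma nn_integral_count_space_indicator_card:
  assumes "finite {i \<in> I. i \<in> B}"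
  shows "(\<integral>\<^sup>+i. indicator B i \<partial>count_space I) = of_nat (card {i \<in> I. i \<in> B})"
proof -
  have "(\<integral>\<^sup>+i. indicator B i \<partial>count_space I) = (\<integral>\<^sup>+i. indicator {i \<in> I. i \<in> B} i \<partial>count_space I)"
    by (intro nn_integral_cong) (auto simp: indicator_def)
  also have "\<dots> = of_nat (card {i \<in> I. i \<in> B})"
    using assms by (subst nn_integral_indicator) (auto simp: emeasure_count_space_finite)
  finally show ?thesis .
qed

lemma emeasure_lborel_prod:
  fixes A :: "'a::euclidean_space set" and B :: "'b::euclidean_space set"
  assumes "A \<in> sets borel" "B \<in> sets borel"
  shows "emeasure lborel (A \<times> B) = emeasure lborel A * emeasure lborel B"
  using assms by (simp add: lborel.emeasure_pair_measure_Times flip: lborel_prod)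

context poisson_points
begin

lemma idx_disjoint: "A \<inter> B = {} \<Longrightarrow> idx A w \<inter> idx B w = {}"
  by (auto simp: idx_def)

lemma factorial_moment_disjoint2:
  assumes "A \<inter> B = {}" "A \<in> sets borel" "B \<in> sets borel" "emeasure lborel A < \<infinity>" "emeasure lborel B < \<infinity>"
  shows "(\<integral>\<^sup>+w. of_nat ((\<Prod>i<a. card (idx A w) - i) * (\<Prod>i<b. card (idx B w) - i)) \<partial>M)
    = ennreal ((\<nu> * measure lborel A) ^ a) * ennreal ((\<nu> * measure lborel B) ^ b)"
proof -
  let ?A = "\<lambda>i::nat. if i = 0 then A else B" and ?m = "\<lambda>i::nat. if i = 0 then a else b"
  have "(\<integral>\<^sup>+w. (\<Prod>i\<in>{0, 1}. of_nat (\<Prod>j<?m i. card (idx (?A i) w) - j)) \<partial>M)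
      = (\<Prod>i\<in>{0, 1}. \<integral>\<^sup>+w. of_nat (\<Prod>j<?m i. card (idx (?A i) w) - j) \<partial>M)"
    using assms by (intro nn_integral_prod_card_idx[where f = "\<lambda>i n. of_nat (\<Prod>j<?m i. n - j)"])
      (auto simp: disjoint_family_on_def)
  then show ?thesis using assms by (simp add: nn_integral_factorial_moment del: of_nat_prod)
qed

lemma factorial_moment_disjoint3:
  assumes "A \<inter> B = {}" "A \<inter> C = {}" "B \<inter> C = {}" "A \<in> sets borel" "B \<in> sets borel" "C \<in> sets borel"
     "emeasure lborel A < \<infinity>" "emeasure lborel B < \<infinity>" "emeasure lborel C < \<infinity>"
  shows "(\<integral>\<^sup>+w. of_nat (card (idx A w) * (card (idx B w) * card (idx C w))) \<partial>M)
    = ennreal (\<nu> * measure lborel A) * (ennreal (\<nu> * measure lborel B) * ennreal (\<nu> * measure lborel C))"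
proof -
  let ?A = "\<lambda>i::nat. if i = 0 then A else if i = 1 then B else C"
  have "(\<integral>\<^sup>+w. (\<Prod>i\<in>{0, 1, 2}. of_nat (card (idx (?A i) w))) \<partial>M)
      = (\<Prod>i\<in>{0, 1, 2}. \<integral>\<^sup>+w. of_nat (card (idx (?A i) w)) \<partial>M)"
    using assms by (intro nn_integral_prod_card_idx[where f = "\<lambda>i n. of_nat n"])
      (auto simp: disjoint_family_on_def)
  then show ?thesis using assms nn_integral_factorial_moment[of _ 1] by (simp add: del: of_nat_prod)
qed

lemma ennreal_nu_measure: "emeasure lborel A < \<infinity> \<Longrightarrow> ennreal (\<nu> * measure lborel A) = ennreal \<nu> * emeasure lborel A"
  using nu_pos by (subst emeasure_eq_ennreal_measure) (auto simp: ennreal_mult')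

text \<open>The two sides of a cube are cells of the same level, hence equal or disjoint. Equal
  cells give the second factorial moment of one Poisson count, disjoint cells a product of
  independent means; both are the product of the two means.\<close>

lemma factorial_measure2:
  "distr (count_space distinct_pairs \<Otimes>\<^sub>M M) borel (\<lambda>((i, j), w). (U i w, U j w))
    = scale_measure (ennreal \<nu> ^ 2) lborel" (is "?L = ?R")
proof (rule measure_eqI_dyadic_cubes)
  have [measurable]: "(\<lambda>((i, j), w). (U i w, U j w)) \<in> borel_measurable (count_space distinct_pairs \<Otimes>\<^sub>M M)"
    by (rule measurable_pair_measure_countable1) auto
  fix n :: nat and m :: "real \<times> real \<Rightarrow> int"
  let ?A = "dyadic_cell n (m (1, 0))" and ?B = "dyadic_cell n (m (0, 1))"
  note fin = emeasure_dyadic_cell_finite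
  have cube: "dyadic_cube n m = ?A \<times> ?B"
    unfolding dyadic_cube_prod[of n m] dyadic_cube_real[of n "\<lambda>b. m (b, 0)"] dyadic_cube_real[of n "\<lambda>b. m (0, b)"] ..
  define p where "p \<longleftrightarrow> m (1, 0) = m (0, 1)"
  have p: "p \<Longrightarrow> ?A = ?B" "\<not> p \<Longrightarrow> ?A \<inter> ?B = {}"
    unfolding p_def using dyadic_cell_disjoint[of "m (1,0)" "m (0,1)" n] by auto
  have "emeasure ?L (dyadic_cube n m)
      = (\<integral>\<^sup>+e. \<integral>\<^sup>+w. indicator {(i, j). i \<in> idx ?A w \<and> j \<in> idx ?B w} e \<partial>M \<partial>count_space distinct_pairs)"
  proof -
    have R [measurable]: "?A \<times> ?B \<in> sets borel" by (intro borel_Times dyadic_cube_borel)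
    have "emeasure ?L (?A \<times> ?B) = (\<integral>\<^sup>+z. indicator (?A \<times> ?B) ((\<lambda>((i, j), w). (U i w, U j w)) z) \<partial>(count_space distinct_pairs \<Otimes>\<^sub>M M))"
      by (subst nn_integral_indicator[symmetric], simp, subst nn_integral_distr, simp_all)
    also have "\<dots> = (\<integral>\<^sup>+e. \<integral>\<^sup>+w. indicator (?A \<times> ?B) ((\<lambda>((i, j), w). (U i w, U j w)) (e, w)) \<partial>M \<partial>count_space distinct_pairs)"
      by (subst nn_integral_fst[symmetric], rule measurable_compose[OF _ borel_measurable_indicator[OF R]]) simp_all
    finally show ?thesis
      unfolding cube by (simp add: idx_def indicator_def case_prod_unfold mem_Times_iff)
  qed
  \<comment> \<open>For a fixed sample point the sum over index pairs is a cardinality, so the sum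
    is brought inside the expectation before it is evaluated.\<close>
  also have "\<dots> = (\<integral>\<^sup>+w. \<integral>\<^sup>+e. indicator {(i, j). i \<in> idx ?A w \<and> j \<in> idx ?B w} e \<partial>count_space distinct_pairs \<partial>M)"
    by (rule nn_integral_count_space_nn_integral[symmetric], simp)
       (simp add: idx_def case_prod_unfold, measurable)
  also have "\<dots> = (\<integral>\<^sup>+w. of_nat (card (idx ?A w) * (card (idx ?B w) - of_bool p)) \<partial>M)"
  proof (rule nn_integral_cong_AE)
    from AE_finite_idx[OF dyadic_cube_borel fin, of n "m (1, 0)"] AE_finite_idx[OF dyadic_cube_borel fin, of n "m (0, 1)"]
    show "AE w in M. (\<integral>\<^sup>+e. indicator {(i, j). i \<in> idx ?A w \<and> j \<in> idx ?B w} e \<partial>count_space distinct_pairs)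
      = of_nat (card (idx ?A w) * (card (idx ?B w) - of_bool p))"
    proof eventually_elim
      case (elim w)
      have "{e \<in> distinct_pairs. e \<in> {(i, j). i \<in> idx ?A w \<and> j \<in> idx ?B w}} = {(i, j). i \<noteq> j \<and> i \<in> idx ?A w \<and> j \<in> idx ?B w}"
        by auto
      moreover have "finite {(i, j). i \<noteq> j \<and> i \<in> idx ?A w \<and> j \<in> idx ?B w}"
        by (rule finite_subset[of _ "idx ?A w \<times> idx ?B w"]) (use elim in auto)
      ultimately show ?case
        using card_distinct_pairs[OF elim, of p] p idx_disjoint[of ?A ?B w]
        by (subst nn_integral_count_space_indicator_card) auto
    qed
  qed
  also have "\<dots> = ennreal (\<nu> * measure lborel ?A) * ennreal (\<nu> * measure lborel ?B)"
  proof (cases p)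
    case True
    then show ?thesis using nn_integral_factorial_moment[OF dyadic_cube_borel fin, of n "m (1,0)" 2] p(1)[OF True] nu_pos
      by (simp add: numeral_2_eq_2 ennreal_mult'[symmetric] del: of_nat_mult)
  next
    case False
    then show ?thesis using factorial_moment_disjoint2[OF p(2)[OF False], of 1 1] fin
      by (simp del: of_nat_mult)
  qed
  also have "\<dots> = emeasure ?R (dyadic_cube n m)"
    unfolding cube using fin by (simp add: ennreal_nu_measure emeasure_lborel_prod power2_eq_square mult_ac)
  finally show "emeasure ?L (dyadic_cube n m) = emeasure ?R (dyadic_cube n m)" .
  then show "emeasure ?L (dyadic_cube n m) \<noteq> \<infinity>"
    unfolding cube using fin[of n "m (1,0)"] fin[of n "m (0,1)"]
    by (simp add: emeasure_lborel_prod ennreal_mult_eq_top_iff power2_eq_square less_top[symmetric])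
qed auto

text \<open>As for pairs, with the three sides of a cube falling into one of five patterns of
  coincidence. The count \<open>?N\<close> looks asymmetric, but in each pattern it is a product of
  falling factorials of counts of disjoint cells.\<close>

lemma factorial_measure3:
  "distr (count_space distinct_triples \<Otimes>\<^sub>M M) borel (\<lambda>((i, j, k), w). (U i w, U j w, U k w))
    = scale_measure (ennreal \<nu> ^ 3) lborel" (is "?L = ?R")
proof (rule measure_eqI_dyadic_cubes)
  have [measurable]: "(\<lambda>((i, j, k), w). (U i w, U j w, U k w)) \<in> borel_measurable (count_space distinct_triples \<Otimes>\<^sub>M M)"
    by (rule measurable_pair_measure_countable1) auto
  fix n :: nat and m :: "real \<times> real \<times> real \<Rightarrow> int"
  let ?a = "m (1, 0, 0)" and ?b = "m (0, 1, 0)" and ?c = "m (0, 0, 1)"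
  let ?A = "dyadic_cell n ?a" and ?B = "dyadic_cell n ?b" and ?C = "dyadic_cell n ?c"
  note fin = emeasure_dyadic_cell_finite
  have cube: "dyadic_cube n m = ?A \<times> ?B \<times> ?C"
    unfolding dyadic_cube_prod[of n m] dyadic_cube_prod[of n "\<lambda>b. m (0, b)"] zero_prod_def
      dyadic_cube_real[of n "\<lambda>b. m (b, 0, 0)"] dyadic_cube_real[of n "\<lambda>b. m (0, b, 0)"] dyadic_cube_real[of n "\<lambda>b. m (0, 0, b)"] ..
  have eqs: "?a = ?b \<Longrightarrow> ?A = ?B" "?a = ?c \<Longrightarrow> ?A = ?C" "?b = ?c \<Longrightarrow> ?B = ?C" by simp_all
  have dis: "?a \<noteq> ?b \<Longrightarrow> ?A \<inter> ?B = {}" "?a \<noteq> ?c \<Longrightarrow> ?A \<inter> ?C = {}" "?b \<noteq> ?c \<Longrightarrow> ?B \<inter> ?C = {}"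
    by (auto dest!: dyadic_cell_disjoint[of _ _ n])
  let ?I = "\<lambda>w. {(i, j, k). i \<in> idx ?A w \<and> j \<in> idx ?B w \<and> k \<in> idx ?C w}"
  let ?N = "\<lambda>w. card (idx ?A w) * ((card (idx ?B w) - of_bool (?a = ?b)) *
    (card (idx ?C w) - of_bool (?a = ?c) - of_bool (?b = ?c)))"
  have "emeasure ?L (dyadic_cube n m)
      = (\<integral>\<^sup>+e. \<integral>\<^sup>+w. indicator (?I w) e \<partial>M \<partial>count_space distinct_triples)"
  proof -
    have R [measurable]: "?A \<times> ?B \<times> ?C \<in> sets borel" by (intro borel_Times dyadic_cube_borel)
    have "emeasure ?L (?A \<times> ?B \<times> ?C) = (\<integral>\<^sup>+z. indicator (?A \<times> ?B \<times> ?C) ((\<lambda>((i, j, k), w). (U i w, U j w, U k w)) z) \<partial>(count_space distinct_triples \<Otimes>\<^sub>M M))"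
      by (subst nn_integral_indicator[symmetric], simp, subst nn_integral_distr, simp_all)
    also have "\<dots> = (\<integral>\<^sup>+e. \<integral>\<^sup>+w. indicator (?A \<times> ?B \<times> ?C) ((\<lambda>((i, j, k), w). (U i w, U j w, U k w)) (e, w)) \<partial>M \<partial>count_space distinct_triples)"
      by (subst nn_integral_fst[symmetric], rule measurable_compose[OF _ borel_measurable_indicator[OF R]]) simp_all
    finally show ?thesis
      unfolding cube by (simp add: idx_def indicator_def case_prod_unfold mem_Times_iff)
  qed
  also have "\<dots> = (\<integral>\<^sup>+w. \<integral>\<^sup>+e. indicator (?I w) e \<partial>count_space distinct_triples \<partial>M)"
    by (rule nn_integral_count_space_nn_integral[symmetric], simp)
       (simp add: idx_def case_prod_unfold, measurable)
  also have "\<dots> = (\<integral>\<^sup>+w. of_nat (?N w) \<partial>M)"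
  proof (rule nn_integral_cong_AE)
    from AE_finite_idx[OF dyadic_cube_borel fin, of n ?a] AE_finite_idx[OF dyadic_cube_borel fin, of n ?b]
      AE_finite_idx[OF dyadic_cube_borel fin, of n ?c]
    show "AE w in M. (\<integral>\<^sup>+e. indicator (?I w) e \<partial>count_space distinct_triples) = of_nat (?N w)"
    proof eventually_elim
      case (elim w)
      let ?S = "{(i, j, k). i \<noteq> j \<and> i \<noteq> k \<and> j \<noteq> k \<and> i \<in> idx ?A w \<and> j \<in> idx ?B w \<and> k \<in> idx ?C w}"
      have "{e \<in> distinct_triples. e \<in> ?I w} = ?S" by auto
      moreover have "finite ?S"
        by (rule finite_subset[of _ "idx ?A w \<times> idx ?B w \<times> idx ?C w"]) (use elim in auto)
      moreover have "card ?S = ?N w"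
        by (rule card_distinct_triples[OF elim]) (use dis in \<open>auto intro!: idx_disjoint simp del: Int_iff\<close>)
      ultimately show ?case
        by (subst nn_integral_count_space_indicator_card) auto
    qed
  qed
  also have "\<dots> = ennreal (\<nu> * measure lborel ?A) * (ennreal (\<nu> * measure lborel ?B) * ennreal (\<nu> * measure lborel ?C))"
  proof -
    \<comment> \<open>These are the five partitions of three cells into classes of equal ones: all
      equal, one of three pairs equal, all distinct.\<close>
    consider "?a = ?b" "?a = ?c" | "?a = ?b" "?a \<noteq> ?c" | "?a \<noteq> ?b" "?a = ?c" | "?a \<noteq> ?b" "?a \<noteq> ?c" "?b = ?c"
      | "?a \<noteq> ?b" "?a \<noteq> ?c" "?b \<noteq> ?c" by metis
    then show ?thesis
    proof cases
      case 1
      then show ?thesis using nn_integral_factorial_moment[OF dyadic_cube_borel fin, of n ?a 3] nu_pos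
        by (simp add: eval_nat_numeral ennreal_mult'[symmetric] mult_ac del: of_nat_mult)
    next
      case 2
      then show ?thesis using factorial_moment_disjoint2[OF dis(2), of 2 1] fin nu_pos
        by (simp add: eval_nat_numeral ennreal_mult'[symmetric] mult_ac del: of_nat_mult)
    next
      case 3
      then have "?b \<noteq> ?a" by simp
      with 3 show ?thesis using factorial_moment_disjoint2[OF dis(1), of 2 1] fin nu_pos
        by (simp add: eval_nat_numeral ennreal_mult'[symmetric] mult_ac del: of_nat_mult)
    next
      case 4
      then show ?thesis using factorial_moment_disjoint2[OF dis(1), of 1 2] fin nu_pos
        by (simp add: eval_nat_numeral ennreal_mult'[symmetric] mult_ac del: of_nat_mult)
    next
      case 5
      then show ?thesis using factorial_moment_disjoint3[OF dis(1) dis(2) dis(3)] fin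
        by (simp del: of_nat_mult)
    qed
  qed
  also have "\<dots> = emeasure ?R (dyadic_cube n m)"
    unfolding cube using fin by (simp add: ennreal_nu_measure emeasure_lborel_prod borel_Times power3_eq_cube mult_ac)
  finally show "emeasure ?L (dyadic_cube n m) = emeasure ?R (dyadic_cube n m)" .
  then show "emeasure ?L (dyadic_cube n m) \<noteq> \<infinity>"
    unfolding cube using fin[of n ?a] fin[of n ?b] fin[of n ?c]
    by (simp add: emeasure_lborel_prod borel_Times ennreal_mult_eq_top_iff power3_eq_cube less_top[symmetric])
qed auto

lemma factorial_measure1:
  "distr (count_space UNIV \<Otimes>\<^sub>M M) borel (\<lambda>(i, w). U i w) = scale_measure (ennreal \<nu>) lborel" (is "?L = ?R")
proof (rule measure_eqI_dyadic_cubes)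
  have [measurable]: "(\<lambda>(i, w). U i w) \<in> borel_measurable (count_space UNIV \<Otimes>\<^sub>M M)"
    by (rule measurable_pair_measure_countable1) auto
  fix n :: nat and m :: "real \<Rightarrow> int"
  let ?A = "dyadic_cell n (m 1)"
  note fin = emeasure_dyadic_cell_finite
  have cube: "dyadic_cube n m = ?A" by (rule dyadic_cube_real)
  have "emeasure ?L (dyadic_cube n m)
      = (\<integral>\<^sup>+e. \<integral>\<^sup>+w. indicator (idx ?A w) e \<partial>M \<partial>count_space UNIV)"
  proof -
    have R [measurable]: "?A \<in> sets borel" by (rule dyadic_cube_borel)
    have "emeasure ?L (?A) = (\<integral>\<^sup>+z. indicator (?A) ((\<lambda>(i, w). U i w) z) \<partial>(count_space UNIV \<Otimes>\<^sub>M M))"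
      by (subst nn_integral_indicator[symmetric], simp, subst nn_integral_distr, simp_all)
    also have "\<dots> = (\<integral>\<^sup>+e. \<integral>\<^sup>+w. indicator (?A) ((\<lambda>(i, w). U i w) (e, w)) \<partial>M \<partial>count_space UNIV)"
      by (subst nn_integral_fst[symmetric], rule measurable_compose[OF _ borel_measurable_indicator[OF R]]) simp_all
    finally show ?thesis
      unfolding cube by (simp add: idx_def indicator_def case_prod_unfold mem_Times_iff)
  qed
  also have "\<dots> = (\<integral>\<^sup>+w. \<integral>\<^sup>+e. indicator (idx ?A w) e \<partial>count_space UNIV \<partial>M)"
    by (rule nn_integral_count_space_nn_integral[symmetric]) (auto simp: idx_def)
  also have "\<dots> = (\<integral>\<^sup>+w. of_nat (card (idx ?A w)) \<partial>M)"
  proof (rule nn_integral_cong_AE)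
    from AE_finite_idx[OF dyadic_cube_borel fin, of n "m 1"]
    show "AE w in M. (\<integral>\<^sup>+e. indicator (idx ?A w) e \<partial>count_space UNIV) = of_nat (card (idx ?A w))"
      by eventually_elim (subst nn_integral_count_space_indicator_card, auto)
  qed
  also have "\<dots> = ennreal (\<nu> * measure lborel ?A)"
    using nn_integral_factorial_moment[OF dyadic_cube_borel fin, of n "m 1" 1] by simp
  also have "\<dots> = emeasure ?R (dyadic_cube n m)"
    unfolding cube using fin by (simp add: ennreal_nu_measure)
  finally show "emeasure ?L (dyadic_cube n m) = emeasure ?R (dyadic_cube n m)" .
  then show "emeasure ?L (dyadic_cube n m) \<noteq> \<infinity>"
    unfolding cube using fin[of n "m 1"] by (simp add: ennreal_mult_eq_top_iff less_top[symmetric])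
qed auto

section \<open>Campbell formulas for the Poisson points\<close>

lemma campbell1:
  assumes [measurable]: "h \<in> borel_measurable borel"
  shows "(\<integral>\<^sup>+i. \<integral>\<^sup>+w. h (U i w) \<partial>M \<partial>count_space UNIV) = ennreal \<nu> * (\<integral>\<^sup>+u. h u \<partial>lborel)"
proof -
  have [measurable]: "(\<lambda>(i, w). U i w) \<in> borel_measurable (count_space UNIV \<Otimes>\<^sub>M M)"
    by (rule measurable_pair_measure_countable1) auto
  have "(\<integral>\<^sup>+i. \<integral>\<^sup>+w. h (U i w) \<partial>M \<partial>count_space UNIV) = (\<integral>\<^sup>+z. h ((\<lambda>(i, w). U i w) z) \<partial>(count_space UNIV \<Otimes>\<^sub>M M))"
    by (subst nn_integral_fst[symmetric]) auto
  also have "\<dots> = (\<integral>\<^sup>+u. h u \<partial>distr (count_space UNIV \<Otimes>\<^sub>M M) borel (\<lambda>(i, w). U i w))"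
    by (subst nn_integral_distr) auto
  finally show ?thesis by (simp add: factorial_measure1 nn_integral_scale_measure)
qed

lemma campbell2:
  assumes [measurable]: "h \<in> borel_measurable borel"
  shows "(\<integral>\<^sup>+(i, j). \<integral>\<^sup>+w. h (U i w, U j w) \<partial>M \<partial>count_space distinct_pairs) = ennreal \<nu> ^ 2 * (\<integral>\<^sup>+u. h u \<partial>lborel)"
proof -
  have [measurable]: "(\<lambda>((i, j), w). (U i w, U j w)) \<in> borel_measurable (count_space distinct_pairs \<Otimes>\<^sub>M M)"
    by (rule measurable_pair_measure_countable1) auto
  have "(\<integral>\<^sup>+(i, j). \<integral>\<^sup>+w. h (U i w, U j w) \<partial>M \<partial>count_space distinct_pairs)
    = (\<integral>\<^sup>+z. h ((\<lambda>((i, j), w). (U i w, U j w)) z) \<partial>(count_space distinct_pairs \<Otimes>\<^sub>M M))"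
    by (subst nn_integral_fst[symmetric], rule measurable_compose[OF _ assms], simp) (simp add: case_prod_unfold)
  also have "\<dots> = (\<integral>\<^sup>+u. h u \<partial>distr (count_space distinct_pairs \<Otimes>\<^sub>M M) borel (\<lambda>((i, j), w). (U i w, U j w)))"
    by (subst nn_integral_distr) auto
  finally show ?thesis by (simp add: factorial_measure2 nn_integral_scale_measure)
qed

lemma campbell3:
  assumes [measurable]: "h \<in> borel_measurable borel"
  shows "(\<integral>\<^sup>+(i, j, k). \<integral>\<^sup>+w. h (U i w, U j w, U k w) \<partial>M \<partial>count_space distinct_triples) = ennreal \<nu> ^ 3 * (\<integral>\<^sup>+u. h u \<partial>lborel)"
proof -
  have [measurable]: "(\<lambda>((i, j, k), w). (U i w, U j w, U k w)) \<in> borel_measurable (count_space distinct_triples \<Otimes>\<^sub>M M)"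
    by (rule measurable_pair_measure_countable1) auto
  have "(\<integral>\<^sup>+(i, j, k). \<integral>\<^sup>+w. h (U i w, U j w, U k w) \<partial>M \<partial>count_space distinct_triples)
    = (\<integral>\<^sup>+z. h ((\<lambda>((i, j, k), w). (U i w, U j w, U k w)) z) \<partial>(count_space distinct_triples \<Otimes>\<^sub>M M))"
    by (subst nn_integral_fst[symmetric], rule measurable_compose[OF _ assms], simp) (simp add: case_prod_unfold)
  also have "\<dots> = (\<integral>\<^sup>+u. h u \<partial>distr (count_space distinct_triples \<Otimes>\<^sub>M M) borel (\<lambda>((i, j, k), w). (U i w, U j w, U k w)))"
    by (subst nn_integral_distr) auto
  finally show ?thesis by (simp add: factorial_measure3 nn_integral_scale_measure)
qed

end

section \<open>Independent marks\<close>

text \<open>Independence makes the joint law agree with the product law on rectangles, hence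
  everywhere. The independent copy is realised by a second integration over \<open>M\<close> itself,
  so no larger probability space is needed.\<close>

lemma (in prob_space) indep_elements_nn_integral:
  assumes X [measurable]: "X \<in> measurable M K" and Y [measurable]: "Y \<in> measurable M L"
    and indep: "indep_elements M K X L Y"
    and h: "(\<lambda>(x, y). h x y) \<in> borel_measurable (K \<Otimes>\<^sub>M L)"
  shows "(\<integral>\<^sup>+w. h (X w) (Y w) \<partial>M) = (\<integral>\<^sup>+w'. \<integral>\<^sup>+w. h (X w') (Y w) \<partial>M \<partial>M)"
proof -
  interpret KX: prob_space "distr M K X" by (rule prob_space_distr) fact
  interpret LY: prob_space "distr M L Y" by (rule prob_space_distr) fact
  have "distr M K X \<Otimes>\<^sub>M distr M L Y = distr M (K \<Otimes>\<^sub>M L) (\<lambda>w. (X w, Y w))"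
  proof (rule pair_measure_eqI)
    fix A B assume "A \<in> sets (distr M K X)" "B \<in> sets (distr M L Y)"
    then have [measurable]: "A \<in> sets K" "B \<in> sets L" by auto
    have "X -` A \<inter> space M \<in> sets (vimage_algebra (space M) X K)" "Y -` B \<inter> space M \<in> sets (vimage_algebra (space M) Y L)"
      by (auto intro!: in_vimage_algebra)
    then have "prob ((X -` A \<inter> space M) \<inter> (Y -` B \<inter> space M)) = prob (X -` A \<inter> space M) * prob (Y -` B \<inter> space M)"
      using indep unfolding indep_elements_def by (rule indep_setD[rotated])
    moreover have "(\<lambda>w. (X w, Y w)) -` (A \<times> B) \<inter> space M = (X -` A \<inter> space M) \<inter> (Y -` B \<inter> space M)" by auto
    ultimately show "emeasure (distr M K X) A * emeasure (distr M L Y) B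
        = emeasure (distr M (K \<Otimes>\<^sub>M L) (\<lambda>w. (X w, Y w))) (A \<times> B)"
      by (simp add: emeasure_distr emeasure_eq_measure ennreal_mult'')
  qed (auto intro: KX.sigma_finite_measure LY.sigma_finite_measure sets_pair_measure_cong)
  note eq = this
  have h2 [measurable]: "(\<lambda>(x, y). h x y) \<in> borel_measurable (distr M K X \<Otimes>\<^sub>M distr M L Y)"
    using h by (simp cong: measurable_cong_sets sets_pair_measure_cong)
  have "(\<integral>\<^sup>+w. h (X w) (Y w) \<partial>M) = (\<integral>\<^sup>+z. (\<lambda>(x, y). h x y) z \<partial>distr M (K \<Otimes>\<^sub>M L) (\<lambda>w. (X w, Y w)))"
    using h by (subst nn_integral_distr) auto
  also have "\<dots> = (\<integral>\<^sup>+x. \<integral>\<^sup>+y. h x y \<partial>distr M L Y \<partial>distr M K X)"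
    unfolding eq[symmetric] using LY.nn_integral_fst[OF h2] by simp
  also have "\<dots> = (\<integral>\<^sup>+w'. \<integral>\<^sup>+y. h (X w') y \<partial>distr M L Y \<partial>M)"
    using LY.borel_measurable_nn_integral_fst[of _ K] h by (subst nn_integral_distr) (auto cong: measurable_cong_sets sets_pair_measure_cong)
  also have "\<dots> = (\<integral>\<^sup>+w'. \<integral>\<^sup>+w. h (X w') (Y w) \<partial>M \<partial>M)"
  proof (rule nn_integral_cong)
    fix w' assume "w' \<in> space M"
    then have "X w' \<in> space K" using measurable_space[OF X] by auto
    then have "h (X w') \<in> borel_measurable L"
      using measurable_Pair2[OF h] by simp
    then show "(\<integral>\<^sup>+y. h (X w') y \<partial>distr M L Y) = (\<integral>\<^sup>+w. h (X w') (Y w) \<partial>M)"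
      by (subst nn_integral_distr) auto
  qed
  finally show ?thesis .
qed

text \<open>The joint law of the three coordinates is a finite product measure, which is unfolded
  one coordinate at a time.\<close>

lemma (in prob_space) indep_vars_nn_integral_triple:
  fixes X :: "nat \<Rightarrow> 'a \<Rightarrow> 'x"
  assumes indep: "indep_vars (\<lambda>_. E) X UNIV" and Q: "\<And>j. distr M E (X j) = Q"
    and dist: "i \<noteq> j" "i \<noteq> k" "j \<noteq> k"
    and f [measurable]: "(\<lambda>(x, y, z). f x y z) \<in> borel_measurable (E \<Otimes>\<^sub>M E \<Otimes>\<^sub>M E)"
  shows "(\<integral>\<^sup>+w. f (X i w) (X j w) (X k w) \<partial>M) = (\<integral>\<^sup>+x. \<integral>\<^sup>+y. \<integral>\<^sup>+z. f x y z \<partial>Q \<partial>Q \<partial>Q)"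
proof -
  have X [measurable]: "X j \<in> measurable M E" for j
    using indep by (auto simp: indep_vars_def)
  interpret Q: prob_space Q
    using prob_space_distr[OF X] Q by metis
  have [measurable_cong, simp]: "sets Q = sets E" using Q[of 0] by auto
  then have [simp]: "space Q = space E" by (rule sets_eq_imp_space_eq)
  interpret P: product_sigma_finite "\<lambda>_. Q" by standard
  let ?I = "{i, j, k}"
  \<comment> \<open>A composition rule in this raw form lets the measurability prover deal with a
    curried function of several arguments; the same device recurs in many proofs below.\<close>
  have [measurable (raw)]: "(\<lambda>p. f (a p) (b p) (c p)) \<in> borel_measurable N"
    if "a \<in> measurable N E" "b \<in> measurable N E" "c \<in> measurable N E" for N :: "'n measure" and a b c
    using measurable_compose[of "\<lambda>p. (a p, b p, c p)" N _ _ borel, OF _ f] that by simp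
  have eq: "distr M (\<Pi>\<^sub>M l\<in>?I. E) (\<lambda>w. \<lambda>l\<in>?I. X l w) = (\<Pi>\<^sub>M l\<in>?I. Q)"
    using indep_vars_iff_distr_eq_PiM[where I = ?I and M' = "\<lambda>_. E" and X = X] indep_vars_subset[OF indep, of ?I] by (simp add: Q)
  have "(\<integral>\<^sup>+w. f (X i w) (X j w) (X k w) \<partial>M) = (\<integral>\<^sup>+g. f (g i) (g j) (g k) \<partial>distr M (\<Pi>\<^sub>M l\<in>?I. E) (\<lambda>w. \<lambda>l\<in>?I. X l w))"
    by (subst nn_integral_distr) auto
  also have "\<dots> = (\<integral>\<^sup>+x. \<integral>\<^sup>+g. f x (g j) (g k) \<partial>(\<Pi>\<^sub>M l\<in>{j, k}. Q) \<partial>Q)"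
    unfolding eq using dist by (subst P.product_nn_integral_insert_rev) auto
  also have "\<dots> = (\<integral>\<^sup>+x. \<integral>\<^sup>+y. \<integral>\<^sup>+g. f x y (g k) \<partial>(\<Pi>\<^sub>M l\<in>{k}. Q) \<partial>Q \<partial>Q)"
    using dist by (intro nn_integral_cong, subst P.product_nn_integral_insert_rev) auto
  also have "\<dots> = (\<integral>\<^sup>+x. \<integral>\<^sup>+y. \<integral>\<^sup>+z. f x y z \<partial>Q \<partial>Q \<partial>Q)"
    by (intro nn_integral_cong, subst P.product_nn_integral_singleton) auto
  finally show ?thesis .
qed

text \<open>Independence enters as two integral identities instead of independence of families. This
  is the form in which it is used, and it can be derived for marks that pair a sign with a cluster,
  where the hypotheses speak of signs, clusters and points separately.\<close>

locale marked_poisson = poisson_points +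
  fixes E :: "'x measure" and X :: "nat \<Rightarrow> 'a \<Rightarrow> 'x" and Q :: "'x measure"
  assumes X_measurable [measurable]: "\<And>j. X j \<in> measurable M E"
    and prob_space_Q: "prob_space Q"
    and sets_Q [measurable_cong, simp]: "sets Q = sets E"
    and marks_indep: "\<And>h. (\<lambda>(u, x). h u x) \<in> borel_measurable ((\<Pi>\<^sub>M j\<in>UNIV. borel) \<Otimes>\<^sub>M (\<Pi>\<^sub>M j\<in>UNIV. E)) \<Longrightarrow>
      (\<integral>\<^sup>+w. h (\<lambda>j. U j w) (\<lambda>j. X j w) \<partial>M) = (\<integral>\<^sup>+w'. \<integral>\<^sup>+w. h (\<lambda>j. U j w) (\<lambda>j. X j w') \<partial>M \<partial>M)"
    and marks_iid: "\<And>i j k f. i \<noteq> j \<Longrightarrow> i \<noteq> k \<Longrightarrow> j \<noteq> k \<Longrightarrow>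
      (\<lambda>(x, y, z). f x y z) \<in> borel_measurable (E \<Otimes>\<^sub>M E \<Otimes>\<^sub>M E) \<Longrightarrow>
      (\<integral>\<^sup>+w. f (X i w) (X j w) (X k w) \<partial>M) = (\<integral>\<^sup>+x. \<integral>\<^sup>+y. \<integral>\<^sup>+z. f x y z \<partial>Q \<partial>Q \<partial>Q)"
begin

sublocale Q: prob_space Q by (rule prob_space_Q)

lemma space_Q [simp]: "space Q = space E"
  by (rule sets_eq_imp_space_eq) simp

lemma marks_iid2:
  assumes "i \<noteq> j" and [measurable]: "(\<lambda>(x, y). f x y) \<in> borel_measurable (E \<Otimes>\<^sub>M E)"
  shows "(\<integral>\<^sup>+w. f (X i w) (X j w) \<partial>M) = (\<integral>\<^sup>+x. \<integral>\<^sup>+y. f x y \<partial>Q \<partial>Q)"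
  \<comment> \<open>The third index is any index different from \<open>i\<close> and
    \<open>j\<close>; its integral is trivial because \<open>Q\<close> has mass one.\<close>
  using marks_iid[of i j "Suc (max i j)" "\<lambda>x y z. f x y"] assms by (simp add: Q.emeasure_space_1[unfolded space_Q])

lemma marks_iid1:
  assumes [measurable]: "f \<in> borel_measurable E"
  shows "(\<integral>\<^sup>+w. f (X i w) \<partial>M) = (\<integral>\<^sup>+x. f x \<partial>Q)"
  using marks_iid2[of i "Suc i" "\<lambda>x y. f x"] assms by (simp add: Q.emeasure_space_1[unfolded space_Q])

text \<open>The mark is first replaced by an independent copy and integrated with its law
  \<open>Q\<close>, the same for every index. With the mark frozen, the sum over the indices is the
  Campbell formula for the points alone.\<close>

lemma marked_campbell1:
  assumes [measurable]: "(\<lambda>(u, x). h u x) \<in> borel_measurable (borel \<Otimes>\<^sub>M E)"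
  shows "(\<integral>\<^sup>+i. \<integral>\<^sup>+w. h (U i w) (X i w) \<partial>M \<partial>count_space UNIV) = ennreal \<nu> * (\<integral>\<^sup>+x. \<integral>\<^sup>+u. h u x \<partial>lborel \<partial>Q)"
proof -
  have "(\<integral>\<^sup>+w. h (U i w) (X i w) \<partial>M) = (\<integral>\<^sup>+x. \<integral>\<^sup>+w. h (U i w) x \<partial>M \<partial>Q)" for i
  proof -
    have "(\<integral>\<^sup>+w. h (U i w) (X i w) \<partial>M) = (\<integral>\<^sup>+w'. \<integral>\<^sup>+w. h (U i w) (X i w') \<partial>M \<partial>M)"
      by (rule marks_indep[of "\<lambda>u x. h (u i) (x i)"]) measurable
    also have "\<dots> = (\<integral>\<^sup>+x. \<integral>\<^sup>+w. h (U i w) x \<partial>M \<partial>Q)"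
      by (rule marks_iid1) measurable
    finally show ?thesis .
  qed
  then have "(\<integral>\<^sup>+i. \<integral>\<^sup>+w. h (U i w) (X i w) \<partial>M \<partial>count_space UNIV) = (\<integral>\<^sup>+i. \<integral>\<^sup>+x. \<integral>\<^sup>+w. h (U i w) x \<partial>M \<partial>Q \<partial>count_space UNIV)"
    by simp
  also have "\<dots> = (\<integral>\<^sup>+x. \<integral>\<^sup>+i. \<integral>\<^sup>+w. h (U i w) x \<partial>M \<partial>count_space UNIV \<partial>Q)"
    by (rule nn_integral_count_space_nn_integral[symmetric]) auto
  also have "\<dots> = (\<integral>\<^sup>+x. ennreal \<nu> * (\<integral>\<^sup>+u. h u x \<partial>lborel) \<partial>Q)"
    by (intro nn_integral_cong campbell1) simp
  also have "\<dots> = ennreal \<nu> * (\<integral>\<^sup>+x. \<integral>\<^sup>+u. h u x \<partial>lborel \<partial>Q)"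
    by (rule nn_integral_cmult) measurable
  finally show ?thesis .
qed

text \<open>The law of two marks with different indices is always the product of \<open>Q\<close>
  with itself, so that the index pair survives only in the points and the sum over pairs can be
  evaluated for frozen marks.\<close>

lemma marked_campbell2:
  assumes [measurable]: "(\<lambda>((u, v), (x, y)). h u v x y) \<in> borel_measurable ((borel \<Otimes>\<^sub>M borel) \<Otimes>\<^sub>M (E \<Otimes>\<^sub>M E))"
  shows "(\<integral>\<^sup>+(i, j). \<integral>\<^sup>+w. h (U i w) (U j w) (X i w) (X j w) \<partial>M \<partial>count_space distinct_pairs)
    = ennreal \<nu> ^ 2 * (\<integral>\<^sup>+x. \<integral>\<^sup>+y. \<integral>\<^sup>+(u, v). h u v x y \<partial>lborel \<partial>Q \<partial>Q)"
proof -
  have [measurable (raw)]: "(\<lambda>p. h (a p) (b p) (c p) (d p)) \<in> borel_measurable N"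
    if "a \<in> borel_measurable N" "b \<in> borel_measurable N" "c \<in> measurable N E" "d \<in> measurable N E"
    for N :: "'n measure" and a b c d
    using measurable_compose[of "\<lambda>p. ((a p, b p), (c p, d p))" N _ _ borel, OF _ assms] that by simp
  have [measurable]: "(\<lambda>p. h (fst (snd p)) (snd (snd p)) (fst (fst p)) (snd (fst p)))
      \<in> borel_measurable ((E \<Otimes>\<^sub>M E) \<Otimes>\<^sub>M borel)"
    unfolding borel_prod[symmetric] by measurable
  have "(\<integral>\<^sup>+w. h (U i w) (U j w) (X i w) (X j w) \<partial>M) = (\<integral>\<^sup>+z. \<integral>\<^sup>+w. h (U i w) (U j w) (fst z) (snd z) \<partial>M \<partial>(Q \<Otimes>\<^sub>M Q))"
    if "i \<noteq> j" for i j
  proof -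
    have "(\<integral>\<^sup>+w. h (U i w) (U j w) (X i w) (X j w) \<partial>M) = (\<integral>\<^sup>+w'. \<integral>\<^sup>+w. h (U i w) (U j w) (X i w') (X j w') \<partial>M \<partial>M)"
      by (rule marks_indep[of "\<lambda>u x. h (u i) (u j) (x i) (x j)"]) (simp add: case_prod_unfold)
    also have "\<dots> = (\<integral>\<^sup>+x. \<integral>\<^sup>+y. \<integral>\<^sup>+w. h (U i w) (U j w) x y \<partial>M \<partial>Q \<partial>Q)"
      by (rule marks_iid2[OF that]) measurable
    also have "\<dots> = (\<integral>\<^sup>+z. \<integral>\<^sup>+w. h (U i w) (U j w) (fst z) (snd z) \<partial>M \<partial>(Q \<Otimes>\<^sub>M Q))"
      by (subst Q.nn_integral_fst[symmetric]) auto
    finally show ?thesis .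
  qed
  then have "(\<integral>\<^sup>+(i, j). \<integral>\<^sup>+w. h (U i w) (U j w) (X i w) (X j w) \<partial>M \<partial>count_space distinct_pairs)
      = (\<integral>\<^sup>+e. \<integral>\<^sup>+z. \<integral>\<^sup>+w. h (U (fst e) w) (U (snd e) w) (fst z) (snd z) \<partial>M \<partial>(Q \<Otimes>\<^sub>M Q) \<partial>count_space distinct_pairs)"
    by (intro nn_integral_cong) auto
  also have "\<dots> = (\<integral>\<^sup>+z. \<integral>\<^sup>+e. \<integral>\<^sup>+w. h (U (fst e) w) (U (snd e) w) (fst z) (snd z) \<partial>M \<partial>count_space distinct_pairs \<partial>(Q \<Otimes>\<^sub>M Q))"
    by (rule nn_integral_count_space_nn_integral[symmetric]) auto
  also have "\<dots> = (\<integral>\<^sup>+z. ennreal \<nu> ^ 2 * (\<integral>\<^sup>+t. h (fst t) (snd t) (fst z) (snd z) \<partial>lborel) \<partial>(Q \<Otimes>\<^sub>M Q))"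
  proof (rule nn_integral_cong)
    fix z assume "z \<in> space (Q \<Otimes>\<^sub>M Q)"
    then have [simp]: "fst z \<in> space E" "snd z \<in> space E"
      by (auto simp: space_pair_measure)
    have "(\<lambda>t. h (fst t) (snd t) (fst z) (snd z)) \<in> borel_measurable (borel \<Otimes>\<^sub>M borel)" by measurable
    then show "(\<integral>\<^sup>+e. \<integral>\<^sup>+w. h (U (fst e) w) (U (snd e) w) (fst z) (snd z) \<partial>M \<partial>count_space distinct_pairs)
        = ennreal \<nu> ^ 2 * (\<integral>\<^sup>+t. h (fst t) (snd t) (fst z) (snd z) \<partial>lborel)"
      using campbell2[of "\<lambda>t. h (fst t) (snd t) (fst z) (snd z)"] by (simp add: case_prod_unfold borel_prod)
  qed
  also have "\<dots> = ennreal \<nu> ^ 2 * (\<integral>\<^sup>+z. \<integral>\<^sup>+t. h (fst t) (snd t) (fst z) (snd z) \<partial>lborel \<partial>(Q \<Otimes>\<^sub>M Q))"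
    by (rule nn_integral_cmult) measurable
  also have "(\<integral>\<^sup>+z. \<integral>\<^sup>+t. h (fst t) (snd t) (fst z) (snd z) \<partial>lborel \<partial>(Q \<Otimes>\<^sub>M Q)) = (\<integral>\<^sup>+x. \<integral>\<^sup>+y. \<integral>\<^sup>+(u, v). h u v x y \<partial>lborel \<partial>Q \<partial>Q)"
    by (subst Q.nn_integral_fst[symmetric]) (auto simp: case_prod_unfold)
  finally show ?thesis .
qed

lemma nn_integral_Q3:
  assumes f [measurable]: "f \<in> borel_measurable (E \<Otimes>\<^sub>M E \<Otimes>\<^sub>M E)"
  shows "(\<integral>\<^sup>+p. f p \<partial>(Q \<Otimes>\<^sub>M Q \<Otimes>\<^sub>M Q)) = (\<integral>\<^sup>+x. \<integral>\<^sup>+y. \<integral>\<^sup>+z. f (x, y, z) \<partial>Q \<partial>Q \<partial>Q)"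
proof -
  interpret QQ: pair_prob_space Q Q ..
  have "(\<integral>\<^sup>+p. f p \<partial>(Q \<Otimes>\<^sub>M Q \<Otimes>\<^sub>M Q)) = (\<integral>\<^sup>+x. \<integral>\<^sup>+q. f (x, q) \<partial>(Q \<Otimes>\<^sub>M Q) \<partial>Q)"
    by (rule QQ.P.nn_integral_fst[symmetric]) simp
  also have "\<dots> = (\<integral>\<^sup>+x. \<integral>\<^sup>+y. \<integral>\<^sup>+z. f (x, y, z) \<partial>Q \<partial>Q \<partial>Q)"
    by (intro nn_integral_cong Q.nn_integral_fst[symmetric]) simp
  finally show ?thesis .
qed

lemma marked_campbell3:
  assumes [measurable]: "(\<lambda>((u, v, t), (x, y, z)). h u v t x y z)
    \<in> borel_measurable ((borel \<Otimes>\<^sub>M borel \<Otimes>\<^sub>M borel) \<Otimes>\<^sub>M (E \<Otimes>\<^sub>M E \<Otimes>\<^sub>M E))"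
  shows "(\<integral>\<^sup>+(i, j, k). \<integral>\<^sup>+w. h (U i w) (U j w) (U k w) (X i w) (X j w) (X k w) \<partial>M \<partial>count_space distinct_triples)
    = ennreal \<nu> ^ 3 * (\<integral>\<^sup>+x. \<integral>\<^sup>+y. \<integral>\<^sup>+z. \<integral>\<^sup>+(u, v, t). h u v t x y z \<partial>lborel \<partial>Q \<partial>Q \<partial>Q)"
proof -
  interpret QQ: pair_prob_space Q Q ..
  have [measurable (raw)]: "(\<lambda>p. h (a p) (b p) (c p) (d p) (e p) (g p)) \<in> borel_measurable N"
    if "a \<in> borel_measurable N" "b \<in> borel_measurable N" "c \<in> borel_measurable N"
      "d \<in> measurable N E" "e \<in> measurable N E" "g \<in> measurable N E"
    for N :: "'n measure" and a b c d e g
    using measurable_compose[of "\<lambda>p. ((a p, b p, c p), (d p, e p, g p))" N _ _ borel, OF _ assms] that by simp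
  let ?H = "\<lambda>u z. h (fst u) (fst (snd u)) (snd (snd u)) (fst z) (fst (snd z)) (snd (snd z))"
  have [measurable]: "(\<lambda>p. ?H (snd p) (fst p)) \<in> borel_measurable ((E \<Otimes>\<^sub>M E \<Otimes>\<^sub>M E) \<Otimes>\<^sub>M borel)"
    unfolding borel_prod[symmetric] by measurable
  have "(\<integral>\<^sup>+w. h (U i w) (U j w) (U k w) (X i w) (X j w) (X k w) \<partial>M)
      = (\<integral>\<^sup>+z. \<integral>\<^sup>+w. ?H (U i w, U j w, U k w) z \<partial>M \<partial>(Q \<Otimes>\<^sub>M Q \<Otimes>\<^sub>M Q))"
    if "i \<noteq> j" "i \<noteq> k" "j \<noteq> k" for i j k
  proof -
    have "(\<integral>\<^sup>+w. h (U i w) (U j w) (U k w) (X i w) (X j w) (X k w) \<partial>M)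
        = (\<integral>\<^sup>+w'. \<integral>\<^sup>+w. h (U i w) (U j w) (U k w) (X i w') (X j w') (X k w') \<partial>M \<partial>M)"
      by (rule marks_indep[of "\<lambda>u x. h (u i) (u j) (u k) (x i) (x j) (x k)"]) (simp add: case_prod_unfold)
    also have "\<dots> = (\<integral>\<^sup>+x. \<integral>\<^sup>+y. \<integral>\<^sup>+z. \<integral>\<^sup>+w. h (U i w) (U j w) (U k w) x y z \<partial>M \<partial>Q \<partial>Q \<partial>Q)"
    proof (rule marks_iid[OF that])
      have "(\<lambda>p. \<integral>\<^sup>+w. ?H (U i w, U j w, U k w) p \<partial>M) \<in> borel_measurable (E \<Otimes>\<^sub>M E \<Otimes>\<^sub>M E)"
        by measurable
      then show "(\<lambda>(x, y, z). \<integral>\<^sup>+w. h (U i w) (U j w) (U k w) x y z \<partial>M) \<in> borel_measurable (E \<Otimes>\<^sub>M E \<Otimes>\<^sub>M E)"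
        by (simp add: case_prod_unfold)
    qed
    also have "\<dots> = (\<integral>\<^sup>+z. \<integral>\<^sup>+w. ?H (U i w, U j w, U k w) z \<partial>M \<partial>(Q \<Otimes>\<^sub>M Q \<Otimes>\<^sub>M Q))"
      by (subst nn_integral_Q3) auto
    finally show ?thesis .
  qed
  then have "(\<integral>\<^sup>+(i, j, k). \<integral>\<^sup>+w. h (U i w) (U j w) (U k w) (X i w) (X j w) (X k w) \<partial>M \<partial>count_space distinct_triples)
      = (\<integral>\<^sup>+e. \<integral>\<^sup>+z. \<integral>\<^sup>+w. ?H (U (fst e) w, U (fst (snd e)) w, U (snd (snd e)) w) z \<partial>M \<partial>(Q \<Otimes>\<^sub>M Q \<Otimes>\<^sub>M Q) \<partial>count_space distinct_triples)"
    by (intro nn_integral_cong) auto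
  also have "\<dots> = (\<integral>\<^sup>+z. \<integral>\<^sup>+e. \<integral>\<^sup>+w. ?H (U (fst e) w, U (fst (snd e)) w, U (snd (snd e)) w) z \<partial>M \<partial>count_space distinct_triples \<partial>(Q \<Otimes>\<^sub>M Q \<Otimes>\<^sub>M Q))"
    by (rule nn_integral_count_space_nn_integral[symmetric]) auto
  also have "\<dots> = (\<integral>\<^sup>+z. ennreal \<nu> ^ 3 * (\<integral>\<^sup>+t. ?H t z \<partial>lborel) \<partial>(Q \<Otimes>\<^sub>M Q \<Otimes>\<^sub>M Q))"
  proof (rule nn_integral_cong)
    fix z assume "z \<in> space (Q \<Otimes>\<^sub>M Q \<Otimes>\<^sub>M Q)"
    then have [simp]: "fst z \<in> space E" "fst (snd z) \<in> space E" "snd (snd z) \<in> space E"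
      by (auto simp: space_pair_measure)
    have "(\<lambda>t. ?H t z) \<in> borel_measurable (borel \<Otimes>\<^sub>M borel \<Otimes>\<^sub>M borel)" by measurable
    then show "(\<integral>\<^sup>+e. \<integral>\<^sup>+w. ?H (U (fst e) w, U (fst (snd e)) w, U (snd (snd e)) w) z \<partial>M \<partial>count_space distinct_triples)
        = ennreal \<nu> ^ 3 * (\<integral>\<^sup>+t. ?H t z \<partial>lborel)"
      using campbell3[of "\<lambda>t. ?H t z"] by (simp add: case_prod_unfold borel_prod)
  qed
  also have "\<dots> = ennreal \<nu> ^ 3 * (\<integral>\<^sup>+z. \<integral>\<^sup>+t. ?H t z \<partial>lborel \<partial>(Q \<Otimes>\<^sub>M Q \<Otimes>\<^sub>M Q))"
    by (rule nn_integral_cmult) measurable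
  also have "(\<integral>\<^sup>+z. \<integral>\<^sup>+t. ?H t z \<partial>lborel \<partial>(Q \<Otimes>\<^sub>M Q \<Otimes>\<^sub>M Q)) = (\<integral>\<^sup>+x. \<integral>\<^sup>+y. \<integral>\<^sup>+z. \<integral>\<^sup>+(u, v, t). h u v t x y z \<partial>lborel \<partial>Q \<partial>Q \<partial>Q)"
    by (subst nn_integral_Q3) (auto simp: case_prod_unfold)
  finally show ?thesis .
qed

end

section \<open>Moments of cluster sums\<close>

abbreviation marks :: "(real \<times> real measure) measure" where
  "marks \<equiv> borel \<Otimes>\<^sub>M counting_space"

text \<open>The contribution of a single cluster: a mark \<open>x\<close> is a pair of a sign and a
  counting measure, and \<open>f\<close> is summed over the points of the signed cluster moved to
  \<open>u\<close>.\<close>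

definition shot :: "real \<Rightarrow> real \<times> real measure \<Rightarrow> (real \<Rightarrow> ennreal) \<Rightarrow> ennreal" where
  "shot u x f = (\<integral>\<^sup>+y. f (fst x * y + u) \<partial>snd x)"

abbreviation mass :: "real \<times> real measure \<Rightarrow> ennreal" where
  "mass x \<equiv> emeasure (snd x) UNIV"

lemma snd_marks: "x \<in> space marks \<Longrightarrow> finite_simple_counting (snd x)"
  by (auto simp: space_pair_measure space_counting_space)

lemma shot_measurable [measurable (raw)]:
  assumes [measurable]: "u \<in> borel_measurable N" "x \<in> measurable N marks"
    "(\<lambda>(p, y). f p y) \<in> borel_measurable (N \<Otimes>\<^sub>M borel)"
  shows "(\<lambda>p. shot (u p) (x p) (f p)) \<in> borel_measurable N"
proof -
  have "(\<lambda>p. (fst p, fst (x (fst p)) * snd p + u (fst p))) \<in> measurable (N \<Otimes>\<^sub>M borel) (N \<Otimes>\<^sub>M borel)"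
    by measurable
  from measurable_compose[OF this assms(3)] show ?thesis
    unfolding shot_def by (intro measurable_nn_integral_counting) (simp_all add: case_prod_unfold)
qed

lemma mass_measurable [measurable]: "mass \<in> borel_measurable marks"
  by measurable

lemma shot_const: "x \<in> space marks \<Longrightarrow> shot u x (\<lambda>_. c) = c * mass x"
  by (simp add: shot_def space_counting[OF snd_marks])

lemma shot_cmult:
  assumes x: "x \<in> space marks" and [measurable]: "f \<in> borel_measurable borel"
  shows "shot u x (\<lambda>y. c * f y) = c * shot u x f"
  unfolding shot_def using sets_counting[OF snd_marks[OF x]]
  by (intro nn_integral_cmult) (simp cong: measurable_cong_sets)

lemma shot_multc:
  assumes x: "x \<in> space marks" and [measurable]: "f \<in> borel_measurable borel"
  shows "shot u x (\<lambda>y. f y * c) = shot u x f * c"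
  using shot_cmult[OF assms] by (simp add: mult.commute)

lemma shot_cong: "(\<And>y. f y = g y) \<Longrightarrow> shot u x f = shot u x g"
  by (simp add: shot_def)

lemma shot_count_space:
  assumes x: "x \<in> space marks" and "countable I" and "\<And>i. i \<in> I \<Longrightarrow> f i \<in> borel_measurable borel"
  shows "shot u x (\<lambda>a. \<integral>\<^sup>+i. f i a \<partial>count_space I) = (\<integral>\<^sup>+i. shot u x (f i) \<partial>count_space I)"
proof -
  have "(\<lambda>y. f i (fst x * y + u)) \<in> borel_measurable (snd x)" if "i \<in> I" for i
    using measurable_compose[of "\<lambda>y. fst x * y + u" borel borel "f i" borel] assms(3)[OF that] sets_counting[OF snd_marks[OF x]]
    by (simp cong: measurable_cong_sets)
  then show ?thesis
    unfolding shot_def by (intro nn_integral_count_space_nn_integral assms)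
qed

lemma shot_count_space2:
  fixes f :: "nat \<Rightarrow> nat \<Rightarrow> real \<Rightarrow> ennreal"
  assumes x: "x \<in> space marks" and f: "\<And>i j. f i j \<in> borel_measurable borel"
  shows "shot u x (\<lambda>a. \<integral>\<^sup>+i. \<integral>\<^sup>+j. f i j a \<partial>count_space UNIV \<partial>count_space UNIV)
    = (\<integral>\<^sup>+i. \<integral>\<^sup>+j. shot u x (f i j) \<partial>count_space UNIV \<partial>count_space UNIV)"
proof -
  have "shot u x (\<lambda>a. \<integral>\<^sup>+p. f (fst p) (snd p) a \<partial>count_space UNIV) = (\<integral>\<^sup>+p. shot u x (f (fst p) (snd p)) \<partial>count_space UNIV)"
    using f by (intro shot_count_space[OF x]) auto
  then show ?thesis by (simp add: nn_integral_fst_count_space[symmetric])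
qed

lemma shot_nn_integral:
  assumes x: "x \<in> space marks" and "sigma_finite_measure L"
    and G: "(\<lambda>(a, v). G a v) \<in> borel_measurable (borel \<Otimes>\<^sub>M L)"
  shows "shot u x (\<lambda>a. \<integral>\<^sup>+v. G a v \<partial>L) = (\<integral>\<^sup>+v. shot u x (\<lambda>a. G a v) \<partial>L)"
proof -
  interpret d: finite_measure "snd x" by (rule finite_measure_counting[OF snd_marks[OF x]])
  interpret L: sigma_finite_measure L by fact
  interpret pair_sigma_finite L "snd x" ..
  have [measurable_cong]: "sets (snd x) = sets borel" by (rule sets_counting[OF snd_marks[OF x]])
  have "(\<lambda>p. (fst x * snd p + u, fst p)) \<in> measurable (L \<Otimes>\<^sub>M snd x) (borel \<Otimes>\<^sub>M L)" by measurable
  from measurable_compose[OF this G] show ?thesis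
    unfolding shot_def by (intro Fubini') (simp add: case_prod_unfold)
qed

text \<open>By translation invariance each point of the cluster sees the full Lebesgue integral,
  whatever the sign and the position inside the cluster.\<close>

lemma shot_integral:
  assumes x: "x \<in> space marks" and [measurable]: "f \<in> borel_measurable borel"
  shows "(\<integral>\<^sup>+u. shot u x f \<partial>lborel) = mass x * (\<integral>\<^sup>+a. f a \<partial>lborel)"
proof -
  interpret d: finite_measure "snd x" by (rule finite_measure_counting[OF snd_marks[OF x]])
  interpret pair_sigma_finite "snd x" lborel ..
  have [measurable_cong]: "sets (snd x) = sets borel" by (rule sets_counting[OF snd_marks[OF x]])
  have "(\<integral>\<^sup>+u. shot u x f \<partial>lborel) = (\<integral>\<^sup>+y. \<integral>\<^sup>+u. f (fst x * y + u) \<partial>lborel \<partial>snd x)"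
    unfolding shot_def by (rule Fubini') measurable
  also have "\<dots> = (\<integral>\<^sup>+y. (\<integral>\<^sup>+a. f a \<partial>lborel) \<partial>snd x)"
    using nn_integral_real_affine[of f 1, symmetric] by simp
  finally show ?thesis by (simp add: space_counting[OF snd_marks[OF x]] mult.commute)
qed

lemma shot_swap:
  assumes x: "x \<in> space marks" and y: "y \<in> space marks"
    and F: "(\<lambda>(a, b). F a b) \<in> borel_measurable (borel \<Otimes>\<^sub>M borel)"
  shows "shot u x (\<lambda>a. shot v y (\<lambda>b. F a b)) = shot v y (\<lambda>b. shot u x (\<lambda>a. F a b))"
proof -
  interpret x: finite_measure "snd x" by (rule finite_measure_counting[OF snd_marks[OF x]])
  interpret y: finite_measure "snd y" by (rule finite_measure_counting[OF snd_marks[OF y]])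
  interpret pair_sigma_finite "snd x" "snd y" ..
  have [measurable_cong]: "sets (snd x) = sets borel" "sets (snd y) = sets borel"
    by (rule sets_counting[OF snd_marks[OF x]], rule sets_counting[OF snd_marks[OF y]])
  have "(\<lambda>p. (fst x * fst p + u, fst y * snd p + v)) \<in> measurable (snd x \<Otimes>\<^sub>M snd y) (borel \<Otimes>\<^sub>M borel)" by measurable
  from measurable_compose[OF this F] show ?thesis
    unfolding shot_def by (intro Fubini'[symmetric]) (simp add: case_prod_unfold)
qed

section \<open>Splitting sums according to coinciding indices\<close>

lemma nn_integral_count_space_image:
  assumes "inj_on g A"
  shows "(\<integral>\<^sup>+y. f y * indicator (g ` A) y \<partial>count_space UNIV) = (\<integral>\<^sup>+x. f (g x) \<partial>count_space A)"
  by (simp add: nn_integral_bij_count_space[OF inj_on_imp_bij_betw[OF assms], symmetric]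
      nn_integral_count_space_indicator[of "g ` A" f, symmetric] del: nn_integral_count_space_indicator)

lemma sum_pairs_split:
  fixes h :: "nat \<times> nat \<Rightarrow> ennreal"
  shows "(\<integral>\<^sup>+e. h e \<partial>count_space UNIV) = (\<integral>\<^sup>+i. h (i, i) \<partial>count_space UNIV) + (\<integral>\<^sup>+(i, j). h (i, j) \<partial>count_space distinct_pairs)"
proof -
  have "(\<integral>\<^sup>+e. h e \<partial>count_space UNIV) = (\<integral>\<^sup>+e. h e * indicator ((\<lambda>i. (i, i)) ` UNIV) e
      + h e * indicator ((\<lambda>(i, j). (i, j)) ` distinct_pairs) e \<partial>count_space UNIV)"
    by (intro nn_integral_cong) (auto simp: indicator_def)
  then show ?thesis
    by (simp only: nn_integral_add borel_measurable_count_space)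
      (subst (1 2) nn_integral_count_space_image; auto intro!: injI inj_onI simp: case_prod_unfold)
qed

text \<open>The five partitions of three positions into classes of equal indices. In the three
  middle terms \<open>i\<close> is the repeated index and \<open>j\<close> the single one, so that
  they can be brought to a common form.\<close>

lemma sum_triples_split:
  fixes h :: "nat \<times> nat \<times> nat \<Rightarrow> ennreal"
  shows "(\<integral>\<^sup>+e. h e \<partial>count_space UNIV) = (\<integral>\<^sup>+i. h (i, i, i) \<partial>count_space UNIV)
    + (\<integral>\<^sup>+(i, j). h (i, i, j) \<partial>count_space distinct_pairs)
    + (\<integral>\<^sup>+(i, j). h (i, j, i) \<partial>count_space distinct_pairs)
    + (\<integral>\<^sup>+(i, j). h (j, i, i) \<partial>count_space distinct_pairs)
    + (\<integral>\<^sup>+(i, j, k). h (i, j, k) \<partial>count_space distinct_triples)"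
proof -
  have "(\<integral>\<^sup>+e. h e \<partial>count_space UNIV) = (\<integral>\<^sup>+e. h e * indicator ((\<lambda>i. (i, i, i)) ` UNIV) e
      + h e * indicator ((\<lambda>(i, j). (i, i, j)) ` distinct_pairs) e
      + h e * indicator ((\<lambda>(i, j). (i, j, i)) ` distinct_pairs) e
      + h e * indicator ((\<lambda>(i, j). (j, i, i)) ` distinct_pairs) e
      + h e * indicator ((\<lambda>(i, j, k). (i, j, k)) ` distinct_triples) e \<partial>count_space UNIV)"
  proof (intro nn_integral_cong)
    fix e :: "nat \<times> nat \<times> nat"
    obtain i j k where e: "e = (i, j, k)" by (cases e)
    have "e \<in> (\<lambda>i. (i, i, i)) ` UNIV \<longleftrightarrow> i = j \<and> j = k"
      "e \<in> (\<lambda>(i, j). (i, i, j)) ` distinct_pairs \<longleftrightarrow> i = j \<and> j \<noteq> k"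
      "e \<in> (\<lambda>(i, j). (i, j, i)) ` distinct_pairs \<longleftrightarrow> i = k \<and> i \<noteq> j"
      "e \<in> (\<lambda>(i, j). (j, i, i)) ` distinct_pairs \<longleftrightarrow> j = k \<and> i \<noteq> j"
      "e \<in> (\<lambda>(i, j, k). (i, j, k)) ` distinct_triples \<longleftrightarrow> i \<noteq> j \<and> i \<noteq> k \<and> j \<noteq> k"
      unfolding e by (auto simp: image_iff)
    then show "h e = h e * indicator ((\<lambda>i. (i, i, i)) ` UNIV) e
      + h e * indicator ((\<lambda>(i, j). (i, i, j)) ` distinct_pairs) e
      + h e * indicator ((\<lambda>(i, j). (i, j, i)) ` distinct_pairs) e
      + h e * indicator ((\<lambda>(i, j). (j, i, i)) ` distinct_pairs) e
      + h e * indicator ((\<lambda>(i, j, k). (i, j, k)) ` distinct_triples) e"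
      unfolding indicator_def by (cases "i = j"; cases "i = k"; cases "j = k") simp_all
  qed
  then show ?thesis
    by (simp only: nn_integral_add borel_measurable_count_space)
      (subst (1 2 3 4 5) nn_integral_count_space_image; auto intro!: injI inj_onI simp: case_prod_unfold)
qed

section \<open>First, second and third moments of the sums over clusters\<close>

locale cluster_points = marked_poisson M \<nu> U marks X Q
  for M :: "'w measure" and \<nu> and U :: "nat \<Rightarrow> 'w \<Rightarrow> real" and X :: "nat \<Rightarrow> 'w \<Rightarrow> real \<times> real measure"
    and Q :: "(real \<times> real measure) measure" +
  assumes third_moment: "(\<integral>\<^sup>+x. mass x ^ 3 \<partial>Q) < \<infinity>"
    and sign_nonzero: "AE x in Q. fst x \<noteq> 0"
begin

definition intensity :: ennreal where
  "intensity = ennreal \<nu> * (\<integral>\<^sup>+x. mass x \<partial>Q)"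

text \<open>\<open>K2\<close> and \<open>K3\<close> collect pairs and triples inside one cluster,
  coinciding points included. A restriction to distinct points is put into \<open>F\<close> when it
  is needed.\<close>

definition K2 :: "(real \<Rightarrow> real \<Rightarrow> ennreal) \<Rightarrow> ennreal" where
  "K2 F = ennreal \<nu> * (\<integral>\<^sup>+x. \<integral>\<^sup>+u. shot u x (\<lambda>a. shot u x (\<lambda>b. F a b)) \<partial>lborel \<partial>Q)"

definition K3 :: "(real \<Rightarrow> real \<Rightarrow> real \<Rightarrow> ennreal) \<Rightarrow> ennreal" where
  "K3 F = ennreal \<nu> * (\<integral>\<^sup>+x. \<integral>\<^sup>+u. shot u x (\<lambda>a. shot u x (\<lambda>b. shot u x (\<lambda>c. F a b c))) \<partial>lborel \<partial>Q)"

text \<open>Points are counted here with multiplicity, once for every cluster and every preimage, in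
  contrast to \<open>points_integral\<close>, which sees each location once.\<close>

definition total :: "'w \<Rightarrow> (real \<Rightarrow> ennreal) \<Rightarrow> ennreal" where
  "total w f = (\<integral>\<^sup>+j. shot (U j w) (X j w) f \<partial>count_space UNIV)"

lemma X_space: "w \<in> space M \<Longrightarrow> X j w \<in> space marks"
  using measurable_space[OF X_measurable] .

lemma expectation_total1:
  assumes [measurable]: "f \<in> borel_measurable borel"
  shows "(\<integral>\<^sup>+w. total w f \<partial>M) = intensity * (\<integral>\<^sup>+a. f a \<partial>lborel)"
proof -
  have "(\<integral>\<^sup>+w. total w f \<partial>M) = (\<integral>\<^sup>+j. \<integral>\<^sup>+w. shot (U j w) (X j w) f \<partial>M \<partial>count_space UNIV)"
    unfolding total_def by (rule nn_integral_count_space_nn_integral) auto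
  also have "\<dots> = ennreal \<nu> * (\<integral>\<^sup>+x. \<integral>\<^sup>+u. shot u x f \<partial>lborel \<partial>Q)"
    by (rule marked_campbell1) measurable
  also have "(\<integral>\<^sup>+x. \<integral>\<^sup>+u. shot u x f \<partial>lborel \<partial>Q) = (\<integral>\<^sup>+x. mass x * (\<integral>\<^sup>+a. f a \<partial>lborel) \<partial>Q)"
    by (intro nn_integral_cong shot_integral) auto
  also have "\<dots> = (\<integral>\<^sup>+x. mass x \<partial>Q) * (\<integral>\<^sup>+a. f a \<partial>lborel)"
    by (rule nn_integral_multc) measurable
  finally show ?thesis by (simp add: intensity_def mult.assoc)
qed

text \<open>Points of different clusters are uncorrelated: integrating out both centres leaves only
  the masses of the clusters, and these combine with the two factors \<open>\<nu>\<close> to the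
  square of the intensity.\<close>

lemma expectation_distinct_pairs:
  assumes F: "(\<lambda>(a, b). F a b) \<in> borel_measurable (borel \<Otimes>\<^sub>M borel)"
  shows "(\<integral>\<^sup>+(i, j). \<integral>\<^sup>+w. shot (U i w) (X i w) (\<lambda>a. shot (U j w) (X j w) (\<lambda>b. F a b)) \<partial>M \<partial>count_space distinct_pairs)
    = intensity ^ 2 * (\<integral>\<^sup>+a. \<integral>\<^sup>+b. F a b \<partial>lborel \<partial>lborel)"
proof -
  have [measurable (raw)]: "(\<lambda>p. F (a p) (b p)) \<in> borel_measurable N"
    if "a \<in> borel_measurable N" "b \<in> borel_measurable N" for N :: "'n measure" and a b
    using measurable_compose[of "\<lambda>p. (a p, b p)" N _ _ borel, OF _ F] that by simp
  let ?T = "\<lambda>u x v y. shot u x (\<lambda>a. shot v y (\<lambda>b. F a b))"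
  have "(\<integral>\<^sup>+(i, j). \<integral>\<^sup>+w. ?T (U i w) (X i w) (U j w) (X j w) \<partial>M \<partial>count_space distinct_pairs)
      = ennreal \<nu> ^ 2 * (\<integral>\<^sup>+x. \<integral>\<^sup>+y. \<integral>\<^sup>+(u, v). ?T u x v y \<partial>lborel \<partial>Q \<partial>Q)"
    by (rule marked_campbell2) (unfold case_prod_unfold, measurable)
  also have "(\<integral>\<^sup>+x. \<integral>\<^sup>+y. \<integral>\<^sup>+(u, v). ?T u x v y \<partial>lborel \<partial>Q \<partial>Q)
      = (\<integral>\<^sup>+x. \<integral>\<^sup>+y. mass x * mass y * (\<integral>\<^sup>+a. \<integral>\<^sup>+b. F a b \<partial>lborel \<partial>lborel) \<partial>Q \<partial>Q)"
  proof (intro nn_integral_cong)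
    fix x y assume "x \<in> space Q" "y \<in> space Q"
    then have x [simp]: "x \<in> space marks" and y [simp]: "y \<in> space marks" by auto
    have "(\<integral>\<^sup>+(u, v). ?T u x v y \<partial>lborel) = (\<integral>\<^sup>+u. \<integral>\<^sup>+v. ?T u x v y \<partial>lborel \<partial>lborel)"
      unfolding lborel_prod[symmetric] by (subst lborel.nn_integral_fst[symmetric]) auto
    also have "\<dots> = (\<integral>\<^sup>+u. shot u x (\<lambda>a. mass y * (\<integral>\<^sup>+b. F a b \<partial>lborel)) \<partial>lborel)"
      by (subst shot_nn_integral[symmetric]) (auto simp: shot_integral lborel.sigma_finite_measure_axioms)
    also have "\<dots> = mass x * (mass y * (\<integral>\<^sup>+a. \<integral>\<^sup>+b. F a b \<partial>lborel \<partial>lborel))"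
      by (subst shot_integral) (auto simp: nn_integral_cmult)
    finally show "(\<integral>\<^sup>+(u, v). ?T u x v y \<partial>lborel) = mass x * mass y * (\<integral>\<^sup>+a. \<integral>\<^sup>+b. F a b \<partial>lborel \<partial>lborel)"
      by (simp add: mult.assoc)
  qed
  also have "\<dots> = (\<integral>\<^sup>+x. mass x \<partial>Q) ^ 2 * (\<integral>\<^sup>+a. \<integral>\<^sup>+b. F a b \<partial>lborel \<partial>lborel)"
    by (simp add: nn_integral_cmult nn_integral_multc mult.assoc power2_eq_square)
  finally show ?thesis by (simp add: intensity_def power_mult_distrib mult.assoc)
qed

lemma expectation_total2:
  assumes F: "(\<lambda>(a, b). F a b) \<in> borel_measurable (borel \<Otimes>\<^sub>M borel)"
  shows "(\<integral>\<^sup>+w. total w (\<lambda>a. total w (\<lambda>b. F a b)) \<partial>M)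
    = K2 F + intensity ^ 2 * (\<integral>\<^sup>+a. \<integral>\<^sup>+b. F a b \<partial>lborel \<partial>lborel)"
proof -
  have [measurable (raw)]: "(\<lambda>p. F (a p) (b p)) \<in> borel_measurable N"
    if "a \<in> borel_measurable N" "b \<in> borel_measurable N" for N :: "'n measure" and a b
    using measurable_compose[of "\<lambda>p. (a p, b p)" N _ _ borel, OF _ F] that by simp
  let ?T = "\<lambda>u x v y. shot u x (\<lambda>a. shot v y (\<lambda>b. F a b))"
  have "(\<integral>\<^sup>+w. total w (\<lambda>a. total w (\<lambda>b. F a b)) \<partial>M)
      = (\<integral>\<^sup>+w. \<integral>\<^sup>+i. \<integral>\<^sup>+j. ?T (U i w) (X i w) (U j w) (X j w) \<partial>count_space UNIV \<partial>count_space UNIV \<partial>M)"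
    unfolding total_def by (intro nn_integral_cong shot_count_space X_space) auto
  also have "\<dots> = (\<integral>\<^sup>+w. \<integral>\<^sup>+(i, j). ?T (U i w) (X i w) (U j w) (X j w) \<partial>count_space UNIV \<partial>M)"
    by (subst nn_integral_fst_count_space[symmetric]) simp
  also have "\<dots> = (\<integral>\<^sup>+(i, j). \<integral>\<^sup>+w. ?T (U i w) (X i w) (U j w) (X j w) \<partial>M \<partial>count_space UNIV)"
    unfolding case_prod_unfold by (rule nn_integral_count_space_nn_integral) auto
  also have "\<dots> = (\<integral>\<^sup>+i. \<integral>\<^sup>+w. ?T (U i w) (X i w) (U i w) (X i w) \<partial>M \<partial>count_space UNIV)
      + (\<integral>\<^sup>+(i, j). \<integral>\<^sup>+w. ?T (U i w) (X i w) (U j w) (X j w) \<partial>M \<partial>count_space distinct_pairs)"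
    by (subst sum_pairs_split) simp
  also have "(\<integral>\<^sup>+i. \<integral>\<^sup>+w. ?T (U i w) (X i w) (U i w) (X i w) \<partial>M \<partial>count_space UNIV) = K2 F"
    unfolding K2_def by (rule marked_campbell1) measurable
  also have "(\<integral>\<^sup>+(i, j). \<integral>\<^sup>+w. ?T (U i w) (X i w) (U j w) (X j w) \<partial>M \<partial>count_space distinct_pairs)
      = intensity ^ 2 * (\<integral>\<^sup>+a. \<integral>\<^sup>+b. F a b \<partial>lborel \<partial>lborel)"
    by (rule expectation_distinct_pairs[OF F])
  finally show ?thesis .
qed

text \<open>Two points come from one cluster and one from another. The centre of the lone cluster is
  integrated out first, which replaces that cluster by its mass times Lebesgue measure.\<close>

lemma expectation_pair_single:
  assumes G: "(\<lambda>(a, b, c). G a b c) \<in> borel_measurable (borel \<Otimes>\<^sub>M borel \<Otimes>\<^sub>M borel)"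
  shows "(\<integral>\<^sup>+(i, j). \<integral>\<^sup>+w. shot (U i w) (X i w) (\<lambda>a. shot (U i w) (X i w) (\<lambda>b. shot (U j w) (X j w) (\<lambda>c. G a b c))) \<partial>M \<partial>count_space distinct_pairs)
    = K2 (\<lambda>a b. intensity * (\<integral>\<^sup>+c. G a b c \<partial>lborel))"
proof -
  have [measurable (raw)]: "(\<lambda>p. G (a p) (b p) (c p)) \<in> borel_measurable N"
    if "a \<in> borel_measurable N" "b \<in> borel_measurable N" "c \<in> borel_measurable N" for N :: "'n measure" and a b c
    using measurable_compose[of "\<lambda>p. (a p, b p, c p)" N _ _ borel, OF _ G] that by simp
  let ?T = "\<lambda>u x v y. shot u x (\<lambda>a. shot u x (\<lambda>b. shot v y (\<lambda>c. G a b c)))"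
  let ?S = "\<lambda>u x. shot u x (\<lambda>a. shot u x (\<lambda>b. \<integral>\<^sup>+c. G a b c \<partial>lborel))"
  have "(\<integral>\<^sup>+(i, j). \<integral>\<^sup>+w. ?T (U i w) (X i w) (U j w) (X j w) \<partial>M \<partial>count_space distinct_pairs)
      = ennreal \<nu> ^ 2 * (\<integral>\<^sup>+x. \<integral>\<^sup>+y. \<integral>\<^sup>+(u, v). ?T u x v y \<partial>lborel \<partial>Q \<partial>Q)"
    by (rule marked_campbell2) (unfold case_prod_unfold, measurable)
  also have "(\<integral>\<^sup>+x. \<integral>\<^sup>+y. \<integral>\<^sup>+(u, v). ?T u x v y \<partial>lborel \<partial>Q \<partial>Q)
      = (\<integral>\<^sup>+x. \<integral>\<^sup>+y. mass y * (\<integral>\<^sup>+u. ?S u x \<partial>lborel) \<partial>Q \<partial>Q)"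
  proof (intro nn_integral_cong)
    fix x y assume "x \<in> space Q" "y \<in> space Q"
    then have x [simp]: "x \<in> space marks" and y [simp]: "y \<in> space marks" by auto
    have "(\<integral>\<^sup>+(u, v). ?T u x v y \<partial>lborel) = (\<integral>\<^sup>+u. \<integral>\<^sup>+v. ?T u x v y \<partial>lborel \<partial>lborel)"
      unfolding lborel_prod[symmetric] by (subst lborel.nn_integral_fst[symmetric]) auto
    also have "\<dots> = (\<integral>\<^sup>+u. shot u x (\<lambda>a. shot u x (\<lambda>b. mass y * (\<integral>\<^sup>+c. G a b c \<partial>lborel))) \<partial>lborel)"
      by (simp add: shot_nn_integral[symmetric] shot_integral lborel.sigma_finite_measure_axioms)
    also have "\<dots> = (\<integral>\<^sup>+u. mass y * ?S u x \<partial>lborel)"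
      by (simp add: shot_cmult)
    also have "\<dots> = mass y * (\<integral>\<^sup>+u. ?S u x \<partial>lborel)"
      by (rule nn_integral_cmult) simp
    finally show "(\<integral>\<^sup>+(u, v). ?T u x v y \<partial>lborel) = mass y * (\<integral>\<^sup>+u. ?S u x \<partial>lborel)" .
  qed
  also have "\<dots> = (\<integral>\<^sup>+y. mass y \<partial>Q) * (\<integral>\<^sup>+x. \<integral>\<^sup>+u. ?S u x \<partial>lborel \<partial>Q)"
    by (simp add: nn_integral_cmult nn_integral_multc)
  \<comment> \<open>One factor \<open>\<nu>\<close> and the mean mass of the lone cluster form
    \<open>intensity\<close>; the other factor \<open>\<nu>\<close> is the one in
    \<open>K2\<close>.\<close>
  also have "ennreal \<nu> ^ 2 * \<dots> = ennreal \<nu> * (\<integral>\<^sup>+x. intensity * (\<integral>\<^sup>+u. ?S u x \<partial>lborel) \<partial>Q)"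
    by (simp add: nn_integral_cmult intensity_def power2_eq_square mult_ac)
  also have "(\<integral>\<^sup>+x. intensity * (\<integral>\<^sup>+u. ?S u x \<partial>lborel) \<partial>Q)
      = (\<integral>\<^sup>+x. \<integral>\<^sup>+u. shot u x (\<lambda>a. shot u x (\<lambda>b. intensity * (\<integral>\<^sup>+c. G a b c \<partial>lborel))) \<partial>lborel \<partial>Q)"
    by (intro nn_integral_cong) (simp add: shot_cmult nn_integral_cmult)
  finally show ?thesis by (simp add: K2_def)
qed

text \<open>The five terms are the five patterns of equal cluster indices. The three patterns with
  one repeated index differ only in the position of the lone cluster, which \<open>shot_swap\<close>
  moves to the innermost place.\<close>

lemma expectation_total3:
  assumes F: "(\<lambda>(a, b, c). F a b c) \<in> borel_measurable (borel \<Otimes>\<^sub>M borel \<Otimes>\<^sub>M borel)"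
  shows "(\<integral>\<^sup>+w. total w (\<lambda>a. total w (\<lambda>b. total w (\<lambda>c. F a b c))) \<partial>M)
    = K3 F + K2 (\<lambda>a b. intensity * (\<integral>\<^sup>+c. F a b c \<partial>lborel))
      + K2 (\<lambda>a b. intensity * (\<integral>\<^sup>+c. F a c b \<partial>lborel))
      + K2 (\<lambda>a b. intensity * (\<integral>\<^sup>+c. F c a b \<partial>lborel))
      + intensity ^ 3 * (\<integral>\<^sup>+a. \<integral>\<^sup>+b. \<integral>\<^sup>+c. F a b c \<partial>lborel \<partial>lborel \<partial>lborel)"
proof -
  have [measurable (raw)]: "(\<lambda>p. F (a p) (b p) (c p)) \<in> borel_measurable N"
    if "a \<in> borel_measurable N" "b \<in> borel_measurable N" "c \<in> borel_measurable N" for N :: "'n measure" and a b c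
    using measurable_compose[of "\<lambda>p. (a p, b p, c p)" N _ _ borel, OF _ F] that by simp
  let ?T = "\<lambda>u x v y t z. shot u x (\<lambda>a. shot v y (\<lambda>b. shot t z (\<lambda>c. F a b c)))"
  let ?TT = "\<lambda>w i j k. ?T (U i w) (X i w) (U j w) (X j w) (U k w) (X k w)"
  have "(\<integral>\<^sup>+w. total w (\<lambda>a. total w (\<lambda>b. total w (\<lambda>c. F a b c))) \<partial>M)
      = (\<integral>\<^sup>+w. \<integral>\<^sup>+i. \<integral>\<^sup>+j. \<integral>\<^sup>+k. ?TT w i j k \<partial>count_space UNIV \<partial>count_space UNIV \<partial>count_space UNIV \<partial>M)"
  proof (rule nn_integral_cong)
    fix w assume w: "w \<in> space M"
    show "total w (\<lambda>a. total w (\<lambda>b. total w (\<lambda>c. F a b c)))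
        = (\<integral>\<^sup>+i. \<integral>\<^sup>+j. \<integral>\<^sup>+k. ?TT w i j k \<partial>count_space UNIV \<partial>count_space UNIV \<partial>count_space UNIV)"
      unfolding total_def using X_space[OF w] by (simp add: shot_count_space shot_count_space2)
  qed
  also have "\<dots> = (\<integral>\<^sup>+w. \<integral>\<^sup>+i. \<integral>\<^sup>+(j, k). ?TT w i j k \<partial>count_space UNIV \<partial>count_space UNIV \<partial>M)"
    by (subst nn_integral_fst_count_space[symmetric]) simp
  also have "\<dots> = (\<integral>\<^sup>+w. \<integral>\<^sup>+(i, j, k). ?TT w i j k \<partial>count_space UNIV \<partial>M)"
    by (subst nn_integral_fst_count_space[symmetric]) simp
  also have "\<dots> = (\<integral>\<^sup>+(i, j, k). \<integral>\<^sup>+w. ?TT w i j k \<partial>M \<partial>count_space UNIV)"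
    unfolding case_prod_unfold by (rule nn_integral_count_space_nn_integral) auto
  also have "\<dots> = (\<integral>\<^sup>+i. \<integral>\<^sup>+w. ?TT w i i i \<partial>M \<partial>count_space UNIV)
      + (\<integral>\<^sup>+(i, j). \<integral>\<^sup>+w. ?TT w i i j \<partial>M \<partial>count_space distinct_pairs)
      + (\<integral>\<^sup>+(i, j). \<integral>\<^sup>+w. ?TT w i j i \<partial>M \<partial>count_space distinct_pairs)
      + (\<integral>\<^sup>+(i, j). \<integral>\<^sup>+w. ?TT w j i i \<partial>M \<partial>count_space distinct_pairs)
      + (\<integral>\<^sup>+(i, j, k). \<integral>\<^sup>+w. ?TT w i j k \<partial>M \<partial>count_space distinct_triples)"
    by (subst sum_triples_split) simp
  also have "(\<integral>\<^sup>+i. \<integral>\<^sup>+w. ?TT w i i i \<partial>M \<partial>count_space UNIV) = K3 F"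
    unfolding K3_def by (rule marked_campbell1) measurable
  also have "(\<integral>\<^sup>+(i, j). \<integral>\<^sup>+w. ?TT w i i j \<partial>M \<partial>count_space distinct_pairs) = K2 (\<lambda>a b. intensity * (\<integral>\<^sup>+c. F a b c \<partial>lborel))"
    by (rule expectation_pair_single[OF F])
  also have "(\<integral>\<^sup>+(i, j). \<integral>\<^sup>+w. ?TT w i j i \<partial>M \<partial>count_space distinct_pairs) = K2 (\<lambda>a b. intensity * (\<integral>\<^sup>+c. F a c b \<partial>lborel))"
  proof (subst expectation_pair_single[symmetric])
    show "(\<integral>\<^sup>+(i, j). \<integral>\<^sup>+w. ?TT w i j i \<partial>M \<partial>count_space distinct_pairs)
        = (\<integral>\<^sup>+(i, j). \<integral>\<^sup>+w. shot (U i w) (X i w) (\<lambda>a. shot (U i w) (X i w) (\<lambda>b. shot (U j w) (X j w) (\<lambda>c. F a c b))) \<partial>M \<partial>count_space distinct_pairs)"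
      unfolding case_prod_unfold by (intro nn_integral_cong shot_cong shot_swap X_space) measurable
  qed measurable
  also have "(\<integral>\<^sup>+(i, j). \<integral>\<^sup>+w. ?TT w j i i \<partial>M \<partial>count_space distinct_pairs) = K2 (\<lambda>a b. intensity * (\<integral>\<^sup>+c. F c a b \<partial>lborel))"
  proof (subst expectation_pair_single[symmetric])
    \<comment> \<open>Here the lone cluster stands outermost and has to pass both integrals over the
      other cluster.\<close>
    have "shot v y (\<lambda>a. shot u x (\<lambda>b. shot u x (\<lambda>c. F a b c))) = shot u x (\<lambda>a. shot u x (\<lambda>b. shot v y (\<lambda>c. F c a b)))"
      if [simp]: "x \<in> space marks" "y \<in> space marks" for u v x y
    proof -
      have "shot v y (\<lambda>a. shot u x (\<lambda>b. shot u x (\<lambda>c. F a b c))) = shot u x (\<lambda>b. shot v y (\<lambda>a. shot u x (\<lambda>c. F a b c)))"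
        by (rule shot_swap) simp_all
      also have "\<dots> = shot u x (\<lambda>b. shot u x (\<lambda>c. shot v y (\<lambda>a. F a b c)))"
        by (intro shot_cong shot_swap) simp_all
      finally show ?thesis .
    qed
    then show "(\<integral>\<^sup>+(i, j). \<integral>\<^sup>+w. ?TT w j i i \<partial>M \<partial>count_space distinct_pairs)
        = (\<integral>\<^sup>+(i, j). \<integral>\<^sup>+w. shot (U i w) (X i w) (\<lambda>a. shot (U i w) (X i w) (\<lambda>b. shot (U j w) (X j w) (\<lambda>c. F c a b))) \<partial>M \<partial>count_space distinct_pairs)"
      unfolding case_prod_unfold by (intro nn_integral_cong) (simp add: X_space)
  qed measurable
  also have "(\<integral>\<^sup>+(i, j, k). \<integral>\<^sup>+w. ?TT w i j k \<partial>M \<partial>count_space distinct_triples)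
      = ennreal \<nu> ^ 3 * (\<integral>\<^sup>+x. \<integral>\<^sup>+y. \<integral>\<^sup>+z. \<integral>\<^sup>+(u, v, t). ?T u x v y t z \<partial>lborel \<partial>Q \<partial>Q \<partial>Q)"
    by (rule marked_campbell3) (unfold case_prod_unfold, measurable)
  also have "(\<integral>\<^sup>+x. \<integral>\<^sup>+y. \<integral>\<^sup>+z. \<integral>\<^sup>+(u, v, t). ?T u x v y t z \<partial>lborel \<partial>Q \<partial>Q \<partial>Q)
      = (\<integral>\<^sup>+x. \<integral>\<^sup>+y. \<integral>\<^sup>+z. mass x * (mass y * (mass z * (\<integral>\<^sup>+a. \<integral>\<^sup>+b. \<integral>\<^sup>+c. F a b c \<partial>lborel \<partial>lborel \<partial>lborel))) \<partial>Q \<partial>Q \<partial>Q)"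
  proof (intro nn_integral_cong)
    fix x y z assume "x \<in> space Q" "y \<in> space Q" "z \<in> space Q"
    then have x [simp]: "x \<in> space marks" and y [simp]: "y \<in> space marks" and z [simp]: "z \<in> space marks" by auto
    note [simp] = lborel.sigma_finite_measure_axioms
    have "(\<integral>\<^sup>+(u, v, t). ?T u x v y t z \<partial>lborel) = (\<integral>\<^sup>+u. \<integral>\<^sup>+(v, t). ?T u x v y t z \<partial>lborel \<partial>lborel)"
      unfolding lborel_prod[symmetric] by (subst lborel_pair.P.nn_integral_fst[symmetric]) auto
    also have "\<dots> = (\<integral>\<^sup>+u. \<integral>\<^sup>+v. \<integral>\<^sup>+t. ?T u x v y t z \<partial>lborel \<partial>lborel \<partial>lborel)"
      unfolding lborel_prod[symmetric] by (intro nn_integral_cong, subst lborel.nn_integral_fst[symmetric]) auto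
    also have "\<dots> = (\<integral>\<^sup>+u. \<integral>\<^sup>+v. shot u x (\<lambda>a. shot v y (\<lambda>b. mass z * (\<integral>\<^sup>+c. F a b c \<partial>lborel))) \<partial>lborel \<partial>lborel)"
      by (simp add: shot_nn_integral[symmetric] shot_integral)
    also have "\<dots> = (\<integral>\<^sup>+u. shot u x (\<lambda>a. mass y * (mass z * (\<integral>\<^sup>+b. \<integral>\<^sup>+c. F a b c \<partial>lborel \<partial>lborel))) \<partial>lborel)"
      by (simp add: shot_nn_integral[symmetric] shot_integral nn_integral_cmult)
    also have "\<dots> = mass x * (mass y * (mass z * (\<integral>\<^sup>+a. \<integral>\<^sup>+b. \<integral>\<^sup>+c. F a b c \<partial>lborel \<partial>lborel \<partial>lborel)))"
      by (simp add: shot_integral nn_integral_cmult)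
    finally show "(\<integral>\<^sup>+(u, v, t). ?T u x v y t z \<partial>lborel)
      = mass x * (mass y * (mass z * (\<integral>\<^sup>+a. \<integral>\<^sup>+b. \<integral>\<^sup>+c. F a b c \<partial>lborel \<partial>lborel \<partial>lborel)))" .
  qed
  also have "\<dots> = (\<integral>\<^sup>+x. mass x \<partial>Q) ^ 3 * (\<integral>\<^sup>+a. \<integral>\<^sup>+b. \<integral>\<^sup>+c. F a b c \<partial>lborel \<partial>lborel \<partial>lborel)"
    by (simp add: nn_integral_cmult nn_integral_multc mult.assoc power3_eq_cube)
  finally show ?thesis by (simp add: intensity_def power_mult_distrib mult.assoc)
qed

end

section \<open>Points of the cluster process\<close>

lemma shot_finite_sum:
  assumes x: "x \<in> space marks" and [measurable]: "f \<in> borel_measurable borel"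
  shows "shot u x f = (\<Sum>y\<in>points (snd x). f (fst x * y + u))"
proof -
  have "shot u x f = (\<integral>\<^sup>+y. f (fst x * y + u) \<partial>count_space (points (snd x)))"
    unfolding shot_def by (rule nn_integral_counting[OF snd_marks[OF x]]) measurable
  then show ?thesis
    using finite_simple_counting_eq_distr(1)[OF snd_marks[OF x]] by (simp add: nn_integral_count_space_finite)
qed

text \<open>The cardinality exceeds one only for sign zero, which collapses the cluster. Sign zero
  has probability zero but is not excluded at every sample point, so the multiplicity is
  kept.\<close>

lemma shot_singleton:
  assumes x: "x \<in> space marks"
  shows "shot u x (indicator {a}) = of_nat (card {y \<in> points (snd x). fst x * y + u = a})"
proof -
  have "shot u x (indicator {a}) = (\<Sum>y\<in>points (snd x). if fst x * y + u = a then 1 else 0)"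
    by (subst shot_finite_sum[OF x]) (auto intro!: sum.cong simp: indicator_def)
  also have "\<dots> = of_nat (card {y \<in> points (snd x). fst x * y + u = a})"
    using finite_simple_counting_eq_distr(1)[OF snd_marks[OF x]] by (simp flip: sum.inter_filter)
  finally show ?thesis .
qed

lemma shot_eq_count_space:
  assumes x: "x \<in> space marks" and [measurable]: "f \<in> borel_measurable borel"
  shows "shot u x f = (\<integral>\<^sup>+a. f a * shot u x (indicator {a}) \<partial>count_space UNIV)"
proof -
  have "(\<integral>\<^sup>+a. f a * shot u x (indicator {a}) \<partial>count_space UNIV)
      = (\<integral>\<^sup>+a. (\<Sum>y\<in>points (snd x). f a * indicator {fst x * y + u} a) \<partial>count_space UNIV)"
    by (subst shot_finite_sum[OF x]) (auto intro!: nn_integral_cong sum.cong simp: sum_distrib_left indicator_def)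
  also have "\<dots> = (\<Sum>y\<in>points (snd x). f (fst x * y + u))"
    by (subst nn_integral_sum) (auto intro!: sum.cong simp: nn_integral_count_space_indicator[symmetric] nn_integral_count_space_finite)
  finally show ?thesis by (simp add: shot_finite_sum[OF x])
qed

lemma emeasure_shift_sign:
  assumes x: "x \<in> space marks" and A: "A \<in> sets borel"
  shows "emeasure (shift_meas u (sign_meas (fst x) (snd x))) A = shot u x (indicator A)"
proof -
  have s: "sets (snd x) = sets borel" by (rule sets_counting[OF snd_marks[OF x]])
  have [measurable]: "(\<lambda>y. fst x * y) \<in> borel_measurable (snd x)"
    using s by (simp cong: measurable_cong_sets)
  have "emeasure (shift_meas u (sign_meas (fst x) (snd x))) A = (\<integral>\<^sup>+y. indicator A y \<partial>shift_meas u (sign_meas (fst x) (snd x)))"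
    using A by (simp add: shift_meas_def)
  also have "\<dots> = shot u x (indicator A)"
    using A unfolding shift_meas_def sign_meas_def shot_def
    by (subst nn_integral_distr, simp, simp, subst nn_integral_distr) auto
  finally show ?thesis .
qed

lemma shot_mono: "(\<And>y. f y \<le> g y) \<Longrightarrow> shot u x f \<le> shot u x g"
  unfolding shot_def by (intro nn_integral_mono) auto

context cluster_points
begin

definition N :: "'w \<Rightarrow> real measure" where
  "N = cluster_process U (\<lambda>j w. fst (X j w)) (\<lambda>j w. snd (X j w))"

lemma total_measurable [measurable (raw)]:
  assumes [measurable]: "w \<in> measurable Y M" "(\<lambda>(p, y). f p y) \<in> borel_measurable (Y \<Otimes>\<^sub>M borel)"
  shows "(\<lambda>p. total (w p) (f p)) \<in> borel_measurable Y"
  unfolding total_def nn_integral_count_space_nat by measurable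

lemma total_count_space:
  fixes f :: "nat \<Rightarrow> real \<Rightarrow> ennreal"
  assumes w: "w \<in> space M" and f: "\<And>i. f i \<in> borel_measurable borel"
  shows "total w (\<lambda>a. \<integral>\<^sup>+i. f i a \<partial>count_space UNIV) = (\<integral>\<^sup>+i. total w (f i) \<partial>count_space UNIV)"
  unfolding total_def using X_space[OF w] f
  by (simp add: shot_count_space) (rule nn_integral_count_space_nn_integral, auto)

text \<open>\<open>measure_of\<close> returns the prescribed values only for a countably additive
  set function; here additivity is an interchange of the sums over the sets and over the
  clusters.\<close>

lemma emeasure_N:
  assumes w: "w \<in> space M" and A: "A \<in> sets borel"
  shows "emeasure (N w) A = total w (indicator A)"
proof -
  have eq: "(\<Sum>j. emeasure (shift_meas (U j w) (sign_meas (fst (X j w)) (snd (X j w)))) A) = total w (indicator A)"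
    if "A \<in> sets borel" for A
    using that by (simp add: emeasure_shift_sign[OF X_space[OF w]] total_def nn_integral_count_space_nat)
  show ?thesis
    unfolding N_def cluster_process_def eq[OF A, symmetric]
  proof (rule emeasure_measure_of_sigma)
    show "sigma_algebra UNIV (sets (borel :: real measure))"
      using sets.sigma_algebra_axioms[of "borel :: real measure"] by simp
    show "positive (sets borel) (\<lambda>A. \<Sum>j. emeasure (shift_meas (U j w) (sign_meas (fst (X j w)) (snd (X j w)))) A)"
      by (simp add: positive_def)
    show "countably_additive (sets borel) (\<lambda>A. \<Sum>j. emeasure (shift_meas (U j w) (sign_meas (fst (X j w)) (snd (X j w)))) A)"
    proof (rule countably_additiveI)
      fix A :: "nat \<Rightarrow> real set"
      assume A: "range A \<subseteq> sets borel" "disjoint_family A" "(\<Union>i. A i) \<in> sets borel"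
      have "total w (indicator (\<Union>i. A i)) = total w (\<lambda>a. \<integral>\<^sup>+i. indicator (A i) a \<partial>count_space UNIV)"
        using A(2) by (simp add: nn_integral_count_space_nat suminf_indicator)
      also have "\<dots> = (\<Sum>i. total w (indicator (A i)))"
        using A(1) by (subst total_count_space[OF w]) (auto simp: nn_integral_count_space_nat)
      finally show "(\<Sum>i. \<Sum>j. emeasure (shift_meas (U j w) (sign_meas (fst (X j w)) (snd (X j w)))) (A i))
        = (\<Sum>j. emeasure (shift_meas (U j w) (sign_meas (fst (X j w)) (snd (X j w)))) (\<Union>i. A i))"
        using A by (subst (1) eq) (auto simp: eq)
    qed
  qed (use A in auto)
qed

section \<open>Multiplicities and measurable sums over the set of points\<close>

definition mult :: "nat \<Rightarrow> 'w \<Rightarrow> real \<Rightarrow> ennreal" where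
  "mult j w a = shot (U j w) (X j w) (indicator {a})"

definition Pts :: "nat \<Rightarrow> 'w \<Rightarrow> real set" where
  "Pts j w = {a. mult j w a \<noteq> 0}"

lemma mult_measurable [measurable (raw)]:
  assumes [measurable]: "w \<in> measurable Y M" "a \<in> borel_measurable Y"
  shows "(\<lambda>p. mult j (w p) (a p)) \<in> borel_measurable Y"
proof -
  have "(\<lambda>(p, y). indicator {a p} y :: ennreal) = (\<lambda>z. indicator {z. a (fst z) = snd z} z)"
    by (auto simp: indicator_def)
  moreover have "(\<lambda>z. indicator {z. a (fst z) = snd z} z :: ennreal) \<in> borel_measurable (Y \<Otimes>\<^sub>M borel)"
    by measurable
  ultimately show ?thesis unfolding mult_def by (intro shot_measurable) simp_all
qed

lemma mult_finite: "w \<in> space M \<Longrightarrow> mult j w a \<noteq> \<infinity>"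
  by (simp add: mult_def shot_singleton[OF X_space])

lemma points_N:
  assumes "w \<in> space M"
  shows "points (N w) = (\<Union>j. Pts j w)"
proof -
  have "total w (indicator {a}) = 0 \<longleftrightarrow> (\<forall>j. mult j w a = 0)" for a
    unfolding total_def mult_def by (subst nn_integral_0_iff_AE) (auto simp: AE_count_space)
  then show ?thesis
    using assms by (auto simp: points_def emeasure_N Pts_def)
qed

definition points_integral :: "'w \<Rightarrow> (real \<Rightarrow> ennreal) \<Rightarrow> ennreal" where
  "points_integral w f = (\<integral>\<^sup>+a. f a \<partial>count_space (points (N w)))"

text \<open>The inverse cancels the multiplicity inside the selected cluster. If that multiplicity
  is zero the inverse is infinite, but it is then multiplied by zero wherever it is
  integrated.\<close>

definition first_weight :: "nat \<Rightarrow> 'w \<Rightarrow> real \<Rightarrow> ennreal" where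
  "first_weight j w a = (if \<forall>i<j. mult i w a = 0 then inverse (mult j w a) else 0)"

lemma first_weight_measurable [measurable (raw)]:
  assumes [measurable]: "w \<in> measurable Y M" "a \<in> borel_measurable Y"
  shows "(\<lambda>p. first_weight j (w p) (a p)) \<in> borel_measurable Y"
  unfolding first_weight_def by measurable

text \<open>Coinciding points of different clusters are counted once, at the first cluster containing
  them; this representation holds for every sample point and not merely almost surely.\<close>

lemma points_integral_eq:
  assumes w: "w \<in> space M" and [measurable]: "f \<in> borel_measurable borel"
  shows "points_integral w f = (\<integral>\<^sup>+j. shot (U j w) (X j w) (\<lambda>a. f a * first_weight j w a) \<partial>count_space UNIV)"
proof -
  have [simp]: "first_weight j w a * mult j w a = indicator (disjointed (\<lambda>j. Pts j w) j) a" for j a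
  proof (cases "mult j w a = 0")
    case False
    then have "inverse (mult j w a) * mult j w a = 1"
      using mult_finite[OF w, of j a] by (simp add: mult.commute ennreal_inverse_mult less_top divide_ennreal_def[symmetric] ennreal_divide_self)
    with False show ?thesis
      by (auto simp: first_weight_def disjointed_def Pts_def indicator_def)
  qed (auto simp: disjointed_def Pts_def indicator_def)
  have "(\<integral>\<^sup>+j. shot (U j w) (X j w) (\<lambda>a. f a * first_weight j w a) \<partial>count_space UNIV)
      = (\<integral>\<^sup>+j. \<integral>\<^sup>+a. f a * indicator (disjointed (\<lambda>j. Pts j w) j) a \<partial>count_space UNIV \<partial>count_space UNIV)"
    by (intro nn_integral_cong, subst shot_eq_count_space[OF X_space[OF w]])
      (use w in \<open>auto simp: mult.assoc mult_def[symmetric]\<close>)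
  also have "\<dots> = (\<integral>\<^sup>+a. \<integral>\<^sup>+j. f a * indicator (disjointed (\<lambda>j. Pts j w) j) a \<partial>count_space UNIV \<partial>count_space UNIV)"
    by (rule nn_integral_count_space_nn_integral[symmetric]) auto
  also have "\<dots> = (\<integral>\<^sup>+a. f a * indicator (points (N w)) a \<partial>count_space UNIV)"
    by (subst nn_integral_cmult)
      (auto simp: nn_integral_count_space_nat suminf_indicator[OF disjoint_family_disjointed] UN_disjointed_eq points_N[OF w])
  also have "\<dots> = points_integral w f"
    unfolding points_integral_def by (cases "points (N w) = UNIV") (simp_all add: nn_integral_count_space_indicator)
  finally show ?thesis ..
qed

text \<open>The random set \<open>points (N w)\<close> has no measurable structure of its own.
  Measurability comes from the representation by shots, which is available at every sample
  point.\<close>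

lemma points_integral_measurable [measurable (raw)]:
  assumes w [measurable]: "w \<in> measurable Y M" and f [measurable]: "(\<lambda>(p, y). f p y) \<in> borel_measurable (Y \<Otimes>\<^sub>M borel)"
  shows "(\<lambda>p. points_integral (w p) (f p)) \<in> borel_measurable Y"
proof -
  have "(\<lambda>p. \<Sum>j. shot (U j (w p)) (X j (w p)) (\<lambda>a. f p a * first_weight j (w p) a)) \<in> borel_measurable Y"
    by measurable
  then show ?thesis
    using measurable_space[OF w] measurable_Pair2[OF f]
    by (subst measurable_cong[where g = "\<lambda>p. \<Sum>j. shot (U j (w p)) (X j (w p)) (\<lambda>a. f p a * first_weight j (w p) a)"])
      (auto simp: points_integral_eq nn_integral_count_space_nat)
qed

end

section \<open>Reflection and simplicity\<close>

lemma ennreal_power_le_cube: "k \<le> 3 \<Longrightarrow> x ^ k \<le> 1 + (x :: ennreal) ^ 3"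
proof (cases x)
  case (real r)
  assume "k \<le> 3"
  have "r ^ k \<le> 1 + r ^ 3"
  proof (cases "r \<le> 1")
    case True
    then have "r ^ k \<le> 1" using real by (intro power_le_one) auto
    then show ?thesis using real by (simp add: add_increasing2)
  next
    case False
    then have "r ^ k \<le> r ^ 3" using \<open>k \<le> 3\<close> by (intro power_increasing) auto
    then show ?thesis by simp
  qed
  then show ?thesis
    using real by (simp add: ennreal_power flip: ennreal_plus ennreal_1)
qed simp

definition cluster2 :: "real \<times> real measure \<Rightarrow> (real \<Rightarrow> real \<Rightarrow> ennreal) \<Rightarrow> ennreal" where
  "cluster2 x F = (\<integral>\<^sup>+u. shot u x (\<lambda>a. shot u x (\<lambda>b. F a b)) \<partial>lborel)"

definition cluster3 :: "real \<times> real measure \<Rightarrow> (real \<Rightarrow> real \<Rightarrow> real \<Rightarrow> ennreal) \<Rightarrow> ennreal" where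
  "cluster3 x F = (\<integral>\<^sup>+u. shot u x (\<lambda>a. shot u x (\<lambda>b. shot u x (\<lambda>c. F a b c))) \<partial>lborel)"

lemma shot_translate: "shot u x f = shot 0 x (\<lambda>a. f (a + u))"
  by (simp add: shot_def)

lemma cluster2_eq:
  assumes x: "x \<in> space marks" and F: "(\<lambda>(a, b). F a b) \<in> borel_measurable (borel \<Otimes>\<^sub>M borel)"
  shows "cluster2 x F = shot 0 x (\<lambda>a. shot 0 x (\<lambda>b. \<integral>\<^sup>+u. F (a + u) (b + u) \<partial>lborel))"
proof -
  have [measurable (raw)]: "(\<lambda>p. F (a p) (b p)) \<in> borel_measurable N"
    if "a \<in> borel_measurable N" "b \<in> borel_measurable N" for N :: "'n measure" and a b
    using measurable_compose[of "\<lambda>p. (a p, b p)" N _ _ borel, OF _ F] that by simp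
  note [simp] = x lborel.sigma_finite_measure_axioms
  show ?thesis
    unfolding cluster2_def by (subst (1 2) shot_translate) (simp add: shot_nn_integral)
qed

text \<open>The substitution \<open>u \<mapsto> r - a - b - u\<close> exchanges the two points of a pair.\<close>

lemma cluster2_reflect:
  assumes x: "x \<in> space marks" and F: "(\<lambda>(a, b). F a b) \<in> borel_measurable (borel \<Otimes>\<^sub>M borel)"
  shows "cluster2 x (\<lambda>a b. F (r - a) (r - b)) = cluster2 x F"
proof -
  have M [measurable (raw)]: "(\<lambda>p. F (a p) (b p)) \<in> borel_measurable N"
    if "a \<in> borel_measurable N" "b \<in> borel_measurable N" for N :: "'n measure" and a b
    using measurable_compose[of "\<lambda>p. (a p, b p)" N _ _ borel, OF _ F] that by simp
  have sub: "(\<integral>\<^sup>+u. F (r - (a + u)) (r - (b + u)) \<partial>lborel) = (\<integral>\<^sup>+u. F (b + u) (a + u) \<partial>lborel)" for a b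
    using nn_integral_real_affine[of "\<lambda>u. F (r - (a + u)) (r - (b + u))" "-1" "r - a - b"]
    by (simp add: algebra_simps)
  have "cluster2 x (\<lambda>a b. F (r - a) (r - b)) = shot 0 x (\<lambda>a. shot 0 x (\<lambda>b. \<integral>\<^sup>+u. F (b + u) (a + u) \<partial>lborel))"
    by (subst cluster2_eq[OF x]) (measurable, simp add: sub)
  also have "\<dots> = cluster2 x F"
    unfolding cluster2_eq[OF x F] by (rule shot_swap[OF x x]) measurable
  finally show ?thesis .
qed

text \<open>Unlike for pairs, no translation undoes the reflection of three points. Substituting
  \<open>r - u\<close> for the centre instead turns the reflected locations into those of the
  cluster with the opposite sign.\<close>

lemma cluster3_reflect:
  assumes d: "d \<in> space counting_space" and F: "(\<lambda>(a, b, c). F a b c) \<in> borel_measurable (borel \<Otimes>\<^sub>M borel \<Otimes>\<^sub>M borel)"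
  shows "cluster3 (- s, d) (\<lambda>a b c. F (r - a) (r - b) (r - c)) = cluster3 (s, d) F"
proof -
  have [measurable (raw)]: "(\<lambda>p. F (a p) (b p) (c p)) \<in> borel_measurable N"
    if "a \<in> borel_measurable N" "b \<in> borel_measurable N" "c \<in> borel_measurable N" for N :: "'n measure" and a b c
    using measurable_compose[of "\<lambda>p. (a p, b p, c p)" N _ _ borel, OF _ F] that by simp
  have [simp]: "(- s, d) \<in> space marks" using d by (simp add: space_pair_measure)
  let ?g = "\<lambda>u. shot u (- s, d) (\<lambda>a. shot u (- s, d) (\<lambda>b. shot u (- s, d) (\<lambda>c. F (r - a) (r - b) (r - c))))"
  have "?g \<in> borel_measurable borel" by measurable
  from nn_integral_real_affine[OF this, of "-1" r] have "(\<integral>\<^sup>+u. ?g u \<partial>lborel) = (\<integral>\<^sup>+u. ?g (r - u) \<partial>lborel)"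
    by simp
  moreover have "?g (r - u) = shot u (s, d) (\<lambda>a. shot u (s, d) (\<lambda>b. shot u (s, d) (\<lambda>c. F a b c)))" for u
    by (simp add: shot_def algebra_simps)
  ultimately show ?thesis by (simp only: cluster3_def)
qed

context cluster_points
begin

lemma K2_eq: "K2 F = ennreal \<nu> * (\<integral>\<^sup>+x. cluster2 x F \<partial>Q)"
  by (simp add: K2_def cluster2_def)

lemma K3_eq: "K3 F = ennreal \<nu> * (\<integral>\<^sup>+x. cluster3 x F \<partial>Q)"
  by (simp add: K3_def cluster3_def)

lemma K2_reflect:
  assumes "(\<lambda>(a, b). F a b) \<in> borel_measurable (borel \<Otimes>\<^sub>M borel)"
  shows "K2 (\<lambda>a b. F (r - a) (r - b)) = K2 F"
  unfolding K2_eq using cluster2_reflect[OF _ assms] by (auto intro!: arg_cong[where f = "(*) _"] nn_integral_cong)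

lemma mass_moment_finite: "k \<le> 3 \<Longrightarrow> (\<integral>\<^sup>+x. mass x ^ k \<partial>Q) < \<infinity>"
proof -
  assume "k \<le> 3"
  then have "(\<integral>\<^sup>+x. mass x ^ k \<partial>Q) \<le> (\<integral>\<^sup>+x. 1 + mass x ^ 3 \<partial>Q)"
    by (intro nn_integral_mono ennreal_power_le_cube)
  also have "\<dots> = 1 + (\<integral>\<^sup>+x. mass x ^ 3 \<partial>Q)"
    by (subst nn_integral_add) (auto simp: Q.emeasure_space_1[unfolded space_Q])
  also have "\<dots> < \<infinity>" using third_moment by (simp add: less_top)
  finally show ?thesis .
qed

lemma intensity_finite: "intensity < \<infinity>"
  using mass_moment_finite[of 1] by (simp add: intensity_def ennreal_mult_less_top)

text \<open>It suffices to confine one of the points to \<open>B\<close>: its integral over the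
  centre is the mass of the cluster times the volume of \<open>B\<close>, and each further point
  costs one more factor of the mass. For triples the third moment is therefore exactly what is
  needed.\<close>

lemma K2_finite:
  assumes le: "\<And>a b. F a b \<le> c * indicator B a" and c: "c < \<infinity>" and B [measurable]: "B \<in> sets borel" and fin: "emeasure lborel B < \<infinity>"
  shows "K2 F < \<infinity>"
proof -
  have "(\<integral>\<^sup>+x. cluster2 x F \<partial>Q) \<le> (\<integral>\<^sup>+x. c * emeasure lborel B * mass x ^ 2 \<partial>Q)"
  proof (rule nn_integral_mono)
    fix x assume "x \<in> space Q"
    then have x [simp]: "x \<in> space marks" by simp
    have "cluster2 x F \<le> cluster2 x (\<lambda>a b. c * indicator B a)"
      unfolding cluster2_def by (intro nn_integral_mono shot_mono le)
    also have "\<dots> = c * emeasure lborel B * mass x ^ 2"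
      unfolding cluster2_def
      by (simp add: shot_const shot_cmult shot_multc shot_integral nn_integral_cmult nn_integral_multc power2_eq_square mult_ac)
    finally show "cluster2 x F \<le> c * emeasure lborel B * mass x ^ 2" .
  qed
  also have "\<dots> = c * emeasure lborel B * (\<integral>\<^sup>+x. mass x ^ 2 \<partial>Q)"
    by (rule nn_integral_cmult) measurable
  also have "\<dots> < \<infinity>"
    using c fin mass_moment_finite[of 2] by (simp add: ennreal_mult_less_top)
  finally show ?thesis by (simp add: K2_eq ennreal_mult_less_top)
qed

lemma K3_finite:
  assumes le: "\<And>a b d. F a b d \<le> c * indicator B a" and c: "c < \<infinity>" and B [measurable]: "B \<in> sets borel" and fin: "emeasure lborel B < \<infinity>"
  shows "K3 F < \<infinity>"
proof -
  have "(\<integral>\<^sup>+x. cluster3 x F \<partial>Q) \<le> (\<integral>\<^sup>+x. c * emeasure lborel B * mass x ^ 3 \<partial>Q)"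
  proof (rule nn_integral_mono)
    fix x assume "x \<in> space Q"
    then have x [simp]: "x \<in> space marks" by simp
    have "cluster3 x F \<le> cluster3 x (\<lambda>a b d. c * indicator B a)"
      unfolding cluster3_def by (intro nn_integral_mono shot_mono le)
    also have "\<dots> = c * emeasure lborel B * mass x ^ 3"
      unfolding cluster3_def
      by (simp add: shot_const shot_cmult shot_multc shot_integral nn_integral_cmult nn_integral_multc power3_eq_cube mult_ac)
    finally show "cluster3 x F \<le> c * emeasure lborel B * mass x ^ 3" .
  qed
  also have "\<dots> = c * emeasure lborel B * (\<integral>\<^sup>+x. mass x ^ 3 \<partial>Q)"
    by (rule nn_integral_cmult) measurable
  also have "\<dots> < \<infinity>"
    using c fin mass_moment_finite[of 3] by (simp add: ennreal_mult_less_top)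
  finally show ?thesis by (simp add: K3_eq ennreal_mult_less_top)
qed

section \<open>Almost sure simplicity and local finiteness\<close>

definition good :: "'w \<Rightarrow> bool" where
  "good w \<longleftrightarrow> w \<in> space M \<and> (\<forall>j. fst (X j w) \<noteq> 0) \<and> (\<forall>i j a. i \<noteq> j \<longrightarrow> mult i w a = 0 \<or> mult j w a = 0)
    \<and> (\<forall>n::nat. total w (indicator {- real n..real n}) < \<infinity>)"

text \<open>Nonzero signs hold by the law of the marks, local finiteness by the finite intensity.
  Different clusters share no point because the expected number of coincidences is an integral over
  the diagonal.\<close>

lemma AE_good: "AE w in M. good w"
proof -
  have "AE w in M. fst (X j w) \<noteq> 0" for j
  proof -
    have "(\<integral>\<^sup>+w. indicator {x \<in> space marks. fst x = 0} (X j w) \<partial>M) = (\<integral>\<^sup>+x. indicator {x \<in> space marks. fst x = 0} x \<partial>Q)"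
      by (rule marks_iid1) measurable
    also have "\<dots> = 0"
      using sign_nonzero by (subst nn_integral_0_iff_AE) (auto simp: indicator_def)
    finally have "AE w in M. indicator {x \<in> space marks. fst x = 0} (X j w) = (0 :: ennreal)"
      by (subst (asm) nn_integral_0_iff_AE) auto
    then show ?thesis
      using AE_space by eventually_elim (auto simp: indicator_def X_space split: if_splits)
  qed
  then have 1: "AE w in M. \<forall>j. fst (X j w) \<noteq> 0" by (simp add: AE_all_countable)
  \<comment> \<open>The diagonal is a null set of the plane, so the formula for distinct clusters
    gives zero for the sum over all index pairs, hence for each pair.\<close>
  have "(\<integral>\<^sup>+w. shot (U i w) (X i w) (\<lambda>a. shot (U j w) (X j w) (\<lambda>b. indicator {a} b)) \<partial>M) = 0" if "i \<noteq> j" for i j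
  proof -
    have m: "(\<lambda>(a, b). indicator {a} b :: ennreal) \<in> borel_measurable (borel \<Otimes>\<^sub>M (borel :: real measure))"
    proof -
      have "(\<lambda>(a, b). indicator {a} b :: ennreal) = indicator {z::real \<times> real. fst z = snd z}"
        by (auto simp: indicator_def)
      moreover have "indicator {z::real \<times> real. fst z = snd z} \<in> borel_measurable (borel \<Otimes>\<^sub>M borel)" by measurable
      ultimately show ?thesis by metis
    qed
    have "(\<integral>\<^sup>+(i, j). \<integral>\<^sup>+w. shot (U i w) (X i w) (\<lambda>a. shot (U j w) (X j w) (\<lambda>b. indicator {a} b)) \<partial>M \<partial>count_space distinct_pairs) = 0"
      by (subst expectation_distinct_pairs[OF m]) simp
    then show ?thesis using that
      by (subst (asm) nn_integral_0_iff_AE) (auto simp: AE_count_space)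
  qed
  moreover have "(\<lambda>w. shot (U i w) (X i w) (\<lambda>a. shot (U j w) (X j w) (\<lambda>b. indicator {a} b))) \<in> borel_measurable M" for i j
    unfolding mult_def[symmetric] by measurable
  ultimately have sh: "AE w in M. shot (U i w) (X i w) (\<lambda>a. shot (U j w) (X j w) (\<lambda>b. indicator {a} b)) = 0" if "i \<noteq> j" for i j
    using that nn_integral_0_iff_AE by blast
  have "AE w in M. \<forall>a. mult i w a = 0 \<or> mult j w a = 0" if "i \<noteq> j" for i j
    using sh[OF that] AE_space[of M]
  proof eventually_elim
    case (elim w)
    have "(\<integral>\<^sup>+a. mult j w a * mult i w a \<partial>count_space UNIV) = 0"
      using elim by (subst (asm) shot_eq_count_space[OF X_space]) (auto simp: mult_def[symmetric])
    then show ?case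
      by (subst (asm) nn_integral_0_iff_AE) (auto simp: AE_count_space)
  qed
  then have 2: "AE w in M. \<forall>i j a. i \<noteq> j \<longrightarrow> mult i w a = 0 \<or> mult j w a = 0"
    by (simp add: AE_all_countable)
  have "AE w in M. total w (indicator {- real n..real n}) \<noteq> \<infinity>" for n
  proof (rule nn_integral_noteq_infinite)
    show "(\<integral>\<^sup>+w. total w (indicator {- real n..real n}) \<partial>M) \<noteq> \<infinity>"
      using intensity_finite by (subst expectation_total1) (auto simp: ennreal_mult_eq_top_iff)
  qed measurable
  then have 3: "AE w in M. \<forall>n. total w (indicator {- real n..real n}) \<noteq> \<infinity>" by (simp add: AE_all_countable)
  from 1 2 3 AE_space show ?thesis
    by eventually_elim (auto simp: good_def less_top)
qed

lemma good_space: "good w \<Longrightarrow> w \<in> space M"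
  by (simp add: good_def)

text \<open>A nonzero sign makes the affine map of a cluster injective, so multiplicities are zero
  or one, and the point sets of different clusters are disjoint. Counting by clusters is then
  counting by locations.\<close>

lemma good_total:
  assumes w: "good w" and [measurable]: "f \<in> borel_measurable borel"
  shows "points_integral w f = total w f"
proof -
  note ws = good_space[OF w]
  have mult_eq: "mult j w a = indicator (Pts j w) a" for j a
  proof (cases "mult j w a = 0")
    case False
    have "{y \<in> points (snd (X j w)). fst (X j w) * y + U j w = a} \<subseteq> {(a - U j w) / fst (X j w)}"
    proof
      fix y assume "y \<in> {y \<in> points (snd (X j w)). fst (X j w) * y + U j w = a}"
      moreover have "fst (X j w) \<noteq> 0" using w by (simp add: good_def)
      ultimately show "y \<in> {(a - U j w) / fst (X j w)}" by (auto simp: eq_divide_eq)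
    qed
    then have "card {y \<in> points (snd (X j w)). fst (X j w) * y + U j w = a} \<le> 1"
      by (rule order_trans[OF card_mono[rotated]]) simp_all
    with False show ?thesis
      by (auto simp: mult_def shot_singleton[OF X_space[OF ws]] Pts_def le_Suc_eq)
  qed (simp add: Pts_def)
  have disj: "disjoint_family (\<lambda>j. Pts j w)"
    using w by (auto simp: good_def Pts_def disjoint_family_on_def)
  have "total w f = (\<integral>\<^sup>+j. \<integral>\<^sup>+a. f a * indicator (Pts j w) a \<partial>count_space UNIV \<partial>count_space UNIV)"
    unfolding total_def
  proof (intro nn_integral_cong)
    fix j show "shot (U j w) (X j w) f = (\<integral>\<^sup>+a. f a * indicator (Pts j w) a \<partial>count_space UNIV)"
      using shot_eq_count_space[OF X_space[OF ws] assms(2), of "U j w" j] unfolding mult_def[symmetric] mult_eq .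
  qed
  also have "\<dots> = (\<integral>\<^sup>+a. \<integral>\<^sup>+j. f a * indicator (Pts j w) a \<partial>count_space UNIV \<partial>count_space UNIV)"
    by (rule nn_integral_count_space_nn_integral[symmetric]) auto
  also have "\<dots> = (\<integral>\<^sup>+a. f a * indicator (points (N w)) a \<partial>count_space UNIV)"
    by (subst nn_integral_cmult) (auto simp: nn_integral_count_space_nat suminf_indicator[OF disj] points_N[OF ws])
  also have "\<dots> = points_integral w f"
    unfolding points_integral_def by (cases "points (N w) = UNIV") (simp_all add: nn_integral_count_space_indicator)
  finally show ?thesis ..
qed

lemma points_integral_indicator_finite_iff:
  "points_integral w (indicator B) < \<infinity> \<longleftrightarrow> finite (points (N w) \<inter> B)"
proof -
  have "points_integral w (indicator B) = emeasure (count_space (points (N w))) (points (N w) \<inter> B)"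
  proof -
    have "points_integral w (indicator B) = (\<integral>\<^sup>+a. indicator (points (N w) \<inter> B) a \<partial>count_space (points (N w)))"
      unfolding points_integral_def by (intro nn_integral_cong) (auto simp: indicator_def)
    then show ?thesis by simp
  qed
  then show ?thesis
    by (cases "finite (points (N w) \<inter> B)") (auto simp: emeasure_count_space_finite of_nat_less_top)
qed

lemma good_finite:
  assumes "good w" "bounded B"
  shows "finite (points (N w) \<inter> B)"
proof -
  obtain r where r: "\<And>x. x \<in> B \<Longrightarrow> \<bar>x\<bar> \<le> r" using assms(2) by (auto simp: bounded_iff)
  obtain n where "r \<le> real n" using real_arch_simple by blast
  then have sub: "B \<subseteq> {- real n..real n}" using r by force
  have "points_integral w (indicator {- real n..real n}) < \<infinity>"
    using assms(1) by (subst good_total) (auto simp: good_def)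
  then have "finite (points (N w) \<inter> {- real n..real n})"
    by (rule points_integral_indicator_finite_iff[THEN iffD1])
  then show ?thesis by (rule finite_subset[rotated]) (use sub in auto)
qed

lemma points_integral_sum:
  assumes "finite (points (N w) \<inter> B)" "\<And>a. a \<notin> B \<Longrightarrow> f a = 0"
  shows "points_integral w f = (\<Sum>a\<in>points (N w) \<inter> B. f a)"
  unfolding points_integral_def using assms by (intro nn_integral_count_space') auto

lemma expectation_points1:
  assumes [measurable]: "f \<in> borel_measurable borel"
  shows "(\<integral>\<^sup>+w. points_integral w f \<partial>M) = intensity * (\<integral>\<^sup>+a. f a \<partial>lborel)"
proof -
  have "(\<integral>\<^sup>+w. points_integral w f \<partial>M) = (\<integral>\<^sup>+w. total w f \<partial>M)"
    using AE_good by (intro nn_integral_cong_AE) (auto simp: good_total)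
  then show ?thesis by (simp add: expectation_total1)
qed

lemma expectation_points2:
  assumes F: "(\<lambda>(a, b). F a b) \<in> borel_measurable (borel \<Otimes>\<^sub>M borel)"
  shows "(\<integral>\<^sup>+w. points_integral w (\<lambda>a. points_integral w (\<lambda>b. F a b)) \<partial>M)
    = K2 F + intensity ^ 2 * (\<integral>\<^sup>+a. \<integral>\<^sup>+b. F a b \<partial>lborel \<partial>lborel)"
proof -
  have [measurable (raw)]: "(\<lambda>p. F (a p) (b p)) \<in> borel_measurable N"
    if "a \<in> borel_measurable N" "b \<in> borel_measurable N" for N :: "'n measure" and a b
    using measurable_compose[of "\<lambda>p. (a p, b p)" N _ _ borel, OF _ F] that by simp
  have "points_integral w (\<lambda>a. points_integral w (\<lambda>b. F a b)) = total w (\<lambda>a. total w (\<lambda>b. F a b))" if w: "good w" for w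
    using good_space[OF w] by (simp add: good_total[OF w])
  then have "(\<integral>\<^sup>+w. points_integral w (\<lambda>a. points_integral w (\<lambda>b. F a b)) \<partial>M) = (\<integral>\<^sup>+w. total w (\<lambda>a. total w (\<lambda>b. F a b)) \<partial>M)"
    using AE_good by (intro nn_integral_cong_AE) auto
  then show ?thesis by (simp add: expectation_total2[OF F])
qed

lemma expectation_points3:
  assumes F: "(\<lambda>(a, b, c). F a b c) \<in> borel_measurable (borel \<Otimes>\<^sub>M borel \<Otimes>\<^sub>M borel)"
  shows "(\<integral>\<^sup>+w. points_integral w (\<lambda>a. points_integral w (\<lambda>b. points_integral w (\<lambda>c. F a b c))) \<partial>M)
    = K3 F + K2 (\<lambda>a b. intensity * (\<integral>\<^sup>+c. F a b c \<partial>lborel))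
      + K2 (\<lambda>a b. intensity * (\<integral>\<^sup>+c. F a c b \<partial>lborel))
      + K2 (\<lambda>a b. intensity * (\<integral>\<^sup>+c. F c a b \<partial>lborel))
      + intensity ^ 3 * (\<integral>\<^sup>+a. \<integral>\<^sup>+b. \<integral>\<^sup>+c. F a b c \<partial>lborel \<partial>lborel \<partial>lborel)"
proof -
  have [measurable (raw)]: "(\<lambda>p. F (a p) (b p) (c p)) \<in> borel_measurable N"
    if "a \<in> borel_measurable N" "b \<in> borel_measurable N" "c \<in> borel_measurable N" for N :: "'n measure" and a b c
    using measurable_compose[of "\<lambda>p. (a p, b p, c p)" N _ _ borel, OF _ F] that by simp
  have "points_integral w (\<lambda>a. points_integral w (\<lambda>b. points_integral w (\<lambda>c. F a b c)))
      = total w (\<lambda>a. total w (\<lambda>b. total w (\<lambda>c. F a b c)))" if w: "good w" for w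
    using good_space[OF w] by (simp add: good_total[OF w])
  then have "(\<integral>\<^sup>+w. points_integral w (\<lambda>a. points_integral w (\<lambda>b. points_integral w (\<lambda>c. F a b c))) \<partial>M)
      = (\<integral>\<^sup>+w. total w (\<lambda>a. total w (\<lambda>b. total w (\<lambda>c. F a b c))) \<partial>M)"
    using AE_good by (intro nn_integral_cong_AE) auto
  then show ?thesis by (simp add: expectation_total3[OF F])
qed

end

section \<open>Left derivatives of the generating functional\<close>

lemma left_derivative_unique:
  assumes "(f has_real_derivative a) (at 0 within {..0})" "(f has_real_derivative b) (at 0 within {..0})"
  shows "a = b"
proof (rule tendsto_unique)
  show "at 0 within {..0::real} \<noteq> bot"
    by (simp add: at_within_Iic_at_left)
qed (use assms in \<open>simp_all add: has_field_derivative_iff\<close>)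

lemma left_derivative_cong:
  assumes "(f has_real_derivative a) (at 0 within {..0})" "0 < d" "\<And>s. s \<in> {-d<..0} \<Longrightarrow> f s = g s"
  shows "(g has_real_derivative a) (at 0 within {..0})"
  using assms by (intro has_field_derivative_transform_within[OF assms(1,2)]) (auto simp: dist_real_def)

text \<open>The intermediate derivatives are existentially quantified, so uniqueness is carried
  through both of them on the smaller of the two ranges. This makes a computed derivative comparable
  with the value that defines the cumulant measure.\<close>

lemma has_mixed_left_derivative3_unique:
  assumes "has_mixed_left_derivative3 \<Phi> L" "has_mixed_left_derivative3 \<Phi> L'"
  shows "L = L'"
proof -
  from assms(1) obtain d D2 D1 where d: "d > 0"
    and D2: "\<And>s0 s1. s0 \<in> {-d<..0} \<Longrightarrow> s1 \<in> {-d<..0} \<Longrightarrow> (\<Phi> s0 s1 has_real_derivative D2 s0 s1) (at 0 within {..0})"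
    and D1: "\<And>s0. s0 \<in> {-d<..0} \<Longrightarrow> (D2 s0 has_real_derivative D1 s0) (at 0 within {..0})"
    and L: "(D1 has_real_derivative L) (at 0 within {..0})"
    unfolding has_mixed_left_derivative3_def by blast
  from assms(2) obtain e E2 E1 where e: "e > 0"
    and E2: "\<And>s0 s1. s0 \<in> {-e<..0} \<Longrightarrow> s1 \<in> {-e<..0} \<Longrightarrow> (\<Phi> s0 s1 has_real_derivative E2 s0 s1) (at 0 within {..0})"
    and E1: "\<And>s0. s0 \<in> {-e<..0} \<Longrightarrow> (E2 s0 has_real_derivative E1 s0) (at 0 within {..0})"
    and L': "(E1 has_real_derivative L') (at 0 within {..0})"
    unfolding has_mixed_left_derivative3_def by blast
  let ?m = "min d e"
  have m: "?m > 0" using d e by simp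
  have eq2: "D2 s0 s1 = E2 s0 s1" if "s0 \<in> {-?m<..0}" "s1 \<in> {-?m<..0}" for s0 s1
    using that by (intro left_derivative_unique[OF D2 E2]) auto
  have eq1: "D1 s0 = E1 s0" if "s0 \<in> {-?m<..0}" for s0
  proof (rule left_derivative_unique)
    show "(D2 s0 has_real_derivative E1 s0) (at 0 within {..0})"
      by (rule left_derivative_cong[OF E1 m]) (use that eq2 in auto)
  qed (use D1 that in auto)
  have "(D1 has_real_derivative L') (at 0 within {..0})"
    by (rule left_derivative_cong[OF L' m]) (use eq1 in auto)
  with L show ?thesis by (rule left_derivative_unique)
qed

lemma has_real_derivative_prod_affine:
  fixes h f :: "'a \<Rightarrow> real"
  assumes "finite P"
  shows "((\<lambda>s. \<Prod>x\<in>P. 1 + h x + s * f x) has_real_derivative (\<Sum>x\<in>P. f x * (\<Prod>y\<in>P - {x}. 1 + h y))) (at 0 within S)"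
  using assms
proof induction
  case (insert x P)
  have "(\<Sum>y\<in>insert x P. f y * (\<Prod>z\<in>insert x P - {y}. 1 + h z))
      = f x * (\<Prod>z\<in>P. 1 + h z) + (1 + h x) * (\<Sum>y\<in>P. f y * (\<Prod>z\<in>P - {y}. 1 + h z))"
  proof -
    have "(\<Prod>z\<in>insert x P - {y}. 1 + h z) = (1 + h x) * (\<Prod>z\<in>P - {y}. 1 + h z)" if "y \<in> P" for y
      using insert that by (subst insert_Diff_if) auto
    then show ?thesis using insert by (simp add: sum_distrib_left mult_ac)
  qed
  moreover have "((\<lambda>s. (1 + h x + s * f x) * (\<Prod>y\<in>P. 1 + h y + s * f y)) has_real_derivative
      f x * (\<Prod>y\<in>P. 1 + h y + 0 * f y) + (\<Sum>y\<in>P. f y * (\<Prod>z\<in>P - {y}. 1 + h z)) * (1 + h x + 0 * f x)) (at 0 within S)"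
    by (intro DERIV_mult insert.IH) (auto intro!: derivative_eq_intros)
  ultimately show ?case using insert by (simp add: mult.commute)
qed simp

text \<open>All factors lie in \<open>[0, 1]\<close>, where a product changes by at most the sum of
  the changes of its factors.\<close>

lemma prod_affine_Lipschitz:
  fixes h f :: "'a \<Rightarrow> real"
  assumes "\<And>x. x \<in> P \<Longrightarrow> 0 \<le> 1 + h x \<and> h x \<le> 0" "\<And>x. x \<in> P \<Longrightarrow> 0 \<le> 1 + h x + s * f x" "s \<le> 0" "\<And>x. x \<in> P \<Longrightarrow> 0 \<le> f x"
  shows "\<bar>(\<Prod>x\<in>P. 1 + h x + s * f x) - (\<Prod>x\<in>P. 1 + h x)\<bar> \<le> - s * (\<Sum>x\<in>P. f x)"
proof -
  have sf: "s * f x \<le> 0" if "x \<in> P" for x using assms(3,4) that by (simp add: mult_nonpos_nonneg)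
  have "norm ((\<Prod>x\<in>P. 1 + h x + s * f x) - (\<Prod>x\<in>P. 1 + h x)) \<le> (\<Sum>x\<in>P. norm ((1 + h x + s * f x) - (1 + h x)))"
    by (intro norm_prod_diff) (use assms sf in \<open>force+\<close>)
  also have "\<dots> = - s * (\<Sum>x\<in>P. f x)"
    unfolding sum_distrib_left by (intro sum.cong) (use assms sf in \<open>auto simp: abs_of_nonpos\<close>)
  finally show ?thesis by simp
qed

text \<open>Differentiation under the expectation at the single point 0. A bound linear in
  \<open>s\<close> with integrable slope \<open>W\<close> dominates the difference quotients, so no
  derivative away from 0 is needed.\<close>

lemma (in prob_space) expectation_left_derivative:
  fixes X :: "real \<Rightarrow> 'a \<Rightarrow> real"
  assumes d: "0 < d"
    and X: "\<And>s. s \<in> {-d<..0} \<Longrightarrow> X s \<in> borel_measurable M"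
    and X0: "integrable M (X 0)" and W: "integrable M W"
    and bound: "\<And>s w. s \<in> {-d<..0} \<Longrightarrow> w \<in> space M \<Longrightarrow> \<bar>X s w - X 0 w\<bar> \<le> - s * W w"
    and deriv: "\<And>w. w \<in> space M \<Longrightarrow> ((\<lambda>s. X s w) has_real_derivative Y w) (at 0 within {..0})"
  shows "Y \<in> borel_measurable M" "integrable M Y"
    and "((\<lambda>s. expectation (X s)) has_real_derivative expectation Y) (at 0 within {..0})"
proof -
  have X0m: "X 0 \<in> borel_measurable M" using X0 by auto
  have q: "(\<lambda>n. (X (S n) w - X 0 w) / S n) \<longlonglongrightarrow> Y w"
    if "w \<in> space M" "\<And>n. S n \<in> {-d<..0} - {0}" "S \<longlonglongrightarrow> 0" for S w
    using deriv[OF that(1)] that(2,3) unfolding has_field_derivative_iff tendsto_at_iff_sequentially comp_def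
    by (elim allE[of _ S]) auto
  have qm: "(\<lambda>w. (X s w - X 0 w) / s) \<in> borel_measurable M" if "s \<in> {-d<..0}" for s
    using X[OF that] X0m by measurable
  have qb: "\<bar>(X s w - X 0 w) / s\<bar> \<le> W w" if "s \<in> {-d<..0} - {0}" "w \<in> space M" for s w
  proof -
    have "\<bar>X s w - X 0 w\<bar> \<le> W w * \<bar>s\<bar>"
      using bound[of s w] that by (simp add: abs_of_neg mult.commute)
    moreover have "0 < \<bar>s\<bar>" using that by simp
    ultimately show ?thesis by (simp only: abs_divide pos_divide_le_eq)
  qed
  \<comment> \<open>Any sequence approaching 0 from the left serves to obtain measurability and
    integrability of \<open>Y\<close>; the offset 2 keeps all its members strictly above
    \<open>- d\<close>.\<close>
  define R where "R n = - d / real (n + 2)" for n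
  have R: "R n \<in> {-d<..0} - {0}" for n
  proof -
    have "d * 1 < d * real (n + 2)" using d by (intro mult_strict_left_mono) auto
    then have "d / real (n + 2) < d" by (subst pos_divide_less_eq) simp_all
    then show ?thesis using d by (simp add: R_def)
  qed
  have "R \<longlonglongrightarrow> 0" unfolding R_def
    using LIMSEQ_ignore_initial_segment[OF lim_const_over_n[of "- d"], of 2] by simp
  note R0 = this
  show Ym: "Y \<in> borel_measurable M"
  proof (rule borel_measurable_LIMSEQ_real)
    show "(\<lambda>n. (X (R n) w - X 0 w) / R n) \<longlonglongrightarrow> Y w" if "w \<in> space M" for w
      by (rule q[OF that R R0])
    show "(\<lambda>w. (X (R n) w - X 0 w) / R n) \<in> borel_measurable M" for n
      using R[of n] by (intro qm) simp
  qed
  have lim: "(\<lambda>n. expectation (\<lambda>w. (X (S n) w - X 0 w) / S n)) \<longlonglongrightarrow> expectation Y" "integrable M Y"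
    if S: "\<And>n. S n \<in> {-d<..0} - {0}" "S \<longlonglongrightarrow> 0" for S
  proof -
    have m: "(\<lambda>w. (X (S n) w - X 0 w) / S n) \<in> borel_measurable M" for n
      using S(1)[of n] by (intro qm) simp
    have l: "AE w in M. (\<lambda>n. (X (S n) w - X 0 w) / S n) \<longlonglongrightarrow> Y w"
      by (rule AE_I2) (rule q[OF _ S])
    have b: "AE w in M. norm ((X (S n) w - X 0 w) / S n) \<le> W w" for n
      unfolding real_norm_def using S(1) by (intro AE_I2 qb)
    show "(\<lambda>n. expectation (\<lambda>w. (X (S n) w - X 0 w) / S n)) \<longlonglongrightarrow> expectation Y"
      by (rule integral_dominated_convergence[OF Ym m W l b])
    show "integrable M Y"
      by (rule integrable_dominated_convergence[OF Ym m W l b])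
  qed
  then show "integrable M Y" using R R0 by blast
  have int: "integrable M (X s)" if "s \<in> {-d<..0}" for s
  proof (rule Bochner_Integration.integrable_bound)
    show "integrable M (\<lambda>w. \<bar>X 0 w\<bar> + - s * W w)" using X0 W by auto
    show "AE w in M. norm (X s w) \<le> norm (\<bar>X 0 w\<bar> + - s * W w)"
      using bound[OF that] by (intro AE_I2) (smt (verit) real_norm_def)
  qed (use X that in auto)
  show "((\<lambda>s. expectation (X s)) has_real_derivative expectation Y) (at 0 within {..0})"
    unfolding has_field_derivative_iff tendsto_at_iff_sequentially comp_def
  proof (intro allI impI)
    fix S :: "nat \<Rightarrow> real" assume S: "\<forall>i. S i \<in> {..0} - {0}" "S \<longlonglongrightarrow> 0"
    then have "eventually (\<lambda>n. S n > - d) sequentially" using d by (intro order_tendstoD(1)) auto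
    then obtain n0 where n0: "\<And>n. n \<ge> n0 \<Longrightarrow> S n > - d" by (auto simp: eventually_sequentially)
    \<comment> \<open>The bound is available only above \<open>- d\<close>, so an initial segment of
      the given sequence is dropped and restored at the end by \<open>LIMSEQ_offset\<close>.\<close>
    let ?S = "\<lambda>n. S (n + n0)"
    have S': "?S n \<in> {-d<..0} - {0}" for n using S(1) n0 by auto
    have "(expectation (X (?S n)) - expectation (X 0)) / (?S n - 0) = expectation (\<lambda>w. (X (?S n) w - X 0 w) / ?S n)" for n
      using int[of "?S n"] X0 S'[of n] by simp
    moreover have "(\<lambda>n. expectation (\<lambda>w. (X (?S n) w - X 0 w) / ?S n)) \<longlonglongrightarrow> expectation Y"
      by (rule lim(1)[of ?S, OF S' LIMSEQ_ignore_initial_segment[OF S(2)]])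
    ultimately have "(\<lambda>n. (expectation (X (?S n)) - expectation (X 0)) / (?S n - 0)) \<longlonglongrightarrow> expectation Y"
      by (simp only:)
    then show "(\<lambda>n. (expectation (X (S n)) - expectation (X 0)) / (S n - 0)) \<longlonglongrightarrow> expectation Y"
      by (rule LIMSEQ_offset)
  qed
qed

section \<open>Sums and products over the points in a bounded set\<close>

context cluster_points
begin

text \<open>Empty for infinitely many points, to match the junk value \<open>0\<close> of sums over infinite sets.\<close>

definition pts_in :: "real set \<Rightarrow> 'w \<Rightarrow> real set" where
  "pts_in B w = (if finite (points (N w) \<inter> B) then points (N w) \<inter> B else {})"

lemma finite_pts_in [simp]: "finite (pts_in B w)"
  by (simp add: pts_in_def)

lemma pred_finite_points [measurable]:
  assumes [measurable]: "B \<in> sets borel"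
  shows "Measurable.pred M (\<lambda>w. finite (points (N w) \<inter> B))"
  unfolding points_integral_indicator_finite_iff[symmetric] by measurable

lemma AE_finite_points: "bounded B \<Longrightarrow> AE w in M. finite (points (N w) \<inter> B)"
  using AE_good by eventually_elim (rule good_finite)

text \<open>The finite sum is read off from \<open>points_integral\<close>, whose measurability is
  known; where the set is infinite, the empty \<open>pts_in\<close> gives zero on both
  sides.\<close>

lemma sum1_pts_in:
  fixes f :: "real \<Rightarrow> real"
  assumes [measurable]: "B \<in> sets borel" "f \<in> borel_measurable borel" and f: "\<And>a. 0 \<le> f a" "\<And>a. a \<notin> B \<Longrightarrow> f a = 0"
  shows "(\<lambda>w. \<Sum>a\<in>pts_in B w. f a) \<in> borel_measurable M"
    and "finite (points (N w) \<inter> B) \<Longrightarrow> ennreal (\<Sum>a\<in>pts_in B w. f a) = points_integral w (\<lambda>a. ennreal (f a))"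
proof -
  have *: "ennreal (\<Sum>a\<in>pts_in B w. f a) = points_integral w (\<lambda>a. ennreal (f a))" if "finite (points (N w) \<inter> B)" for w
    using that f by (subst points_integral_sum[OF that]) (auto simp: pts_in_def)
  then show "finite (points (N w) \<inter> B) \<Longrightarrow> ennreal (\<Sum>a\<in>pts_in B w. f a) = points_integral w (\<lambda>a. ennreal (f a))" .
  have "(\<lambda>w. \<Sum>a\<in>pts_in B w. f a) = (\<lambda>w. if finite (points (N w) \<inter> B) then enn2real (points_integral w (\<lambda>a. ennreal (f a))) else 0)"
    using f(1) by (auto simp: fun_eq_iff *[symmetric] sum_nonneg) (simp add: pts_in_def)
  then show "(\<lambda>w. \<Sum>a\<in>pts_in B w. f a) \<in> borel_measurable M" by simp
qed

lemma sum2_pts_in: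
  fixes F :: "real \<Rightarrow> real \<Rightarrow> real"
  assumes B [measurable]: "B \<in> sets borel" and F: "(\<lambda>(a, b). F a b) \<in> borel_measurable (borel \<Otimes>\<^sub>M borel)"
    and pos: "\<And>a b. 0 \<le> F a b" and supp: "\<And>a b. a \<notin> B \<or> b \<notin> B \<Longrightarrow> F a b = 0"
  shows "(\<lambda>w. \<Sum>a\<in>pts_in B w. \<Sum>b\<in>pts_in B w. F a b) \<in> borel_measurable M"
    and "finite (points (N w) \<inter> B) \<Longrightarrow> ennreal (\<Sum>a\<in>pts_in B w. \<Sum>b\<in>pts_in B w. F a b)
      = points_integral w (\<lambda>a. points_integral w (\<lambda>b. ennreal (F a b)))"
proof -
  have [measurable (raw)]: "(\<lambda>p. F (a p) (b p)) \<in> borel_measurable N"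
    if "a \<in> borel_measurable N" "b \<in> borel_measurable N" for N :: "'n measure" and a b
    using measurable_compose[of "\<lambda>p. (a p, b p)" N _ _ borel, OF _ F] that by simp
  have *: "ennreal (\<Sum>a\<in>pts_in B w. \<Sum>b\<in>pts_in B w. F a b) = points_integral w (\<lambda>a. points_integral w (\<lambda>b. ennreal (F a b)))"
    if fin: "finite (points (N w) \<inter> B)" for w
  proof -
    have "points_integral w (\<lambda>b. ennreal (F a b)) = (\<Sum>b\<in>pts_in B w. ennreal (F a b))" for a
      using fin supp by (subst points_integral_sum[OF fin]) (auto simp: pts_in_def)
    then have "points_integral w (\<lambda>a. points_integral w (\<lambda>b. ennreal (F a b))) = (\<Sum>a\<in>pts_in B w. \<Sum>b\<in>pts_in B w. ennreal (F a b))"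
      using fin supp by (simp, subst points_integral_sum[OF fin]) (auto simp: pts_in_def)
    then show ?thesis using pos by (simp add: sum_nonneg)
  qed
  then show "finite (points (N w) \<inter> B) \<Longrightarrow> ennreal (\<Sum>a\<in>pts_in B w. \<Sum>b\<in>pts_in B w. F a b)
      = points_integral w (\<lambda>a. points_integral w (\<lambda>b. ennreal (F a b)))" .
  have "(\<lambda>w. \<Sum>a\<in>pts_in B w. \<Sum>b\<in>pts_in B w. F a b)
      = (\<lambda>w. if finite (points (N w) \<inter> B) then enn2real (points_integral w (\<lambda>a. points_integral w (\<lambda>b. ennreal (F a b)))) else 0)"
    using pos by (auto simp: fun_eq_iff *[symmetric] sum_nonneg) (simp add: pts_in_def)
  then show "(\<lambda>w. \<Sum>a\<in>pts_in B w. \<Sum>b\<in>pts_in B w. F a b) \<in> borel_measurable M" by simp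
qed

lemma sum3_pts_in:
  fixes F :: "real \<Rightarrow> real \<Rightarrow> real \<Rightarrow> real"
  assumes B [measurable]: "B \<in> sets borel" and F: "(\<lambda>(a, b, c). F a b c) \<in> borel_measurable (borel \<Otimes>\<^sub>M borel \<Otimes>\<^sub>M borel)"
    and pos: "\<And>a b c. 0 \<le> F a b c" and supp: "\<And>a b c. a \<notin> B \<or> b \<notin> B \<or> c \<notin> B \<Longrightarrow> F a b c = 0"
  shows "(\<lambda>w. \<Sum>a\<in>pts_in B w. \<Sum>b\<in>pts_in B w. \<Sum>c\<in>pts_in B w. F a b c) \<in> borel_measurable M"
    and "finite (points (N w) \<inter> B) \<Longrightarrow> ennreal (\<Sum>a\<in>pts_in B w. \<Sum>b\<in>pts_in B w. \<Sum>c\<in>pts_in B w. F a b c)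
      = points_integral w (\<lambda>a. points_integral w (\<lambda>b. points_integral w (\<lambda>c. ennreal (F a b c))))"
proof -
  have [measurable (raw)]: "(\<lambda>p. F (a p) (b p) (c p)) \<in> borel_measurable N"
    if "a \<in> borel_measurable N" "b \<in> borel_measurable N" "c \<in> borel_measurable N" for N :: "'n measure" and a b c
    using measurable_compose[of "\<lambda>p. (a p, b p, c p)" N _ _ borel, OF _ F] that by simp
  have *: "ennreal (\<Sum>a\<in>pts_in B w. \<Sum>b\<in>pts_in B w. \<Sum>c\<in>pts_in B w. F a b c)
      = points_integral w (\<lambda>a. points_integral w (\<lambda>b. points_integral w (\<lambda>c. ennreal (F a b c))))"
    if fin: "finite (points (N w) \<inter> B)" for w
  proof -
    have 1: "points_integral w (\<lambda>c. ennreal (F a b c)) = (\<Sum>c\<in>pts_in B w. ennreal (F a b c))" for a b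
      using fin supp by (subst points_integral_sum[OF fin]) (auto simp: pts_in_def)
    have 2: "points_integral w (\<lambda>b. \<Sum>c\<in>pts_in B w. ennreal (F a b c)) = (\<Sum>b\<in>pts_in B w. \<Sum>c\<in>pts_in B w. ennreal (F a b c))" for a
      using fin supp by (subst points_integral_sum[OF fin]) (auto simp: pts_in_def)
    have "points_integral w (\<lambda>a. points_integral w (\<lambda>b. points_integral w (\<lambda>c. ennreal (F a b c))))
        = (\<Sum>a\<in>pts_in B w. \<Sum>b\<in>pts_in B w. \<Sum>c\<in>pts_in B w. ennreal (F a b c))"
      unfolding 1 2 using fin supp by (subst points_integral_sum[OF fin]) (auto simp: pts_in_def)
    then show ?thesis using pos by (simp add: sum_nonneg)
  qed
  then show "finite (points (N w) \<inter> B) \<Longrightarrow> ennreal (\<Sum>a\<in>pts_in B w. \<Sum>b\<in>pts_in B w. \<Sum>c\<in>pts_in B w. F a b c)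
      = points_integral w (\<lambda>a. points_integral w (\<lambda>b. points_integral w (\<lambda>c. ennreal (F a b c))))" .
  have "(\<lambda>w. \<Sum>a\<in>pts_in B w. \<Sum>b\<in>pts_in B w. \<Sum>c\<in>pts_in B w. F a b c)
      = (\<lambda>w. if finite (points (N w) \<inter> B) then enn2real (points_integral w (\<lambda>a. points_integral w (\<lambda>b. points_integral w (\<lambda>c. ennreal (F a b c))))) else 0)"
    using pos by (auto simp: fun_eq_iff *[symmetric] sum_nonneg) (simp add: pts_in_def)
  then show "(\<lambda>w. \<Sum>a\<in>pts_in B w. \<Sum>b\<in>pts_in B w. \<Sum>c\<in>pts_in B w. F a b c) \<in> borel_measurable M" by simp
qed

text \<open>Positive factors allow the product to be written as the exponential of a sum of
  logarithms. These are nonpositive, so the negated sum is covered by the measurability of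
  nonnegative sums.\<close>

lemma prod_pts_in_measurable:
  fixes h :: "real \<Rightarrow> real"
  assumes [measurable]: "B \<in> sets borel" "h \<in> borel_measurable borel" and h: "\<And>a. - 1 < h a \<and> h a \<le> 0" "\<And>a. a \<notin> B \<Longrightarrow> h a = 0"
  shows "(\<lambda>w. \<Prod>a\<in>pts_in B w. 1 + h a) \<in> borel_measurable M"
proof -
  have "(\<Prod>a\<in>pts_in B w. 1 + h a) = exp (- (\<Sum>a\<in>pts_in B w. - ln (1 + h a)))" for w
  proof -
    have "exp (ln (1 + h a)) = 1 + h a" for a using h(1)[of a] by (intro exp_ln) simp
    then show ?thesis by (simp only: sum_negf minus_minus exp_sum[OF finite_pts_in])
  qed
  moreover have "(\<lambda>w. \<Sum>a\<in>pts_in B w. - ln (1 + h a)) \<in> borel_measurable M"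
  proof (rule sum1_pts_in)
    show "0 \<le> - ln (1 + h a)" for a
      using h(1)[of a] ln_le_minus_one[of "1 + h a"] by simp
  qed (use h in auto)
  ultimately show ?thesis by simp
qed

end

section \<open>Derivatives of a finite product\<close>

definition off2 :: "(real \<Rightarrow> real) \<Rightarrow> (real \<Rightarrow> real) \<Rightarrow> real \<Rightarrow> real \<Rightarrow> real" where
  "off2 f g a b = (if a = b then 0 else f a * g b)"

definition off3 :: "(real \<Rightarrow> real) \<Rightarrow> (real \<Rightarrow> real) \<Rightarrow> (real \<Rightarrow> real) \<Rightarrow> real \<Rightarrow> real \<Rightarrow> real \<Rightarrow> real" where
  "off3 f g h a b c = (if a = b \<or> a = c \<or> b = c then 0 else f a * g b * h c)"

definition prod1 :: "(real \<Rightarrow> real) \<Rightarrow> real set \<Rightarrow> real" where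
  "prod1 h P = (\<Prod>x\<in>P. 1 + h x)"

text \<open>Each factor is affine, so differentiating in the direction \<open>f\<close> deletes the
  factor of one point and multiplies by \<open>f\<close> there. A deleted point cannot be chosen
  again; this is how sums over distinct points, and thus factorial moments, arise from the
  product.\<close>

definition prod_d1 :: "(real \<Rightarrow> real) \<Rightarrow> (real \<Rightarrow> real) \<Rightarrow> real set \<Rightarrow> real" where
  "prod_d1 f h P = (\<Sum>x\<in>P. f x * prod1 h (P - {x}))"

definition prod_d2 :: "(real \<Rightarrow> real) \<Rightarrow> (real \<Rightarrow> real) \<Rightarrow> (real \<Rightarrow> real) \<Rightarrow> real set \<Rightarrow> real" where
  "prod_d2 f g h P = (\<Sum>x\<in>P. f x * prod_d1 g h (P - {x}))"

definition prod_d3 :: "(real \<Rightarrow> real) \<Rightarrow> (real \<Rightarrow> real) \<Rightarrow> (real \<Rightarrow> real) \<Rightarrow> (real \<Rightarrow> real) \<Rightarrow> real set \<Rightarrow> real" where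
  "prod_d3 f g k h P = (\<Sum>x\<in>P. f x * prod_d2 g k h (P - {x}))"

lemma prod1_0 [simp]: "prod1 (\<lambda>_. 0) P = 1"
  by (simp add: prod1_def)

lemma prod_d1_0: "prod_d1 f (\<lambda>_. 0) P = (\<Sum>x\<in>P. f x)"
  by (simp add: prod_d1_def)

lemma prod_d2_0: "finite P \<Longrightarrow> prod_d2 f g (\<lambda>_. 0) P = (\<Sum>a\<in>P. \<Sum>b\<in>P. off2 f g a b)"
proof -
  assume P: "finite P"
  have "f a * (\<Sum>b\<in>P - {a}. g b) = (\<Sum>b\<in>P. off2 f g a b)" if "a \<in> P" for a
    using P that by (simp add: sum.remove[of P a] off2_def sum_distrib_left)
  then show ?thesis by (simp add: prod_d2_def prod_d1_0)
qed

lemma prod_d3_0: "finite P \<Longrightarrow> prod_d3 f g k (\<lambda>_. 0) P = (\<Sum>a\<in>P. \<Sum>b\<in>P. \<Sum>c\<in>P. off3 f g k a b c)"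
proof -
  assume P: "finite P"
  have "f a * prod_d2 g k (\<lambda>_. 0) (P - {a}) = (\<Sum>b\<in>P. \<Sum>c\<in>P. off3 f g k a b c)" if a: "a \<in> P" for a
  proof -
    have "f a * off2 g k b c = off3 f g k a b c" if "b \<noteq> a" "c \<noteq> a" for b c
      using that by (simp add: off2_def off3_def)
    then have "f a * prod_d2 g k (\<lambda>_. 0) (P - {a}) = (\<Sum>b\<in>P - {a}. \<Sum>c\<in>P - {a}. off3 f g k a b c)"
      using P by (auto simp: prod_d2_0 sum_distrib_left intro!: sum.cong)
    also have "\<dots> = (\<Sum>b\<in>P - {a}. \<Sum>c\<in>P. off3 f g k a b c)"
      using P a by (intro sum.cong refl sum.mono_neutral_left) (auto simp: off3_def)
    also have "\<dots> = (\<Sum>b\<in>P. \<Sum>c\<in>P. off3 f g k a b c)"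
      using P a by (intro sum.mono_neutral_left) (auto simp: off3_def)
    finally show ?thesis .
  qed
  then show ?thesis by (simp add: prod_d3_def)
qed

lemma prod1_bounds:
  assumes "\<And>x. - 1 < h x \<and> h x \<le> (0::real)"
  shows "0 < prod1 h P" "prod1 h P \<le> 1"
proof -
  have h: "0 < 1 + h x" "1 + h x \<le> 1" for x using assms[of x] by simp_all
  show "0 < prod1 h P" unfolding prod1_def by (intro prod_pos) (use h in blast)
  show "prod1 h P \<le> 1" unfolding prod1_def by (intro prod_le_1) (use h less_imp_le in blast)
qed

text \<open>Removing a point means dividing by its nonzero factor. The derivatives thereby become a
  product times sums over all of \<open>P\<close> with weights \<open>f x / (1 + h x)\<close>, a
  form in which they are measurable.\<close>

lemma prod1_remove:
  assumes "finite P" "x \<in> P" "\<And>x. - 1 < h x"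
  shows "prod1 h (P - {x}) = prod1 h P / (1 + h x)"
proof -
  have "1 + h x \<noteq> 0" using assms(3)[of x] by linarith
  then show ?thesis using assms(1,2) by (simp add: prod1_def prod.remove[of P x])
qed

lemma prod_d1_eq:
  assumes "finite P" "\<And>x. - 1 < h x"
  shows "prod_d1 f h P = prod1 h P * (\<Sum>x\<in>P. f x / (1 + h x))"
  using assms by (simp add: prod_d1_def prod1_remove sum_distrib_left mult.commute)

lemma prod_d2_eq:
  assumes P: "finite P" and h: "\<And>x. - 1 < h x"
  shows "prod_d2 f g h P = prod1 h P * (\<Sum>a\<in>P. \<Sum>b\<in>P. off2 (\<lambda>x. f x / (1 + h x)) (\<lambda>x. g x / (1 + h x)) a b)"
proof -
  have "prod_d2 f g h P = (\<Sum>x\<in>P. f x * (prod1 h P / (1 + h x) * (\<Sum>y\<in>P - {x}. g y / (1 + h y))))"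
    using P h by (simp add: prod_d2_def prod_d1_eq prod1_remove)
  also have "\<dots> = prod1 h P * prod_d2 (\<lambda>x. f x / (1 + h x)) (\<lambda>x. g x / (1 + h x)) (\<lambda>_. 0) P"
    by (simp add: prod_d2_def prod_d1_0 sum_distrib_left mult_ac)
  finally show ?thesis using P by (simp add: prod_d2_0)
qed

lemma prod1_derivative:
  "finite P \<Longrightarrow> ((\<lambda>s. prod1 (\<lambda>x. h x + s * f x) P) has_real_derivative prod_d1 f h P) (at 0 within {..0})"
  using has_real_derivative_prod_affine[of P h f "{..0}"] by (simp add: prod1_def prod_d1_def add.assoc)

lemma prod_d1_derivative:
  "finite P \<Longrightarrow> ((\<lambda>s. prod_d1 g (\<lambda>x. h x + s * f x) P) has_real_derivative prod_d2 g f h P) (at 0 within {..0})"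
  unfolding prod_d1_def[of g] prod_d2_def by (intro DERIV_sum DERIV_cmult prod1_derivative) auto

lemma prod_d2_derivative:
  "finite P \<Longrightarrow> ((\<lambda>s. prod_d2 g k (\<lambda>x. h x + s * f x) P) has_real_derivative prod_d3 g k f h P) (at 0 within {..0})"
  unfolding prod_d2_def[of g] prod_d3_def by (intro DERIV_sum DERIV_cmult prod_d1_derivative) auto

lemma prod1_Lipschitz:
  assumes "\<And>x. - 1 < h x \<and> h x \<le> 0" "\<And>x. - 1 < h x + s * f x" "s \<le> 0" "\<And>x. 0 \<le> f x"
  shows "\<bar>prod1 (\<lambda>x. h x + s * f x) P - prod1 h P\<bar> \<le> - s * (\<Sum>x\<in>P. f x)"
proof -
  have "0 \<le> 1 + h x \<and> h x \<le> 0" "0 \<le> 1 + h x + s * f x" for x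
    using assms(1)[of x] assms(2)[of x] by linarith+
  then show ?thesis
    using prod_affine_Lipschitz[of P h s f] assms(3,4) by (simp add: prod1_def add.assoc)
qed

lemma sum_diff_Lipschitz:
  fixes g u v B :: "'a \<Rightarrow> real"
  assumes "\<And>x. x \<in> P \<Longrightarrow> 0 \<le> g x" "\<And>x. x \<in> P \<Longrightarrow> \<bar>u x - v x\<bar> \<le> - s * B x"
  shows "\<bar>(\<Sum>x\<in>P. g x * u x) - (\<Sum>x\<in>P. g x * v x)\<bar> \<le> - s * (\<Sum>x\<in>P. g x * B x)"
proof -
  have "\<bar>(\<Sum>x\<in>P. g x * u x) - (\<Sum>x\<in>P. g x * v x)\<bar> = \<bar>\<Sum>x\<in>P. g x * (u x - v x)\<bar>"
    by (simp add: sum_subtractf right_diff_distrib)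
  also have "\<dots> \<le> (\<Sum>x\<in>P. g x * (- s * B x))"
    by (rule sum_abs[THEN order_trans], rule sum_mono)
       (use assms in \<open>simp only: abs_mult abs_of_nonneg mult_left_mono\<close>)
  also have "\<dots> = - s * (\<Sum>x\<in>P. g x * B x)"
    by (simp only: sum_distrib_left mult.left_commute)
  finally show ?thesis .
qed

text \<open>The Lipschitz constant is the factorial sum of the next order at the origin. Starting
  from order two this leads to order three, the last one with finite expectation by
  hypothesis.\<close>

lemma prod_d1_Lipschitz:
  assumes "\<And>x. - 1 < h x \<and> h x \<le> 0" "\<And>x. - 1 < h x + s * f x" "s \<le> 0" "\<And>x. 0 \<le> f x" "\<And>x. 0 \<le> g x"
  shows "\<bar>prod_d1 g (\<lambda>x. h x + s * f x) P - prod_d1 g h P\<bar> \<le> - s * prod_d2 g f (\<lambda>_. 0) P"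
  unfolding prod_d1_def[of g] prod_d2_def prod_d1_0
  by (intro sum_diff_Lipschitz prod1_Lipschitz assms)

lemma prod_d2_Lipschitz:
  assumes "\<And>x. - 1 < h x \<and> h x \<le> 0" "\<And>x. - 1 < h x + s * f x" "s \<le> 0" "\<And>x. 0 \<le> f x" "\<And>x. 0 \<le> g x" "\<And>x. 0 \<le> k x"
  shows "\<bar>prod_d2 g k (\<lambda>x. h x + s * f x) P - prod_d2 g k h P\<bar> \<le> - s * prod_d3 g k f (\<lambda>_. 0) P"
  unfolding prod_d2_def[of g] prod_d3_def
  by (intro sum_diff_Lipschitz prod_d1_Lipschitz assms)

section \<open>Moments and left derivatives of the generating functional\<close>

context cluster_points
begin

lemma K2_cmult:
  assumes F: "(\<lambda>(a, b). F a b) \<in> borel_measurable (borel \<Otimes>\<^sub>M borel)"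
  shows "K2 (\<lambda>a b. k * F a b) = k * K2 F"
proof -
  have [measurable (raw)]: "(\<lambda>p. F (a p) (b p)) \<in> borel_measurable N"
    if "a \<in> borel_measurable N" "b \<in> borel_measurable N" for N :: "'n measure" and a b
    using measurable_compose[of "\<lambda>p. (a p, b p)" N _ _ borel, OF _ F] that by simp
  have "(\<integral>\<^sup>+x. \<integral>\<^sup>+u. shot u x (\<lambda>a. shot u x (\<lambda>b. k * F a b)) \<partial>lborel \<partial>Q)
      = (\<integral>\<^sup>+x. k * (\<integral>\<^sup>+u. shot u x (\<lambda>a. shot u x (\<lambda>b. F a b)) \<partial>lborel) \<partial>Q)"
    by (intro nn_integral_cong) (simp add: shot_cmult nn_integral_cmult)
  also have "\<dots> = k * (\<integral>\<^sup>+x. \<integral>\<^sup>+u. shot u x (\<lambda>a. shot u x (\<lambda>b. F a b)) \<partial>lborel \<partial>Q)"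
    by (rule nn_integral_cmult) measurable
  finally show ?thesis by (simp add: K2_def mult.left_commute)
qed

text \<open>\<open>k2\<close> and \<open>k3\<close> restrict the one-cluster terms to distinct
  points. Passing to reals loses nothing for bounded functions with bounded support, as
  \<open>K2_k2\<close> and \<open>K3_k3\<close> show.\<close>

definition k2 :: "(real \<Rightarrow> real) \<Rightarrow> (real \<Rightarrow> real) \<Rightarrow> real" where
  "k2 f g = enn2real (K2 (\<lambda>a b. ennreal (off2 f g a b)))"

definition k3 :: "(real \<Rightarrow> real) \<Rightarrow> (real \<Rightarrow> real) \<Rightarrow> (real \<Rightarrow> real) \<Rightarrow> real" where
  "k3 f g h = enn2real (K3 (\<lambda>a b c. ennreal (off3 f g h a b c)))"

definition lam :: real where "lam = enn2real intensity"

lemma intensity_lam: "intensity = ennreal lam" "0 \<le> lam"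
  using intensity_finite by (simp_all add: lam_def)

text \<open>One bounded set \<open>B\<close> and one bound \<open>C\<close> serve all test functions
  that enter a cumulant, so that the single finite set \<open>pts_in B w\<close> carries all sums
  and products.\<close>

context
  fixes B :: "real set" and C :: real
  assumes B [measurable]: "B \<in> sets borel" and bdB: "bounded B" and C: "0 < C"
begin

definition tf :: "(real \<Rightarrow> real) \<Rightarrow> bool" where
  "tf f \<longleftrightarrow> f \<in> borel_measurable borel \<and> (\<forall>x. 0 \<le> f x \<and> f x \<le> C) \<and> (\<forall>x. x \<notin> B \<longrightarrow> f x = 0)"

lemma tfD:
  assumes "tf f"
  shows "f \<in> borel_measurable borel" "0 \<le> f x" "f x \<le> C" "x \<notin> B \<Longrightarrow> f x = 0"
  using assms by (auto simp: tf_def)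

lemma finB: "emeasure lborel B < \<infinity>"
  by (rule emeasure_bounded_finite[OF bdB])

lemma tf_integral:
  assumes f: "tf f"
  shows "(\<integral>\<^sup>+x. ennreal (f x) \<partial>lborel) = ennreal (LINT x|lborel. f x)" "0 \<le> (LINT x|lborel. f x)"
proof -
  note [measurable] = tfD(1)[OF f]
  have i: "integrable lborel (\<lambda>x. indicator B x * C)"
    using finB by (intro integrable_mult_left integrable_real_indicator) auto
  have "integrable lborel f"
  proof (rule Bochner_Integration.integrable_bound[OF i])
    show "AE x in lborel. norm (f x) \<le> norm (indicator B x * C)"
    proof (rule AE_I2)
      fix x show "norm (f x) \<le> norm (indicator B x * C)"
        using tfD(2-4)[OF f, of x] C by (cases "x \<in> B") simp_all
    qed
  qed measurable
  then show "(\<integral>\<^sup>+x. ennreal (f x) \<partial>lborel) = ennreal (LINT x|lborel. f x)"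
    using tfD(2)[OF f] by (intro nn_integral_eq_integral) auto
  show "0 \<le> (LINT x|lborel. f x)" using tfD(2)[OF f] by (intro Bochner_Integration.integral_nonneg) auto
qed

lemma off2_measurable:
  assumes [measurable]: "f \<in> borel_measurable borel" "g \<in> borel_measurable borel"
  shows "(\<lambda>(a, b). off2 f g a b) \<in> borel_measurable (borel \<Otimes>\<^sub>M borel)"
  unfolding off2_def case_prod_unfold by measurable

lemma off3_measurable:
  assumes [measurable]: "f \<in> borel_measurable borel" "g \<in> borel_measurable borel" "h \<in> borel_measurable borel"
  shows "(\<lambda>(a, b, c). off3 f g h a b c) \<in> borel_measurable (borel \<Otimes>\<^sub>M borel \<Otimes>\<^sub>M borel)"
  unfolding off3_def case_prod_unfold by measurable

lemma AE_neq: "AE c in lborel. c \<noteq> (a::real)"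
  by (rule AE_lborel_singleton)

lemma off2_nonneg: "tf f \<Longrightarrow> tf g \<Longrightarrow> 0 \<le> off2 f g a b"
  by (simp add: off2_def tfD)

lemma off3_nonneg: "tf f \<Longrightarrow> tf g \<Longrightarrow> tf h \<Longrightarrow> 0 \<le> off3 f g h a b c"
  by (simp add: off3_def tfD)

lemma off2_le: "tf f \<Longrightarrow> tf g \<Longrightarrow> ennreal (off2 f g a b) \<le> ennreal (C * C) * indicator B a"
proof -
  assume f: "tf f" and g: "tf g"
  have "f a * g b \<le> C * C" using tfD[OF f] tfD[OF g] C by (intro mult_mono) auto
  moreover have "0 \<le> f a * g b" using tfD(2)[OF f] tfD(2)[OF g] by simp
  ultimately show ?thesis using tfD(4)[OF f, of a] by (cases "a \<in> B") (simp_all add: off2_def ennreal_leI)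
qed

lemma off3_le: "tf f \<Longrightarrow> tf g \<Longrightarrow> tf h \<Longrightarrow> ennreal (off3 f g h a b c) \<le> ennreal (C * C * C) * indicator B a"
proof -
  assume f: "tf f" and g: "tf g" and h: "tf h"
  have "f a * g b * h c \<le> C * C * C" using tfD[OF f] tfD[OF g] tfD[OF h] C by (intro mult_mono) auto
  moreover have "0 \<le> f a * g b * h c" using tfD(2)[OF f] tfD(2)[OF g] tfD(2)[OF h] by simp
  ultimately show ?thesis using tfD(4)[OF f, of a] by (cases "a \<in> B") (simp_all add: off3_def ennreal_leI)
qed

lemma K2_k2:
  assumes "tf f" "tf g"
  shows "K2 (\<lambda>a b. ennreal (off2 f g a b)) = ennreal (k2 f g)"
proof -
  have "K2 (\<lambda>a b. ennreal (off2 f g a b)) < \<infinity>"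
    by (rule K2_finite[where c = "ennreal (C * C)" and B = B]) (use off2_le[OF assms] finB in auto)
  then show ?thesis by (simp add: k2_def)
qed

lemma K3_k3:
  assumes "tf f" "tf g" "tf h"
  shows "K3 (\<lambda>a b c. ennreal (off3 f g h a b c)) = ennreal (k3 f g h)"
proof -
  have "K3 (\<lambda>a b c. ennreal (off3 f g h a b c)) < \<infinity>"
    by (rule K3_finite[where c = "ennreal (C * C * C)" and B = B]) (use off3_le[OF assms] finB in auto)
  then show ?thesis by (simp add: k3_def)
qed

lemma off2_integral:
  assumes "tf f" "tf g"
  shows "(\<integral>\<^sup>+b. ennreal (off2 f g a b) \<partial>lborel) = ennreal (f a) * ennreal (LINT x|lborel. g x)"
proof -
  note [measurable] = tfD(1)[OF assms(2)]
  have "(\<integral>\<^sup>+b. ennreal (off2 f g a b) \<partial>lborel) = (\<integral>\<^sup>+b. ennreal (f a) * ennreal (g b) \<partial>lborel)"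
    using AE_neq[of a] by (intro nn_integral_cong_AE) (auto simp: off2_def ennreal_mult tfD[OF assms(1)] tfD[OF assms(2)])
  then show ?thesis by (simp add: nn_integral_cmult tf_integral(1)[OF assms(2)])
qed

text \<open>For fixed \<open>a\<close> and \<open>b\<close> the excluded values of \<open>c\<close>
  form a null set. The three equations correspond to the three positions that the point outside the
  pair can take.\<close>

lemma off3_integral:
  assumes f: "tf f" and g: "tf g" and h: "tf h"
  shows "(\<integral>\<^sup>+c. ennreal (off3 f g h a b c) \<partial>lborel) = ennreal (LINT x|lborel. h x) * ennreal (off2 f g a b)"
    and "(\<integral>\<^sup>+c. ennreal (off3 f h g a c b) \<partial>lborel) = ennreal (LINT x|lborel. h x) * ennreal (off2 f g a b)"
    and "(\<integral>\<^sup>+c. ennreal (off3 h f g c a b) \<partial>lborel) = ennreal (LINT x|lborel. h x) * ennreal (off2 f g a b)"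
proof -
  note [measurable] = tfD(1)[OF h]
  have ae: "AE c in lborel. c \<noteq> a \<and> c \<noteq> b" using AE_neq[of a] AE_neq[of b] by eventually_elim auto
  have I: "(\<integral>\<^sup>+c. ennreal (h c) * ennreal (off2 f g a b) \<partial>lborel) = ennreal (LINT x|lborel. h x) * ennreal (off2 f g a b)"
    by (simp add: nn_integral_multc tf_integral(1)[OF h])
  have nn: "0 \<le> f a * g b" using tfD(2)[OF f] tfD(2)[OF g] by simp
  have "ennreal (off3 f g h a b c) = ennreal (h c) * ennreal (off2 f g a b)"
    "ennreal (off3 f h g a c b) = ennreal (h c) * ennreal (off2 f g a b)"
    "ennreal (off3 h f g c a b) = ennreal (h c) * ennreal (off2 f g a b)" if "c \<noteq> a \<and> c \<noteq> b" for c
    using that nn tfD(2)[OF h, of c] by (auto simp: off3_def off2_def ennreal_mult[symmetric] mult_ac)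
  then show "(\<integral>\<^sup>+c. ennreal (off3 f g h a b c) \<partial>lborel) = ennreal (LINT x|lborel. h x) * ennreal (off2 f g a b)"
    "(\<integral>\<^sup>+c. ennreal (off3 f h g a c b) \<partial>lborel) = ennreal (LINT x|lborel. h x) * ennreal (off2 f g a b)"
    "(\<integral>\<^sup>+c. ennreal (off3 h f g c a b) \<partial>lborel) = ennreal (LINT x|lborel. h x) * ennreal (off2 f g a b)"
    unfolding I[symmetric] by (intro nn_integral_cong_AE; use ae in eventually_elim; blast)+
qed

lemma AE_finB: "AE w in M. finite (points (N w) \<inter> B)"
  by (rule AE_finite_points[OF bdB])

lemma moment1:
  assumes f: "tf f"
  shows "has_bochner_integral M (\<lambda>w. prod_d1 f (\<lambda>_. 0) (pts_in B w)) (lam * (LINT x|lborel. f x))"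
proof (rule has_bochner_integral_nn_integral)
  note [measurable] = tfD(1)[OF f]
  note S = sum1_pts_in[OF B tfD(1)[OF f] tfD(2)[OF f] tfD(4)[OF f]]
  show "(\<lambda>w. prod_d1 f (\<lambda>_. 0) (pts_in B w)) \<in> borel_measurable M" unfolding prod_d1_0 by (rule S(1))
  show "AE w in M. 0 \<le> prod_d1 f (\<lambda>_. 0) (pts_in B w)"
    unfolding prod_d1_0 by (intro AE_I2 sum_nonneg tfD(2)[OF f])
  show "0 \<le> lam * (LINT x|lborel. f x)" using tf_integral(2)[OF f] intensity_lam(2) by simp
  have "(\<integral>\<^sup>+w. ennreal (prod_d1 f (\<lambda>_. 0) (pts_in B w)) \<partial>M) = (\<integral>\<^sup>+w. points_integral w (\<lambda>a. ennreal (f a)) \<partial>M)"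
    unfolding prod_d1_0 by (rule nn_integral_cong_AE, rule AE_mp[OF AE_finB], rule AE_I2, rule impI, rule S(2))
  also have "\<dots> = ennreal (lam * (LINT x|lborel. f x))"
    by (subst expectation_points1) (use intensity_lam tf_integral[OF f] in \<open>auto simp: ennreal_mult\<close>)
  finally show "(\<integral>\<^sup>+w. ennreal (prod_d1 f (\<lambda>_. 0) (pts_in B w)) \<partial>M) = ennreal (lam * (LINT x|lborel. f x))" .
qed

lemma moment2:
  assumes f: "tf f" and g: "tf g"
  shows "has_bochner_integral M (\<lambda>w. prod_d2 f g (\<lambda>_. 0) (pts_in B w))
    (k2 f g + lam\<^sup>2 * (LINT x|lborel. f x) * (LINT x|lborel. g x))"
proof (rule has_bochner_integral_nn_integral)
  note [measurable] = tfD(1)[OF f] tfD(1)[OF g]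
  note m = off2_measurable[OF tfD(1)[OF f] tfD(1)[OF g]]
  have supp: "off2 f g a b = 0" if "a \<notin> B \<or> b \<notin> B" for a b using that tfD(4)[OF f] tfD(4)[OF g] by (auto simp: off2_def)
  note S = sum2_pts_in[OF B m off2_nonneg[OF f g] supp]
  note e = prod_d2_0[OF finite_pts_in]
  show "(\<lambda>w. prod_d2 f g (\<lambda>_. 0) (pts_in B w)) \<in> borel_measurable M" unfolding e by (rule S(1))
  show "AE w in M. 0 \<le> prod_d2 f g (\<lambda>_. 0) (pts_in B w)"
    unfolding e by (intro AE_I2 sum_nonneg off2_nonneg[OF f g])
  note nn = tf_integral(2)[OF f] tf_integral(2)[OF g] intensity_lam(2)
  have kn: "0 \<le> k2 f g" by (simp add: k2_def)
  show "0 \<le> k2 f g + lam\<^sup>2 * (LINT x|lborel. f x) * (LINT x|lborel. g x)" using nn kn by simp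
  have "(\<integral>\<^sup>+w. ennreal (prod_d2 f g (\<lambda>_. 0) (pts_in B w)) \<partial>M)
      = (\<integral>\<^sup>+w. points_integral w (\<lambda>a. points_integral w (\<lambda>b. ennreal (off2 f g a b))) \<partial>M)"
    unfolding e by (rule nn_integral_cong_AE, rule AE_mp[OF AE_finB], rule AE_I2, rule impI, rule S(2))
  also have "\<dots> = K2 (\<lambda>a b. ennreal (off2 f g a b)) + intensity ^ 2 * (\<integral>\<^sup>+a. \<integral>\<^sup>+b. ennreal (off2 f g a b) \<partial>lborel \<partial>lborel)"
    by (rule expectation_points2) (use m in measurable)
  also have "(\<integral>\<^sup>+a. \<integral>\<^sup>+b. ennreal (off2 f g a b) \<partial>lborel \<partial>lborel) = ennreal ((LINT x|lborel. f x) * (LINT x|lborel. g x))"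
    using nn by (simp add: off2_integral[OF f g] nn_integral_multc tf_integral(1)[OF f] ennreal_mult)
  also have "K2 (\<lambda>a b. ennreal (off2 f g a b)) + intensity ^ 2 * ennreal ((LINT x|lborel. f x) * (LINT x|lborel. g x))
      = ennreal (k2 f g + lam\<^sup>2 * (LINT x|lborel. f x) * (LINT x|lborel. g x))"
    using nn kn by (simp add: K2_k2[OF f g] intensity_lam(1) ennreal_power ennreal_mult[symmetric] ennreal_plus[symmetric] mult.assoc del: ennreal_plus)
  finally show "(\<integral>\<^sup>+w. ennreal (prod_d2 f g (\<lambda>_. 0) (pts_in B w)) \<partial>M) = \<dots>" .
qed

text \<open>The moment-cumulant relation of order three: the third cumulant, three products of a
  mean with a pair cumulant, and the product of three means.\<close>

lemma moment3:
  assumes f: "tf f" and g: "tf g" and h: "tf h"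
  shows "has_bochner_integral M (\<lambda>w. prod_d3 f g h (\<lambda>_. 0) (pts_in B w))
    (k3 f g h + lam * (LINT x|lborel. h x) * k2 f g + lam * (LINT x|lborel. g x) * k2 f h + lam * (LINT x|lborel. f x) * k2 g h
      + lam ^ 3 * (LINT x|lborel. f x) * (LINT x|lborel. g x) * (LINT x|lborel. h x))" (is "has_bochner_integral M _ ?R")
proof (rule has_bochner_integral_nn_integral)
  note [measurable] = tfD(1)[OF f] tfD(1)[OF g] tfD(1)[OF h]
  note m = off3_measurable[OF tfD(1)[OF f] tfD(1)[OF g] tfD(1)[OF h]]
  have supp: "off3 f g h a b c = 0" if "a \<notin> B \<or> b \<notin> B \<or> c \<notin> B" for a b c
    using that tfD(4)[OF f] tfD(4)[OF g] tfD(4)[OF h] by (auto simp: off3_def)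
  note S = sum3_pts_in[OF B m off3_nonneg[OF f g h] supp]
  note e = prod_d3_0[OF finite_pts_in]
  show "(\<lambda>w. prod_d3 f g h (\<lambda>_. 0) (pts_in B w)) \<in> borel_measurable M" unfolding e by (rule S(1))
  show "AE w in M. 0 \<le> prod_d3 f g h (\<lambda>_. 0) (pts_in B w)"
    unfolding e by (intro AE_I2 sum_nonneg off3_nonneg[OF f g h])
  note nn = tf_integral(2)[OF f] tf_integral(2)[OF g] tf_integral(2)[OF h] intensity_lam(2)
  have kn: "0 \<le> k3 f g h" "0 \<le> k2 f g" "0 \<le> k2 f h" "0 \<le> k2 g h" by (simp_all add: k2_def k3_def)
  show "0 \<le> ?R" using nn kn by simp
  have "(\<integral>\<^sup>+w. ennreal (prod_d3 f g h (\<lambda>_. 0) (pts_in B w)) \<partial>M)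
      = (\<integral>\<^sup>+w. points_integral w (\<lambda>a. points_integral w (\<lambda>b. points_integral w (\<lambda>c. ennreal (off3 f g h a b c)))) \<partial>M)"
    unfolding e by (rule nn_integral_cong_AE, rule AE_mp[OF AE_finB], rule AE_I2, rule impI, rule S(2))
  also have "\<dots> = K3 (\<lambda>a b c. ennreal (off3 f g h a b c))
      + K2 (\<lambda>a b. intensity * (\<integral>\<^sup>+c. ennreal (off3 f g h a b c) \<partial>lborel))
      + K2 (\<lambda>a b. intensity * (\<integral>\<^sup>+c. ennreal (off3 f g h a c b) \<partial>lborel))
      + K2 (\<lambda>a b. intensity * (\<integral>\<^sup>+c. ennreal (off3 f g h c a b) \<partial>lborel))
      + intensity ^ 3 * (\<integral>\<^sup>+a. \<integral>\<^sup>+b. \<integral>\<^sup>+c. ennreal (off3 f g h a b c) \<partial>lborel \<partial>lborel \<partial>lborel)"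
    by (rule expectation_points3) (use measurable_compose[OF m measurable_ennreal] in \<open>simp add: case_prod_unfold\<close>)
  also have "(\<integral>\<^sup>+a. \<integral>\<^sup>+b. \<integral>\<^sup>+c. ennreal (off3 f g h a b c) \<partial>lborel \<partial>lborel \<partial>lborel)
      = ennreal ((LINT x|lborel. f x) * (LINT x|lborel. g x) * (LINT x|lborel. h x))"
  proof -
    have [measurable]: "(\<lambda>b. off2 f g a b) \<in> borel_measurable borel" for a unfolding off2_def by measurable
    have "(\<integral>\<^sup>+a. \<integral>\<^sup>+b. \<integral>\<^sup>+c. ennreal (off3 f g h a b c) \<partial>lborel \<partial>lborel \<partial>lborel)
        = (\<integral>\<^sup>+a. ennreal (LINT x|lborel. h x) * (ennreal (f a) * ennreal (LINT x|lborel. g x)) \<partial>lborel)"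
      by (simp add: off3_integral(1)[OF f g h] nn_integral_cmult off2_integral[OF f g])
    then show ?thesis using nn
      by (simp add: nn_integral_cmult nn_integral_multc tf_integral(1)[OF f] ennreal_mult[symmetric] mult_ac)
  qed
  also have "K2 (\<lambda>a b. intensity * (\<integral>\<^sup>+c. ennreal (off3 f g h a b c) \<partial>lborel)) = ennreal (lam * (LINT x|lborel. h x) * k2 f g)"
    unfolding off3_integral(1)[OF f g h] mult.assoc[symmetric] by (subst K2_cmult) (use off2_measurable nn kn in \<open>auto simp: K2_k2 f g intensity_lam(1) ennreal_mult\<close>)
  also have "K2 (\<lambda>a b. intensity * (\<integral>\<^sup>+c. ennreal (off3 f g h a c b) \<partial>lborel)) = ennreal (lam * (LINT x|lborel. g x) * k2 f h)"
    unfolding off3_integral(2)[OF f h g] mult.assoc[symmetric] by (subst K2_cmult) (use off2_measurable nn kn in \<open>auto simp: K2_k2 f h intensity_lam(1) ennreal_mult\<close>)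
  also have "K2 (\<lambda>a b. intensity * (\<integral>\<^sup>+c. ennreal (off3 f g h c a b) \<partial>lborel)) = ennreal (lam * (LINT x|lborel. f x) * k2 g h)"
    unfolding off3_integral(3)[OF g h f] mult.assoc[symmetric] by (subst K2_cmult) (use off2_measurable nn kn in \<open>auto simp: K2_k2 g h intensity_lam(1) ennreal_mult\<close>)
  also have "K3 (\<lambda>a b c. ennreal (off3 f g h a b c)) + ennreal (lam * (LINT x|lborel. h x) * k2 f g)
      + ennreal (lam * (LINT x|lborel. g x) * k2 f h) + ennreal (lam * (LINT x|lborel. f x) * k2 g h)
      + intensity ^ 3 * ennreal ((LINT x|lborel. f x) * (LINT x|lborel. g x) * (LINT x|lborel. h x)) = ennreal ?R"
    using nn kn by (simp add: K3_k3[OF f g h] intensity_lam(1) ennreal_power ennreal_mult[symmetric] ennreal_plus[symmetric] mult.assoc del: ennreal_plus)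
  finally show "(\<integral>\<^sup>+w. ennreal (prod_d3 f g h (\<lambda>_. 0) (pts_in B w)) \<partial>M) = ennreal ?R" .
qed

definition okh :: "(real \<Rightarrow> real) \<Rightarrow> bool" where
  "okh h \<longleftrightarrow> h \<in> borel_measurable borel \<and> (\<forall>x. - 1 < h x \<and> h x \<le> 0) \<and> (\<forall>x. x \<notin> B \<longrightarrow> h x = 0)"

lemma okhD:
  assumes "okh h"
  shows "h \<in> borel_measurable borel" "- 1 < h x" "h x \<le> 0" "x \<notin> B \<Longrightarrow> h x = 0" "- 1 < h x \<and> h x \<le> 0" "0 < 1 + h x"
proof -
  show "- 1 < h x" using assms by (simp add: okh_def)
  then show "0 < 1 + h x" by linarith
qed (use assms in \<open>auto simp: okh_def\<close>)

abbreviation e0 :: "(real \<Rightarrow> real) \<Rightarrow> real" where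
  "e0 h \<equiv> expectation (\<lambda>w. prod1 h (pts_in B w))"
abbreviation e1 :: "(real \<Rightarrow> real) \<Rightarrow> (real \<Rightarrow> real) \<Rightarrow> real" where
  "e1 f h \<equiv> expectation (\<lambda>w. prod_d1 f h (pts_in B w))"
abbreviation e2 :: "(real \<Rightarrow> real) \<Rightarrow> (real \<Rightarrow> real) \<Rightarrow> (real \<Rightarrow> real) \<Rightarrow> real" where
  "e2 f g h \<equiv> expectation (\<lambda>w. prod_d2 f g h (pts_in B w))"
abbreviation e3 :: "(real \<Rightarrow> real) \<Rightarrow> (real \<Rightarrow> real) \<Rightarrow> (real \<Rightarrow> real) \<Rightarrow> (real \<Rightarrow> real) \<Rightarrow> real" where
  "e3 f g k h \<equiv> expectation (\<lambda>w. prod_d3 f g k h (pts_in B w))"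

lemma prod1_measurable:
  assumes h: "okh h"
  shows "(\<lambda>w. prod1 h (pts_in B w)) \<in> borel_measurable M"
  unfolding prod1_def by (rule prod_pts_in_measurable[OF B okhD(1)[OF h] okhD(5)[OF h] okhD(4)[OF h]])

lemma weighted_tf:
  assumes h: "okh h" and f: "tf f"
  shows "(\<lambda>x. f x / (1 + h x)) \<in> borel_measurable borel" "0 \<le> f x / (1 + h x)" "x \<notin> B \<Longrightarrow> f x / (1 + h x) = 0"
proof -
  note [measurable] = okhD(1)[OF h] tfD(1)[OF f]
  show "(\<lambda>x. f x / (1 + h x)) \<in> borel_measurable borel" by measurable
  show "0 \<le> f x / (1 + h x)" using okhD(6)[OF h, of x] tfD(2)[OF f, of x] by (intro divide_nonneg_pos)
  show "x \<notin> B \<Longrightarrow> f x / (1 + h x) = 0" using tfD(4)[OF f] by simp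
qed

lemma prod_d1_measurable:
  assumes h: "okh h" and f: "tf f"
  shows "(\<lambda>w. prod_d1 f h (pts_in B w)) \<in> borel_measurable M"
  unfolding prod_d1_eq[OF finite_pts_in okhD(2)[OF h]]
  by (intro borel_measurable_times prod1_measurable[OF h] sum1_pts_in(1)[OF B weighted_tf[OF h f]])

lemma prod_d2_measurable:
  assumes h: "okh h" and f: "tf f" and g: "tf g"
  shows "(\<lambda>w. prod_d2 f g h (pts_in B w)) \<in> borel_measurable M"
  unfolding prod_d2_eq[OF finite_pts_in okhD(2)[OF h]]
proof (intro borel_measurable_times prod1_measurable[OF h] sum2_pts_in(1)[OF B])
  show "(\<lambda>(a, b). off2 (\<lambda>x. f x / (1 + h x)) (\<lambda>x. g x / (1 + h x)) a b) \<in> borel_measurable (borel \<Otimes>\<^sub>M borel)"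
    by (rule off2_measurable[OF weighted_tf(1)[OF h f] weighted_tf(1)[OF h g]])
  show "0 \<le> off2 (\<lambda>x. f x / (1 + h x)) (\<lambda>x. g x / (1 + h x)) a b" for a b
    unfolding off2_def
    by (split if_split) (use mult_nonneg_nonneg[OF weighted_tf(2)[OF h f, of a] weighted_tf(2)[OF h g, of b]] in \<open>simp only: order_refl simp_thms\<close>)
  show "off2 (\<lambda>x. f x / (1 + h x)) (\<lambda>x. g x / (1 + h x)) a b = 0" if "a \<notin> B \<or> b \<notin> B" for a b
    using that weighted_tf(3)[OF h f, of a] weighted_tf(3)[OF h g, of b] unfolding off2_def
    by (elim disjE) (simp_all only: simp_thms mult_zero_left mult_zero_right if_cancel)
qed

lemma prod1_integrable: "okh h \<Longrightarrow> integrable M (\<lambda>w. prod1 h (pts_in B w))"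
proof (rule integrable_const_bound[where B = 1])
  assume h: "okh h"
  show "AE w in M. norm (prod1 h (pts_in B w)) \<le> 1"
    using prod1_bounds[of h, OF okhD(5)[OF h]] by (intro AE_I2) (simp add: abs_of_pos)
qed (rule prod1_measurable)

lemma prod_d1_le:
  assumes h: "okh h" and f: "tf f"
  shows "0 \<le> prod_d1 f h P" "prod_d1 f h P \<le> prod_d1 f (\<lambda>_. 0) P"
proof -
  note b = prod1_bounds[of h, OF okhD(5)[OF h]]
  show "0 \<le> prod_d1 f h P" unfolding prod_d1_def
    by (intro sum_nonneg mult_nonneg_nonneg tfD(2)[OF f] less_imp_le b(1))
  have "f x * prod1 h (P - {x}) \<le> f x" for x
    using mult_left_mono[OF b(2)[of "P - {x}"] tfD(2)[OF f, of x]] by simp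
  then show "prod_d1 f h P \<le> prod_d1 f (\<lambda>_. 0) P" unfolding prod_d1_0 unfolding prod_d1_def by (rule sum_mono)
qed

lemma prod_d2_le:
  assumes h: "okh h" and f: "tf f" and g: "tf g"
  shows "0 \<le> prod_d2 f g h P" "prod_d2 f g h P \<le> prod_d2 f g (\<lambda>_. 0) P"
  unfolding prod_d2_def
  by (intro sum_nonneg mult_nonneg_nonneg tfD(2)[OF f] prod_d1_le(1)[OF h g])
     (intro sum_mono mult_left_mono tfD(2)[OF f] prod_d1_le(2)[OF h g])

lemma prod_d1_integrable:
  assumes h: "okh h" and f: "tf f"
  shows "integrable M (\<lambda>w. prod_d1 f h (pts_in B w))"
proof (rule Bochner_Integration.integrable_bound[OF integrable.intros[OF moment1[OF f]] prod_d1_measurable[OF h f]])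
  show "AE w in M. norm (prod_d1 f h (pts_in B w)) \<le> norm (prod_d1 f (\<lambda>_. 0) (pts_in B w))"
    unfolding real_norm_def abs_of_nonneg[OF prod_d1_le(1)[OF h f]]
    by (intro AE_I2 order_trans[OF prod_d1_le(2)[OF h f] abs_ge_self])
qed

lemma prod_d2_integrable:
  assumes h: "okh h" and f: "tf f" and g: "tf g"
  shows "integrable M (\<lambda>w. prod_d2 f g h (pts_in B w))"
proof (rule Bochner_Integration.integrable_bound[OF integrable.intros[OF moment2[OF f g]] prod_d2_measurable[OF h f g]])
  show "AE w in M. norm (prod_d2 f g h (pts_in B w)) \<le> norm (prod_d2 f g (\<lambda>_. 0) (pts_in B w))"
    unfolding real_norm_def abs_of_nonneg[OF prod_d2_le(1)[OF h f g]]
    by (intro AE_I2 order_trans[OF prod_d2_le(2)[OF h f g] abs_ge_self])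
qed

context
  fixes d :: real and h f :: "real \<Rightarrow> real"
  assumes d: "0 < d" and ok: "\<And>s. s \<in> {-d<..0} \<Longrightarrow> okh (\<lambda>x. h x + s * f x)" and f: "tf f"
begin

lemma okh_h: "okh h"
  using ok[of 0] d by simp

lemma e0_derivative: "((\<lambda>s. e0 (\<lambda>x. h x + s * f x)) has_real_derivative e1 f h) (at 0 within {..0})"
proof (rule expectation_left_derivative(3)[OF d])
  show "\<bar>prod1 (\<lambda>x. h x + s * f x) (pts_in B w) - prod1 (\<lambda>x. h x + 0 * f x) (pts_in B w)\<bar> \<le> - s * prod_d1 f (\<lambda>_. 0) (pts_in B w)"
    if "s \<in> {-d<..0}" for s w
    using prod1_Lipschitz[OF okhD(5)[OF okh_h] okhD(2)[OF ok[OF that]] _ tfD(2)[OF f]] that by (simp add: prod_d1_0)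
qed (use prod1_measurable[OF ok] prod1_integrable[OF okh_h] integrable.intros[OF moment1[OF f]] prod1_derivative in auto)

lemma e1_derivative:
  assumes g: "tf g"
  shows "((\<lambda>s. e1 g (\<lambda>x. h x + s * f x)) has_real_derivative e2 g f h) (at 0 within {..0})"
proof (rule expectation_left_derivative(3)[OF d])
  show "\<bar>prod_d1 g (\<lambda>x. h x + s * f x) (pts_in B w) - prod_d1 g (\<lambda>x. h x + 0 * f x) (pts_in B w)\<bar> \<le> - s * prod_d2 g f (\<lambda>_. 0) (pts_in B w)"
    if "s \<in> {-d<..0}" for s w
    using prod_d1_Lipschitz[OF okhD(5)[OF okh_h] okhD(2)[OF ok[OF that]] _ tfD(2)[OF f] tfD(2)[OF g]] that by simp
qed (use prod_d1_measurable[OF ok g] prod_d1_integrable[OF okh_h g] integrable.intros[OF moment2[OF g f]] prod_d1_derivative in auto)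

lemma e2_derivative:
  assumes g: "tf g" and k: "tf k"
  shows "((\<lambda>s. e2 g k (\<lambda>x. h x + s * f x)) has_real_derivative e3 g k f h) (at 0 within {..0})"
proof (rule expectation_left_derivative(3)[OF d])
  show "\<bar>prod_d2 g k (\<lambda>x. h x + s * f x) (pts_in B w) - prod_d2 g k (\<lambda>x. h x + 0 * f x) (pts_in B w)\<bar> \<le> - s * prod_d3 g k f (\<lambda>_. 0) (pts_in B w)"
    if "s \<in> {-d<..0}" for s w
    using prod_d2_Lipschitz[OF okhD(5)[OF okh_h] okhD(2)[OF ok[OF that]] _ tfD(2)[OF f] tfD(2)[OF g] tfD(2)[OF k]] that by simp
qed (use prod_d2_measurable[OF ok g k] prod_d2_integrable[OF okh_h g k] integrable.intros[OF moment3[OF g k f]] prod_d2_derivative in auto)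

end

lemma e0_pos:
  assumes h: "okh h"
  shows "0 < e0 h"
  by (intro expectation_greater prod1_integrable[OF h] AE_I2 prod1_bounds(1)[of h, OF okhD(5)[OF h]])

text \<open>Points of \<open>B\<close> at which \<open>h\<close> vanishes contribute the factor 1,
  so the two products agree as soon as \<open>B\<close> contains finitely many points, which holds
  almost surely.\<close>

lemma pgfl_eq:
  assumes h: "okh h"
  shows "pgfl M N h = e0 h"
  unfolding pgfl_def
proof (rule integral_cong_AE)
  note [measurable] = okhD(1)[OF h]
  let ?B = "{x. h x \<noteq> 0}"
  \<comment> \<open>This identity holds at every sample point: a product over an infinite set is 1
    by default, just as the product over the empty \<open>pts_in\<close>.\<close>
  have "(\<Prod>x\<in>{x \<in> points (N w). h x \<noteq> 0}. 1 + h x) = (\<Prod>x\<in>pts_in ?B w. 1 + h x)" for w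
    by (simp add: pts_in_def Int_def)
  moreover have "(\<lambda>w. \<Prod>x\<in>pts_in ?B w. 1 + h x) \<in> borel_measurable M"
    by (rule prod_pts_in_measurable[OF _ okhD(1)[OF h] okhD(5)[OF h]]) auto
  ultimately show "(\<lambda>w. \<Prod>x\<in>{x \<in> points (N w). h x \<noteq> 0}. 1 + h x) \<in> borel_measurable M" by simp
  show "(\<lambda>w. prod1 h (pts_in B w)) \<in> borel_measurable M" by (rule prod1_measurable[OF h])
  from AE_finB show "AE w in M. (\<Prod>x\<in>{x \<in> points (N w). h x \<noteq> 0}. 1 + h x) = prod1 h (pts_in B w)"
  proof eventually_elim
    case (elim w)
    have "{x \<in> points (N w). h x \<noteq> 0} \<subseteq> pts_in B w" using elim okhD(4)[OF h] by (auto simp: pts_in_def)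
    then show ?case
      unfolding prod1_def using elim by (intro prod.mono_neutral_left) (auto simp: pts_in_def)
  qed
qed

text \<open>The three derivatives of the logarithm of the mean product express the third cumulant
  through factorial moments up to order three; inserting these moments leaves only the term of a
  single cluster.\<close>

lemma mixed_derivative_log_pgfl:
  assumes f0: "tf f0" and f1: "tf f1" and f2: "tf f2"
  shows "has_mixed_left_derivative3 (\<lambda>s0 s1 s2. ln (pgfl M N (\<lambda>x. s0 * f0 x + s1 * f1 x + s2 * f2 x))) (k3 f2 f1 f0)"
proof -
  \<comment> \<open>Each of the three perturbations then stays above \<open>- 1 / 6\<close>, so
    their sum stays above \<open>- 1\<close> and all factors remain positive.\<close>
  define d where "d = 1 / (6 * C)"
  have d: "0 < d" using C by (simp add: d_def)
  have sf: "- (1 / 6) \<le> s * f x" "s * f x \<le> 0" if "s \<in> {-d<..0}" "tf f" for s f x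
  proof -
    have "- s * f x \<le> d * C" using that tfD(2,3)[OF that(2), of x] d by (intro mult_mono) auto
    then show "- (1 / 6) \<le> s * f x" using C by (simp add: d_def)
    show "s * f x \<le> 0" using that tfD(2)[OF that(2), of x] by (simp add: mult_nonpos_nonneg)
  qed
  have ok3: "okh (\<lambda>x. s0 * f0 x + s1 * f1 x + s2 * f2 x)" if "s0 \<in> {-d<..0}" "s1 \<in> {-d<..0}" "s2 \<in> {-d<..0}" for s0 s1 s2
    unfolding okh_def
  proof (intro conjI allI impI)
    note [measurable] = tfD(1)[OF f0] tfD(1)[OF f1] tfD(1)[OF f2]
    show "(\<lambda>x. s0 * f0 x + s1 * f1 x + s2 * f2 x) \<in> borel_measurable borel" by measurable
    fix x
    note b = sf[OF that(1) f0, of x] sf[OF that(2) f1, of x] sf[OF that(3) f2, of x]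
    show "- 1 < s0 * f0 x + s1 * f1 x + s2 * f2 x" "s0 * f0 x + s1 * f1 x + s2 * f2 x \<le> 0" using b by linarith+
    show "s0 * f0 x + s1 * f1 x + s2 * f2 x = 0" if "x \<notin> B"
      using tfD(4)[OF f0 that] tfD(4)[OF f1 that] tfD(4)[OF f2 that] by simp
  qed
  have zero: "0 \<in> {-d<..0}" using d by simp
  have ok2: "okh (\<lambda>x. s0 * f0 x + s1 * f1 x)" if "s0 \<in> {-d<..0}" "s1 \<in> {-d<..0}" for s0 s1
    using ok3[OF that zero] by simp
  have ok1: "okh (\<lambda>x. s0 * f0 x)" if "s0 \<in> {-d<..0}" for s0 using ok2[OF that zero] by simp
  have ok0: "okh (\<lambda>_. 0)" using ok1[OF zero] by simp
  \<comment> \<open>The summand 0 is kept so that the pattern \<open>h x + s * f x\<close> of the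
    derivative rules matches with \<open>h\<close> equal to zero.\<close>
  have ok1': "okh (\<lambda>x. 0 + s0 * f0 x)" if "s0 \<in> {-d<..0}" for s0 using ok1[OF that] by simp
  let ?D2 = "\<lambda>s0 s1. e1 f2 (\<lambda>x. s0 * f0 x + s1 * f1 x) / e0 (\<lambda>x. s0 * f0 x + s1 * f1 x)"
  let ?D1 = "\<lambda>s0. (e2 f2 f1 (\<lambda>x. s0 * f0 x) * e0 (\<lambda>x. s0 * f0 x) - e1 f2 (\<lambda>x. s0 * f0 x) * e1 f1 (\<lambda>x. s0 * f0 x))
    / (e0 (\<lambda>x. s0 * f0 x) * e0 (\<lambda>x. s0 * f0 x))"
  have D2: "((\<lambda>s2. ln (pgfl M N (\<lambda>x. s0 * f0 x + s1 * f1 x + s2 * f2 x))) has_real_derivative ?D2 s0 s1) (at 0 within {..0})"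
    if s: "s0 \<in> {-d<..0}" "s1 \<in> {-d<..0}" for s0 s1
  proof (rule left_derivative_cong[OF _ d])
    let ?h = "\<lambda>x. s0 * f0 x + s1 * f1 x"
    have "((\<lambda>s. ln (e0 (\<lambda>x. ?h x + s * f2 x))) has_real_derivative 1 / e0 (\<lambda>x. ?h x + 0 * f2 x) * e1 f2 ?h) (at 0 within {..0})"
      by (rule DERIV_chain2[OF DERIV_ln_divide[OF e0_pos[OF ok3[OF s zero]]] e0_derivative[OF d ok3[OF s] f2]])
    then show "((\<lambda>s. ln (e0 (\<lambda>x. ?h x + s * f2 x))) has_real_derivative ?D2 s0 s1) (at 0 within {..0})" by simp
    show "ln (e0 (\<lambda>x. ?h x + s2 * f2 x)) = ln (pgfl M N (\<lambda>x. ?h x + s2 * f2 x))" if "s2 \<in> {-d<..0}" for s2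
      using pgfl_eq[OF ok3[OF s that]] by simp
  qed
  have D1: "(?D2 s0 has_real_derivative ?D1 s0) (at 0 within {..0})" if s: "s0 \<in> {-d<..0}" for s0
  proof -
    let ?h = "\<lambda>x. s0 * f0 x"
    have "(?D2 s0 has_real_derivative (e2 f2 f1 ?h * e0 (\<lambda>x. ?h x + 0 * f1 x) - e1 f2 (\<lambda>x. ?h x + 0 * f1 x) * e1 f1 ?h)
        / (e0 (\<lambda>x. ?h x + 0 * f1 x) * e0 (\<lambda>x. ?h x + 0 * f1 x))) (at 0 within {..0})"
      by (rule DERIV_divide[OF e1_derivative[OF d ok2[OF s] f1 f2] e0_derivative[OF d ok2[OF s] f1] e0_pos[OF ok2[OF s zero], THEN less_imp_neq, THEN not_sym]])
    then show ?thesis by simp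
  qed
  have L: "(?D1 has_real_derivative k3 f2 f1 f0) (at 0 within {..0})"
  proof -
    note v = has_bochner_integral_integral_eq[OF moment1[OF f0]] has_bochner_integral_integral_eq[OF moment1[OF f1]] has_bochner_integral_integral_eq[OF moment1[OF f2]]
      has_bochner_integral_integral_eq[OF moment2[OF f2 f1]] has_bochner_integral_integral_eq[OF moment2[OF f2 f0]] has_bochner_integral_integral_eq[OF moment2[OF f1 f0]]
      has_bochner_integral_integral_eq[OF moment3[OF f2 f1 f0]]
    note E0 = e0_derivative[OF d ok1' f0]
    have "e0 (\<lambda>x. 0 + 0 * f0 x) = 1" by (simp add: prob_space)
    then have nz: "e0 (\<lambda>x. 0 + 0 * f0 x) * e0 (\<lambda>x. 0 + 0 * f0 x) \<noteq> 0" by simp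
    have "((\<lambda>s. (e2 f2 f1 (\<lambda>x. 0 + s * f0 x) * e0 (\<lambda>x. 0 + s * f0 x) - e1 f2 (\<lambda>x. 0 + s * f0 x) * e1 f1 (\<lambda>x. 0 + s * f0 x))
        / (e0 (\<lambda>x. 0 + s * f0 x) * e0 (\<lambda>x. 0 + s * f0 x))) has_real_derivative
      ((e3 f2 f1 f0 (\<lambda>x. 0) * e0 (\<lambda>x. 0 + 0 * f0 x) + e1 f0 (\<lambda>x. 0) * e2 f2 f1 (\<lambda>x. 0 + 0 * f0 x)
        - (e2 f2 f0 (\<lambda>x. 0) * e1 f1 (\<lambda>x. 0 + 0 * f0 x) + e2 f1 f0 (\<lambda>x. 0) * e1 f2 (\<lambda>x. 0 + 0 * f0 x)))
        * (e0 (\<lambda>x. 0 + 0 * f0 x) * e0 (\<lambda>x. 0 + 0 * f0 x))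
       - (e2 f2 f1 (\<lambda>x. 0 + 0 * f0 x) * e0 (\<lambda>x. 0 + 0 * f0 x) - e1 f2 (\<lambda>x. 0 + 0 * f0 x) * e1 f1 (\<lambda>x. 0 + 0 * f0 x))
        * (e1 f0 (\<lambda>x. 0) * e0 (\<lambda>x. 0 + 0 * f0 x) + e1 f0 (\<lambda>x. 0) * e0 (\<lambda>x. 0 + 0 * f0 x)))
      / ((e0 (\<lambda>x. 0 + 0 * f0 x) * e0 (\<lambda>x. 0 + 0 * f0 x)) * (e0 (\<lambda>x. 0 + 0 * f0 x) * e0 (\<lambda>x. 0 + 0 * f0 x)))) (at 0 within {..0})"
      by (rule DERIV_divide[OF DERIV_diff[OF DERIV_mult[OF e2_derivative[OF d ok1' f0 f2 f1] E0] DERIV_mult[OF e1_derivative[OF d ok1' f0 f2] e1_derivative[OF d ok1' f0 f1]]] DERIV_mult[OF E0 E0] nz])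
    \<comment> \<open>At the origin the mean product equals 1, so all denominators
      disappear.\<close>
    then have "(?D1 has_real_derivative (e3 f2 f1 f0 (\<lambda>x. 0) + e1 f0 (\<lambda>x. 0) * e2 f2 f1 (\<lambda>x. 0)
        - (e2 f2 f0 (\<lambda>x. 0) * e1 f1 (\<lambda>x. 0) + e2 f1 f0 (\<lambda>x. 0) * e1 f2 (\<lambda>x. 0)))
       - (e2 f2 f1 (\<lambda>x. 0) - e1 f2 (\<lambda>x. 0) * e1 f1 (\<lambda>x. 0)) * (e1 f0 (\<lambda>x. 0) + e1 f0 (\<lambda>x. 0))) (at 0 within {..0})"
      by (simp add: prob_space)
    \<comment> \<open>With the moments inserted, the products of means with pair terms and the
      product of three means cancel.\<close>
    then show ?thesis unfolding v by (simp add: algebra_simps power2_eq_square power3_eq_cube)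
  qed
  show ?thesis
    unfolding has_mixed_left_derivative3_def
    by (intro exI[of _ d] exI[of _ ?D2] exI[of _ ?D1] conjI ballI d D2 D1 L)
qed

end

end

section \<open>The third factorial cumulant measure\<close>

text \<open>A measure in functional form. Identities between signed measures are stated below with the negative
  parts moved to the other side, so that only such functionals occur.\<close>

definition sigma_linear :: "(('a::euclidean_space \<Rightarrow> ennreal) \<Rightarrow> ennreal) \<Rightarrow> bool" where
  "sigma_linear \<Lambda> \<longleftrightarrow>
    (\<forall>f\<in>borel_measurable borel. \<forall>g\<in>borel_measurable borel. \<Lambda> (\<lambda>x. f x + g x) = \<Lambda> f + \<Lambda> g) \<and>
    (\<forall>f\<in>borel_measurable borel. \<forall>c. \<Lambda> (\<lambda>x. c * f x) = c * \<Lambda> f) \<and>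
    (\<forall>F. (\<forall>i::nat. F i \<in> borel_measurable borel) \<and> incseq F \<longrightarrow> \<Lambda> (\<lambda>x. SUP i. F i x) = (SUP i. \<Lambda> (F i)))"

lemma sigma_linear_nn_integral:
  assumes [measurable_cong]: "sets \<mu> = sets borel" and [measurable]: "w \<in> borel_measurable borel"
  shows "sigma_linear (\<lambda>f. \<integral>\<^sup>+x. f x * w x \<partial>\<mu>)"
  unfolding sigma_linear_def
proof (intro conjI ballI allI impI)
  fix f g :: "'a \<Rightarrow> ennreal" and c
  assume [measurable]: "f \<in> borel_measurable borel" "g \<in> borel_measurable borel"
  show "(\<integral>\<^sup>+x. (f x + g x) * w x \<partial>\<mu>) = (\<integral>\<^sup>+x. f x * w x \<partial>\<mu>) + (\<integral>\<^sup>+x. g x * w x \<partial>\<mu>)"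
    by (simp add: distrib_right nn_integral_add)
next
  fix f :: "'a \<Rightarrow> ennreal" and c
  assume [measurable]: "f \<in> borel_measurable borel"
  show "(\<integral>\<^sup>+x. c * f x * w x \<partial>\<mu>) = c * (\<integral>\<^sup>+x. f x * w x \<partial>\<mu>)"
    by (simp add: mult.assoc nn_integral_cmult)
next
  fix F :: "nat \<Rightarrow> 'a \<Rightarrow> ennreal" assume F: "(\<forall>i. F i \<in> borel_measurable borel) \<and> incseq F"
  then have [measurable]: "F i \<in> borel_measurable borel" for i by auto
  have "incseq (\<lambda>i x. F i x * w x)"
    using F by (auto simp: incseq_def le_fun_def intro!: mult_right_mono)
  then have "(\<integral>\<^sup>+x. (SUP i. F i x * w x) \<partial>\<mu>) = (SUP i. \<integral>\<^sup>+x. F i x * w x \<partial>\<mu>)"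
    by (rule nn_integral_monotone_convergence_SUP) measurable
  then show "(\<integral>\<^sup>+x. (SUP i. F i x) * w x \<partial>\<mu>) = (SUP i. \<integral>\<^sup>+x. F i x * w x \<partial>\<mu>)"
    by (simp add: SUP_mult_right_ennreal)
qed

text \<open>Monotonicity is a consequence of continuity along increasing sequences, applied to the
  sequence \<open>f\<close>, \<open>g\<close>, \<open>g\<close>, and so on.\<close>

lemma sigma_linear_mono:
  assumes L: "sigma_linear \<Lambda>" and m: "f \<in> borel_measurable borel" "g \<in> borel_measurable borel" and le: "\<And>x. f x \<le> g x"
  shows "\<Lambda> f \<le> \<Lambda> g"
proof -
  have "(\<lambda>x. SUP i::nat. if i = 0 then f x else g x) = g"
  proof (rule ext)
    fix x show "(SUP i::nat. if i = 0 then f x else g x) = g x"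
    proof (rule antisym)
      show "(SUP i::nat. if i = 0 then f x else g x) \<le> g x" by (rule SUP_least) (simp add: le)
      show "g x \<le> (SUP i::nat. if i = 0 then f x else g x)" by (rule SUP_upper2[of 1]) simp_all
    qed
  qed
  moreover have "\<Lambda> (\<lambda>x. SUP i::nat. (\<lambda>i x. if i = 0 then f x else g x) i x) = (SUP i::nat. \<Lambda> ((\<lambda>i x. if i = 0 then f x else g x) i))"
    using L m le unfolding sigma_linear_def
    by (elim conjE allE[of _ "\<lambda>i x. if i = 0 then f x else g x"] impE) (auto simp: incseq_def le_fun_def)
  moreover have "\<Lambda> f \<le> (SUP i::nat. \<Lambda> ((\<lambda>i x. if i = 0 then f x else g x) i))"
    by (rule SUP_upper2[of 0]) simp_all
  ultimately show ?thesis by simp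
qed

lemma sigma_linear_add:
  assumes L: "sigma_linear \<Lambda>" and L': "sigma_linear \<Lambda>'"
  shows "sigma_linear (\<lambda>f. \<Lambda> f + \<Lambda>' f)"
  unfolding sigma_linear_def
proof (intro conjI ballI allI impI)
  fix F :: "nat \<Rightarrow> 'a \<Rightarrow> ennreal" assume F: "(\<forall>i. F i \<in> borel_measurable borel) \<and> incseq F"
  have "mono (\<lambda>i. \<Lambda> (F i))" "mono (\<lambda>i. \<Lambda>' (F i))"
    using F sigma_linear_mono[OF L] sigma_linear_mono[OF L'] by (auto simp: mono_def le_fun_def)
  then have "(SUP i. \<Lambda> (F i) + \<Lambda>' (F i)) = (SUP i. \<Lambda> (F i)) + (SUP i. \<Lambda>' (F i))"
    by (rule ennreal_SUP_add)
  then show "\<Lambda> (\<lambda>x. SUP i. F i x) + \<Lambda>' (\<lambda>x. SUP i. F i x) = (SUP i. \<Lambda> (F i) + \<Lambda>' (F i))"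
    using L L' F unfolding sigma_linear_def by simp
qed (use L L' in \<open>auto simp: sigma_linear_def distrib_left add_ac\<close>)

lemma sigma_linear_suminf:
  assumes L: "sigma_linear \<Lambda>" and f: "\<And>n. f n \<in> borel_measurable borel"
  shows "\<Lambda> (\<lambda>x. \<Sum>n. f n x) = (\<Sum>n. \<Lambda> (f n))"
proof -
  have z: "\<Lambda> (\<lambda>x. 0) = 0"
  proof -
    have "\<Lambda> (\<lambda>x. 0 * 0) = 0 * \<Lambda> (\<lambda>x. 0)"
      using L unfolding sigma_linear_def by (elim conjE ballE[of _ _ "\<lambda>x. 0"] allE[of _ 0]) auto
    then show ?thesis by simp
  qed
  have s: "\<Lambda> (\<lambda>x. \<Sum>n<k. f n x) = (\<Sum>n<k. \<Lambda> (f n))" for k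
  proof (induction k)
    case (Suc k)
    have "\<Lambda> (\<lambda>x. (\<Sum>n<k. f n x) + f k x) = \<Lambda> (\<lambda>x. \<Sum>n<k. f n x) + \<Lambda> (f k)"
      using L f unfolding sigma_linear_def by (elim conjE) simp
    then show ?case using Suc by simp
  qed (simp add: z)
  have "incseq (\<lambda>k x. \<Sum>n<k. f n x)" by (auto simp: incseq_def le_fun_def intro!: sum_mono2)
  then have "\<Lambda> (\<lambda>x. SUP k. (\<lambda>k x. \<Sum>n<k. f n x) k x) = (SUP k. \<Lambda> ((\<lambda>k x. \<Sum>n<k. f n x) k))"
    using L f unfolding sigma_linear_def by (elim conjE allE[of _ "\<lambda>k x. \<Sum>n<k. f n x"]) auto
  then show ?thesis by (simp add: s suminf_eq_SUP)
qed

text \<open>The values on indicators define a measure. Two such measures that agree and are finite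
  on cubes are equal, and the induction over nonnegative measurable functions returns from measures
  to functionals.\<close>

lemma sigma_linear_eqI:
  assumes L: "sigma_linear \<Lambda>" and L': "sigma_linear \<Lambda>'"
    and cubes: "\<And>n m. \<Lambda> (indicator (dyadic_cube n m)) = \<Lambda>' (indicator (dyadic_cube n m))"
    and fin: "\<And>n m. \<Lambda> (indicator (dyadic_cube n m)) \<noteq> \<infinity>"
    and f: "f \<in> borel_measurable borel"
  shows "\<Lambda> f = \<Lambda>' f"
proof -
  define meas :: "(('a \<Rightarrow> ennreal) \<Rightarrow> ennreal) \<Rightarrow> 'a measure" where "meas L = measure_of UNIV (sets borel) (\<lambda>A. L (indicator A))" for L
  have em: "emeasure (meas L) A = L (indicator A)" if "sigma_linear L" "A \<in> sets borel" for L A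
    unfolding meas_def
  proof (rule emeasure_measure_of_sigma)
    show "sigma_algebra UNIV (sets (borel :: 'a measure))"
      using sets.sigma_algebra_axioms[of "borel :: 'a measure"] by simp
    have "L (indicator {}) = 0"
    proof -
      have "L (\<lambda>x. 0 * 0) = 0 * L (\<lambda>x. 0)"
        using that(1) unfolding sigma_linear_def by (elim conjE ballE[of _ _ "\<lambda>x. 0"] allE[of _ 0]) auto
      moreover have "(indicator {} :: 'a \<Rightarrow> ennreal) = (\<lambda>x. 0)" by (simp add: fun_eq_iff)
      ultimately show ?thesis by simp
    qed
    then show "positive (sets borel) (\<lambda>A. L (indicator A))" by (simp add: positive_def)
    show "countably_additive (sets borel) (\<lambda>A. L (indicator A))"
    proof (rule countably_additiveI)
      fix A :: "nat \<Rightarrow> 'a set" assume A: "range A \<subseteq> sets borel" "disjoint_family A"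
      have "(indicator (\<Union>i. A i) :: 'a \<Rightarrow> ennreal) = (\<lambda>x. \<Sum>n. indicator (A n) x)"
        using suminf_indicator[OF A(2)] by auto
      then show "(\<Sum>i. L (indicator (A i))) = L (indicator (\<Union>i. A i))"
        using sigma_linear_suminf[OF that(1), of "\<lambda>n. indicator (A n)"] A(1) by auto
    qed
  qed (use that in auto)
  have "meas \<Lambda> = meas \<Lambda>'"
  proof (rule measure_eqI_dyadic_cubes)
    show "emeasure (meas \<Lambda>) (dyadic_cube n m) = emeasure (meas \<Lambda>') (dyadic_cube n m)" for n m
      by (simp add: em L L' cubes)
    show "emeasure (meas \<Lambda>) (dyadic_cube n m) \<noteq> \<infinity>" for n m using fin by (simp add: em L)
  qed (simp_all add: meas_def sets.sigma_sets_eq[of borel, simplified])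
  then have ind: "\<Lambda> (indicator A) = \<Lambda>' (indicator A)" if "A \<in> sets borel" for A
    using em[OF L that] em[OF L' that] by simp
  show ?thesis using f
  proof (induction rule: borel_measurable_induct)
    case (cong f g)
    then have "f = g" by (auto simp: fun_eq_iff)
    then show ?case using cong by simp
  next
    case (seq F)
    have "\<Lambda> (\<lambda>x. SUP i. F i x) = (SUP i. \<Lambda> (F i))" "\<Lambda>' (\<lambda>x. SUP i. F i x) = (SUP i. \<Lambda>' (F i))"
      using L L' seq unfolding sigma_linear_def by auto
    moreover have "Sup (range F) = (\<lambda>x. SUP i. F i x)" by (auto simp: fun_eq_iff image_comp)
    ultimately show ?case using seq by (simp add: image_comp)
  qed (use ind L L' in \<open>auto simp: sigma_linear_def\<close>)
qed

section \<open>Test functions and signed measures\<close>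

lemma fun_supp_zero: "x \<notin> fun_supp f \<Longrightarrow> f x = 0"
  using closure_subset[of "{x. f x \<noteq> 0}"] by (auto simp: fun_supp_def)

lemma test_fun_nn_integral_finite:
  assumes G: "test_fun G" and s: "sets \<mu> = sets borel" and lf: "\<And>K. compact K \<Longrightarrow> emeasure \<mu> K < \<infinity>"
  shows "(\<integral>\<^sup>+x. ennreal (G x) \<partial>\<mu>) < \<infinity>" and "integrable \<mu> G"
proof -
  have Gm [measurable]: "G \<in> borel_measurable \<mu>" using G s by (simp add: test_fun_def cong: measurable_cong_sets)
  obtain C where C: "\<And>x. \<bar>G x\<bar> \<le> C" using G by (auto simp: test_fun_def bounded_iff)
  have cpt: "compact (fun_supp G)" using G by (simp add: test_fun_def)
  then have K [measurable]: "fun_supp G \<in> sets \<mu>" unfolding s by (rule borel_compact)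
  have "(\<integral>\<^sup>+x. ennreal (norm (G x)) \<partial>\<mu>) \<le> (\<integral>\<^sup>+x. ennreal C * indicator (fun_supp G) x \<partial>\<mu>)"
  proof (rule nn_integral_mono)
    fix x show "ennreal (norm (G x)) \<le> ennreal C * indicator (fun_supp G) x"
      using C[of x] fun_supp_zero[of x G] by (cases "x \<in> fun_supp G") (simp_all add: ennreal_leI)
  qed
  also have "\<dots> < \<infinity>" using lf[OF cpt] by (simp add: nn_integral_cmult_indicator ennreal_mult_less_top)
  finally have *: "(\<integral>\<^sup>+x. ennreal (norm (G x)) \<partial>\<mu>) < \<infinity>" .
  then show "integrable \<mu> G" by (simp add: integrable_iff_bounded)
  have "(\<integral>\<^sup>+x. ennreal (G x) \<partial>\<mu>) \<le> (\<integral>\<^sup>+x. ennreal (norm (G x)) \<partial>\<mu>)"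
    by (intro nn_integral_mono ennreal_leI) simp
  with * show "(\<integral>\<^sup>+x. ennreal (G x) \<partial>\<mu>) < \<infinity>" by simp
qed

lemma test_fun_uminus: "test_fun G \<Longrightarrow> test_fun (\<lambda>x. - G x)"
  by (auto simp: test_fun_def fun_supp_def bounded_iff)

lemma test_fun_integral:
  assumes G: "test_fun G" and s: "sets \<mu> = sets borel" and lf: "\<And>K. compact K \<Longrightarrow> emeasure \<mu> K < \<infinity>"
  shows "(LINT x|\<mu>. G x) = enn2real (\<integral>\<^sup>+x. ennreal (G x) \<partial>\<mu>) - enn2real (\<integral>\<^sup>+x. ennreal (- G x) \<partial>\<mu>)"
  by (rule real_lebesgue_integral_def[OF test_fun_nn_integral_finite(2)[OF assms]])

text \<open>The density is given only on bounded Borel sets. With the negative parts of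
  \<open>\<rho>\<close> and of \<open>c\<close> moved to the other sides, this becomes an identity
  of two nonnegative functionals; it is checked on cubes, and the subtraction is performed after the
  finite integrals of a test function have been inserted.\<close>

lemma signed_density_integral:
  assumes \<rho>: "signed_radon \<rho>" and d: "signed_density \<rho> c" and c: "integrable lborel c" and F: "test_fun F"
  shows "signed_int \<rho> F = (LINT x|lborel. F x * c x)"
proof -
  have s: "sets (fst \<rho>) = sets borel" "sets (snd \<rho>) = sets borel"
    and lf: "\<And>K. compact K \<Longrightarrow> emeasure (fst \<rho>) K < \<infinity>" "\<And>K. compact K \<Longrightarrow> emeasure (snd \<rho>) K < \<infinity>"
    using \<rho> by (auto simp: signed_radon_def)
  have [measurable]: "c \<in> borel_measurable borel" using c by auto
  \<comment> \<open>Since \<open>ennreal\<close> truncates at zero, the weights are the negative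
    part of \<open>c\<close> here and its positive part in \<open>?L2\<close>.\<close>
  let ?L1 = "\<lambda>f. (\<integral>\<^sup>+x. f x * 1 \<partial>fst \<rho>) + (\<integral>\<^sup>+x. f x * ennreal (- c x) \<partial>lborel)"
  let ?L2 = "\<lambda>f. (\<integral>\<^sup>+x. f x * 1 \<partial>snd \<rho>) + (\<integral>\<^sup>+x. f x * ennreal (c x) \<partial>lborel)"
  have fin: "emeasure (fst \<rho>) A < \<infinity>" "emeasure (snd \<rho>) A < \<infinity>" if "bounded A" for A
  proof -
    have "compact (closure A)" using that by (simp add: compact_closure)
    moreover have "emeasure \<mu> A \<le> emeasure \<mu> (closure A)" if "sets \<mu> = sets borel" for \<mu> :: "'a measure"
      using that by (intro emeasure_mono closure_subset) (simp add: borel_closed)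
    ultimately show "emeasure (fst \<rho>) A < \<infinity>" "emeasure (snd \<rho>) A < \<infinity>"
      using lf s by (meson order_le_less_trans)+
  qed
  have cpos: "integrable lborel (\<lambda>x. max 0 (c x))" "integrable lborel (\<lambda>x. max 0 (- c x))" using c by auto
  have cfin: "(\<integral>\<^sup>+x. ennreal (c x) \<partial>lborel) < \<infinity>" "(\<integral>\<^sup>+x. ennreal (- c x) \<partial>lborel) < \<infinity>"
    using c by (auto simp: real_integrable_def less_top)
  have key: "?L1 f = ?L2 f" if "f \<in> borel_measurable borel" for f
  proof (rule sigma_linear_eqI[of ?L1 ?L2, OF _ _ _ _ that])
    show "sigma_linear ?L1"
      by (intro sigma_linear_add sigma_linear_nn_integral s(1)) simp_all
    show "sigma_linear ?L2"
      by (intro sigma_linear_add sigma_linear_nn_integral s(2)) simp_all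
    fix n and m :: "'a \<Rightarrow> int"
    let ?A = "dyadic_cube n m"
    have bd: "bounded ?A"
    proof -
      have "norm x \<le> (\<Sum>b\<in>Basis. \<bar>(real_of_int (\<bar>m b\<bar> + 1))\<bar>)" if "x \<in> ?A" for x
      proof -
        have "\<bar>x \<bullet> b\<bar> \<le> \<bar>real_of_int (\<bar>m b\<bar> + 1)\<bar>" if "b \<in> Basis" for b
        proof -
          have "\<lfloor>2 ^ n * (x \<bullet> b)\<rfloor> = m b" using \<open>x \<in> ?A\<close> that by (simp add: dyadic_cube_def)
          then have "\<bar>2 ^ n * (x \<bullet> b)\<bar> \<le> real_of_int (\<bar>m b\<bar> + 1)" by linarith
          moreover have "1 * \<bar>x \<bullet> b\<bar> \<le> 2 ^ n * \<bar>x \<bullet> b\<bar>" by (intro mult_right_mono) auto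
          ultimately show ?thesis by (simp add: abs_mult)
        qed
        then have "(\<Sum>b\<in>Basis. \<bar>x \<bullet> b\<bar>) \<le> (\<Sum>b\<in>Basis. \<bar>(real_of_int (\<bar>m b\<bar> + 1))\<bar>)" by (rule sum_mono)
        then show ?thesis using norm_le_l1[of x] by linarith
      qed
      then show ?thesis by (auto simp: bounded_iff)
    qed
    have lfin: "(\<integral>\<^sup>+x. indicator ?A x * ennreal (c x) \<partial>lborel) < \<infinity>" "(\<integral>\<^sup>+x. indicator ?A x * ennreal (- c x) \<partial>lborel) < \<infinity>"
      by (rule order_le_less_trans[OF nn_integral_mono cfin(1)], simp add: indicator_def)
        (rule order_le_less_trans[OF nn_integral_mono cfin(2)], simp add: indicator_def)
    have "measure (fst \<rho>) ?A - measure (snd \<rho>) ?A = (LINT x:?A|lborel. c x)"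
      using d bd unfolding signed_density_def by auto
    also have "\<dots> = enn2real (\<integral>\<^sup>+x. ennreal (indicator ?A x * c x) \<partial>lborel) - enn2real (\<integral>\<^sup>+x. ennreal (- (indicator ?A x * c x)) \<partial>lborel)"
      unfolding set_lebesgue_integral_def real_scaleR_def
      by (intro real_lebesgue_integral_def) (rule Bochner_Integration.integrable_bound[OF c], auto simp: indicator_def)
    also have "(\<lambda>x. ennreal (indicator ?A x * c x)) = (\<lambda>x. indicator ?A x * ennreal (c x))" by (auto simp: indicator_def)
    also have "(\<lambda>x. ennreal (- (indicator ?A x * c x))) = (\<lambda>x. indicator ?A x * ennreal (- c x))" by (auto simp: indicator_def)
    finally have eq: "measure (fst \<rho>) ?A + enn2real (\<integral>\<^sup>+x. indicator ?A x * ennreal (- c x) \<partial>lborel)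
        = measure (snd \<rho>) ?A + enn2real (\<integral>\<^sup>+x. indicator ?A x * ennreal (c x) \<partial>lborel)" by linarith
    have e1: "emeasure (fst \<rho>) ?A = ennreal (measure (fst \<rho>) ?A)" "emeasure (snd \<rho>) ?A = ennreal (measure (snd \<rho>) ?A)"
      using fin[OF bd] by (auto intro!: emeasure_eq_ennreal_measure)
    have e2: "(\<integral>\<^sup>+x. indicator ?A x * ennreal (c x) \<partial>lborel) = ennreal (enn2real (\<integral>\<^sup>+x. indicator ?A x * ennreal (c x) \<partial>lborel))"
      "(\<integral>\<^sup>+x. indicator ?A x * ennreal (- c x) \<partial>lborel) = ennreal (enn2real (\<integral>\<^sup>+x. indicator ?A x * ennreal (- c x) \<partial>lborel))"
      using lfin by simp_all
    have i: "(\<integral>\<^sup>+x. indicator ?A x * 1 \<partial>fst \<rho>) = emeasure (fst \<rho>) ?A" "(\<integral>\<^sup>+x. indicator ?A x * 1 \<partial>snd \<rho>) = emeasure (snd \<rho>) ?A"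
      using s by simp_all
    show "?L1 (indicator ?A) = ?L2 (indicator ?A)"
      unfolding i by (subst e1, subst e1(2), subst e2, subst e2(2)) (simp add: eq ennreal_plus[symmetric] del: ennreal_plus)
    show "?L1 (indicator ?A) \<noteq> \<infinity>"
      unfolding i using fin[OF bd] lfin by (simp add: less_top)
  qed
  have Fm [measurable]: "F \<in> borel_measurable borel" using F by (simp add: test_fun_def)
  obtain C where C: "\<And>x. \<bar>F x\<bar> \<le> C" using F by (auto simp: test_fun_def bounded_iff)
  have C0: "0 \<le> C" using C[of undefined] by linarith
  have Fc: "integrable lborel (\<lambda>x. F x * v x)" if v: "integrable lborel v" for v
  proof (rule Bochner_Integration.integrable_bound[of _ "\<lambda>x. C * v x"])
    show "integrable lborel (\<lambda>x. C * v x)" using v by simp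
    show "AE x in lborel. norm (F x * v x) \<le> norm (C * v x)"
      using C C0 by (intro AE_I2) (simp add: abs_mult mult_right_mono)
    show "(\<lambda>x. F x * v x) \<in> borel_measurable lborel" using v by measurable
  qed
  \<comment> \<open>Applied to \<open>F\<close> and to \<open>- F\<close>, this yields both halves
    of the integral; \<open>ennreal (H x)\<close> sees only the positive part
    \<open>max 0 (H x)\<close>.\<close>
  have part: "enn2real (\<integral>\<^sup>+x. ennreal (H x) \<partial>fst \<rho>) - enn2real (\<integral>\<^sup>+x. ennreal (H x) \<partial>snd \<rho>) = (LINT x|lborel. max 0 (H x) * c x)"
    if H: "test_fun H" and HF: "H = F \<or> H = (\<lambda>x. - F x)" for H
  proof -
    have Hm [measurable]: "H \<in> borel_measurable borel" using H by (simp add: test_fun_def)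
    have Hi: "integrable lborel (\<lambda>x. max 0 (H x) * v x)" if v: "integrable lborel v" for v
    proof (rule Bochner_Integration.integrable_bound[of _ "\<lambda>x. F x * v x", OF Fc[OF v]])
      show "AE x in lborel. norm (max 0 (H x) * v x) \<le> norm (F x * v x)"
        using HF by (intro AE_I2) (auto simp: abs_mult intro!: mult_right_mono)
      show "(\<lambda>x. max 0 (H x) * v x) \<in> borel_measurable lborel" using v by measurable
    qed
    have n: "(\<integral>\<^sup>+x. ennreal (H x) * ennreal (v x) \<partial>lborel) = ennreal (LINT x|lborel. max 0 (H x) * max 0 (v x))"
      if v: "integrable lborel v" for v
    proof -
      have "(\<integral>\<^sup>+x. ennreal (H x) * ennreal (v x) \<partial>lborel) = (\<integral>\<^sup>+x. ennreal (max 0 (H x) * max 0 (v x)) \<partial>lborel)"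
        by (intro nn_integral_cong) (simp add: ennreal_mult max_def ennreal_neg)
      also have "\<dots> = ennreal (LINT x|lborel. max 0 (H x) * max 0 (v x))"
        using Hi[of "\<lambda>x. max 0 (v x)"] v by (intro nn_integral_eq_integral) auto
      finally show ?thesis .
    qed
    have eq: "(\<integral>\<^sup>+x. ennreal (H x) \<partial>fst \<rho>) + ennreal (LINT x|lborel. max 0 (H x) * max 0 (- c x))
        = (\<integral>\<^sup>+x. ennreal (H x) \<partial>snd \<rho>) + ennreal (LINT x|lborel. max 0 (H x) * max 0 (c x))"
      using key[of "\<lambda>x. ennreal (H x)"] n[OF c] n[of "\<lambda>x. - c x"] c by simp
    have f1: "(\<integral>\<^sup>+x. ennreal (H x) \<partial>fst \<rho>) < \<top>" "(\<integral>\<^sup>+x. ennreal (H x) \<partial>snd \<rho>) < \<top>"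
      using test_fun_nn_integral_finite(1)[OF H s(1) lf(1)] test_fun_nn_integral_finite(1)[OF H s(2) lf(2)] by auto
    have nnI: "0 \<le> (LINT x|lborel. max 0 (H x) * max 0 (v x))" for v
      by (intro Bochner_Integration.integral_nonneg) simp
    have "enn2real (\<integral>\<^sup>+x. ennreal (H x) \<partial>fst \<rho>) + (LINT x|lborel. max 0 (H x) * max 0 (- c x))
        = enn2real (\<integral>\<^sup>+x. ennreal (H x) \<partial>snd \<rho>) + (LINT x|lborel. max 0 (H x) * max 0 (c x))"
      using arg_cong[OF eq, of enn2real] enn2real_plus[OF f1(1) ennreal_less_top] enn2real_plus[OF f1(2) ennreal_less_top] enn2real_ennreal[OF nnI]
      by (simp only:)
    moreover have "(LINT x|lborel. max 0 (H x) * max 0 (c x)) - (LINT x|lborel. max 0 (H x) * max 0 (- c x)) = (LINT x|lborel. max 0 (H x) * c x)"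
    proof -
      have "(LINT x|lborel. max 0 (H x) * max 0 (c x) - max 0 (H x) * max 0 (- c x)) = (LINT x|lborel. max 0 (H x) * c x)"
        by (intro Bochner_Integration.integral_cong refl) (simp add: max_def)
      then show ?thesis using Bochner_Integration.integral_diff[OF Hi[OF cpos(1)] Hi[OF cpos(2)]] by simp
    qed
    ultimately show ?thesis by linarith
  qed
  have FI: "integrable lborel (\<lambda>x. max 0 (F x) * c x)" "integrable lborel (\<lambda>x. max 0 (- F x) * c x)"
    by (rule Bochner_Integration.integrable_bound[OF Fc[OF c]]; auto simp: abs_mult intro!: AE_I2 mult_right_mono)+
  have "signed_int \<rho> F = (LINT x|lborel. max 0 (F x) * c x) - (LINT x|lborel. max 0 (- F x) * c x)"
    unfolding signed_int_def
    using test_fun_integral[OF F s(1) lf(1)] test_fun_integral[OF F s(2) lf(2)] part[OF F] part[OF test_fun_uminus[OF F]] by simp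
  also have "\<dots> = (LINT x|lborel. max 0 (F x) * c x - max 0 (- F x) * c x)"
    by (rule Bochner_Integration.integral_diff[OF FI, symmetric])
  also have "\<dots> = (LINT x|lborel. F x * c x)"
    by (intro Bochner_Integration.integral_cong refl) (simp add: max_def)
  finally show ?thesis .
qed

section \<open>Identification of the cumulant measure with the one-cluster term\<close>

lemma shot_add:
  assumes x: "x \<in> space marks" and [measurable]: "f \<in> borel_measurable borel" "g \<in> borel_measurable borel"
  shows "shot u x (\<lambda>a. f a + g a) = shot u x f + shot u x g"
proof -
  have [measurable_cong]: "sets (snd x) = sets borel" by (rule sets_counting[OF snd_marks[OF x]])
  show ?thesis unfolding shot_def by (rule nn_integral_add) measurable
qed

lemma shot_SUP:
  assumes x: "x \<in> space marks" and F [measurable]: "\<And>i::nat. F i \<in> borel_measurable borel" and inc: "\<And>a. incseq (\<lambda>i. F i a)"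
  shows "shot u x (\<lambda>a. SUP i. F i a) = (SUP i. shot u x (F i))"
proof -
  have [measurable_cong]: "sets (snd x) = sets borel" by (rule sets_counting[OF snd_marks[OF x]])
  show ?thesis unfolding shot_def
    by (rule nn_integral_monotone_convergence_SUP) (use inc in \<open>auto simp: incseq_def le_fun_def\<close>)
qed

lemma incseq_shot: "(\<And>a. incseq (\<lambda>i::nat. F i a)) \<Longrightarrow> incseq (\<lambda>i. shot u x (F i))"
  unfolding incseq_def by (auto intro!: shot_mono)

text \<open>The arguments are reversed because the derivative in \<open>s\<^sub>2\<close> is taken first.\<close>

definition off_diagonal :: "(real \<times> real \<times> real \<Rightarrow> ennreal) \<Rightarrow> real \<Rightarrow> real \<Rightarrow> real \<Rightarrow> ennreal" where
  "off_diagonal G a b c = (if a = b \<or> a = c \<or> b = c then 0 else G (c, b, a))"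

lemma off_diagonal_measurable:
  assumes "G \<in> borel_measurable borel"
  shows "(\<lambda>(a, b, c). off_diagonal G a b c) \<in> borel_measurable (borel \<Otimes>\<^sub>M borel \<Otimes>\<^sub>M borel)"
proof -
  have [measurable]: "G \<in> borel_measurable (borel \<Otimes>\<^sub>M borel \<Otimes>\<^sub>M borel)" using assms by (simp add: borel_prod)
  show ?thesis unfolding off_diagonal_def case_prod_unfold by measurable
qed

lemma off_diagonal_measurable' [measurable (raw)]:
  assumes G: "G \<in> borel_measurable borel" and [measurable]: "a \<in> borel_measurable N" "b \<in> borel_measurable N" "c \<in> borel_measurable N"
  shows "(\<lambda>p. off_diagonal G (a p) (b p) (c p)) \<in> borel_measurable N"
  using measurable_compose[of "\<lambda>p. (a p, b p, c p)" N _ _ borel, OF _ off_diagonal_measurable[OF G]] by simp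

context cluster_points
begin

text \<open>Additivity, homogeneity and monotone convergence pass through the three shots, the
  integral over the centre and the integral over the mark in turn.\<close>

lemma sigma_linear_K3: "sigma_linear (\<lambda>G. K3 (off_diagonal G))"
  unfolding sigma_linear_def
proof (intro conjI ballI allI impI)
  fix f g :: "real \<times> real \<times> real \<Rightarrow> ennreal"
  assume [measurable]: "f \<in> borel_measurable borel" "g \<in> borel_measurable borel"
  have o: "off_diagonal (\<lambda>x. f x + g x) a b = (\<lambda>c. off_diagonal f a b c + off_diagonal g a b c)" for a b by (auto simp: off_diagonal_def)
  have "K3 (off_diagonal (\<lambda>x. f x + g x)) = ennreal \<nu> * (\<integral>\<^sup>+x. (\<integral>\<^sup>+u. shot u x (\<lambda>a. shot u x (\<lambda>b. shot u x (\<lambda>c. off_diagonal f a b c))) \<partial>lborel)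
      + (\<integral>\<^sup>+u. shot u x (\<lambda>a. shot u x (\<lambda>b. shot u x (\<lambda>c. off_diagonal g a b c))) \<partial>lborel) \<partial>Q)"
    unfolding K3_def o by (intro arg_cong[where f = "(*) _"] nn_integral_cong) (simp add: shot_add nn_integral_add)
  also have "\<dots> = K3 (off_diagonal f) + K3 (off_diagonal g)"
    unfolding K3_def by (subst nn_integral_add) (simp_all add: distrib_left)
  finally show "K3 (off_diagonal (\<lambda>x. f x + g x)) = K3 (off_diagonal f) + K3 (off_diagonal g)" .
next
  fix f :: "real \<times> real \<times> real \<Rightarrow> ennreal" and c
  assume [measurable]: "f \<in> borel_measurable borel"
  have o: "off_diagonal (\<lambda>x. c * f x) a b = (\<lambda>d. c * off_diagonal f a b d)" for a b by (auto simp: off_diagonal_def)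
  have "K3 (off_diagonal (\<lambda>x. c * f x)) = ennreal \<nu> * (\<integral>\<^sup>+x. c * (\<integral>\<^sup>+u. shot u x (\<lambda>a. shot u x (\<lambda>b. shot u x (\<lambda>c. off_diagonal f a b c))) \<partial>lborel) \<partial>Q)"
    unfolding K3_def o by (intro arg_cong[where f = "(*) _"] nn_integral_cong) (simp add: shot_cmult nn_integral_cmult)
  also have "\<dots> = c * K3 (off_diagonal f)"
    unfolding K3_def by (subst nn_integral_cmult) (simp_all add: mult.left_commute)
  finally show "K3 (off_diagonal (\<lambda>x. c * f x)) = c * K3 (off_diagonal f)" .
next
  fix F :: "nat \<Rightarrow> real \<times> real \<times> real \<Rightarrow> ennreal" assume F: "(\<forall>i. F i \<in> borel_measurable borel) \<and> incseq F"
  then have [measurable]: "F i \<in> borel_measurable borel" for i by auto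
  have inc0: "incseq (\<lambda>i. off_diagonal (F i) a b c)" for a b c
    using F by (auto simp: off_diagonal_def incseq_def le_fun_def)
  have inc1: "incseq (\<lambda>i. shot u x (\<lambda>c. off_diagonal (F i) a b c))" for u x a b
    by (rule incseq_shot[OF inc0])
  have inc2: "incseq (\<lambda>i. shot u x (\<lambda>b. shot u x (\<lambda>c. off_diagonal (F i) a b c)))" for u x a
    by (rule incseq_shot[OF inc1])
  have inc3: "incseq (\<lambda>i. shot u x (\<lambda>a. shot u x (\<lambda>b. shot u x (\<lambda>c. off_diagonal (F i) a b c))))" for u x
    by (rule incseq_shot[OF inc2])
  have o: "off_diagonal (\<lambda>x. SUP i. F i x) a b = (\<lambda>c. SUP i. off_diagonal (F i) a b c)" for a b by (auto simp: off_diagonal_def fun_eq_iff)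
  have "K3 (off_diagonal (\<lambda>x. SUP i. F i x)) = ennreal \<nu> * (\<integral>\<^sup>+x. \<integral>\<^sup>+u. (SUP i. shot u x (\<lambda>a. shot u x (\<lambda>b. shot u x (\<lambda>c. off_diagonal (F i) a b c)))) \<partial>lborel \<partial>Q)"
    unfolding K3_def o by (intro arg_cong[where f = "(*) _"] nn_integral_cong) (simp add: shot_SUP inc0 inc1 inc2)
  also have "\<dots> = ennreal \<nu> * (\<integral>\<^sup>+x. (SUP i. \<integral>\<^sup>+u. shot u x (\<lambda>a. shot u x (\<lambda>b. shot u x (\<lambda>c. off_diagonal (F i) a b c))) \<partial>lborel) \<partial>Q)"
    by (intro arg_cong[where f = "(*) _"] nn_integral_cong nn_integral_monotone_convergence_SUP)
       (use inc3 in \<open>auto simp: incseq_def le_fun_def\<close>)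
  also have "\<dots> = ennreal \<nu> * (SUP i. \<integral>\<^sup>+x. \<integral>\<^sup>+u. shot u x (\<lambda>a. shot u x (\<lambda>b. shot u x (\<lambda>c. off_diagonal (F i) a b c))) \<partial>lborel \<partial>Q)"
    by (intro arg_cong[where f = "(*) _"] nn_integral_monotone_convergence_SUP)
       (use inc3 in \<open>auto simp: incseq_def le_fun_def intro!: nn_integral_mono\<close>)
  also have "\<dots> = (SUP i. K3 (off_diagonal (F i)))"
    unfolding K3_def by (simp add: SUP_mult_left_ennreal)
  finally show "K3 (off_diagonal (\<lambda>x. SUP i. F i x)) = (SUP i. K3 (off_diagonal (F i)))" .
qed

text \<open>The cumulant condition is tested with the indicators of the three sides of a cube, where
  uniqueness of the mixed derivative turns it into \<open>k3\<close>. Consequently the cumulant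
  measure is the one-cluster term on distinct points; in particular it is nonnegative, although
  \<open>\<kappa>\<close> is given as a difference.\<close>

lemma cumulant_nn_integral:
  assumes \<kappa>: "factorial_cumulant3 M N \<kappa>" and f: "f \<in> borel_measurable borel"
  shows "(\<integral>\<^sup>+x. f x \<partial>fst \<kappa>) = K3 (off_diagonal f) + (\<integral>\<^sup>+x. f x \<partial>snd \<kappa>)"
proof -
  have r: "signed_radon \<kappa>" using \<kappa> by (simp add: factorial_cumulant3_def)
  have s: "sets (fst \<kappa>) = sets borel" "sets (snd \<kappa>) = sets borel"
    and lf: "\<And>K. compact K \<Longrightarrow> emeasure (fst \<kappa>) K < \<infinity>" "\<And>K. compact K \<Longrightarrow> emeasure (snd \<kappa>) K < \<infinity>"
    using r by (auto simp: signed_radon_def)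
  let ?L1 = "\<lambda>f. (\<integral>\<^sup>+x. f x * 1 \<partial>fst \<kappa>)"
  let ?L2 = "\<lambda>f. K3 (off_diagonal f) + (\<integral>\<^sup>+x. f x * 1 \<partial>snd \<kappa>)"
  have "?L1 f = ?L2 f"
  proof (rule sigma_linear_eqI[of ?L1 ?L2, OF _ _ _ _ f])
    show "sigma_linear ?L1"
      by (rule sigma_linear_nn_integral[OF s(1)]) simp
    show "sigma_linear ?L2"
      by (rule sigma_linear_add[OF sigma_linear_K3 sigma_linear_nn_integral[OF s(2)]]) simp
    fix n and m :: "real \<times> real \<times> real \<Rightarrow> int"
    let ?A = "dyadic_cell n (m (1, 0, 0))" and ?B = "dyadic_cell n (m (0, 1, 0))" and ?C = "dyadic_cell n (m (0, 0, 1))"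
    have cube: "dyadic_cube n m = ?A \<times> ?B \<times> ?C"
      unfolding dyadic_cube_prod[of n m] dyadic_cube_prod[of n "\<lambda>b. m (0, b)"] zero_prod_def
        dyadic_cube_real[of n "\<lambda>b. m (b, 0, 0)"] dyadic_cube_real[of n "\<lambda>b. m (0, b, 0)"] dyadic_cube_real[of n "\<lambda>b. m (0, 0, b)"] ..
    have bc: "bounded (dyadic_cell n k)" for k by (rule bounded_subset[OF bounded_closed_interval bounded_dyadic_cell])
    have bd: "bounded (dyadic_cube n m)" unfolding cube by (intro bounded_Times bc)
    have cpt: "compact (closure (dyadic_cube n m))" using bd by (simp add: compact_closure)
    have fin: "emeasure \<mu> (dyadic_cube n m) < \<infinity>" if "sets \<mu> = sets borel" "emeasure \<mu> (closure (dyadic_cube n m)) < \<infinity>" for \<mu> :: "(real \<times> real \<times> real) measure"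
      using that by (intro order_le_less_trans[OF emeasure_mono[OF closure_subset] that(2)]) (simp add: borel_closed)
    note fin1 = fin[OF s(1) lf(1)[OF cpt]] and fin2 = fin[OF s(2) lf(2)[OF cpt]]
    \<comment> \<open>The union of the three sides is a common bounded set for the three indicators,
      whose common bound is 1.\<close>
    define B where "B = ?A \<union> ?B \<union> ?C"
    have Bm: "B \<in> sets borel" "bounded B" unfolding B_def using bc by auto
    have tf_iff: "tf B 1 f \<longleftrightarrow> f \<in> borel_measurable borel \<and> (\<forall>x. 0 \<le> f x \<and> f x \<le> 1) \<and> (\<forall>x. x \<notin> B \<longrightarrow> f x = 0)" for f :: "real \<Rightarrow> real"
      using Bm by (simp add: tf_def)
    have t: "tf B 1 (indicator ?A)" "tf B 1 (indicator ?B)" "tf B 1 (indicator ?C)"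
      unfolding tf_iff by (simp_all add: B_def indicator_def)
    have ts: "test_fun (indicator (dyadic_cell n k) :: real \<Rightarrow> real)" for k
    proof -
      have "fun_supp (indicator (dyadic_cell n k) :: real \<Rightarrow> real) = closure (dyadic_cell n k)"
        unfolding fun_supp_def by (rule arg_cong[where f = closure]) (auto simp: indicator_def)
      moreover have "bounded (range (indicator (dyadic_cell n k) :: real \<Rightarrow> real))"
        by (rule boundedI[of _ 1]) (auto simp: indicator_def)
      ultimately show ?thesis using bc[of k] by (simp add: test_fun_def compact_closure)
    qed
    have cum: "has_mixed_left_derivative3 (\<lambda>s0 s1 s2. ln (pgfl M N (\<lambda>x. s0 * f0 x + s1 * f1 x + s2 * f2 x)))
        (signed_int \<kappa> (\<lambda>(t0, t1, t2). f0 t0 * f1 t1 * f2 t2))"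
      if "test_fun f0" "test_fun f1" "test_fun f2" "\<And>x. 0 \<le> f0 x" "\<And>x. 0 \<le> f1 x" "\<And>x. 0 \<le> f2 x" for f0 f1 f2
      using \<kappa> that unfolding factorial_cumulant3_def by blast
    have "has_mixed_left_derivative3 (\<lambda>s0 s1 s2. ln (pgfl M N (\<lambda>x. s0 * indicator ?A x + s1 * indicator ?B x + s2 * indicator ?C x)))
        (signed_int \<kappa> (\<lambda>(t0, t1, t2). indicator ?A t0 * indicator ?B t1 * indicator ?C t2))"
      by (rule cum) (use ts in simp_all)
    \<comment> \<open>The prescribed and the computed derivative coincide; the sides then appear in
      reverse order, which matches \<open>off_diagonal\<close>.\<close>
    from has_mixed_left_derivative3_unique[OF this mixed_derivative_log_pgfl[OF Bm zero_less_one t]]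
    have "signed_int \<kappa> (\<lambda>(t0, t1, t2). indicator ?A t0 * indicator ?B t1 * indicator ?C t2) = k3 (indicator ?C) (indicator ?B) (indicator ?A)" .
    also have "(\<lambda>(t0, t1, t2). indicator ?A t0 * indicator ?B t1 * indicator ?C t2 :: real) = indicator (dyadic_cube n m)"
      unfolding cube by (auto simp: indicator_def fun_eq_iff)
    finally have "measure (fst \<kappa>) (dyadic_cube n m) - measure (snd \<kappa>) (dyadic_cube n m) = k3 (indicator ?C) (indicator ?B) (indicator ?A)"
      unfolding signed_int_def using s by simp
    then have eq: "measure (fst \<kappa>) (dyadic_cube n m) = k3 (indicator ?C) (indicator ?B) (indicator ?A) + measure (snd \<kappa>) (dyadic_cube n m)" by simp
    have "(\<lambda>a b c. ennreal (off3 (indicator ?C) (indicator ?B) (indicator ?A) a b c)) = off_diagonal (indicator (dyadic_cube n m))"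
      unfolding cube by (auto simp: fun_eq_iff off3_def off_diagonal_def indicator_def)
    then have k: "K3 (off_diagonal (indicator (dyadic_cube n m))) = ennreal (k3 (indicator ?C) (indicator ?B) (indicator ?A))"
      using K3_k3[OF Bm zero_less_one t(3) t(2) t(1)] by simp
    have i: "(\<integral>\<^sup>+x. indicator (dyadic_cube n m) x * 1 \<partial>fst \<kappa>) = ennreal (measure (fst \<kappa>) (dyadic_cube n m))"
      "(\<integral>\<^sup>+x. indicator (dyadic_cube n m) x * 1 \<partial>snd \<kappa>) = ennreal (measure (snd \<kappa>) (dyadic_cube n m))"
      using s fin1 fin2 by (simp_all add: emeasure_eq_ennreal_measure)
    have "0 \<le> k3 (indicator ?C) (indicator ?B) (indicator ?A)" by (simp add: k3_def)
    then show "?L1 (indicator (dyadic_cube n m)) = ?L2 (indicator (dyadic_cube n m))"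
      unfolding i k eq by simp
    show "?L1 (indicator (dyadic_cube n m)) \<noteq> \<infinity>" unfolding i by simp
  qed
  then show ?thesis by simp
qed

text \<open>The two components of \<open>\<kappa>\<close> may share a common part. It is finite on
  the support of the test function and cancels in the difference.\<close>

lemma cumulant_signed_int:
  assumes \<kappa>: "factorial_cumulant3 M N \<kappa>" and G: "test_fun G"
  shows "signed_int \<kappa> G = enn2real (K3 (off_diagonal (\<lambda>x. ennreal (G x)))) - enn2real (K3 (off_diagonal (\<lambda>x. ennreal (- G x))))"
proof -
  have r: "signed_radon \<kappa>" using \<kappa> by (simp add: factorial_cumulant3_def)
  have s: "sets (fst \<kappa>) = sets borel" "sets (snd \<kappa>) = sets borel"
    and lf: "\<And>K. compact K \<Longrightarrow> emeasure (fst \<kappa>) K < \<infinity>" "\<And>K. compact K \<Longrightarrow> emeasure (snd \<kappa>) K < \<infinity>"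
    using r by (auto simp: signed_radon_def)
  have *: "enn2real (\<integral>\<^sup>+x. ennreal (H x) \<partial>fst \<kappa>) - enn2real (\<integral>\<^sup>+x. ennreal (H x) \<partial>snd \<kappa>) = enn2real (K3 (off_diagonal (\<lambda>x. ennreal (H x))))"
    if H: "test_fun H" for H
  proof -
    have [measurable]: "H \<in> borel_measurable borel" using H by (simp add: test_fun_def)
    have m: "(\<lambda>x. ennreal (H x)) \<in> borel_measurable borel" by measurable
    note eq = cumulant_nn_integral[OF \<kappa> m]
    have f1: "(\<integral>\<^sup>+x. ennreal (H x) \<partial>fst \<kappa>) < \<infinity>" "(\<integral>\<^sup>+x. ennreal (H x) \<partial>snd \<kappa>) < \<infinity>"
      using test_fun_nn_integral_finite(1)[OF H s(1) lf(1)] test_fun_nn_integral_finite(1)[OF H s(2) lf(2)] by auto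
    then have "K3 (off_diagonal (\<lambda>x. ennreal (H x))) < \<infinity>" unfolding eq by (simp add: less_top)
    then have "enn2real (\<integral>\<^sup>+x. ennreal (H x) \<partial>fst \<kappa>) = enn2real (K3 (off_diagonal (\<lambda>x. ennreal (H x)))) + enn2real (\<integral>\<^sup>+x. ennreal (H x) \<partial>snd \<kappa>)"
      unfolding eq using f1(2) by (intro enn2real_plus) auto
    then show ?thesis by simp
  qed
  show ?thesis
    unfolding signed_int_def
    using test_fun_integral[OF G s(1) lf(1)] test_fun_integral[OF G s(2) lf(2)] *[OF G] *[OF test_fun_uminus[OF G]] by linarith
qed

end

section \<open>Fourier inversion and window asymptotics\<close>

lemma integrable_std_normal_iexp: "integrable lborel (\<lambda>x. iexp (t * x) * complex_of_real (std_normal_density x))"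
proof (rule Bochner_Integration.integrable_bound[of _ std_normal_density])
  show "integrable lborel std_normal_density" by simp
  show "AE x in lborel. norm (iexp (t * x) * complex_of_real (std_normal_density x)) \<le> norm (std_normal_density x)"
    by (simp add: norm_mult)
qed measurable

lemma integral_std_normal_iexp: "(LINT x|lborel. iexp (t * x) * complex_of_real (std_normal_density x)) = complex_of_real (exp (- (t\<^sup>2) / 2))"
proof -
  have "char std_normal_distribution t = (LINT x|lborel. std_normal_density x *\<^sub>R iexp (t * x))"
    unfolding char_def by (subst integral_density) auto
  then show ?thesis
    by (simp add: char_std_normal_distribution scaleR_conv_of_real mult.commute)
qed

text \<open>The characteristic function of the standard normal law after the substitution
  \<open>x = \<sigma> * w\<close>; the factor \<open>sqrt (2 * pi)\<close> is the missing
  normalisation of the density.\<close>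

lemma gauss_fourier1:
  assumes "0 < \<sigma>"
  shows "integrable lborel (\<lambda>w. iexp (w * y) * complex_of_real (exp (- (\<sigma> * w)\<^sup>2 / 2)))" (is ?I)
    and "(LINT w|lborel. iexp (w * y) * complex_of_real (exp (- (\<sigma> * w)\<^sup>2 / 2)))
      = complex_of_real (sqrt (2 * pi) / \<sigma> * exp (- ((y / \<sigma>)\<^sup>2) / 2))" (is "?L = ?R")
proof -
  let ?f = "\<lambda>x. iexp (y / \<sigma> * x) * complex_of_real (std_normal_density x)"
  have eq: "iexp (w * y) * complex_of_real (exp (- (\<sigma> * w)\<^sup>2 / 2)) = complex_of_real (sqrt (2 * pi)) * ?f (0 + \<sigma> * w)" for w
    using assms by (simp add: std_normal_density_def mult_ac)
  have "integrable lborel (\<lambda>w. ?f (0 + \<sigma> * w))"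
    using assms integrable_std_normal_iexp[of "y / \<sigma>"] by (subst lborel_integrable_real_affine_iff) auto
  then show ?I unfolding eq by (rule integrable_mult_right)
  have "(LINT x|lborel. ?f x) = \<bar>\<sigma>\<bar> *\<^sub>R (LINT w|lborel. ?f (0 + \<sigma> * w))"
    using assms by (intro lborel_integral_real_affine) auto
  then have "(LINT w|lborel. ?f (0 + \<sigma> * w)) = complex_of_real (exp (- ((y / \<sigma>)\<^sup>2) / 2)) / complex_of_real \<sigma>"
    using assms unfolding integral_std_normal_iexp by (simp add: scaleR_conv_of_real field_simps)
  moreover have "?L = complex_of_real (sqrt (2 * pi)) * (LINT w|lborel. ?f (0 + \<sigma> * w))"
    unfolding eq by (rule integral_mult_right_zero)
  ultimately show "?L = ?R" by (simp only:) simp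
qed

lemma integral_lborel_product:
  fixes f h :: "real \<Rightarrow> complex"
  assumes f: "integrable lborel f" and h: "integrable lborel h"
  shows "integrable lborel (\<lambda>z. f (fst z) * h (snd z))"
    and "(LINT z|lborel. f (fst z) * h (snd z)) = (LINT x|lborel. f x) * (LINT y|lborel. h y)"
proof -
  have [measurable]: "f \<in> borel_measurable borel" "h \<in> borel_measurable borel"
    using f h by auto
  have I: "integrable (lborel \<Otimes>\<^sub>M lborel) (\<lambda>z. f (fst z) * h (snd z))"
  proof (rule lborel_pair.Fubini_integrable)
    show "integrable lborel (\<lambda>x. LINT y|lborel. norm (f (fst (x, y)) * h (snd (x, y))))"
      using integrable_norm[OF f] by (simp add: norm_mult)
    show "AE x in lborel. integrable lborel (\<lambda>y. f (fst (x, y)) * h (snd (x, y)))"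
      using h by simp
  qed measurable
  then show "integrable lborel (\<lambda>z. f (fst z) * h (snd z))" by (simp add: lborel_prod)
  have "(LINT z|(lborel \<Otimes>\<^sub>M lborel). f (fst z) * h (snd z)) = (LINT x|lborel. LINT y|lborel. f x * h y)"
    using lborel_pair.integral_fst'[OF I] by simp
  then show "(LINT z|lborel. f (fst z) * h (snd z)) = (LINT x|lborel. f x) * (LINT y|lborel. h y)"
    by (simp add: lborel_prod)
qed

lemma gauss_fourier2:
  fixes y :: "real \<times> real"
  assumes s: "0 < \<sigma>"
  shows "integrable lborel (\<lambda>w. iexp (w \<bullet> y) * complex_of_real (exp (- \<sigma>\<^sup>2 * (w \<bullet> w) / 2)))" (is ?I)
    and "(LINT w|lborel. iexp (w \<bullet> y) * complex_of_real (exp (- \<sigma>\<^sup>2 * (w \<bullet> w) / 2)))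
      = complex_of_real (2 * pi / \<sigma>\<^sup>2 * exp (- (y \<bullet> y) / \<sigma>\<^sup>2 / 2))" (is "?L = ?R")
proof -
  let ?f = "\<lambda>y w. iexp (w * y) * complex_of_real (exp (- (\<sigma> * w)\<^sup>2 / 2))"
  have eq: "iexp (w \<bullet> y) * complex_of_real (exp (- \<sigma>\<^sup>2 * (w \<bullet> w) / 2)) = ?f (fst y) (fst w) * ?f (snd y) (snd w)" for w
  proof -
    have "iexp (w \<bullet> y) = iexp (fst w * fst y) * iexp (snd w * snd y)"
      by (simp add: inner_prod_def exp_add[symmetric] algebra_simps)
    moreover have "exp (- \<sigma>\<^sup>2 * (w \<bullet> w) / 2) = exp (- (\<sigma> * fst w)\<^sup>2 / 2) * exp (- (\<sigma> * snd w)\<^sup>2 / 2)"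
      by (simp add: inner_prod_def exp_add[symmetric] power2_eq_square field_simps)
    ultimately show ?thesis by (simp only: of_real_mult mult_ac)
  qed
  show ?I unfolding eq by (rule integral_lborel_product(1)) (rule gauss_fourier1[OF s])+
  have "?L = (LINT w|lborel. ?f (fst y) w) * (LINT w|lborel. ?f (snd y) w)"
    unfolding eq by (rule integral_lborel_product(2)) (rule gauss_fourier1[OF s])+
  also have "\<dots> = complex_of_real ((sqrt (2 * pi) / \<sigma> * exp (- ((fst y / \<sigma>)\<^sup>2) / 2)) * (sqrt (2 * pi) / \<sigma> * exp (- ((snd y / \<sigma>)\<^sup>2) / 2)))"
    unfolding gauss_fourier1(2)[OF s] by simp
  also have "(sqrt (2 * pi) / \<sigma> * exp (- ((fst y / \<sigma>)\<^sup>2) / 2)) * (sqrt (2 * pi) / \<sigma> * exp (- ((snd y / \<sigma>)\<^sup>2) / 2))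
      = (sqrt (2 * pi) * sqrt (2 * pi)) / \<sigma>\<^sup>2 * (exp (- ((fst y / \<sigma>)\<^sup>2) / 2) * exp (- ((snd y / \<sigma>)\<^sup>2) / 2))"
    by (simp add: power2_eq_square)
  also have "exp (- ((fst y / \<sigma>)\<^sup>2) / 2) * exp (- ((snd y / \<sigma>)\<^sup>2) / 2) = exp (- (y \<bullet> y) / \<sigma>\<^sup>2 / 2)"
    unfolding exp_add[symmetric] inner_prod_def by (simp add: power_divide power2_eq_square add_divide_distrib diff_divide_distrib)
  finally show "?L = ?R" by simp
qed

lemma integral_lborel_affine2:
  fixes f :: "real \<times> real \<Rightarrow> real"
  assumes [measurable]: "f \<in> borel_measurable borel" and "0 < \<sigma>"
  shows "(LINT t|lborel. f t) = \<sigma>\<^sup>2 * (LINT z|lborel. f (s + \<sigma> *\<^sub>R z))"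
proof -
  have "(LINT t|lborel. f t) = (LINT t|density (distr lborel borel (\<lambda>x. s + \<sigma> *\<^sub>R x)) (\<lambda>_. \<bar>\<sigma>\<bar> ^ DIM(real \<times> real)). f t)"
    using assms(2) by (subst lborel_affine[of \<sigma> s]) simp_all
  also have "\<dots> = (LINT z|lborel. \<bar>\<sigma>\<bar> ^ DIM(real \<times> real) * f (s + \<sigma> *\<^sub>R z))"
    using assms(2) by (subst integral_density) (auto simp: integral_distr)
  finally show ?thesis using assms(2) by (simp add: power2_eq_square)
qed

definition gauss2 :: "real \<times> real \<Rightarrow> real" where
  "gauss2 z = exp (- (z \<bullet> z) / 2) / (2 * pi)"

lemma gauss2_measurable [measurable]: "gauss2 \<in> borel_measurable borel"
  unfolding gauss2_def[abs_def] by measurable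

lemma gauss2_nonneg [simp]: "0 \<le> gauss2 z"
  by (simp add: gauss2_def)

lemma gauss2_integral: "integrable lborel gauss2" "(LINT z|lborel. gauss2 z) = 1"
proof -
  have *: "integrable lborel (\<lambda>w::real \<times> real. complex_of_real (exp (- (w \<bullet> w) / 2)))"
    "(LINT w::real \<times> real|lborel. complex_of_real (exp (- (w \<bullet> w) / 2))) = complex_of_real (2 * pi)"
    using gauss_fourier2[of 1 0] by simp_all
  have "integrable lborel (\<lambda>w::real \<times> real. exp (- (w \<bullet> w) / 2))"
    using integrable_Re[OF *(1)] by simp
  moreover have "(LINT w::real \<times> real|lborel. exp (- (w \<bullet> w) / 2)) = 2 * pi"
    using *(2) unfolding integral_complex_of_real by (simp only: of_real_eq_iff)
  ultimately show "integrable lborel gauss2" "(LINT z|lborel. gauss2 z) = 1"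
    unfolding gauss2_def[abs_def] by (auto simp: integral_divide_zero)
qed

lemma integrable_bounded_compact:
  fixes g :: "real \<times> real \<Rightarrow> real"
  assumes "g \<in> borel_measurable borel" "bounded (range g)" "compact (fun_supp g)"
  shows "integrable lborel g"
proof -
  obtain C where C: "\<And>x. \<bar>g x\<bar> \<le> C" using assms(2) by (auto simp: bounded_iff)
  have "integrable lborel (\<lambda>x. indicator (fun_supp g) x *\<^sub>R C)"
    using assms(3) emeasure_compact_finite[OF assms(3)] by (intro integrable_scaleR_left) (auto intro: borel_compact simp: integrable_indicator_iff)
  then show ?thesis
  proof (rule Bochner_Integration.integrable_bound)
    have z: "g x = 0" if "x \<notin> fun_supp g" for x
      using that closure_subset[of "{x. g x \<noteq> 0}"] by (auto simp: fun_supp_def)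
    show "AE x in lborel. norm (g x) \<le> norm (indicator (fun_supp g) x *\<^sub>R C)"
    proof (rule AE_I2)
      fix x show "norm (g x) \<le> norm (indicator (fun_supp g) x *\<^sub>R C)"
        using C[of x] z[of x] by (cases "x \<in> fun_supp g") simp_all
    qed
  qed (use assms(1) in simp)
qed

text \<open>The Gaussian factor makes the double integral over frequency and position absolutely
  convergent. Exchanging the integrals yields a Gaussian average of \<open>g\<close> of width
  \<open>\<sigma>\<close> around \<open>s\<close>, written with the scaled variable \<open>z\<close>
  so that the weight does not depend on \<open>\<sigma>\<close>.\<close>

lemma gauss_smoothing:
  fixes g :: "real \<times> real \<Rightarrow> real"
  assumes [measurable]: "g \<in> borel_measurable borel" and g: "integrable lborel g" and s: "0 < \<sigma>"
  shows "(LINT w|lborel. fourier2 g w * (iexp (w \<bullet> s) * complex_of_real (exp (- \<sigma>\<^sup>2 * (w \<bullet> w) / 2))))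
    = (2 * pi)\<^sup>2 * complex_of_real (LINT z|lborel. g (s + \<sigma> *\<^sub>R z) * gauss2 z)"
proof -
  let ?e = "\<lambda>w::real \<times> real. complex_of_real (exp (- \<sigma>\<^sup>2 * (w \<bullet> w) / 2))"
  let ?F = "\<lambda>w t. complex_of_real (g t) * (iexp (w \<bullet> (s - t)) * ?e w)"
  have e: "integrable lborel (\<lambda>w. norm (?e w))"
    using integrable_norm[OF gauss_fourier2(1)[OF s, of 0]] by simp
  have I: "integrable (lborel \<Otimes>\<^sub>M lborel) (\<lambda>(w, t). ?F w t)"
  proof (rule lborel_pair.Fubini_integrable)
    show "integrable lborel (\<lambda>w. LINT t|lborel. norm (case (w, t) of (w, t) \<Rightarrow> ?F w t))"
      using e by (simp add: norm_mult)
    show "AE w in lborel. integrable lborel (\<lambda>t. case (w, t) of (w, t) \<Rightarrow> ?F w t)"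
    proof (rule AE_I2)
      fix w
      have "integrable lborel (\<lambda>t. \<bar>g t\<bar> * norm (?e w))" using g by simp
      then show "integrable lborel (\<lambda>t. case (w, t) of (w, t) \<Rightarrow> ?F w t)"
        by (rule Bochner_Integration.integrable_bound) (auto simp: norm_mult)
    qed
  qed measurable
  have "fourier2 g w * (iexp (w \<bullet> s) * ?e w) = (LINT t|lborel. ?F w t)" for w
  proof -
    have "exp (- (\<i> * complex_of_real (w \<bullet> t))) * iexp (w \<bullet> s) = iexp (w \<bullet> (s - t))" for t
      unfolding exp_add[symmetric] by (simp add: inner_diff_right algebra_simps)
    then have "?F w t = complex_of_real (g t) * ((exp (- (\<i> * complex_of_real (w \<bullet> t))) * iexp (w \<bullet> s)) * ?e w)" for t
      by (simp only:)
    then have "exp (- (\<i> * complex_of_real (w \<bullet> t))) * complex_of_real (g t) * (iexp (w \<bullet> s) * ?e w) = ?F w t" for t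
      by (simp only: mult_ac)
    then show ?thesis unfolding fourier2_def integral_mult_left_zero[symmetric] by (simp only:)
  qed
  then have "(LINT w|lborel. fourier2 g w * (iexp (w \<bullet> s) * ?e w)) = (LINT w|lborel. LINT t|lborel. ?F w t)"
    by simp
  also have "\<dots> = (LINT t|lborel. LINT w|lborel. ?F w t)"
    using lborel_pair.Fubini_integral[OF I] by simp
  also have "\<dots> = (LINT t|lborel. complex_of_real (g t * (2 * pi / \<sigma>\<^sup>2 * exp (- ((s - t) \<bullet> (s - t)) / \<sigma>\<^sup>2 / 2))))"
    by (intro Bochner_Integration.integral_cong refl) (simp only: integral_mult_right_zero gauss_fourier2(2)[OF s] of_real_mult)
  also have "\<dots> = complex_of_real (LINT t|lborel. g t * (2 * pi / \<sigma>\<^sup>2 * exp (- ((s - t) \<bullet> (s - t)) / \<sigma>\<^sup>2 / 2)))"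
    by (rule integral_complex_of_real)
  also have "(LINT t|lborel. g t * (2 * pi / \<sigma>\<^sup>2 * exp (- ((s - t) \<bullet> (s - t)) / \<sigma>\<^sup>2 / 2)))
      = \<sigma>\<^sup>2 * (LINT z|lborel. g (s + \<sigma> *\<^sub>R z) * (2 * pi / \<sigma>\<^sup>2 * exp (- ((s - (s + \<sigma> *\<^sub>R z)) \<bullet> (s - (s + \<sigma> *\<^sub>R z))) / \<sigma>\<^sup>2 / 2)))"
    using s by (intro integral_lborel_affine2) auto
  also have "\<dots> = (LINT z|lborel. \<sigma>\<^sup>2 * (g (s + \<sigma> *\<^sub>R z) * (2 * pi / \<sigma>\<^sup>2 * exp (- ((s - (s + \<sigma> *\<^sub>R z)) \<bullet> (s - (s + \<sigma> *\<^sub>R z))) / \<sigma>\<^sup>2 / 2))))"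
    by (rule integral_mult_right_zero[symmetric])
  also have "\<dots> = (LINT z|lborel. (2 * pi)\<^sup>2 * (g (s + \<sigma> *\<^sub>R z) * gauss2 z))"
  proof (intro Bochner_Integration.integral_cong refl)
    fix z :: "real \<times> real"
    have "(s - (s + \<sigma> *\<^sub>R z)) \<bullet> (s - (s + \<sigma> *\<^sub>R z)) / \<sigma>\<^sup>2 = z \<bullet> z"
      using s by (simp add: power2_eq_square)
    then have "- ((s - (s + \<sigma> *\<^sub>R z)) \<bullet> (s - (s + \<sigma> *\<^sub>R z))) / \<sigma>\<^sup>2 / 2 = - (z \<bullet> z) / 2" by simp
    then show "\<sigma>\<^sup>2 * (g (s + \<sigma> *\<^sub>R z) * (2 * pi / \<sigma>\<^sup>2 * exp (- ((s - (s + \<sigma> *\<^sub>R z)) \<bullet> (s - (s + \<sigma> *\<^sub>R z))) / \<sigma>\<^sup>2 / 2)))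
      = (2 * pi)\<^sup>2 * (g (s + \<sigma> *\<^sub>R z) * gauss2 z)"
      using s unfolding gauss2_def by (simp only:) (simp add: power2_eq_square)
  qed
  also have "\<dots> = (2 * pi)\<^sup>2 * (LINT z|lborel. g (s + \<sigma> *\<^sub>R z) * gauss2 z)"
    by (rule integral_mult_right_zero)
  finally show ?thesis by simp
qed

section \<open>Reflection, translation and the effect of the window\<close>

lemma distr_lborel_uminus: "distr lborel borel uminus = (lborel :: 'a::euclidean_space measure)"
  using lborel_affine[of "- 1" "0 :: 'a"] by (simp add: density_1 uminus_add_conv_diff[symmetric] cong: distr_cong)

lemma integrable_reflect:
  fixes c :: "'a::euclidean_space \<Rightarrow> real"
  assumes "integrable lborel c"
  shows "integrable lborel (\<lambda>\<tau>. c (- \<tau>))"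
proof -
  have "integrable (distr lborel borel uminus) c" unfolding distr_lborel_uminus by (rule assms)
  then show ?thesis by (rule integrable_distr[rotated]) simp
qed

lemma integral_reflect:
  fixes c :: "'a::euclidean_space \<Rightarrow> real"
  assumes [measurable]: "c \<in> borel_measurable borel"
  shows "(LINT \<tau>|lborel. c (- \<tau>)) = (LINT \<tau>|lborel. c \<tau>)"
  using integral_distr[of uminus lborel borel c] by (simp add: distr_lborel_uminus)

lemma integral_translate:
  fixes f :: "'a::euclidean_space \<Rightarrow> real"
  assumes [measurable]: "f \<in> borel_measurable borel"
  shows "(LINT t|lborel. f (a + t)) = (LINT t|lborel. f t)"
  using integral_distr[of "(+) a" lborel borel f] by (simp add: lborel_distr_plus)

lemma window_mean_asymptotics:
  fixes c g :: "real \<times> real \<Rightarrow> real"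
  assumes c: "integrable lborel c" and g [measurable]: "g \<in> borel_measurable borel" and bnd: "bounded (range g)"
    and supp: "fun_supp g \<subseteq> {-H..H} \<times> {-H..H}"
  shows "(\<lambda>T. window_mean c g T - limit_mean c g) \<in> O[at_top](\<lambda>T. 1 / T)"
proof -
  have cm [measurable]: "c \<in> borel_measurable borel" using c by auto
  obtain K where K: "\<And>x. \<bar>g x\<bar> \<le> K" using bnd by (auto simp: bounded_iff)
  have om [measurable]: "odd_part c \<in> borel_measurable borel" unfolding odd_part_def[abs_def] by measurable
  have "integrable lborel (\<lambda>\<tau>. c (- \<tau>))"
    by (rule integrable_reflect[OF c])
  then have o: "integrable lborel (odd_part c)" unfolding odd_part_def[abs_def] using c by auto
  have go: "integrable lborel (\<lambda>\<tau>. g \<tau> * odd_part c \<tau>)"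
    by (rule Bochner_Integration.integrable_bound[of _ "\<lambda>\<tau>. K * odd_part c \<tau>"])
       (use o K in \<open>auto simp: abs_mult intro!: mult_mono order_trans[OF K abs_ge_self]\<close>)
  define A where "A = (LINT \<tau>|lborel. \<bar>g \<tau> * odd_part c \<tau>\<bar>)"
  have A: "0 \<le> A" unfolding A_def by simp
  \<comment> \<open>The absolute value also covers a negative \<open>H\<close>, for which the
    support is empty and \<open>H\<close> itself could not be the length of a strip.\<close>
  define h where "h = \<bar>H\<bar>"
  have g0: "g (a, b) = 0" if "\<bar>a\<bar> > h \<or> \<bar>b\<bar> > h" for a b
  proof (rule ccontr)
    assume "g (a, b) \<noteq> 0"
    then have "(a, b) \<in> fun_supp g" using closure_subset[of "{x. g x \<noteq> 0}"] by (auto simp: fun_supp_def)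
    then have "(a, b) \<in> {-H..H} \<times> {-H..H}" using supp by blast
    then show False using that unfolding h_def by (auto simp: abs_le_iff)
  qed
  have main: "\<bar>window_mean c g T - limit_mean c g\<bar> \<le> 2 * h * A * (1 / T)" if T: "T > 0" for T
  proof -
    define W where "W x = {\<tau>::real \<times> real. 0 \<le> x + fst \<tau> \<and> x + fst \<tau> \<le> T \<and> 0 \<le> x + snd \<tau> \<and> x + snd \<tau> \<le> T}" for x
    define v where "v x = (LINT \<tau>|lborel. g \<tau> * indicator (W x) \<tau> * odd_part c \<tau>)" for x
    have Wm: "W x \<in> sets borel" for x 
      by (intro borel_closed) (auto simp: W_def intro!: closed_Collect_conj closed_Collect_le continuous_intros)
    have ind: "(\<lambda>p. indicator (W (fst p)) (snd p) :: real) \<in> borel_measurable (lborel \<Otimes>\<^sub>M lborel)"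
    proof -
      have "closed {p::real \<times> real \<times> real. snd p \<in> W (fst p)}"
        unfolding W_def mem_Collect_eq by (intro closed_Collect_conj closed_Collect_le continuous_intros)
      then have "{p \<in> space (lborel \<Otimes>\<^sub>M lborel). snd p \<in> W (fst p)} \<in> sets (lborel \<Otimes>\<^sub>M lborel)"
        unfolding lborel_prod by (simp add: borel_closed)
      then show ?thesis by (rule borel_measurable_indicator')
    qed
    have int: "integrable lborel (\<lambda>\<tau>. g \<tau> * indicator (W x) \<tau> * odd_part c \<tau>)" for x
      by (rule Bochner_Integration.integrable_bound[OF go]) (use Wm in \<open>auto simp: indicator_def\<close>)
    have [measurable]: "v \<in> borel_measurable lborel"
      unfolding v_def using ind by (intro lborel.borel_measurable_lebesgue_integral) (simp add: case_prod_unfold)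
    have diff: "v x - limit_mean c g = (LINT \<tau>|lborel. g \<tau> * indicator (- W x) \<tau> * - odd_part c \<tau>)" for x
    proof -
      have "v x - limit_mean c g = (LINT \<tau>|lborel. g \<tau> * indicator (W x) \<tau> * odd_part c \<tau> - g \<tau> * odd_part c \<tau>)"
        unfolding v_def limit_mean_def by (rule Bochner_Integration.integral_diff[OF int go, symmetric])
      also have "\<dots> = (LINT \<tau>|lborel. g \<tau> * indicator (- W x) \<tau> * - odd_part c \<tau>)"
        by (intro Bochner_Integration.integral_cong refl) (simp add: indicator_def)
      finally show ?thesis .
    qed
    have b1: "\<bar>v x - limit_mean c g\<bar> \<le> A" for x
      unfolding diff A_def
      by (rule order_trans[OF integral_abs_bound integral_mono']) (use go in \<open>auto simp: indicator_def\<close>)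
    have b0: "v x - limit_mean c g = 0" if "h < x" "x < T - h" for x
    proof -
      have z: "g \<tau> * indicator (- W x) \<tau> * - odd_part c \<tau> = 0" for \<tau>
      proof (cases "\<bar>fst \<tau>\<bar> \<le> h \<and> \<bar>snd \<tau>\<bar> \<le> h")
        case True
        then have "\<tau> \<in> W x" using that unfolding W_def by (auto simp: abs_le_iff)
        then show ?thesis by simp
      next
        case False
        then show ?thesis using g0[of "fst \<tau>" "snd \<tau>"] by auto
      qed
      show ?thesis unfolding diff z by simp
    qed
    let ?J = "\<lambda>x. indicator {0..T} x *\<^sub>R (v x - limit_mean c g)"
    \<comment> \<open>The two boundary strips may overlap or leave the window; adding both bounds
      keeps the estimate valid for every positive \<open>T\<close>.\<close>
    have bJ: "\<bar>?J x\<bar> \<le> A * indicator {0..h} x + A * indicator {T - h..T} x" for x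
      using b1[of x] b0[of x] A T by (auto simp: indicator_def)
    have iJ: "integrable lborel (\<lambda>x. A * indicator {0..h} x + A * indicator {T - h..T} x :: real)"
      by (intro Bochner_Integration.integrable_add integrable_mult_right integrable_real_indicator) (auto simp: emeasure_lborel_Icc_eq)
    have J: "integrable lborel ?J"
      by (rule Bochner_Integration.integrable_bound[OF iJ]) (use bJ in \<open>auto intro!: AE_I2 order_trans[OF bJ abs_ge_self] simp del: real_scaleR_def\<close>)
    have c1: "integrable lborel (\<lambda>x. indicator {0..T} x *\<^sub>R limit_mean c g)"
      by (intro integrable_scaleR_left integrable_real_indicator) (auto simp: emeasure_lborel_Icc_eq)
    have "(LINT x|lborel. ?J x) = (LINT x|lborel. indicator {0..T} x *\<^sub>R v x) - (LINT x|lborel. indicator {0..T} x *\<^sub>R limit_mean c g)"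
    proof -
      have "integrable lborel (\<lambda>x. indicator {0..T} x *\<^sub>R v x)"
        using Bochner_Integration.integrable_add[OF J c1] by (simp add: algebra_simps)
      from Bochner_Integration.integral_diff[OF this c1] show ?thesis by (simp add: algebra_simps)
    qed
    also have "(LINT x|lborel. indicator {0..T} x *\<^sub>R limit_mean c g) = T * limit_mean c g"
      using T by simp
    finally have eq: "window_mean c g T - limit_mean c g = 1 / T * (LINT x|lborel. ?J x)"
      using T unfolding window_mean_def set_lebesgue_integral_def v_def W_def by (simp add: field_simps)
    have "\<bar>LINT x|lborel. ?J x\<bar> \<le> (LINT x|lborel. \<bar>?J x\<bar>)" by (rule integral_abs_bound)
    also have "\<dots> \<le> (LINT x|lborel. A * indicator {0..h} x + A * indicator {T - h..T} x)"
      using J iJ bJ by (intro integral_mono) auto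
    also have "\<dots> = A * h + A * h"
      by (subst Bochner_Integration.integral_add) (auto simp: h_def)
    finally have "\<bar>LINT x|lborel. ?J x\<bar> \<le> 2 * h * A" by (simp add: mult_ac)
    then have "1 / T * \<bar>LINT x|lborel. ?J x\<bar> \<le> 1 / T * (2 * h * A)"
      using T by (intro mult_left_mono) auto
    then show ?thesis using T unfolding eq abs_mult by (simp add: mult.commute)
  qed
  show ?thesis
  proof (rule bigoI)
    show "eventually (\<lambda>T. norm (window_mean c g T - limit_mean c g) \<le> 2 * h * A * norm (1 / T)) at_top"
      using eventually_gt_at_top[of "0::real"]
    proof eventually_elim
      case (elim T)
      show ?case using main[OF elim] elim by simp
    qed
  qed
qed

section \<open>Fourier inversion almost everywhere\<close>

text \<open>Convexity is recorded because it makes the boundary of a cube a null set, and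
  boundedness because it makes the volume finite.\<close>

lemma convex_bounded_dyadic_cube2:
  "convex (dyadic_cube n (m :: real \<times> real \<Rightarrow> int))" "bounded (dyadic_cube n (m :: real \<times> real \<Rightarrow> int))"
proof -
  have "convex (dyadic_cell n k)" for k
  proof -
    have "dyadic_cell n k = {real_of_int k / 2 ^ n ..< real_of_int (k + 1) / 2 ^ n}"
      by (auto simp: dyadic_cube_def floor_eq_iff field_simps)
    then show ?thesis by (simp only:) (rule convex_real_interval)
  qed
  then have 1: "convex (dyadic_cube n k)" for k :: "real \<Rightarrow> int" using dyadic_cube_real[of n k] by metis
  have "bounded (dyadic_cell n k)" for k
    by (rule bounded_subset[OF bounded_closed_interval bounded_dyadic_cell])
  then have 2: "bounded (dyadic_cube n k)" for k :: "real \<Rightarrow> int" using dyadic_cube_real[of n k] by metis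
  show "convex (dyadic_cube n m)" "bounded (dyadic_cube n m)"
    unfolding dyadic_cube_prod[of n m] using 1 2 by (auto intro: convex_Times bounded_Times)
qed

text \<open>The Gaussian averages converge everywhere to the inversion integral, since the transform
  is integrable. Convergence to \<open>g\<close> is shown only after integration over cubes;
  equality of the integrals over all cubes then forces equality almost everywhere. No continuity of
  \<open>g\<close> is assumed.\<close>

lemma fourier_inversion_AE:
  fixes g :: "real \<times> real \<Rightarrow> real"
  assumes gm [measurable]: "g \<in> borel_measurable borel" and g: "integrable lborel g" and K: "\<And>x. \<bar>g x\<bar> \<le> K"
    and G: "integrable lborel (fourier2 g)"
  shows "AE s in lborel. (LINT w|lborel. fourier2 g w * iexp (w \<bullet> s)) = (2 * pi)\<^sup>2 * complex_of_real (g s)"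
proof -
  define \<sigma> where "\<sigma> n = 1 / real (Suc n)" for n
  have s0: "0 < \<sigma> n" for n by (simp add: \<sigma>_def)
  have slim: "\<sigma> \<longlonglongrightarrow> 0" unfolding \<sigma>_def by (rule LIMSEQ_Suc[OF lim_1_over_n])
  have Gm [measurable]: "fourier2 g \<in> borel_measurable borel" using G by auto
  have K0: "0 \<le> K" using K[of 0] by linarith
  define h where "h n s = (LINT z|lborel. g (s + \<sigma> n *\<^sub>R z) * gauss2 z)" for n s
  \<comment> \<open>The inversion integral exists at every \<open>s\<close> and is the candidate to
    be compared with \<open>g\<close>.\<close>
  define gt where "gt s = (LINT w|lborel. fourier2 g w * iexp (w \<bullet> s)) / (2 * pi)\<^sup>2" for s
  have L1: "(\<lambda>n. complex_of_real (h n s)) \<longlonglongrightarrow> gt s" for s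
  proof -
    have "(\<lambda>n. LINT w|lborel. fourier2 g w * (iexp (w \<bullet> s) * complex_of_real (exp (- (\<sigma> n)\<^sup>2 * (w \<bullet> w) / 2))))
        \<longlonglongrightarrow> (LINT w|lborel. fourier2 g w * iexp (w \<bullet> s))"
    proof (rule integral_dominated_convergence[where w = "\<lambda>w. norm (fourier2 g w)"])
      show "AE w in lborel. (\<lambda>n. fourier2 g w * (iexp (w \<bullet> s) * complex_of_real (exp (- (\<sigma> n)\<^sup>2 * (w \<bullet> w) / 2))))
          \<longlonglongrightarrow> fourier2 g w * iexp (w \<bullet> s)"
      proof (rule AE_I2)
        fix w
        have "(\<lambda>n. fourier2 g w * (iexp (w \<bullet> s) * complex_of_real (exp (- (\<sigma> n)\<^sup>2 * (w \<bullet> w) / 2))))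
            \<longlonglongrightarrow> fourier2 g w * (iexp (w \<bullet> s) * complex_of_real (exp (- 0\<^sup>2 * (w \<bullet> w) / 2)))"
          by (intro tendsto_intros slim) auto
        then show "(\<lambda>n. fourier2 g w * (iexp (w \<bullet> s) * complex_of_real (exp (- (\<sigma> n)\<^sup>2 * (w \<bullet> w) / 2))))
          \<longlonglongrightarrow> fourier2 g w * iexp (w \<bullet> s)" by simp
      qed
      show "AE w in lborel. norm (fourier2 g w * (iexp (w \<bullet> s) * complex_of_real (exp (- (\<sigma> n)\<^sup>2 * (w \<bullet> w) / 2)))) \<le> norm (fourier2 g w)" for n
        by (intro AE_I2) (simp add: norm_mult mult_left_le)
    qed (use G in auto)
    then have "(\<lambda>n. (2 * pi)\<^sup>2 * complex_of_real (h n s)) \<longlonglongrightarrow> (LINT w|lborel. fourier2 g w * iexp (w \<bullet> s))"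
      unfolding gauss_smoothing[OF gm g s0] h_def .
    from tendsto_divide[OF this tendsto_const[of "complex_of_real ((2 * pi)\<^sup>2)"]] show ?thesis
      by (simp add: gt_def)
  qed
  \<comment> \<open>As a limit of real averages the candidate is real.\<close>
  have gtR: "(\<lambda>n. h n s) \<longlonglongrightarrow> Re (gt s)" and gtI: "Im (gt s) = 0" for s
    using tendsto_Re[OF L1[of s]] tendsto_Im[OF L1[of s]] by (simp_all add: LIMSEQ_const_iff)
  have hm [measurable]: "h n \<in> borel_measurable borel" for n
    unfolding h_def by (rule lborel.borel_measurable_lebesgue_integral) measurable
  have pw: "\<bar>g (s + \<sigma> n *\<^sub>R z) * gauss2 z\<bar> \<le> K * gauss2 z" for s n z
    by (simp add: abs_mult mult_right_mono K del: real_scaleR_def)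
  have iK: "integrable lborel (\<lambda>z. K * gauss2 z)" by (intro integrable_mult_right gauss2_integral(1))
  have gI: "integrable lborel (\<lambda>z. g (s + \<sigma> n *\<^sub>R z) * gauss2 z)" for s n
  proof (rule Bochner_Integration.integrable_bound[OF iK])
    show "AE z in lborel. norm (g (s + \<sigma> n *\<^sub>R z) * gauss2 z) \<le> norm (K * gauss2 z)"
      unfolding real_norm_def by (intro AE_I2 order_trans[OF pw abs_ge_self])
  qed measurable
  have habs: "(LINT z|lborel. \<bar>g (s + \<sigma> n *\<^sub>R z) * gauss2 z\<bar>) \<le> K" for n s
  proof -
    have "(LINT z|lborel. \<bar>g (s + \<sigma> n *\<^sub>R z) * gauss2 z\<bar>) \<le> (LINT z|lborel. K * gauss2 z)"
      by (rule integral_mono[OF integrable_abs[OF gI] iK pw])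
    then show ?thesis by (simp add: gauss2_integral(2))
  qed
  have hb: "\<bar>h n s\<bar> \<le> K" for n s
    unfolding h_def by (rule order_trans[OF integral_abs_bound habs])
  have gtm [measurable]: "(\<lambda>s. Re (gt s)) \<in> borel_measurable borel"
    by (rule borel_measurable_LIMSEQ_real[OF gtR hm])
  have gtb: "\<bar>Re (gt s)\<bar> \<le> K" for s
    by (rule LIMSEQ_le_const2[OF tendsto_rabs[OF gtR]]) (use hb in auto)
  \<comment> \<open>The averages are integrated over \<open>Q\<close> and their limit is computed in
    two ways: pointwise, and after moving the translation from \<open>g\<close> to the
    indicator.\<close>
  have eqQ: "(LINT s|lborel. indicator Q s * Re (gt s)) = (LINT s|lborel. indicator Q s * g s)"
    if Qm [measurable]: "Q \<in> sets borel" and cvx: "convex Q" and bd: "bounded Q" for Q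
  proof (rule LIMSEQ_unique)
    have iQ: "integrable lborel (\<lambda>s. indicator Q s * K)"
      using emeasure_bounded_finite[OF bd] by (intro integrable_mult_left) auto
    show "(\<lambda>n. LINT s|lborel. indicator Q s * h n s) \<longlonglongrightarrow> (LINT s|lborel. indicator Q s * Re (gt s))"
    proof (rule integral_dominated_convergence[where w = "\<lambda>s. indicator Q s * K"])
      show "AE s in lborel. (\<lambda>n. indicator Q s * h n s) \<longlonglongrightarrow> indicator Q s * Re (gt s)"
        by (intro AE_I2 tendsto_mult tendsto_const gtR)
      show "AE s in lborel. norm (indicator Q s * h n s) \<le> indicator Q s * K" for n
        using hb by (intro AE_I2) (auto simp: indicator_def)
    qed (use iQ in auto)
    \<comment> \<open>Translation invariance shifts the set instead of the function; the dependence
      on \<open>n\<close> then sits in an indicator, whose limit is easy.\<close>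
    have swap: "(LINT s|lborel. indicator Q s * h n s) = (LINT z|lborel. gauss2 z * (LINT t|lborel. indicator Q (t - \<sigma> n *\<^sub>R z) * g t))" for n
    proof -
      let ?f = "\<lambda>s z. indicator Q s * (g (s + \<sigma> n *\<^sub>R z) * gauss2 z)"
      have I: "integrable (lborel \<Otimes>\<^sub>M lborel) (\<lambda>(s, z). ?f s z)"
      proof (rule lborel_pair.Fubini_integrable)
        have "(\<lambda>s. LINT z|lborel. norm (case (s, z) of (s, z) \<Rightarrow> ?f s z)) \<in> borel_measurable lborel"
          by (rule lborel.borel_measurable_lebesgue_integral) measurable
        then show "integrable lborel (\<lambda>s. LINT z|lborel. norm (case (s, z) of (s, z) \<Rightarrow> ?f s z))"
        proof (rule Bochner_Integration.integrable_bound[OF iQ])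
          show "AE s in lborel. norm (LINT z|lborel. norm (case (s, z) of (s, z) \<Rightarrow> ?f s z)) \<le> norm (indicator Q s * K)"
          proof (rule AE_I2)
            fix s
            show "norm (LINT z|lborel. norm (case (s, z) of (s, z) \<Rightarrow> ?f s z)) \<le> norm (indicator Q s * K)"
              using habs[of s n] K0 by (cases "s \<in> Q") simp_all
          qed
        qed
        show "AE s in lborel. integrable lborel (\<lambda>z. case (s, z) of (s, z) \<Rightarrow> ?f s z)"
          unfolding prod.case by (intro AE_I2 integrable_mult_right gI)
      qed measurable
      have "(LINT s|lborel. indicator Q s * h n s) = (LINT s|lborel. LINT z|lborel. ?f s z)"
        unfolding h_def by (simp only: integral_mult_right_zero)
      also have "\<dots> = (LINT z|lborel. LINT s|lborel. ?f s z)"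
        using lborel_pair.Fubini_integral[OF I] by simp
      also have "\<dots> = (LINT z|lborel. gauss2 z * (LINT t|lborel. indicator Q (t - \<sigma> n *\<^sub>R z) * g t))"
      proof (intro Bochner_Integration.integral_cong refl)
        fix z
        have "(LINT s|lborel. ?f s z) = (LINT s|lborel. gauss2 z * (indicator Q s * g (s + \<sigma> n *\<^sub>R z)))"
          by (intro Bochner_Integration.integral_cong refl) simp
        also have "\<dots> = gauss2 z * (LINT s|lborel. indicator Q s * g (s + \<sigma> n *\<^sub>R z))"
          by (rule integral_mult_right_zero)
        also have "(LINT s|lborel. indicator Q s * g (s + \<sigma> n *\<^sub>R z)) = (LINT t|lborel. indicator Q (t - \<sigma> n *\<^sub>R z) * g t)"
          using integral_translate[of "\<lambda>t. indicator Q (t - \<sigma> n *\<^sub>R z) * g t" "\<sigma> n *\<^sub>R z"]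
          by (simp add: add.commute)
        finally show "(LINT s|lborel. ?f s z) = gauss2 z * (LINT t|lborel. indicator Q (t - \<sigma> n *\<^sub>R z) * g t)" .
      qed
      finally show ?thesis .
    qed
    have inner: "(\<lambda>n. LINT t|lborel. indicator Q (t - \<sigma> n *\<^sub>R z) * g t) \<longlonglongrightarrow> (LINT t|lborel. indicator Q t * g t)" for z
    proof (rule integral_dominated_convergence[where w = "\<lambda>t. \<bar>g t\<bar>"])
      \<comment> \<open>Off the null boundary of \<open>Q\<close> the shifted indicators are
        eventually constant.\<close>
      have "negligible (frontier Q)" by (rule negligible_convex_frontier[OF cvx])
      then have "AE t in lborel. t \<notin> frontier Q"
        by (intro AE_not_in) (simp add: null_sets_completion_iff negligible_iff_null_sets)
      then show "AE t in lborel. (\<lambda>n. indicator Q (t - \<sigma> n *\<^sub>R z) * g t) \<longlonglongrightarrow> indicator Q t * g t"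
      proof eventually_elim
        case (elim t)
        have "(\<lambda>n. t - \<sigma> n *\<^sub>R z) \<longlonglongrightarrow> t - 0 *\<^sub>R z" by (intro tendsto_intros slim)
        then have lim: "(\<lambda>n. t - \<sigma> n *\<^sub>R z) \<longlonglongrightarrow> t" by simp
        have "eventually (\<lambda>n. indicator Q (t - \<sigma> n *\<^sub>R z) = (indicator Q t :: real)) sequentially"
        proof (cases "t \<in> interior Q")
          case True
          from topological_tendstoD[OF lim open_interior True] show ?thesis
            by eventually_elim (use True interior_subset[of Q] in \<open>auto simp: indicator_def\<close>)
        next
          case False
          then have "t \<in> - closure Q" using elim by (auto simp: frontier_def)
          from topological_tendstoD[OF lim open_Compl[OF closed_closure] this] show ?thesis
            by eventually_elim (use \<open>t \<in> - closure Q\<close> closure_subset[of Q] in \<open>auto simp: indicator_def\<close>)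
        qed
        then have "(\<lambda>n. indicator Q (t - \<sigma> n *\<^sub>R z) :: real) \<longlonglongrightarrow> indicator Q t"
          by (rule tendsto_eventually)
        then show ?case by (rule tendsto_mult[OF _ tendsto_const])
      qed
      show "AE t in lborel. norm (indicator Q (t - \<sigma> n *\<^sub>R z) * g t) \<le> \<bar>g t\<bar>" for n
        by (intro AE_I2) (auto simp: indicator_def)
    qed (use g in auto)
    have "(\<lambda>n. LINT z|lborel. gauss2 z * (LINT t|lborel. indicator Q (t - \<sigma> n *\<^sub>R z) * g t))
        \<longlonglongrightarrow> (LINT z|lborel. gauss2 z * (LINT t|lborel. indicator Q t * g t))"
    proof (rule integral_dominated_convergence[where w = "\<lambda>z. gauss2 z * (LINT t|lborel. \<bar>g t\<bar>)"])
      show "AE z in lborel. (\<lambda>n. gauss2 z * (LINT t|lborel. indicator Q (t - \<sigma> n *\<^sub>R z) * g t))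
          \<longlonglongrightarrow> gauss2 z * (LINT t|lborel. indicator Q t * g t)"
        by (intro AE_I2 tendsto_mult tendsto_const inner)
      have "\<bar>LINT t|lborel. indicator Q (t - \<sigma> n *\<^sub>R z) * g t\<bar> \<le> (LINT t|lborel. \<bar>g t\<bar>)" for n z
        by (rule order_trans[OF integral_abs_bound integral_mono']) (use g in \<open>auto simp: indicator_def\<close>)
      then show "AE z in lborel. norm (gauss2 z * (LINT t|lborel. indicator Q (t - \<sigma> n *\<^sub>R z) * g t)) \<le> gauss2 z * (LINT t|lborel. \<bar>g t\<bar>)" for n
        by (intro AE_I2) (simp add: abs_mult mult_left_mono divide_right_mono)
      show "integrable lborel (\<lambda>z. gauss2 z * (LINT t|lborel. \<bar>g t\<bar>))"
        by (intro integrable_mult_left impI gauss2_integral(1))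
      have "(\<lambda>z. LINT t|lborel. indicator Q (t - \<sigma> n *\<^sub>R z) * g t) \<in> borel_measurable lborel" for n
        by (rule lborel.borel_measurable_lebesgue_integral) measurable
      then show "(\<lambda>z. gauss2 z * (LINT t|lborel. indicator Q (t - \<sigma> n *\<^sub>R z) * g t)) \<in> borel_measurable lborel" for n
        by measurable
    qed measurable
    moreover have "(LINT z|lborel. gauss2 z * (LINT t|lborel. indicator Q t * g t)) = (LINT t|lborel. indicator Q t * g t)"
      by (subst integral_mult_left_zero) (simp add: gauss2_integral(2))
    ultimately show "(\<lambda>n. LINT s|lborel. indicator Q s * h n s) \<longlonglongrightarrow> (LINT s|lborel. indicator Q s * g s)"
      unfolding swap by (simp only:)
  qed
  \<comment> \<open>Adding the bound \<open>K\<close> turns a function with absolute value at most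
    \<open>K\<close> into a nonnegative density, so that the two functions can be compared as
    measures.\<close>
  have dens: "emeasure (density lborel (\<lambda>s. ennreal (f s + K))) Q = ennreal ((LINT s|lborel. indicator Q s * f s) + K * measure lborel Q)"
    if [measurable]: "f \<in> borel_measurable borel" "Q \<in> sets borel" and f: "\<And>s. \<bar>f s\<bar> \<le> K" and bd: "bounded Q" for f Q
  proof -
    have fin: "emeasure lborel Q < \<infinity>" by (rule emeasure_bounded_finite[OF bd])
    have i2: "integrable lborel (\<lambda>s. indicator Q s * K)"
      using fin by (intro integrable_mult_left integrable_real_indicator) auto
    have i1: "integrable lborel (\<lambda>s. indicator Q s * f s)"
    proof (rule Bochner_Integration.integrable_bound[OF i2])
      show "AE s in lborel. norm (indicator Q s * f s) \<le> norm (indicator Q s * K)"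
        using f K0 by (intro AE_I2) (simp add: indicator_def)
    qed measurable
    have nn: "0 \<le> f s + K" for s using f[of s] by linarith
    have "emeasure (density lborel (\<lambda>s. ennreal (f s + K))) Q = (\<integral>\<^sup>+s. ennreal (indicator Q s * f s + indicator Q s * K) \<partial>lborel)"
      by (subst emeasure_density) (auto intro!: nn_integral_cong simp: indicator_def)
    also have "\<dots> = ennreal (LINT s|lborel. indicator Q s * f s + indicator Q s * K)"
      using i1 i2 nn by (intro nn_integral_eq_integral Bochner_Integration.integrable_add) (auto simp: indicator_def)
    also have "(LINT s|lborel. indicator Q s * f s + indicator Q s * K) = (LINT s|lborel. indicator Q s * f s) + K * measure lborel Q"
      using i1 i2 by (subst Bochner_Integration.integral_add) auto
    finally show ?thesis .
  qed
  have "density lborel (\<lambda>s. ennreal (Re (gt s) + K)) = density lborel (\<lambda>s. ennreal (g s + K))"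
  proof (rule measure_eqI_dyadic_cubes)
    fix n and m :: "real \<times> real \<Rightarrow> int"
    note Q = dyadic_cube_borel[of n m] convex_bounded_dyadic_cube2[of n m]
    show "emeasure (density lborel (\<lambda>s. ennreal (Re (gt s) + K))) (dyadic_cube n m) = emeasure (density lborel (\<lambda>s. ennreal (g s + K))) (dyadic_cube n m)"
      by (simp add: dens[OF gtm Q(1) gtb Q(3)] dens[OF gm Q(1) K Q(3)] eqQ[OF Q])
    show "emeasure (density lborel (\<lambda>s. ennreal (Re (gt s) + K))) (dyadic_cube n m) \<noteq> \<infinity>"
      by (simp add: dens[OF gtm Q(1) gtb Q(3)])
  qed auto
  then have "AE s in lborel. ennreal (Re (gt s) + K) = ennreal (g s + K)"
    by (rule sigma_finite_measure.density_unique[OF lborel.sigma_finite_measure_axioms, rotated 2]) auto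
  then show ?thesis
  proof eventually_elim
    case (elim s)
    have "Re (gt s) + K = g s + K" using elim gtb[of s] K[of s] by (subst (asm) ennreal_inj) linarith+
    then have "gt s = complex_of_real (g s)" using gtI[of s] by (simp add: complex_eq_iff)
    then show ?case unfolding gt_def by (simp add: field_simps)
  qed
qed

section \<open>The spectral formula\<close>

text \<open>Reflecting the plane shows that the even part of \<open>c\<close> integrates to zero
  against the odd function \<open>g\<close>, so the odd part may be replaced by \<open>c\<close>
  itself.\<close>

lemma limit_mean_odd:
  fixes c g :: "real \<times> real \<Rightarrow> real"
  assumes c: "integrable lborel c" and [measurable]: "g \<in> borel_measurable borel" and K: "\<And>x. \<bar>g x\<bar> \<le> K"
    and odd: "\<And>\<tau>. g (- \<tau>) = - g \<tau>"
  shows "limit_mean c g = (LINT \<tau>|lborel. g \<tau> * c \<tau>)" "integrable lborel (\<lambda>\<tau>. g \<tau> * c \<tau>)"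
proof -
  have [measurable]: "c \<in> borel_measurable borel" using c by auto
  show i: "integrable lborel (\<lambda>\<tau>. g \<tau> * c \<tau>)"
    by (rule Bochner_Integration.integrable_bound[of _ "\<lambda>\<tau>. K * c \<tau>"])
       (use c K in \<open>auto simp: abs_mult intro!: mult_mono order_trans[OF K abs_ge_self]\<close>)
  have i': "integrable lborel (\<lambda>\<tau>. g \<tau> * c (- \<tau>))"
    using integrable_reflect[OF i] by (simp add: odd)
  have r: "(LINT \<tau>|lborel. g \<tau> * c (- \<tau>)) = - (LINT \<tau>|lborel. g \<tau> * c \<tau>)"
    using integral_reflect[of "\<lambda>\<tau>. g \<tau> * c \<tau>"] by (simp add: odd)
  have "limit_mean c g = (LINT \<tau>|lborel. 1 / 2 * (g \<tau> * c \<tau>) - 1 / 2 * (g \<tau> * c (- \<tau>)))"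
    unfolding limit_mean_def odd_part_def by (intro Bochner_Integration.integral_cong refl) (simp add: algebra_simps)
  also have "\<dots> = 1 / 2 * (LINT \<tau>|lborel. g \<tau> * c \<tau>) - 1 / 2 * (LINT \<tau>|lborel. g \<tau> * c (- \<tau>))"
    using i i' by (subst Bochner_Integration.integral_diff) auto
  finally show "limit_mean c g = (LINT \<tau>|lborel. g \<tau> * c \<tau>)" by (simp add: r)
qed

text \<open>The inversion formula is inserted for \<open>g\<close> and the integrals are exchanged;
  integrability of both \<open>c\<close> and \<open>Hg\<close> permits this. The inner integral over
  \<open>c\<close> is then the conjugate of its transform.\<close>

lemma limit_mean_parseval:
  fixes c g Hg :: "real \<times> real \<Rightarrow> real"
  assumes c: "integrable lborel c" and gm [measurable]: "g \<in> borel_measurable borel" and bnd: "bounded (range g)"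
    and cpt: "compact (fun_supp g)" and odd: "\<And>\<tau>. g (- \<tau>) = - g \<tau>"
    and Hg: "integrable lborel Hg" and FT: "\<And>w. fourier2 g w = \<i> * complex_of_real (Hg w)"
  shows "limit_mean c g = 1 / (2 * pi)\<^sup>2 * (LINT w|lborel. Hg w * Im (fourier2 c w))"
proof -
  obtain K where K: "\<And>x. \<bar>g x\<bar> \<le> K" using bnd by (auto simp: bounded_iff)
  have [measurable]: "c \<in> borel_measurable borel" "Hg \<in> borel_measurable borel" using c Hg by auto
  have g: "integrable lborel g" by (rule integrable_bounded_compact[OF gm bnd cpt])
  have G: "integrable lborel (fourier2 g)" unfolding FT[abs_def] using Hg by auto
  let ?F = "\<lambda>s w. complex_of_real (c s) * (\<i> * complex_of_real (Hg w) * iexp (w \<bullet> s))"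
  have I: "integrable (lborel \<Otimes>\<^sub>M lborel) (\<lambda>(s, w). ?F s w)"
  proof (rule lborel_pair.Fubini_integrable)
    show "integrable lborel (\<lambda>s. LINT w|lborel. norm (case (s, w) of (s, w) \<Rightarrow> ?F s w))"
      using c by (simp add: norm_mult)
    show "AE s in lborel. integrable lborel (\<lambda>w. case (s, w) of (s, w) \<Rightarrow> ?F s w)"
    proof (rule AE_I2)
      fix s
      have "integrable lborel (\<lambda>w. \<bar>c s\<bar> * \<bar>Hg w\<bar>)" using Hg by simp
      then show "integrable lborel (\<lambda>w. case (s, w) of (s, w) \<Rightarrow> ?F s w)"
        by (rule Bochner_Integration.integrable_bound) (auto simp: norm_mult)
    qed
  qed measurable
  have cnj: "(LINT s|lborel. ?F s w) = \<i> * complex_of_real (Hg w) * cnj (fourier2 c w)" for w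
  proof -
    have "cnj (fourier2 c w) = (LINT s|lborel. iexp (w \<bullet> s) * complex_of_real (c s))"
      unfolding fourier2_def by (subst Bochner_Integration.integral_cnj[symmetric]) (simp only: complex_cnj_mult exp_cnj complex_cnj_minus complex_cnj_i complex_cnj_complex_of_real minus_mult_left minus_minus)
    then have "\<i> * complex_of_real (Hg w) * cnj (fourier2 c w) = (LINT s|lborel. \<i> * complex_of_real (Hg w) * (iexp (w \<bullet> s) * complex_of_real (c s)))"
      by (simp only: integral_mult_right_zero)
    then show ?thesis by (simp only: mult_ac)
  qed
  have "(2 * pi)\<^sup>2 * complex_of_real (LINT s|lborel. g s * c s) = (LINT s|lborel. complex_of_real (c s) * ((2 * pi)\<^sup>2 * complex_of_real (g s)))"
  proof -
    have "(2 * pi)\<^sup>2 * complex_of_real (LINT s|lborel. g s * c s) = (LINT s|lborel. (2 * pi)\<^sup>2 * complex_of_real (g s * c s))"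
      unfolding integral_complex_of_real[symmetric] by (rule integral_mult_right_zero[symmetric])
    then show ?thesis by (simp add: mult_ac)
  qed
  also have "\<dots> = (LINT s|lborel. complex_of_real (c s) * (LINT w|lborel. fourier2 g w * iexp (w \<bullet> s)))"
  proof (rule integral_cong_AE)
    show "AE s in lborel. complex_of_real (c s) * ((2 * pi)\<^sup>2 * complex_of_real (g s))
        = complex_of_real (c s) * (LINT w|lborel. fourier2 g w * iexp (w \<bullet> s))"
      using fourier_inversion_AE[OF gm g K G] by eventually_elim simp
    have "(\<lambda>s. LINT w|lborel. fourier2 g w * iexp (w \<bullet> s)) \<in> borel_measurable lborel"
      unfolding FT by (rule lborel.borel_measurable_lebesgue_integral) measurable
    then show "(\<lambda>s. complex_of_real (c s) * (LINT w|lborel. fourier2 g w * iexp (w \<bullet> s))) \<in> borel_measurable lborel"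
      by measurable
  qed measurable
  also have "\<dots> = (LINT s|lborel. LINT w|lborel. ?F s w)"
    unfolding FT by (simp only: integral_mult_right_zero)
  also have "\<dots> = (LINT w|lborel. LINT s|lborel. ?F s w)"
    using lborel_pair.Fubini_integral[OF I] by simp
  finally have eq: "(2 * pi)\<^sup>2 * complex_of_real (LINT s|lborel. g s * c s) = (LINT w|lborel. \<i> * complex_of_real (Hg w) * cnj (fourier2 c w))"
    unfolding cnj .
  have int: "integrable lborel (\<lambda>w. \<i> * complex_of_real (Hg w) * cnj (fourier2 c w))"
    using lborel_pair.integrable_snd[OF I] unfolding cnj .
  \<comment> \<open>The left side is real, and the real part of \<open>\<i>\<close> times the
    conjugate of a number is the imaginary part of that number.\<close>
  have "(2 * pi)\<^sup>2 * (LINT s|lborel. g s * c s) = Re ((2 * pi)\<^sup>2 * complex_of_real (LINT s|lborel. g s * c s))"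
    by (simp flip: of_real_mult of_real_power)
  also have "\<dots> = (LINT w|lborel. Re (\<i> * complex_of_real (Hg w) * cnj (fourier2 c w)))"
    unfolding eq by (rule integral_Re[OF int, symmetric])
  also have "\<dots> = (LINT w|lborel. Hg w * Im (fourier2 c w))" by simp
  finally show ?thesis
    using limit_mean_odd(1)[OF c gm K odd] by (simp add: field_simps)
qed

section \<open>The triple statistic\<close>

definition stat_kernel :: "(real \<times> real \<Rightarrow> real) \<Rightarrow> real \<Rightarrow> real \<times> real \<times> real \<Rightarrow> real" where
  "stat_kernel g T = (\<lambda>(t0, t1, t2). g (t1 - t0, t2 - t0) * indicator ({0..T} \<times> {0..T} \<times> {0..T}) (t0, t1, t2))"

lemma stat_kernel_reflect:
  assumes odd: "\<And>\<tau>1 \<tau>2. g (- \<tau>1, - \<tau>2) = - g (\<tau>1, \<tau>2)"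
  shows "stat_kernel g T (T - a, T - b, T - c) = - stat_kernel g T (a, b, c)"
  using odd[of "b - a" "c - a"] by (auto simp: stat_kernel_def indicator_def)

lemma stat_kernel_measurable [measurable]:
  assumes g: "g \<in> borel_measurable borel"
  shows "stat_kernel g T \<in> borel_measurable borel"
proof -
  have [measurable]: "g \<in> borel_measurable (borel \<Otimes>\<^sub>M borel)" using g by (simp add: borel_prod)
  have "stat_kernel g T \<in> borel_measurable (borel \<Otimes>\<^sub>M borel \<Otimes>\<^sub>M borel)"
    unfolding stat_kernel_def case_prod_unfold by measurable
  then show ?thesis by (simp add: borel_prod)
qed

lemma test_fun_stat_kernel:
  assumes g: "g \<in> borel_measurable borel" and bnd: "bounded (range g)"
  shows "test_fun (stat_kernel g T)"
  unfolding test_fun_def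
proof (intro conjI)
  show "stat_kernel g T \<in> borel_measurable borel" by (rule stat_kernel_measurable[OF g])
  obtain C where C: "\<And>x. \<bar>g x\<bar> \<le> C" using bnd by (auto simp: bounded_iff)
  have "0 \<le> C" using C[of undefined] by linarith
  then show "bounded (range (stat_kernel g T))"
    using C by (intro boundedI[of _ C]) (auto simp: stat_kernel_def indicator_def)
  have "{x. stat_kernel g T x \<noteq> 0} \<subseteq> {0..T} \<times> {0..T} \<times> {0..T}" by (auto simp: stat_kernel_def indicator_def)
  then have "bounded {x. stat_kernel g T x \<noteq> 0}"
    by (rule bounded_subset[rotated]) (intro bounded_Times bounded_closed_interval)
  then show "compact (fun_supp (stat_kernel g T))" by (simp add: fun_supp_def compact_closure)
qed

definition off_diagonal_real :: "(real \<times> real \<times> real \<Rightarrow> real) \<Rightarrow> real \<Rightarrow> real \<Rightarrow> real \<Rightarrow> real" where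
  "off_diagonal_real G a b c = (if a = b \<or> a = c \<or> b = c then 0 else G (c, b, a))"

text \<open>Two points are fixed and the third varies. With infinitely many points in the window the
  statistic is then a sum over an infinite set, hence zero by default, in agreement with the empty
  \<open>pts_in\<close>.\<close>

lemma infinite_distinct_triples:
  assumes "infinite P"
  shows "infinite {(x0, x1, x2). x0 \<in> P \<and> x1 \<in> P \<and> x2 \<in> P \<and> x0 \<noteq> x1 \<and> x0 \<noteq> x2 \<and> x1 \<noteq> x2}"
proof
  assume fin: "finite {(x0, x1, x2). x0 \<in> P \<and> x1 \<in> P \<and> x2 \<in> P \<and> x0 \<noteq> x1 \<and> x0 \<noteq> x2 \<and> x1 \<noteq> x2}"
  obtain p where p: "p \<in> P" using assms by fastforce
  obtain q where q: "q \<in> P" "q \<noteq> p" using infinite_imp_nonempty[OF infinite_remove[OF assms, of p]] by blast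
  have "(\<lambda>x. (x, p, q)) ` (P - {p, q}) \<subseteq> {(x0, x1, x2). x0 \<in> P \<and> x1 \<in> P \<and> x2 \<in> P \<and> x0 \<noteq> x1 \<and> x0 \<noteq> x2 \<and> x1 \<noteq> x2}"
    using p q by auto
  then have "finite ((\<lambda>x. (x, p, q)) ` (P - {p, q}))" using fin by (rule finite_subset)
  then have "finite (P - {p, q})" by (rule finite_imageD) (auto simp: inj_on_def)
  with assms show False by simp
qed

lemma triple_stat_eq_sum:
  assumes P: "P = (if finite (points \<mu> \<inter> {0..T}) then points \<mu> \<inter> {0..T} else {})"
  shows "triple_stat T g \<mu> = 1 / T * (\<Sum>a\<in>P. \<Sum>b\<in>P. \<Sum>c\<in>P. off_diagonal_real (stat_kernel g T) a b c)"
proof (cases "finite (points \<mu> \<inter> {0..T})")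
  case False
  then show ?thesis using infinite_distinct_triples[OF False] P by (simp add: triple_stat_def)
next
  case True
  then have P: "P = points \<mu> \<inter> {0..T}" and fin: "finite P" using assms by auto
  let ?D = "{(x0, x1, x2). x0 \<in> P \<and> x1 \<in> P \<and> x2 \<in> P \<and> x0 \<noteq> x1 \<and> x0 \<noteq> x2 \<and> x1 \<noteq> x2}"
  have "(\<Sum>a\<in>P. \<Sum>b\<in>P. \<Sum>c\<in>P. off_diagonal_real (stat_kernel g T) a b c) = (\<Sum>(a, b, c)\<in>P \<times> P \<times> P. off_diagonal_real (stat_kernel g T) a b c)"
    by (simp add: sum.cartesian_product)
  also have "\<dots> = (\<Sum>(a, b, c)\<in>?D. off_diagonal_real (stat_kernel g T) a b c)"
    using fin by (intro sum.mono_neutral_right) (auto simp: off_diagonal_real_def)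
  \<comment> \<open>Reading the triples backwards undoes the reversal built into
    \<open>off_diagonal_real\<close>.\<close>
  also have "\<dots> = (\<Sum>(x0, x1, x2)\<in>?D. g (x1 - x0, x2 - x0))"
    by (rule sum.reindex_bij_witness[of _ "\<lambda>(a, b, c). (c, b, a)" "\<lambda>(a, b, c). (c, b, a)"])
      (auto simp: off_diagonal_real_def stat_kernel_def P)
  finally show ?thesis by (simp add: triple_stat_def P)
qed

section \<open>Mean of the statistic\<close>

context cluster_points
begin

text \<open>All terms of the third moment except the one from a single cluster; they depend on the
  signs in no essential way.\<close>

definition mixed :: "(real \<Rightarrow> real \<Rightarrow> real \<Rightarrow> ennreal) \<Rightarrow> ennreal" where
  "mixed F = K2 (\<lambda>a b. intensity * (\<integral>\<^sup>+c. F a b c \<partial>lborel)) + K2 (\<lambda>a b. intensity * (\<integral>\<^sup>+c. F a c b \<partial>lborel))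
    + K2 (\<lambda>a b. intensity * (\<integral>\<^sup>+c. F c a b \<partial>lborel))
    + intensity ^ 3 * (\<integral>\<^sup>+a. \<integral>\<^sup>+b. \<integral>\<^sup>+c. F a b c \<partial>lborel \<partial>lborel \<partial>lborel)"

text \<open>Arguments integrated against Lebesgue measure are reflected one at a time, and the two
  arguments inside one cluster together by \<open>K2_reflect\<close>. No symmetry of
  \<open>F\<close> itself is involved.\<close>

lemma mixed_reflect:
  assumes F: "(\<lambda>(a, b, c). F a b c) \<in> borel_measurable (borel \<Otimes>\<^sub>M borel \<Otimes>\<^sub>M borel)"
  shows "mixed (\<lambda>a b c. F (r - a) (r - b) (r - c)) = mixed F"
proof -
  have [measurable (raw)]: "(\<lambda>p. F (a p) (b p) (c p)) \<in> borel_measurable N"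
    if "a \<in> borel_measurable N" "b \<in> borel_measurable N" "c \<in> borel_measurable N" for N :: "'n measure" and a b c
    using measurable_compose[of "\<lambda>p. (a p, b p, c p)" N _ _ borel, OF _ F] that by simp
  have r: "(\<integral>\<^sup>+c. f (r - c) \<partial>lborel) = (\<integral>\<^sup>+c. f c \<partial>lborel)" if "f \<in> borel_measurable borel" for f :: "real \<Rightarrow> ennreal"
    using nn_integral_real_affine[OF that, of "- 1" r] by simp
  have r1: "(\<integral>\<^sup>+c. F a b (r - c) \<partial>lborel) = (\<integral>\<^sup>+c. F a b c \<partial>lborel)" for a b by (rule r) measurable
  have r2: "(\<integral>\<^sup>+c. F a (r - c) b \<partial>lborel) = (\<integral>\<^sup>+c. F a c b \<partial>lborel)" for a b by (rule r[of "\<lambda>c. F a c b"]) measurable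
  have r3: "(\<integral>\<^sup>+c. F (r - c) a b \<partial>lborel) = (\<integral>\<^sup>+c. F c a b \<partial>lborel)" for a b by (rule r[of "\<lambda>c. F c a b"]) measurable
  have k1: "K2 (\<lambda>a b. intensity * (\<integral>\<^sup>+c. F (r - a) (r - b) c \<partial>lborel)) = K2 (\<lambda>a b. intensity * (\<integral>\<^sup>+c. F a b c \<partial>lborel))"
    by (rule K2_reflect[where F = "\<lambda>a b. intensity * (\<integral>\<^sup>+c. F a b c \<partial>lborel)"]) measurable
  have k2: "K2 (\<lambda>a b. intensity * (\<integral>\<^sup>+c. F (r - a) c (r - b) \<partial>lborel)) = K2 (\<lambda>a b. intensity * (\<integral>\<^sup>+c. F a c b \<partial>lborel))"
    by (rule K2_reflect[where F = "\<lambda>a b. intensity * (\<integral>\<^sup>+c. F a c b \<partial>lborel)"]) measurable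
  have k3: "K2 (\<lambda>a b. intensity * (\<integral>\<^sup>+c. F c (r - a) (r - b) \<partial>lborel)) = K2 (\<lambda>a b. intensity * (\<integral>\<^sup>+c. F c a b \<partial>lborel))"
    by (rule K2_reflect[where F = "\<lambda>a b. intensity * (\<integral>\<^sup>+c. F c a b \<partial>lborel)"]) measurable
  have i2: "(\<integral>\<^sup>+b. \<integral>\<^sup>+c. F a (r - b) c \<partial>lborel \<partial>lborel) = (\<integral>\<^sup>+b. \<integral>\<^sup>+c. F a b c \<partial>lborel \<partial>lborel)" for a
    by (rule r[of "\<lambda>b. \<integral>\<^sup>+c. F a b c \<partial>lborel"]) measurable
  have i3: "(\<integral>\<^sup>+a. \<integral>\<^sup>+b. \<integral>\<^sup>+c. F (r - a) b c \<partial>lborel \<partial>lborel \<partial>lborel) = (\<integral>\<^sup>+a. \<integral>\<^sup>+b. \<integral>\<^sup>+c. F a b c \<partial>lborel \<partial>lborel \<partial>lborel)"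
    by (rule r[of "\<lambda>a. \<integral>\<^sup>+b. \<integral>\<^sup>+c. F a b c \<partial>lborel \<partial>lborel"]) measurable
  show ?thesis unfolding mixed_def r1 r2 r3 k1 k2 k3 i2 i3 ..
qed

lemma K3_off_diagonal_finite:
  assumes G: "test_fun G"
  shows "K3 (off_diagonal (\<lambda>x. ennreal (G x))) < \<infinity>"
proof -
  obtain C where C: "\<And>x. \<bar>G x\<bar> \<le> C" using G by (auto simp: test_fun_def bounded_iff)
  have cpt: "compact (fun_supp G)" using G by (simp add: test_fun_def)
  \<comment> \<open>The third coordinate is projected out because \<open>off_diagonal\<close> passes
    its first argument there.\<close>
  define B where "B = (\<lambda>x. snd (snd x)) ` fun_supp G"
  have cB: "compact B" unfolding B_def by (intro compact_continuous_image continuous_intros cpt)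
  show ?thesis
  proof (rule K3_finite[where c = "ennreal C" and B = B])
    fix a b d
    show "off_diagonal (\<lambda>x. ennreal (G x)) a b d \<le> ennreal C * indicator B a"
    proof (cases "a \<in> B")
      case True
      then show ?thesis using C[of "(d, b, a)"] by (auto simp: off_diagonal_def intro!: ennreal_leI)
    next
      case False
      then have "(d, b, a) \<notin> fun_supp G" by (force simp: B_def)
      then show ?thesis by (simp add: off_diagonal_def fun_supp_zero)
    qed
  qed (use cB emeasure_compact_finite[OF cB] in \<open>auto intro: borel_compact\<close>)
qed

text \<open>The positive and negative parts of the kernel have separate finite expectations.
  Reflection maps one part to the other, so their mixed terms are equal and cancel in the
  difference.\<close>

lemma triple_stat_expectation:
  assumes g [measurable]: "g \<in> borel_measurable borel" and bnd: "bounded (range g)"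
    and odd: "\<And>\<tau>1 \<tau>2. g (- \<tau>1, - \<tau>2) = - g (\<tau>1, \<tau>2)"
  shows "integrable M (\<lambda>w. triple_stat T g (N w))"
    and "(LINT w|M. triple_stat T g (N w)) = 1 / T *
      (enn2real (K3 (off_diagonal (\<lambda>x. ennreal (stat_kernel g T x)))) - enn2real (K3 (off_diagonal (\<lambda>x. ennreal (- stat_kernel g T x)))))"
proof -
  let ?B = "{0..T}"
  let ?G = "stat_kernel g T"
  define sm where "sm f w = (\<Sum>a\<in>pts_in ?B w. \<Sum>b\<in>pts_in ?B w. \<Sum>c\<in>pts_in ?B w. f a b c :: real)" for f w
  \<comment> \<open>For \<open>s = 1\<close> and \<open>s = - 1\<close> this is the positive and the
    negative part of the kernel.\<close>
  define p where "p s a b c = max 0 (s * off_diagonal_real ?G a b c)" for s a b c :: real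
  obtain C where C: "\<And>x. \<bar>g x\<bar> \<le> C" using bnd by (auto simp: bounded_iff)
  have Gm: "(\<lambda>(a, b, c). ?G (c, b, a)) \<in> borel_measurable (borel \<Otimes>\<^sub>M borel \<Otimes>\<^sub>M borel)"
  proof -
    have [measurable]: "?G \<in> borel_measurable (borel \<Otimes>\<^sub>M borel \<Otimes>\<^sub>M borel)" using stat_kernel_measurable[OF g] by (simp add: borel_prod)
    show ?thesis by measurable
  qed
  have [measurable (raw)]: "(\<lambda>p. ?G (c p, b p, a p)) \<in> borel_measurable N"
    if "a \<in> borel_measurable N" "b \<in> borel_measurable N" "c \<in> borel_measurable N" for N :: "'n measure" and a b c
    using measurable_compose[of "\<lambda>p. (a p, b p, c p)" N _ _ borel, OF _ Gm] that by simp
  have pm: "(\<lambda>(a, b, c). p s a b c) \<in> borel_measurable (borel \<Otimes>\<^sub>M borel \<Otimes>\<^sub>M borel)" for s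
    unfolding p_def off_diagonal_real_def case_prod_unfold by measurable
  have pm': "(\<lambda>(a, b, c). ennreal (p s a b c)) \<in> borel_measurable (borel \<Otimes>\<^sub>M borel \<Otimes>\<^sub>M borel)" for s
    using measurable_compose[OF pm measurable_ennreal, of s] by (simp add: case_prod_unfold)
  have p0: "0 \<le> p s a b c" for s a b c by (simp add: p_def)
  have psupp: "p s a b c = 0" if "a \<notin> ?B \<or> b \<notin> ?B \<or> c \<notin> ?B" for s a b c
    using that by (auto simp: p_def off_diagonal_real_def stat_kernel_def)
  note S = sum3_pts_in[of ?B, OF _ pm p0 psupp, simplified, folded sm_def]
  have E: "(\<integral>\<^sup>+w. ennreal (sm (p s) w) \<partial>M) = K3 (\<lambda>a b c. ennreal (p s a b c)) + mixed (\<lambda>a b c. ennreal (p s a b c))" for s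
  proof -
    have "(\<integral>\<^sup>+w. ennreal (sm (p s) w) \<partial>M)
        = (\<integral>\<^sup>+w. points_integral w (\<lambda>a. points_integral w (\<lambda>b. points_integral w (\<lambda>c. ennreal (p s a b c)))) \<partial>M)"
      by (rule nn_integral_cong_AE, rule AE_mp[OF AE_finite_points[OF bounded_closed_interval[of 0 T]]], rule AE_I2, rule impI, rule S(2))
    also have "\<dots> = K3 (\<lambda>a b c. ennreal (p s a b c)) + mixed (\<lambda>a b c. ennreal (p s a b c))"
      unfolding expectation_points3[OF pm'] mixed_def by (simp only: add.assoc)
    finally show ?thesis .
  qed
  have fin: "(\<integral>\<^sup>+w. ennreal (sm (p s) w) \<partial>M) < \<infinity>" if s: "\<bar>s\<bar> = 1" for s
  proof -
    \<comment> \<open>A number at least 1, so that its cube dominates the bound of \<open>g\<close>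
      and the kernel lies below a product of three copies of one test function.\<close>
    let ?c = "1 + \<bar>C\<bar>"
    let ?f = "\<lambda>x. ?c * indicator ?B x"
    have cp: "0 < ?c" by simp
    have tf: "tf ?B ?c ?f" using tf_def[of ?B ?c ?f] by (simp add: indicator_def)
    note m = moment3[of ?B ?c, OF _ _ cp tf tf tf, simplified]
    have le: "p s a b c \<le> off3 ?f ?f ?f a b c" for a b c
    proof -
      have "\<bar>g x\<bar> \<le> ?c * ?c * ?c" for x
      proof -
        have "?c * 1 * 1 \<le> ?c * ?c * ?c" by (intro mult_mono) auto
        moreover have "\<bar>g x\<bar> \<le> ?c * 1 * 1" using C[of x] by simp
        ultimately show ?thesis by (rule order_trans[rotated])
      qed
      moreover have "s * y \<le> \<bar>y\<bar>" for y using s by (metis abs_ge_self abs_mult mult_1)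
      ultimately have "s * g x \<le> ?c * ?c * ?c" for x by (meson order_trans)
      then show ?thesis by (simp add: p_def off_diagonal_real_def off3_def stat_kernel_def indicator_def)
    qed
    have "(\<integral>\<^sup>+w. ennreal (sm (p s) w) \<partial>M) \<le> (\<integral>\<^sup>+w. ennreal (prod_d3 ?f ?f ?f (\<lambda>_. 0) (pts_in ?B w)) \<partial>M)"
      unfolding prod_d3_0[OF finite_pts_in] sm_def by (intro nn_integral_mono ennreal_leI sum_mono le)
    also have "\<dots> < \<infinity>"
      using has_bochner_integral_integrable m by (auto simp: has_bochner_integral_iff real_integrable_def less_top)
    finally show ?thesis .
  qed
  have int: "integrable M (sm (p s))" "(LINT w|M. sm (p s) w) = enn2real (\<integral>\<^sup>+w. ennreal (sm (p s) w) \<partial>M)" if "\<bar>s\<bar> = 1" for s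
  proof -
    have nn: "0 \<le> sm (p s) w" for w unfolding sm_def by (intro sum_nonneg p0)
    have [measurable]: "sm (p s) \<in> borel_measurable M" using S(1) by (simp add: sm_def[abs_def])
    show "integrable M (sm (p s))" using fin[OF that] nn by (intro integrableI_nonneg) auto
    show "(LINT w|M. sm (p s) w) = enn2real (\<integral>\<^sup>+w. ennreal (sm (p s) w) \<partial>M)"
      using nn by (intro integral_eq_nn_integral) auto
  qed
  have stat: "triple_stat T g (N w) = 1 / T * (sm (p 1) w - sm (p (- 1)) w)" for w
    unfolding triple_stat_eq_sum[OF pts_in_def] sm_def sum_subtractf[symmetric]
    by (intro arg_cong[where f = "(*) _"] sum.cong refl) (simp add: p_def max_def)
  show "integrable M (\<lambda>w. triple_stat T g (N w))"
    unfolding stat using int(1)[of 1] int(1)[of "- 1"] by (intro integrable_mult_right Bochner_Integration.integrable_diff) auto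
  have offp: "(\<lambda>a b c. ennreal (p 1 a b c)) = off_diagonal (\<lambda>x. ennreal (?G x))"
    "(\<lambda>a b c. ennreal (p (- 1) a b c)) = off_diagonal (\<lambda>x. ennreal (- ?G x))"
    by (simp_all add: fun_eq_iff p_def off_diagonal_real_def off_diagonal_def max_def ennreal_neg)
  \<comment> \<open>The condition of distinctness is invariant under the reflection, so only the
    sign of the odd kernel changes.\<close>
  have refl: "p (- 1) a b c = p 1 (T - a) (T - b) (T - c)" for a b c
    using stat_kernel_reflect[of g T c b a, OF odd] by (simp add: p_def off_diagonal_real_def)
  have mix: "mixed (\<lambda>a b c. ennreal (p (- 1) a b c)) = mixed (\<lambda>a b c. ennreal (p 1 a b c))"
    unfolding refl by (rule mixed_reflect[OF pm'])
  \<comment> \<open>Finiteness of each summand is what allows the common mixed term to be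
    subtracted.\<close>
  have fk: "K3 (\<lambda>a b c. ennreal (p s a b c)) < \<top>" "mixed (\<lambda>a b c. ennreal (p s a b c)) < \<top>" if "\<bar>s\<bar> = 1" for s
    using fin[OF that] unfolding E by (simp_all add: less_top)
  have "(LINT w|M. triple_stat T g (N w)) = 1 / T * ((LINT w|M. sm (p 1) w) - (LINT w|M. sm (p (- 1)) w))"
    unfolding stat using int(1)[of 1] int(1)[of "- 1"] by simp
  also have "\<dots> = 1 / T * (enn2real (K3 (\<lambda>a b c. ennreal (p 1 a b c))) - enn2real (K3 (\<lambda>a b c. ennreal (p (- 1) a b c))))"
    using int(2)[of 1] int(2)[of "- 1"] fk[of 1] fk[of "- 1"] unfolding E by (simp add: enn2real_plus mix)
  finally show "(LINT w|M. triple_stat T g (N w)) = 1 / T *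
      (enn2real (K3 (off_diagonal (\<lambda>x. ennreal (?G x)))) - enn2real (K3 (off_diagonal (\<lambda>x. ennreal (- ?G x)))))"
    unfolding offp .
qed

end

section \<open>Random signs\<close>

text \<open>The two prescribed probabilities add up to one, so no other value of the sign has
  positive probability and every expectation is a sum of two terms.\<close>

lemma (in prob_space) nn_integral_sign:
  assumes s [measurable]: "s \<in> borel_measurable M"
    and pos: "measure M {w \<in> space M. s w = 1} = (1 + \<theta>) / 2" and neg: "measure M {w \<in> space M. s w = -1} = (1 - \<theta>) / 2"
  shows "AE w in M. s w = 1 \<or> s w = (- 1 :: real)"
    and "(\<integral>\<^sup>+w. f (s w) \<partial>M) = ennreal ((1 + \<theta>) / 2) * f 1 + ennreal ((1 - \<theta>) / 2) * f (- 1)"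
proof -
  let ?P = "{w \<in> space M. s w = 1}" and ?N = "{w \<in> space M. s w = -1}"
  have "prob (?P \<union> ?N) = prob ?P + prob ?N" by (rule finite_measure_Union) auto
  also have "\<dots> = 1" using pos neg by (simp add: field_simps)
  also have "?P \<union> ?N = {w \<in> space M. s w = 1 \<or> s w = -1}" by auto
  finally show ae: "AE w in M. s w = 1 \<or> s w = - 1" by (subst (asm) prob_eq_1) auto
  have "(\<integral>\<^sup>+w. f (s w) \<partial>M) = (\<integral>\<^sup>+w. f 1 * indicator ?P w + f (- 1) * indicator ?N w \<partial>M)"
    using ae by (intro nn_integral_cong_AE) (auto simp: indicator_def)
  also have "\<dots> = f 1 * emeasure M ?P + f (- 1) * emeasure M ?N"
    by (subst nn_integral_add) (simp_all add: nn_integral_cmult_indicator)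
  finally show "(\<integral>\<^sup>+w. f (s w) \<partial>M) = ennreal ((1 + \<theta>) / 2) * f 1 + ennreal ((1 - \<theta>) / 2) * f (- 1)"
    by (simp add: emeasure_eq_measure pos neg mult.commute)
qed

text \<open>The six integrals are reordered so that all signs precede all clusters. In this order
  the product law of three marks can be compared with the separate independence of the signs and of
  the clusters.\<close>

lemma nn_integral_pair_cube:
  assumes "prob_space A" "prob_space B"
    and f: "(\<lambda>(x, y, z). f x y z) \<in> borel_measurable ((A \<Otimes>\<^sub>M B) \<Otimes>\<^sub>M (A \<Otimes>\<^sub>M B) \<Otimes>\<^sub>M (A \<Otimes>\<^sub>M B))"
  shows "(\<integral>\<^sup>+x. \<integral>\<^sup>+y. \<integral>\<^sup>+z. f x y z \<partial>(A \<Otimes>\<^sub>M B) \<partial>(A \<Otimes>\<^sub>M B) \<partial>(A \<Otimes>\<^sub>M B))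
    = (\<integral>\<^sup>+a. \<integral>\<^sup>+b. \<integral>\<^sup>+c. \<integral>\<^sup>+x. \<integral>\<^sup>+y. \<integral>\<^sup>+z. f (a, x) (b, y) (c, z) \<partial>B \<partial>B \<partial>B \<partial>A \<partial>A \<partial>A)"
proof -
  interpret A: prob_space A by fact
  interpret B: prob_space B by fact
  interpret AB: pair_prob_space A B ..
  interpret BA: pair_prob_space B A ..
  have [measurable (raw)]: "(\<lambda>p. f (a p) (b p) (c p)) \<in> borel_measurable N"
    if "a \<in> measurable N (A \<Otimes>\<^sub>M B)" "b \<in> measurable N (A \<Otimes>\<^sub>M B)" "c \<in> measurable N (A \<Otimes>\<^sub>M B)" for N :: "'n measure" and a b c
    using measurable_compose[of "\<lambda>p. (a p, b p, c p)" N _ _ borel, OF _ f] that by simp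
  have "(\<integral>\<^sup>+x. \<integral>\<^sup>+y. \<integral>\<^sup>+z. f x y z \<partial>(A \<Otimes>\<^sub>M B) \<partial>(A \<Otimes>\<^sub>M B) \<partial>(A \<Otimes>\<^sub>M B))
    = (\<integral>\<^sup>+a. \<integral>\<^sup>+x. \<integral>\<^sup>+b. \<integral>\<^sup>+y. \<integral>\<^sup>+c. \<integral>\<^sup>+z. f (a, x) (b, y) (c, z) \<partial>B \<partial>A \<partial>B \<partial>A \<partial>B \<partial>A)"
  proof -
    have 1: "(\<integral>\<^sup>+z. f x y z \<partial>(A \<Otimes>\<^sub>M B)) = (\<integral>\<^sup>+c. \<integral>\<^sup>+z. f x y (c, z) \<partial>B \<partial>A)"
      if "x \<in> space (A \<Otimes>\<^sub>M B)" "y \<in> space (A \<Otimes>\<^sub>M B)" for x y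
      by (rule B.nn_integral_fst[symmetric]) (use that in measurable)
    have 2: "(\<integral>\<^sup>+y. \<integral>\<^sup>+z. f x y z \<partial>(A \<Otimes>\<^sub>M B) \<partial>(A \<Otimes>\<^sub>M B)) = (\<integral>\<^sup>+b. \<integral>\<^sup>+y. \<integral>\<^sup>+c. \<integral>\<^sup>+z. f x (b, y) (c, z) \<partial>B \<partial>A \<partial>B \<partial>A)"
      if x: "x \<in> space (A \<Otimes>\<^sub>M B)" for x
    proof -
      have "(\<integral>\<^sup>+y. \<integral>\<^sup>+z. f x y z \<partial>(A \<Otimes>\<^sub>M B) \<partial>(A \<Otimes>\<^sub>M B)) = (\<integral>\<^sup>+y. \<integral>\<^sup>+c. \<integral>\<^sup>+z. f x y (c, z) \<partial>B \<partial>A \<partial>(A \<Otimes>\<^sub>M B))"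
        by (intro nn_integral_cong 1 x)
      also have "\<dots> = (\<integral>\<^sup>+b. \<integral>\<^sup>+y. \<integral>\<^sup>+c. \<integral>\<^sup>+z. f x (b, y) (c, z) \<partial>B \<partial>A \<partial>B \<partial>A)"
        by (rule B.nn_integral_fst[symmetric]) (use x in measurable)
      finally show ?thesis .
    qed
    have "(\<integral>\<^sup>+x. \<integral>\<^sup>+y. \<integral>\<^sup>+z. f x y z \<partial>(A \<Otimes>\<^sub>M B) \<partial>(A \<Otimes>\<^sub>M B) \<partial>(A \<Otimes>\<^sub>M B))
        = (\<integral>\<^sup>+x. \<integral>\<^sup>+b. \<integral>\<^sup>+y. \<integral>\<^sup>+c. \<integral>\<^sup>+z. f x (b, y) (c, z) \<partial>B \<partial>A \<partial>B \<partial>A \<partial>(A \<Otimes>\<^sub>M B))"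
      by (intro nn_integral_cong 2)
    also have "\<dots> = (\<integral>\<^sup>+a. \<integral>\<^sup>+x. \<integral>\<^sup>+b. \<integral>\<^sup>+y. \<integral>\<^sup>+c. \<integral>\<^sup>+z. f (a, x) (b, y) (c, z) \<partial>B \<partial>A \<partial>B \<partial>A \<partial>B \<partial>A)"
      by (rule B.nn_integral_fst[symmetric]) measurable
    finally show ?thesis .
  qed
  also have "\<dots> = (\<integral>\<^sup>+a. \<integral>\<^sup>+b. \<integral>\<^sup>+x. \<integral>\<^sup>+y. \<integral>\<^sup>+c. \<integral>\<^sup>+z. f (a, x) (b, y) (c, z) \<partial>B \<partial>A \<partial>B \<partial>B \<partial>A \<partial>A)"
    by (intro nn_integral_cong AB.Fubini') measurable
  also have "\<dots> = (\<integral>\<^sup>+a. \<integral>\<^sup>+b. \<integral>\<^sup>+x. \<integral>\<^sup>+c. \<integral>\<^sup>+y. \<integral>\<^sup>+z. f (a, x) (b, y) (c, z) \<partial>B \<partial>B \<partial>A \<partial>B \<partial>A \<partial>A)"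
    by (intro nn_integral_cong AB.Fubini') measurable
  also have "\<dots> = (\<integral>\<^sup>+a. \<integral>\<^sup>+b. \<integral>\<^sup>+c. \<integral>\<^sup>+x. \<integral>\<^sup>+y. \<integral>\<^sup>+z. f (a, x) (b, y) (c, z) \<partial>B \<partial>B \<partial>B \<partial>A \<partial>A \<partial>A)"
    by (intro nn_integral_cong AB.Fubini') measurable
  finally show ?thesis .
qed

section \<open>Processes with random signs\<close>

text \<open>The one-cluster term when all signs are \<open>+ 1\<close>. It depends only on the rate
  and on the cluster law \<open>R\<close>, and so is the common reference for all values of
  \<open>\<theta>\<close>.\<close>

definition unsigned_cumulant :: "real \<Rightarrow> real measure measure \<Rightarrow> (real \<Rightarrow> real \<Rightarrow> real \<Rightarrow> ennreal) \<Rightarrow> ennreal" where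
  "unsigned_cumulant \<nu> R F = ennreal \<nu> * (\<integral>\<^sup>+d. cluster3 (1, d) F \<partial>R)"

locale signed_clusters = poisson_points M \<nu> U
  for M :: "'w measure" and \<nu> :: real and U :: "nat \<Rightarrow> 'w \<Rightarrow> real" +
  fixes D :: "nat \<Rightarrow> 'w \<Rightarrow> real measure" and R :: "real measure measure" and s :: "nat \<Rightarrow> 'w \<Rightarrow> real" and \<theta> :: real
  assumes D [measurable]: "\<And>j. D j \<in> measurable M counting_space"
    and D_law: "\<And>j. distr M counting_space (D j) = R"
    and D_indep: "indep_vars (\<lambda>_. counting_space) D UNIV"
    and U_D_indep: "indep_elements M (\<Pi>\<^sub>M j\<in>UNIV. borel) (\<lambda>w j. U j w) (\<Pi>\<^sub>M j\<in>UNIV. counting_space) (\<lambda>w j. D j w)"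
    and s [measurable]: "\<And>j. s j \<in> borel_measurable M"
    and s_pos: "\<And>j. prob {w \<in> space M. s j w = 1} = (1 + \<theta>) / 2"
    and s_neg: "\<And>j. prob {w \<in> space M. s j w = -1} = (1 - \<theta>) / 2"
    and s_indep: "indep_vars (\<lambda>_. borel) s UNIV"
    and s_UD_indep: "indep_elements M (\<Pi>\<^sub>M j\<in>UNIV. borel) (\<lambda>w j. s j w)
      ((\<Pi>\<^sub>M j\<in>UNIV. borel) \<Otimes>\<^sub>M (\<Pi>\<^sub>M j\<in>UNIV. counting_space)) (\<lambda>w. (\<lambda>j. U j w, \<lambda>j. D j w))"
    and R_moment: "(\<integral>\<^sup>+d. emeasure d UNIV ^ 3 \<partial>R) < \<infinity>"
begin

abbreviation sign_law :: "real measure" where "sign_law \<equiv> distr M borel (s 0)"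

lemma sign_law: "distr M borel (s j) = sign_law"
proof (rule measure_eqI)
  fix A assume "A \<in> sets (distr M borel (s j))"
  then have [measurable]: "A \<in> sets borel" by simp
  have "emeasure (distr M borel (s i)) A = (\<integral>\<^sup>+w. indicator A (s i w) \<partial>M)" for i
    using nn_integral_distr[OF s, of "indicator A" i] by simp
  then show "emeasure (distr M borel (s j)) A = emeasure sign_law A"
    unfolding nn_integral_sign(2)[OF s s_pos s_neg] by simp
qed simp

lemma prob_space_sign_law: "prob_space sign_law" by (rule prob_space_distr) measurable

lemma R_eq: "R = distr M counting_space (D 0)" by (rule D_law[symmetric])

lemma prob_space_R: "prob_space R" unfolding R_eq by (rule prob_space_distr) measurable

lemma sets_R [measurable_cong, simp]: "sets R = sets counting_space" unfolding R_eq by simp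

lemma space_R [simp]: "space R = space counting_space" unfolding R_eq by simp

lemma path_measurable [measurable (raw)]:
  assumes [measurable]: "q \<in> measurable K M"
  shows "(\<lambda>p j. s j (q p)) \<in> measurable K (\<Pi>\<^sub>M j\<in>UNIV. borel)"
    and "(\<lambda>p j. U j (q p)) \<in> measurable K (\<Pi>\<^sub>M j\<in>UNIV. borel)"
    and "(\<lambda>p j. D j (q p)) \<in> measurable K (\<Pi>\<^sub>M j\<in>UNIV. counting_space)"
  by (rule measurable_PiM_single'; simp add: PiE_iff measurable_space[OF D measurable_space[OF assms]])+

lemma zip_measurable [measurable (raw)]:
  fixes a :: "'k \<Rightarrow> nat \<Rightarrow> real"
  assumes a: "a \<in> measurable K (\<Pi>\<^sub>M j\<in>UNIV. borel)" and b: "b \<in> measurable K (\<Pi>\<^sub>M j\<in>UNIV. counting_space)"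
  shows "(\<lambda>p j. (a p j, b p j)) \<in> measurable K (\<Pi>\<^sub>M j\<in>UNIV. marks)"
proof (rule measurable_PiM_single')
  show *: "(\<lambda>p. (a p j, b p j)) \<in> measurable K marks" for j
    by (rule measurable_Pair; rule measurable_compose[OF _ measurable_component_singleton], rule a b; simp)
  show "(\<lambda>p j. (a p j, b p j)) \<in> space K \<rightarrow> (\<Pi>\<^sub>E j\<in>UNIV. space marks)"
    using measurable_space[OF *] by (auto simp: PiE_iff)
qed

lemma s_UD_nn_integral:
  assumes h: "(\<lambda>(x, y, z). h x y z) \<in> borel_measurable ((\<Pi>\<^sub>M j\<in>UNIV. borel) \<Otimes>\<^sub>M (\<Pi>\<^sub>M j\<in>UNIV. borel) \<Otimes>\<^sub>M (\<Pi>\<^sub>M j\<in>UNIV. counting_space))"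
  shows "(\<integral>\<^sup>+w. h (\<lambda>j. s j w) (\<lambda>j. U j w) (\<lambda>j. D j w) \<partial>M) = (\<integral>\<^sup>+w'. \<integral>\<^sup>+w. h (\<lambda>j. s j w') (\<lambda>j. U j w) (\<lambda>j. D j w) \<partial>M \<partial>M)"
proof -
  have m: "(\<lambda>(x, y). (\<lambda>x (y, z). h x y z) x y) \<in> borel_measurable
      ((\<Pi>\<^sub>M j\<in>UNIV. borel) \<Otimes>\<^sub>M (\<Pi>\<^sub>M j\<in>UNIV. borel) \<Otimes>\<^sub>M (\<Pi>\<^sub>M j\<in>UNIV. counting_space))"
    using h by (simp add: case_prod_unfold)
  have "(\<integral>\<^sup>+w. (\<lambda>x (y, z). h x y z) (\<lambda>j. s j w) (\<lambda>j. U j w, \<lambda>j. D j w) \<partial>M)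
      = (\<integral>\<^sup>+w'. \<integral>\<^sup>+w. (\<lambda>x (y, z). h x y z) (\<lambda>j. s j w') (\<lambda>j. U j w, \<lambda>j. D j w) \<partial>M \<partial>M)"
    by (rule indep_elements_nn_integral[OF _ _ s_UD_indep m]) measurable
  then show ?thesis by simp
qed

lemma U_D_nn_integral:
  assumes h: "(\<lambda>(x, y). h x y) \<in> borel_measurable ((\<Pi>\<^sub>M j\<in>UNIV. borel) \<Otimes>\<^sub>M (\<Pi>\<^sub>M j\<in>UNIV. counting_space))"
  shows "(\<integral>\<^sup>+w. h (\<lambda>j. U j w) (\<lambda>j. D j w) \<partial>M) = (\<integral>\<^sup>+w'. \<integral>\<^sup>+w. h (\<lambda>j. U j w') (\<lambda>j. D j w) \<partial>M \<partial>M)"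
  by (rule indep_elements_nn_integral[OF _ _ U_D_indep h]) measurable

text \<open>Independence of the points from the pairs of sign and cluster is assembled from two
  hypotheses: the signs are separated from points and clusters and frozen, the points are separated
  from the clusters, and then signs and clusters are joined again.\<close>

lemma marks_indep:
  assumes h: "(\<lambda>(u, x). h u x) \<in> borel_measurable ((\<Pi>\<^sub>M j\<in>UNIV. borel) \<Otimes>\<^sub>M (\<Pi>\<^sub>M j\<in>UNIV. marks))"
  shows "(\<integral>\<^sup>+w. h (\<lambda>j. U j w) (\<lambda>j. (s j w, D j w)) \<partial>M)
    = (\<integral>\<^sup>+w'. \<integral>\<^sup>+w. h (\<lambda>j. U j w) (\<lambda>j. (s j w', D j w')) \<partial>M \<partial>M)"
proof -
  interpret MM: pair_prob_space M M ..
  have [measurable (raw)]: "(\<lambda>p. h (a p) (\<lambda>j. b p j)) \<in> borel_measurable N"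
    if "a \<in> measurable N (\<Pi>\<^sub>M j\<in>UNIV. borel)" "(\<lambda>p. (\<lambda>j. b p j)) \<in> measurable N (\<Pi>\<^sub>M j\<in>UNIV. marks)" for N :: "'n measure" and a b
    using measurable_compose[of "\<lambda>p. (a p, \<lambda>j. b p j)" N _ _ borel, OF _ h] that by simp
  have "(\<integral>\<^sup>+w. h (\<lambda>j. U j w) (\<lambda>j. (s j w, D j w)) \<partial>M) = (\<integral>\<^sup>+w'. \<integral>\<^sup>+w. h (\<lambda>j. U j w) (\<lambda>j. (s j w', D j w)) \<partial>M \<partial>M)"
    by (rule s_UD_nn_integral[where h = "\<lambda>x y z. h y (\<lambda>j. (x j, z j))"]) measurable
  also have "\<dots> = (\<integral>\<^sup>+w'. \<integral>\<^sup>+v. \<integral>\<^sup>+w. h (\<lambda>j. U j v) (\<lambda>j. (s j w', D j w)) \<partial>M \<partial>M \<partial>M)"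
  proof (rule nn_integral_cong)
    fix w' assume "w' \<in> space M"
    have [simp]: "(\<lambda>j. s j w') \<in> space (\<Pi>\<^sub>M j\<in>UNIV. borel)" by (simp add: space_PiM)
    show "(\<integral>\<^sup>+w. h (\<lambda>j. U j w) (\<lambda>j. (s j w', D j w)) \<partial>M) = (\<integral>\<^sup>+v. \<integral>\<^sup>+w. h (\<lambda>j. U j v) (\<lambda>j. (s j w', D j w)) \<partial>M \<partial>M)"
      by (rule U_D_nn_integral[where h = "\<lambda>y z. h y (\<lambda>j. (s j w', z j))"]) measurable
  qed
  also have "\<dots> = (\<integral>\<^sup>+v. \<integral>\<^sup>+w'. \<integral>\<^sup>+w. h (\<lambda>j. U j v) (\<lambda>j. (s j w', D j w)) \<partial>M \<partial>M \<partial>M)"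
    by (rule MM.Fubini') measurable
  \<comment> \<open>With the points frozen, the independence of signs and clusters is used backwards
    to bring both to the same sample point.\<close>
  also have "\<dots> = (\<integral>\<^sup>+v. \<integral>\<^sup>+w. h (\<lambda>j. U j v) (\<lambda>j. (s j w, D j w)) \<partial>M \<partial>M)"
  proof (rule nn_integral_cong)
    fix v assume "v \<in> space M"
    have [simp]: "(\<lambda>j. U j v) \<in> space (\<Pi>\<^sub>M j\<in>UNIV. borel)" by (simp add: space_PiM)
    show "(\<integral>\<^sup>+w'. \<integral>\<^sup>+w. h (\<lambda>j. U j v) (\<lambda>j. (s j w', D j w)) \<partial>M \<partial>M) = (\<integral>\<^sup>+w. h (\<lambda>j. U j v) (\<lambda>j. (s j w, D j w)) \<partial>M)"
      by (rule s_UD_nn_integral[where h = "\<lambda>x y z. h (\<lambda>j. U j v) (\<lambda>j. (x j, z j))", symmetric]) measurable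
  qed
  also have "\<dots> = (\<integral>\<^sup>+w. \<integral>\<^sup>+v. h (\<lambda>j. U j v) (\<lambda>j. (s j w, D j w)) \<partial>M \<partial>M)"
    by (rule MM.Fubini') measurable
  finally show ?thesis .
qed

text \<open>The signs are frozen by their independence from the clusters; three clusters and then
  three signs are integrated by their own product laws, and the order of integration is
  restored.\<close>

lemma marks_iid:
  assumes ne: "i \<noteq> j" "i \<noteq> k" "j \<noteq> k" and f: "(\<lambda>(x, y, z). f x y z) \<in> borel_measurable (marks \<Otimes>\<^sub>M marks \<Otimes>\<^sub>M marks)"
  shows "(\<integral>\<^sup>+w. f (s i w, D i w) (s j w, D j w) (s k w, D k w) \<partial>M)
    = (\<integral>\<^sup>+x. \<integral>\<^sup>+y. \<integral>\<^sup>+z. f x y z \<partial>(sign_law \<Otimes>\<^sub>M R) \<partial>(sign_law \<Otimes>\<^sub>M R) \<partial>(sign_law \<Otimes>\<^sub>M R))"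
proof -
  interpret R: prob_space R by (rule prob_space_R)
  have [measurable (raw)]: "(\<lambda>p. f (a p) (b p) (c p)) \<in> borel_measurable N"
    if "a \<in> measurable N marks" "b \<in> measurable N marks" "c \<in> measurable N marks" for N :: "'n measure" and a b c
    using measurable_compose[of "\<lambda>p. (a p, b p, c p)" N _ _ borel, OF _ f] that by simp
  have "(\<integral>\<^sup>+w. f (s i w, D i w) (s j w, D j w) (s k w, D k w) \<partial>M)
      = (\<integral>\<^sup>+w'. \<integral>\<^sup>+w. f (s i w', D i w) (s j w', D j w) (s k w', D k w) \<partial>M \<partial>M)"
    by (rule s_UD_nn_integral[where h = "\<lambda>x y z. f (x i, z i) (x j, z j) (x k, z k)"]) measurable
  also have "\<dots> = (\<integral>\<^sup>+w'. \<integral>\<^sup>+x. \<integral>\<^sup>+y. \<integral>\<^sup>+z. f (s i w', x) (s j w', y) (s k w', z) \<partial>R \<partial>R \<partial>R \<partial>M)"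
  proof (rule nn_integral_cong)
    fix w' assume "w' \<in> space M"
    show "(\<integral>\<^sup>+w. f (s i w', D i w) (s j w', D j w) (s k w', D k w) \<partial>M)
        = (\<integral>\<^sup>+x. \<integral>\<^sup>+y. \<integral>\<^sup>+z. f (s i w', x) (s j w', y) (s k w', z) \<partial>R \<partial>R \<partial>R)"
      by (rule indep_vars_nn_integral_triple[where f = "\<lambda>x y z. f (s i w', x) (s j w', y) (s k w', z)", OF D_indep D_law ne]) measurable
  qed
  also have "\<dots> = (\<integral>\<^sup>+a. \<integral>\<^sup>+b. \<integral>\<^sup>+c. \<integral>\<^sup>+x. \<integral>\<^sup>+y. \<integral>\<^sup>+z. f (a, x) (b, y) (c, z) \<partial>R \<partial>R \<partial>R \<partial>sign_law \<partial>sign_law \<partial>sign_law)"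
    by (rule indep_vars_nn_integral_triple[where f = "\<lambda>a b c. \<integral>\<^sup>+x. \<integral>\<^sup>+y. \<integral>\<^sup>+z. f (a, x) (b, y) (c, z) \<partial>R \<partial>R \<partial>R", OF s_indep sign_law ne]) measurable
  also have "\<dots> = (\<integral>\<^sup>+x. \<integral>\<^sup>+y. \<integral>\<^sup>+z. f x y z \<partial>(sign_law \<Otimes>\<^sub>M R) \<partial>(sign_law \<Otimes>\<^sub>M R) \<partial>(sign_law \<Otimes>\<^sub>M R))"
    by (rule nn_integral_pair_cube[OF prob_space_sign_law prob_space_R, symmetric]) measurable
  finally show ?thesis .
qed

lemma cluster_points: "cluster_points M \<nu> U (\<lambda>j w. (s j w, D j w)) (sign_law \<Otimes>\<^sub>M R)"
proof (intro cluster_points.intro marked_poisson.intro marked_poisson_axioms.intro cluster_points_axioms.intro poisson_points_axioms)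
  interpret S: prob_space sign_law by (rule prob_space_sign_law)
  interpret R: prob_space R by (rule prob_space_R)
  interpret SR: pair_prob_space sign_law R ..
  show "(\<lambda>w. (s j w, D j w)) \<in> measurable M marks" for j by measurable
  show "prob_space (sign_law \<Otimes>\<^sub>M R)" by (rule SR.prob_space_axioms)
  show "sets (sign_law \<Otimes>\<^sub>M R) = sets marks" by (intro sets_pair_measure_cong) simp_all
  show "(\<integral>\<^sup>+w. h (\<lambda>j. U j w) (\<lambda>j. (s j w, D j w)) \<partial>M) = (\<integral>\<^sup>+w'. \<integral>\<^sup>+w. h (\<lambda>j. U j w) (\<lambda>j. (s j w', D j w')) \<partial>M \<partial>M)"
    if "(\<lambda>(u, x). h u x) \<in> borel_measurable ((\<Pi>\<^sub>M j\<in>UNIV. borel) \<Otimes>\<^sub>M (\<Pi>\<^sub>M j\<in>UNIV. marks))" for h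
    by (rule marks_indep[OF that])
  show "(\<integral>\<^sup>+w. f (s i w, D i w) (s j w, D j w) (s k w, D k w) \<partial>M)
      = (\<integral>\<^sup>+x. \<integral>\<^sup>+y. \<integral>\<^sup>+z. f x y z \<partial>(sign_law \<Otimes>\<^sub>M R) \<partial>(sign_law \<Otimes>\<^sub>M R) \<partial>(sign_law \<Otimes>\<^sub>M R))"
    if "i \<noteq> j" "i \<noteq> k" "j \<noteq> k" "(\<lambda>(x, y, z). f x y z) \<in> borel_measurable (marks \<Otimes>\<^sub>M marks \<Otimes>\<^sub>M marks)" for i j k f
    by (rule marks_iid[OF that])
  have "(\<integral>\<^sup>+x. mass x ^ 3 \<partial>(sign_law \<Otimes>\<^sub>M R)) = (\<integral>\<^sup>+a. \<integral>\<^sup>+d. mass (a, d) ^ 3 \<partial>R \<partial>sign_law)"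
    by (rule R.nn_integral_fst[symmetric]) measurable
  also have "\<dots> = (\<integral>\<^sup>+d. emeasure d UNIV ^ 3 \<partial>R)" using S.emeasure_space_1 by simp
  finally show "(\<integral>\<^sup>+x. mass x ^ 3 \<partial>(sign_law \<Otimes>\<^sub>M R)) < \<infinity>" using R_moment by simp
  have "AE a in sign_law. a \<noteq> 0"
    using nn_integral_sign(1)[OF s s_pos s_neg, of 0] by (subst AE_distr_iff) auto
  then have "emeasure sign_law {0} = 0" by (subst (asm) AE_iff_measurable[of "{0}"]) auto
  then have "emeasure (sign_law \<Otimes>\<^sub>M R) ({0} \<times> space R) = 0" by (subst R.emeasure_pair_measure_Times) auto
  then show "AE x in sign_law \<Otimes>\<^sub>M R. fst x \<noteq> 0"
    by (intro AE_I[of _ _ "{0} \<times> space R"]) (auto simp: space_pair_measure)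
qed

sublocale cluster_points M \<nu> U "\<lambda>j w. (s j w, D j w)" "sign_law \<Otimes>\<^sub>M R" by (rule cluster_points)

lemma N_eq: "N = cluster_process U s D" by (simp add: N_def)

text \<open>The sign of the single cluster is averaged out, and a cluster with sign
  \<open>- 1\<close> is traded for a reflected kernel. The centre \<open>r\<close> of the reflection
  is free because the position of the cluster is integrated over the line.\<close>

lemma K3_unsigned:
  assumes F: "(\<lambda>(a, b, c). F a b c) \<in> borel_measurable (borel \<Otimes>\<^sub>M borel \<Otimes>\<^sub>M borel)" 
  shows "K3 F = ennreal ((1 + \<theta>) / 2) * unsigned_cumulant \<nu> R F + ennreal ((1 - \<theta>) / 2) * unsigned_cumulant \<nu> R (\<lambda>a b c. F (r - a) (r - b) (r - c))"
proof -
  interpret S: prob_space sign_law by (rule prob_space_sign_law)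
  interpret R: prob_space R by (rule prob_space_R)
  interpret SR: pair_prob_space sign_law R ..
  have [measurable (raw)]: "(\<lambda>p. F (a p) (b p) (c p)) \<in> borel_measurable N"
    if "a \<in> borel_measurable N" "b \<in> borel_measurable N" "c \<in> borel_measurable N" for N :: "'n measure" and a b c
    using measurable_compose[of "\<lambda>p. (a p, b p, c p)" N _ _ borel, OF _ F] that by simp
  have [measurable (raw)]: "(\<lambda>p. cluster3 (x p) F) \<in> borel_measurable N" if "x \<in> measurable N marks" for N :: "'n measure" and x
    using that unfolding cluster3_def by measurable
  let ?F = "\<lambda>a b c. F (r - a) (r - b) (r - c)"
  have [measurable (raw)]: "(\<lambda>p. cluster3 (x p) ?F) \<in> borel_measurable N" if "x \<in> measurable N marks" for N :: "'n measure" and x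
    using that unfolding cluster3_def by measurable
  have Fr: "(\<lambda>(a, b, c). ?F a b c) \<in> borel_measurable (borel \<Otimes>\<^sub>M borel \<Otimes>\<^sub>M borel)" by measurable
  have refl: "cluster3 (- 1, d) F = cluster3 (1, d) ?F" if "d \<in> space R" for d
    using cluster3_reflect[of d ?F 1 r] that Fr by simp
  have "(\<integral>\<^sup>+x. cluster3 x F \<partial>(sign_law \<Otimes>\<^sub>M R)) = (\<integral>\<^sup>+a. \<integral>\<^sup>+d. cluster3 (a, d) F \<partial>R \<partial>sign_law)"
    by (rule R.nn_integral_fst[symmetric]) measurable
  also have "\<dots> = (\<integral>\<^sup>+w. \<integral>\<^sup>+d. cluster3 (s 0 w, d) F \<partial>R \<partial>M)"
    by (rule nn_integral_distr) measurable
  also have "\<dots> = ennreal ((1 + \<theta>) / 2) * (\<integral>\<^sup>+d. cluster3 (1, d) F \<partial>R) + ennreal ((1 - \<theta>) / 2) * (\<integral>\<^sup>+d. cluster3 (- 1, d) F \<partial>R)"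
    by (rule nn_integral_sign(2)[OF s s_pos s_neg])
  also have "(\<integral>\<^sup>+d. cluster3 (- 1, d) F \<partial>R) = (\<integral>\<^sup>+d. cluster3 (1, d) ?F \<partial>R)"
    by (intro nn_integral_cong refl)
  finally show ?thesis by (simp add: K3_eq unsigned_cumulant_def distrib_left mult.left_commute)
qed

text \<open>At \<open>\<theta> = 1\<close> the weight of the reflected term is zero, so the
  reference quantity is computed from the cumulant of the unsigned process.\<close>

lemma cumulant_unsigned:
  assumes \<theta>: "\<theta> = 1" and G: "test_fun G"
  shows "factorial_cumulant3 M (cluster_process U s D) \<kappa> \<Longrightarrow> signed_int \<kappa> G
      = enn2real (unsigned_cumulant \<nu> R (off_diagonal (\<lambda>x. ennreal (G x)))) - enn2real (unsigned_cumulant \<nu> R (off_diagonal (\<lambda>x. ennreal (- G x))))"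
    and "unsigned_cumulant \<nu> R (off_diagonal (\<lambda>x. ennreal (G x))) < \<infinity>"
proof -
  have *: "K3 (off_diagonal (\<lambda>x. ennreal (H x))) = unsigned_cumulant \<nu> R (off_diagonal (\<lambda>x. ennreal (H x)))" if H: "test_fun H" for H
  proof -
    have [measurable]: "H \<in> borel_measurable borel" using H by (simp add: test_fun_def)
    have "(\<lambda>x. ennreal (H x)) \<in> borel_measurable borel" by measurable
    from K3_unsigned[OF off_diagonal_measurable[OF this]] show ?thesis using \<theta> by simp
  qed
  show "signed_int \<kappa> G
      = enn2real (unsigned_cumulant \<nu> R (off_diagonal (\<lambda>x. ennreal (G x)))) - enn2real (unsigned_cumulant \<nu> R (off_diagonal (\<lambda>x. ennreal (- G x))))"
    if "factorial_cumulant3 M (cluster_process U s D) \<kappa>"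
    using cumulant_signed_int[OF that[folded N_eq] G] *[OF G] *[OF test_fun_uminus[OF G]] by simp
  show "unsigned_cumulant \<nu> R (off_diagonal (\<lambda>x. ennreal (G x))) < \<infinity>"
    using K3_off_diagonal_finite[OF G] *[OF G] by simp
qed

lemma triple_stat_unsigned:
  assumes g [measurable]: "g \<in> borel_measurable borel" and bnd: "bounded (range g)"
    and odd: "\<And>\<tau>1 \<tau>2. g (- \<tau>1, - \<tau>2) = - g (\<tau>1, \<tau>2)"
    and fin: "unsigned_cumulant \<nu> R (off_diagonal (\<lambda>x. ennreal (stat_kernel g T x))) < \<infinity>"
      "unsigned_cumulant \<nu> R (off_diagonal (\<lambda>x. ennreal (- stat_kernel g T x))) < \<infinity>"
  shows "integrable M (\<lambda>w. triple_stat T g (cluster_process U s D w))"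
    and "(LINT w|M. triple_stat T g (cluster_process U s D w)) = 1 / T * (\<theta> *
      (enn2real (unsigned_cumulant \<nu> R (off_diagonal (\<lambda>x. ennreal (stat_kernel g T x))))
        - enn2real (unsigned_cumulant \<nu> R (off_diagonal (\<lambda>x. ennreal (- stat_kernel g T x))))))"
proof -
  let ?G = "stat_kernel g T" and ?p = "(1 + \<theta>) / 2" and ?q = "(1 - \<theta>) / 2"
  let ?F = "off_diagonal (\<lambda>x. ennreal (?G x))" and ?F' = "off_diagonal (\<lambda>x. ennreal (- ?G x))"
  show "integrable M (\<lambda>w. triple_stat T g (cluster_process U s D w))"
    using triple_stat_expectation(1)[OF g bnd odd] unfolding N_eq .
  \<comment> \<open>The weights are probabilities of the sign with index 0, hence nonnegative, as
    the arithmetic of \<open>ennreal\<close> requires.\<close>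
  have pq: "0 \<le> ?p" "0 \<le> ?q" using measure_nonneg[of M] s_pos[of 0] s_neg[of 0] by metis+
  have [measurable]: "?G \<in> borel_measurable borel" by (rule stat_kernel_measurable[OF g])
  have m: "(\<lambda>x. ennreal (?G x)) \<in> borel_measurable borel" "(\<lambda>x. ennreal (- ?G x)) \<in> borel_measurable borel" by measurable
  \<comment> \<open>With the centre chosen as \<open>T\<close>, reflection exchanges the positive
    and negative parts of the kernel. The two parts are thus mixed with exchanged weights, and the
    difference of the weights comes out.\<close>
  have r: "(\<lambda>a b c. ?F (T - a) (T - b) (T - c)) = ?F'" "(\<lambda>a b c. ?F' (T - a) (T - b) (T - c)) = ?F"
    by (simp_all add: off_diagonal_def fun_eq_iff stat_kernel_reflect[OF odd])
  have e: "enn2real (ennreal ?p * x + ennreal ?q * y) = ?p * enn2real x + ?q * enn2real y" if "x < \<infinity>" "y < \<infinity>" for x y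
    using that pq by (simp add: enn2real_plus enn2real_mult ennreal_mult_less_top)
  have k1: "enn2real (K3 ?F) = ?p * enn2real (unsigned_cumulant \<nu> R ?F) + ?q * enn2real (unsigned_cumulant \<nu> R ?F')"
    using K3_unsigned[OF off_diagonal_measurable[OF m(1)], of T] e[OF fin] unfolding r by simp
  have k2: "enn2real (K3 ?F') = ?p * enn2real (unsigned_cumulant \<nu> R ?F') + ?q * enn2real (unsigned_cumulant \<nu> R ?F)"
    using K3_unsigned[OF off_diagonal_measurable[OF m(2)], of T] e[OF fin(2) fin(1)] unfolding r by simp
  have "?p - ?q = \<theta>" by (simp add: field_simps)
  then have "enn2real (K3 ?F) - enn2real (K3 ?F') = \<theta> * (enn2real (unsigned_cumulant \<nu> R ?F) - enn2real (unsigned_cumulant \<nu> R ?F'))"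
    unfolding k1 k2 by (simp add: field_simps)
  then show "(LINT w|M. triple_stat T g (cluster_process U s D w)) = 1 / T * (\<theta> *
      (enn2real (unsigned_cumulant \<nu> R ?F) - enn2real (unsigned_cumulant \<nu> R ?F')))"
    using triple_stat_expectation(2)[OF g bnd odd, of T] unfolding N_eq by simp
qed

end

section \<open>From the cumulant measure to the windowed mean\<close>

text \<open>Disintegration produces a mean with \<open>c\<close> in place of its odd part. The
  admissible increments for one base point are not symmetric, so the even part of \<open>c\<close>
  disappears only after integration over the base point, where \<open>x\<close> and
  \<open>T - x\<close> are paired.\<close>

lemma cumulant_window_mean:
  fixes c g :: "real \<times> real \<Rightarrow> real"
  assumes \<kappa>: "reduced_measure3 \<kappa> \<rho>" and d: "signed_density \<rho> c" and c: "integrable lborel c"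
    and g [measurable]: "g \<in> borel_measurable borel" and bnd: "bounded (range g)"
    and odd: "\<And>\<tau>. g (- \<tau>) = - g \<tau>" and T: "0 < T"
  shows "signed_int \<kappa> (stat_kernel g T) = T * window_mean c g T"
proof -
  have \<rho>: "signed_radon \<rho>" using \<kappa> by (simp add: reduced_measure3_def)
  have [measurable]: "c \<in> borel_measurable borel" using c by auto
  obtain K where K: "\<And>x. \<bar>g x\<bar> \<le> K" using bnd by (auto simp: bounded_iff)
  have K0: "0 \<le> K" using K[of undefined] by linarith
  define W where "W x = {\<tau>::real \<times> real. 0 \<le> x + fst \<tau> \<and> x + fst \<tau> \<le> T \<and> 0 \<le> x + snd \<tau> \<and> x + snd \<tau> \<le> T}" for x
  define V where "V x = (LINT \<tau>|lborel. g \<tau> * indicator (W x) \<tau> * c \<tau>)" for x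
  let ?I = "\<lambda>x. indicator {0..T} x :: real"
  have Wm [measurable]: "W x \<in> sets borel" for x 
    by (intro borel_closed) (auto simp: W_def intro!: closed_Collect_conj closed_Collect_le continuous_intros)
  have ind: "(\<lambda>p. indicator (W (fst p)) (snd p) :: real) \<in> borel_measurable (lborel \<Otimes>\<^sub>M lborel)"
  proof -
    have "closed {p::real \<times> real \<times> real. snd p \<in> W (fst p)}"
      unfolding W_def mem_Collect_eq by (intro closed_Collect_conj closed_Collect_le continuous_intros)
    then have "{p \<in> space (lborel \<Otimes>\<^sub>M lborel). snd p \<in> W (fst p)} \<in> sets (lborel \<Otimes>\<^sub>M lborel)"
      unfolding lborel_prod by (simp add: borel_closed)
    then show ?thesis by (rule borel_measurable_indicator')
  qed
  have gc: "integrable lborel (\<lambda>\<tau>. g \<tau> * v \<tau>)" if v: "integrable lborel v" for v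
  proof (rule Bochner_Integration.integrable_bound[of _ "\<lambda>\<tau>. K * v \<tau>"])
    show "AE \<tau> in lborel. norm (g \<tau> * v \<tau>) \<le> norm (K * v \<tau>)"
      using K K0 by (intro AE_I2) (simp add: abs_mult mult_right_mono)
    show "(\<lambda>\<tau>. g \<tau> * v \<tau>) \<in> borel_measurable lborel" using v by measurable
  qed (use v in simp)
  have gW: "integrable lborel (\<lambda>\<tau>. g \<tau> * indicator (W x) \<tau> * v \<tau>)" if v: "integrable lborel v" for v x
  proof (rule Bochner_Integration.integrable_bound[OF gc[OF v]])
    show "(\<lambda>\<tau>. g \<tau> * indicator (W x) \<tau> * v \<tau>) \<in> borel_measurable lborel" using v by measurable
  qed (simp add: indicator_def)
  have Vm [measurable]: "V \<in> borel_measurable borel"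
  proof -
    have "V \<in> borel_measurable lborel"
      unfolding V_def using ind by (intro lborel.borel_measurable_lebesgue_integral) (simp add: case_prod_unfold)
    then show ?thesis by simp
  qed
  have Vb: "\<bar>V x\<bar> \<le> (LINT \<tau>|lborel. \<bar>g \<tau> * c \<tau>\<bar>)" for x
    unfolding V_def by (rule order_trans[OF integral_abs_bound integral_mono']) (use gc[OF c] in \<open>auto simp: indicator_def\<close>)
  have IV: "integrable lborel (\<lambda>x. ?I x * V x)"
  proof (rule Bochner_Integration.integrable_bound[of _ "\<lambda>x. ?I x * (LINT \<tau>|lborel. \<bar>g \<tau> * c \<tau>\<bar>)"])
    show "integrable lborel (\<lambda>x. ?I x * (LINT \<tau>|lborel. \<bar>g \<tau> * c \<tau>\<bar>))"
      by (intro integrable_mult_left integrable_real_indicator) (auto simp: emeasure_lborel_Icc_eq)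
    show "AE x in lborel. norm (?I x * V x) \<le> norm (?I x * (LINT \<tau>|lborel. \<bar>g \<tau> * c \<tau>\<bar>))"
      using Vb by (intro AE_I2) (simp add: indicator_def)
  qed measurable
  \<comment> \<open>For a fixed base point the kernel is a bounded function of the increments with
    bounded support, to which the density of the reduced measure applies.\<close>
  have slice: "signed_int \<rho> (\<lambda>(\<tau>1, \<tau>2). stat_kernel g T (x, x + \<tau>1, x + \<tau>2)) = ?I x * V x" for x
  proof -
    let ?h = "\<lambda>\<tau>. ?I x * (g \<tau> * indicator (W x) \<tau>)"
    have h: "(\<lambda>(\<tau>1, \<tau>2). stat_kernel g T (x, x + \<tau>1, x + \<tau>2)) = ?h"
      by (auto simp: fun_eq_iff stat_kernel_def W_def indicator_def)
    have "test_fun ?h"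
      unfolding test_fun_def
    proof (intro conjI)
      show "?h \<in> borel_measurable borel" by measurable
      show "bounded (range ?h)" using K K0 by (intro boundedI[of _ K]) (auto simp: indicator_def)
      have "{\<tau>. ?h \<tau> \<noteq> 0} \<subseteq> {- x..T - x} \<times> {- x..T - x}" by (auto simp: W_def indicator_def)
      then have "bounded {\<tau>. ?h \<tau> \<noteq> 0}"
        by (rule bounded_subset[rotated]) (intro bounded_Times bounded_closed_interval)
      then show "compact (fun_supp ?h)" by (simp add: fun_supp_def compact_closure)
    qed
    from signed_density_integral[OF \<rho> d c this] show ?thesis
      unfolding h V_def by (simp add: mult.assoc)
  qed
  have "signed_int \<kappa> (stat_kernel g T) = (LINT x|lborel. ?I x * V x)"
    using \<kappa> test_fun_stat_kernel[OF g bnd, of T] unfolding reduced_measure3_def slice[symmetric] by blast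
  moreover have "T * window_mean c g T = (LINT x|lborel. ?I x * V x)"
  proof -
    have cr: "integrable lborel (\<lambda>\<tau>. c (- \<tau>))" by (rule integrable_reflect[OF c])
    \<comment> \<open>Reversing the increments carries the window seen from \<open>x\<close> to the
      window seen from \<open>T - x\<close>; oddness of \<open>g\<close> supplies the sign.\<close>
    have V': "(LINT \<tau>|lborel. g \<tau> * indicator (W x) \<tau> * c (- \<tau>)) = - V (T - x)" for x
    proof -
      have W: "indicator (W x) (- \<tau>) = (indicator (W (T - x)) \<tau> :: real)" for \<tau> by (auto simp: W_def indicator_def)
      have "(\<lambda>\<tau>. g (- \<tau>) * indicator (W x) (- \<tau>) * c \<tau>) \<in> borel_measurable borel" by measurable
      from integral_reflect[OF this] show ?thesis unfolding V_def by (simp add: odd W)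
    qed
    have o: "(LINT \<tau>|lborel. g \<tau> * indicator (W x) \<tau> * odd_part c \<tau>) = 1 / 2 * (V x + V (T - x))" for x
    proof -
      have "(LINT \<tau>|lborel. g \<tau> * indicator (W x) \<tau> * odd_part c \<tau>)
          = (LINT \<tau>|lborel. 1 / 2 * (g \<tau> * indicator (W x) \<tau> * c \<tau> - g \<tau> * indicator (W x) \<tau> * c (- \<tau>)))"
        by (intro Bochner_Integration.integral_cong refl) (simp add: odd_part_def algebra_simps)
      also have "\<dots> = 1 / 2 * (V x - (LINT \<tau>|lborel. g \<tau> * indicator (W x) \<tau> * c (- \<tau>)))"
        unfolding V_def using Bochner_Integration.integral_diff[OF gW[OF c, of x] gW[OF cr, of x]] by (simp only: integral_mult_right_zero)
      finally show ?thesis unfolding V' by simp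
    qed
    have If: "?I (T + - 1 * x) = ?I x" for x by (auto simp: indicator_def)
    have IV': "integrable lborel (\<lambda>x. ?I x * V (T - x))"
      using lborel_integrable_real_affine[OF IV, of "- 1" T] If by simp
    \<comment> \<open>The substitution \<open>x\<close> to \<open>T - x\<close> preserves the
      interval of base points, so both halves have the same integral.\<close>
    have e: "(LINT x|lborel. ?I x * V (T - x)) = (LINT x|lborel. ?I x * V x)"
      using lborel_integral_real_affine[of "- 1" "\<lambda>x. ?I x * V x" T] If by simp
    have "T * window_mean c g T = (LINT x|lborel. 1 / 2 * (?I x * V x + ?I x * V (T - x)))"
      unfolding window_mean_def set_lebesgue_integral_def W_def[symmetric] o using T
      by (simp add: algebra_simps)
    also have "\<dots> = 1 / 2 * ((LINT x|lborel. ?I x * V x) + (LINT x|lborel. ?I x * V (T - x)))"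
      using Bochner_Integration.integral_add[OF IV IV'] by (simp only: integral_mult_right_zero)
    finally show ?thesis unfolding e by simp
  qed
  ultimately show ?thesis by simp
qed

theorem proposition4p1:
  fixes \<Omega> :: "'c measure" and C :: "'c \<Rightarrow> real measure"
    and M :: "'w measure" and \<nu> :: real
    and U :: "nat \<Rightarrow> 'w \<Rightarrow> real" and D :: "nat \<Rightarrow> 'w \<Rightarrow> real measure"
    and S :: "real \<Rightarrow> nat \<Rightarrow> 'w \<Rightarrow> real"
    and N :: "real \<Rightarrow> 'w \<Rightarrow> real measure"
    and \<kappa> :: "(real \<times> real \<times> real) signed_measure" and \<rho> :: "(real \<times> real) signed_measure"
    and c g :: "real \<times> real \<Rightarrow> real"
  assumes "prob_space \<Omega>"
    and "C \<in> measurable \<Omega> counting_space"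
    and "AE w in \<Omega>. emeasure (C w) {0} = 1"
    and "AE w in \<Omega>. measure_supp (C w) \<subseteq> {0..}"
    and "(\<integral>\<^sup>+w. emeasure (C w) UNIV ^ 3 \<partial>\<Omega>) < \<infinity>"
    and "\<nu> > 0"
    and "prob_space M"
    and "poisson_process M \<nu> U"
    and "\<And>j. D j \<in> measurable M counting_space"
    and "\<And>j. distr M counting_space (D j) = distr \<Omega> counting_space C"
    and "prob_space.indep_vars M (\<lambda>_. counting_space) D UNIV"
    and "indep_elements M (\<Pi>\<^sub>M j\<in>UNIV. borel) (\<lambda>w j. U j w) (\<Pi>\<^sub>M j\<in>UNIV. counting_space) (\<lambda>w j. D j w)"
    and "\<And>\<theta> j. \<theta> \<in> {-1..1} \<Longrightarrow> S \<theta> j \<in> borel_measurable M"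
    and "\<And>\<theta> j. \<theta> \<in> {-1..1} \<Longrightarrow> measure M {w \<in> space M. S \<theta> j w = 1} = (1 + \<theta>) / 2"
    and "\<And>\<theta> j. \<theta> \<in> {-1..1} \<Longrightarrow> measure M {w \<in> space M. S \<theta> j w = -1} = (1 - \<theta>) / 2"
    and "\<And>\<theta>. \<theta> \<in> {-1..1} \<Longrightarrow> prob_space.indep_vars M (\<lambda>_. borel) (S \<theta>) UNIV"
    and "\<And>\<theta>. \<theta> \<in> {-1..1} \<Longrightarrow>
           indep_elements M (\<Pi>\<^sub>M j\<in>UNIV. borel) (\<lambda>w j. S \<theta> j w)
             ((\<Pi>\<^sub>M j\<in>UNIV. borel) \<Otimes>\<^sub>M (\<Pi>\<^sub>M j\<in>UNIV. counting_space)) (\<lambda>w. (\<lambda>j. U j w, \<lambda>j. D j w))"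
    and "\<And>\<theta>. N \<theta> = cluster_process U (S \<theta>) D"
    and "factorial_cumulant3 M (N 1) \<kappa>"
    and "reduced_measure3 \<kappa> \<rho>"
    and "integrable lborel c"
    and "signed_density \<rho> c"
    and "g \<in> borel_measurable borel"
    and "bounded (range g)"
    and "compact (fun_supp g)"
    and "\<And>\<tau>1 \<tau>2. g (- \<tau>1, - \<tau>2) = - g (\<tau>1, \<tau>2)"
  shows "(\<forall>T>0. \<forall>\<theta>\<in>{-1..1}.
            integrable M (\<lambda>w. triple_stat T g (N \<theta> w)) \<and>
            (LINT w|M. triple_stat T g (N \<theta> w)) = \<theta> * window_mean c g T) \<and>
         (\<forall>H. fun_supp g \<subseteq> {-H..H} \<times> {-H..H} \<longrightarrow>
            (\<lambda>T. window_mean c g T - limit_mean c g) \<in> O[at_top](\<lambda>T. 1 / T)) \<and>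
         (\<forall>Hg :: real \<times> real \<Rightarrow> real.
            integrable lborel Hg \<and> (\<forall>\<omega>. fourier2 g \<omega> = \<i> * complex_of_real (Hg \<omega>)) \<longrightarrow>
            limit_mean c g = 1 / (2 * pi)\<^sup>2 * (LINT \<omega>|lborel. Hg \<omega> * Im (fourier2 c \<omega>)))"
proof -
  interpret M: prob_space M by fact
  interpret \<Omega>: prob_space \<Omega> by fact
  note C [measurable] = assms(2)
  define R where "R = distr \<Omega> counting_space C"
  have moment: "(\<integral>\<^sup>+d. emeasure d UNIV ^ 3 \<partial>R) < \<infinity>"
    using assms(5) unfolding R_def by (subst nn_integral_distr) simp_all
  have clusters: "signed_clusters M \<nu> U D R (S \<theta>) \<theta>" if \<theta>: "\<theta> \<in> {-1..1}" for \<theta>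
    by (intro signed_clusters.intro poisson_points.intro poisson_points_axioms.intro signed_clusters_axioms.intro moment)
      (use assms \<theta> in \<open>simp_all add: R_def\<close>)
  have odd: "g (- \<tau>) = - g \<tau>" for \<tau> using assms(26)[of "fst \<tau>" "snd \<tau>"] by (simp add: uminus_prod_def)
  \<comment> \<open>The cumulant hypothesis concerns only \<open>\<theta> = 1\<close>. It gives the
    finiteness and the value of the reference quantity, to which the means for all other
    \<open>\<theta>\<close> are then reduced.\<close>
  note one = signed_clusters.cumulant_unsigned[OF clusters[of 1] refl]
  have "integrable M (\<lambda>w. triple_stat T g (N \<theta> w)) \<and> (LINT w|M. triple_stat T g (N \<theta> w)) = \<theta> * window_mean c g T"
    if T: "0 < T" and \<theta>: "\<theta> \<in> {-1..1}" for T \<theta>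
  proof -
    note G = test_fun_stat_kernel[OF assms(23,24), of T]
    have fin: "unsigned_cumulant \<nu> R (off_diagonal (\<lambda>x. ennreal (stat_kernel g T x))) < \<infinity>"
        "unsigned_cumulant \<nu> R (off_diagonal (\<lambda>x. ennreal (- stat_kernel g T x))) < \<infinity>"
      using one(2)[OF _ G] one(2)[OF _ test_fun_uminus[OF G]] by simp_all
    have "factorial_cumulant3 M (cluster_process U (S 1) D) \<kappa>" using assms(19) unfolding assms(18) .
    from one(1)[OF _ G this] have
      "enn2real (unsigned_cumulant \<nu> R (off_diagonal (\<lambda>x. ennreal (stat_kernel g T x))))
        - enn2real (unsigned_cumulant \<nu> R (off_diagonal (\<lambda>x. ennreal (- stat_kernel g T x)))) = T * window_mean c g T"
      using cumulant_window_mean[OF assms(20,22,21,23,24) odd T] by simp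
    then show ?thesis
      using signed_clusters.triple_stat_unsigned[OF clusters[OF \<theta>] assms(23,24,26) fin] T by (simp add: assms(18))
  qed
  moreover have "(\<lambda>T. window_mean c g T - limit_mean c g) \<in> O[at_top](\<lambda>T. 1 / T)" if "fun_supp g \<subseteq> {-H..H} \<times> {-H..H}" for H
    by (rule window_mean_asymptotics[OF assms(21,23,24) that])
  moreover have "limit_mean c g = 1 / (2 * pi)\<^sup>2 * (LINT \<omega>|lborel. Hg \<omega> * Im (fourier2 c \<omega>))"
    if "integrable lborel Hg" "\<And>\<omega>. fourier2 g \<omega> = \<i> * complex_of_real (Hg \<omega>)" for Hg :: "real \<times> real \<Rightarrow> real"
    by (rule limit_mean_parseval[OF assms(21,23,24,25) odd that])
  ultimately show ?thesis by blast
qed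

end
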